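(* Let $\lambda=(n-k,1^k)$ with $k>1$. Then the fundamental group $\pi_1$ of the complement $V_\lambda\setminus\bigcup_{H\in\mathcal A_\lambda}H$ to the intrinsic arrangement $\mathcal A_\lambda$ is free Abelian of rank equal to the size of the arrangement (the number of hyperplanes in $\mathcal A_\lambda$). Besides, this complement is not a $K(\pi,1)$ space.
   Context: $\mathfrak S_n$ is the symmetric group on $[n]=\{1,\dots,n\}$; for a partition $\lambda$ of $n$, $\pi_\lambda$ is the irreducible complex representation of $\mathfrak S_n$ with Young diagram $\lambda$ (so $\pi_{(n)}$ is trivial), $V_\lambda$ is its (complex) space, and $\lambda'$ is the conjugate partition. $(n-k,1^k)$ is the hook partition of $n$ with first part $n-k$ followed by $k$ ones. Intrinsic arrangement. A set partition $\alpha$ of $[n]$ is of type $\mu$ if its block sizes form the partition $\mu$ of $n$; $\mathfrak S_\alpha\subset\mathfrak S_n$ is the Young subgroup of permutations preserving every block of $\alpha$. For $\alpha$ of type $\lambda'$ put $H_\alpha=\sum_{\tau\in T}V_\lambda^\tau$, where $T$ is any set of transpositions generating $\mathfrak S_\alpha$ and $V_\lambda^\tau$ is the subspace of $\tau$-fixed vectors in $V_\lambda$; $H_\alpha$ is a hyperplane in $V_\lambda$ independent of the choice of $T$. Then $\mathcal A_\lambda=\{H_\alpha\}$, where $\alpha$ ranges over all set partitions of $[n]$ of type $\lambda'$. A $K(\pi,1)$ space is a connected space all of whose homotopy groups in degrees $\ge 2$ vanish.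
   Formalization: The claim that the complement is not a K(π,1) space is stated only for n−k>1: when n−k=1 the partition is (1^n), V_λ is one-dimensional with the single hyperplane {0}, and the complement ℂ∖{0} is a K(ℤ,1) space. The claim about π_1 is kept for all 1<k<n. *)

theory Defs
  imports
    "HOL-Analysis.Analysis"
    "HOL-Algebra.Sym_Groups"
    "HOL-Algebra.Free_Abelian_Groups"
    "HOL-Library.Function_Algebras"
    "HOL-Library.Disjoint_Sets"
    "HOL-Library.Multiset"
begin

section \<open>Partitions and set partitions\<close>

text \<open>A partition of a natural number is given by the weakly decreasing list of its (positive) parts.\<close>

definition hook_partition :: "nat \<Rightarrow> nat \<Rightarrow> nat list" where
  "hook_partition n k = (n - k) # replicate k 1"

definition conjugate_partition :: "nat list \<Rightarrow> nat list" where
  "conjugate_partition lam =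
     map (\<lambda>j. length (filter (\<lambda>p. j < p) lam)) [0..<foldr max lam 0]"

definition set_partitions_of_type :: "nat \<Rightarrow> nat list \<Rightarrow> nat set set set" where
  "set_partitions_of_type n mu =
     {\<alpha>. partition_on {1..n} \<alpha> \<and> image_mset card (mset_set \<alpha>) = mset mu}"

definition young_subgroup :: "nat \<Rightarrow> nat set set \<Rightarrow> (nat \<Rightarrow> nat) set" where
  "young_subgroup n \<alpha> = {\<sigma>. \<sigma> permutes {1..n} \<and> (\<forall>B\<in>\<alpha>. \<sigma> ` B = B)}"

definition transpositions :: "nat \<Rightarrow> (nat \<Rightarrow> nat) set" where
  "transpositions n = {Transposition.transpose a b | a b. a \<in> {1..n} \<and> b \<in> {1..n} \<and> a \<noteq> b}"


section \<open>The irreducible representations of the symmetric group\<close>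

global_interpretation cfun: vector_space "\<lambda>(c::complex) (f :: 'a \<Rightarrow> complex) x. c * f x"
  by unfold_locales (auto simp: fun_eq_iff algebra_simps)

text \<open>
  The irreducible representation with diagram \<open>lam\<close> is realised as the complex Specht module,
  the span of the polytabloids inside the permutation module on the tabloids of shape \<open>lam\<close>.
  In this convention the partition with one part gives the trivial representation.

  A tableau \<open>t\<close> maps each entry to the cell (row, column), counted from 0, that contains it.
  Its tabloid is the map sending each entry to its row, and the action of a permutation
  \<open>\<sigma>\<close> on tabloids is \<open>r \<mapsto> r \<circ> inv_into UNIV \<sigma>\<close>.  A formal complex combination of tabloids is represented by
  its coefficient function, which vanishes at all functions \<open>nat \<Rightarrow> nat\<close> that are not tabloids.
\<close>

type_synonym tabloid_vector = "(nat \<Rightarrow> nat) \<Rightarrow> complex"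

definition young_diagram :: "nat list \<Rightarrow> (nat \<times> nat) set" where
  "young_diagram lam = {(i, j). i < length lam \<and> j < lam ! i}"

definition tableaux :: "nat \<Rightarrow> nat list \<Rightarrow> (nat \<Rightarrow> nat \<times> nat) set" where
  "tableaux n lam =
     {t \<in> {1..n} \<rightarrow>\<^sub>E young_diagram lam. bij_betw t {1..n} (young_diagram lam)}"

definition tabloid :: "nat \<Rightarrow> (nat \<Rightarrow> nat \<times> nat) \<Rightarrow> nat \<Rightarrow> nat" where
  "tabloid n t = restrict (fst \<circ> t) {1..n}"

definition column_stabilizer :: "nat \<Rightarrow> (nat \<Rightarrow> nat \<times> nat) \<Rightarrow> (nat \<Rightarrow> nat) set" where
  "column_stabilizer n t =
     {\<sigma>. \<sigma> permutes {1..n} \<and> (\<forall>i\<in>{1..n}. snd (t (\<sigma> i)) = snd (t i))}"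

definition polytabloid :: "nat \<Rightarrow> (nat \<Rightarrow> nat \<times> nat) \<Rightarrow> tabloid_vector" where
  "polytabloid n t =
     (\<lambda>r. \<Sum>\<sigma>\<in>column_stabilizer n t. of_int (sign \<sigma>) * (if r = tabloid n t \<circ> inv_into UNIV \<sigma> then 1 else 0))"

definition specht_module :: "nat \<Rightarrow> nat list \<Rightarrow> tabloid_vector set" where
  "specht_module n lam = cfun.span (polytabloid n ` tableaux n lam)"

definition perm_action :: "(nat \<Rightarrow> nat) \<Rightarrow> tabloid_vector \<Rightarrow> tabloid_vector" where
  "perm_action \<sigma> v = (\<lambda>r. v (r \<circ> \<sigma>))"

definition fixed_subspace :: "nat \<Rightarrow> nat list \<Rightarrow> (nat \<Rightarrow> nat) \<Rightarrow> tabloid_vector set" where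
  "fixed_subspace n lam \<sigma> = {v \<in> specht_module n lam. perm_action \<sigma> v = v}"


section \<open>The intrinsic arrangement\<close>

text \<open>The sum of a family of subspaces is the span of their union.\<close>

definition intrinsic_hyperplane :: "nat \<Rightarrow> nat list \<Rightarrow> (nat \<Rightarrow> nat) set \<Rightarrow> tabloid_vector set" where
  "intrinsic_hyperplane n lam T = cfun.span (\<Union>\<tau>\<in>T. fixed_subspace n lam \<tau>)"

text \<open>
  The hyperplane attached to a set partition \<open>\<alpha>\<close> does not depend on the generating set \<open>T\<close>;
  every admissible \<open>T\<close> is allowed here, so no choice has to be made.
\<close>

definition intrinsic_arrangement :: "nat \<Rightarrow> nat list \<Rightarrow> tabloid_vector set set" where
  "intrinsic_arrangement n lam =
     {intrinsic_hyperplane n lam T | \<alpha> T.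
        \<alpha> \<in> set_partitions_of_type n (conjugate_partition lam) \<and>
        T \<subseteq> transpositions n \<and> generate (sym_group n) T = young_subgroup n \<alpha>}"

text \<open>
  The ambient function space carries the product topology.  Vectors of the Specht module vanish
  off the finitely many tabloids, so the topology induced on it is the usual one of a
  finite-dimensional complex vector space.
\<close>

definition arrangement_complement :: "nat \<Rightarrow> nat list \<Rightarrow> tabloid_vector topology" where
  "arrangement_complement n lam =
     top_of_set (specht_module n lam - \<Union>(intrinsic_arrangement n lam))"


section \<open>Homotopy groups\<close>

definition cube :: "nat \<Rightarrow> (nat \<Rightarrow> real) topology" where
  "cube m = product_topology (\<lambda>_. top_of_set {0..1}) {..<m}"

definition cube_boundary :: "nat \<Rightarrow> (nat \<Rightarrow> real) set" where
  "cube_boundary m = {x \<in> topspace (cube m). \<exists>i<m. x i = 0 \<or> x i = 1}"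

definition spheroids :: "nat \<Rightarrow> 'a topology \<Rightarrow> 'a \<Rightarrow> ((nat \<Rightarrow> real) \<Rightarrow> 'a) set" where
  "spheroids m X p = {f. continuous_map (cube m) X f \<and> (\<forall>x\<in>cube_boundary m. f x = p)}"

definition spheroid_class ::
    "nat \<Rightarrow> 'a topology \<Rightarrow> 'a \<Rightarrow> ((nat \<Rightarrow> real) \<Rightarrow> 'a) \<Rightarrow> ((nat \<Rightarrow> real) \<Rightarrow> 'a) set" where
  "spheroid_class m X p f =
     {g. homotopic_with (\<lambda>h. \<forall>x\<in>cube_boundary m. h x = p) (cube m) X f g}"

definition spheroid_join ::
    "((nat \<Rightarrow> real) \<Rightarrow> 'a) \<Rightarrow> ((nat \<Rightarrow> real) \<Rightarrow> 'a) \<Rightarrow> (nat \<Rightarrow> real) \<Rightarrow> 'a" where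
  "spheroid_join f g =
     (\<lambda>x. if x 0 \<le> 1/2 then f (x(0 := 2 * x 0)) else g (x(0 := 2 * x 0 - 1)))"

text \<open>The group of homotopy classes of spheroids, for \<open>m \<ge> 1\<close>; it is the fundamental group for \<open>m = 1\<close>.
  The union in the product is taken over one and the same class.\<close>

definition homotopy_group :: "nat \<Rightarrow> 'a topology \<Rightarrow> 'a \<Rightarrow> ((nat \<Rightarrow> real) \<Rightarrow> 'a) set monoid" where
  "homotopy_group m X p =
     \<lparr>carrier = spheroid_class m X p ` spheroids m X p,
      mult = (\<lambda>A B. \<Union>f\<in>A. \<Union>g\<in>B. spheroid_class m X p (spheroid_join f g)),
      one = spheroid_class m X p (\<lambda>_. p)\<rparr>"

abbreviation fundamental_group :: "'a topology \<Rightarrow> 'a \<Rightarrow> ((nat \<Rightarrow> real) \<Rightarrow> 'a) set monoid" where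
  "fundamental_group \<equiv> homotopy_group 1"

definition K_pi_1_space :: "'a topology \<Rightarrow> bool" where
  "K_pi_1_space X \<longleftrightarrow>
     connected_space X \<and>
     (\<forall>m\<ge>2. \<forall>p\<in>topspace X. carrier (homotopy_group m X p) = {\<one>\<^bsub>homotopy_group m X p\<^esub>})"

end

theory Submission
  imports Defs "HOL-Complex_Analysis.Complex_Analysis"
begin

text \<open>
  On the Specht module \<open>V\<close> of the hook, realised inside the permutation module, the hyperplanes are the kernels of the
  pairings with the polytabloids, one for each set \<open>B\<close> of \<open>k + 1\<close> entries of the first column.  For \<open>k > 1\<close>
  no hyperplane contains the intersection of two others.  Hence every
  hyperplane has a point near which a generic line meets the arrangement in well separated points, meridians of different
  hyperplanes commute, all meridians of one hyperplane agree, and a meridian is transported to itself along every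
  path.  The meridians generate the fundamental group, and winding numbers show that they are independent.

  For the last claim take \<open>\<bar>D\<bar> = k + 2\<close>.  The \<open>k + 2\<close> forms of the sets \<open>B\<close> inside \<open>D\<close> satisfy a single relation, so their
  ratios map the complement to that of \<open>k + 2\<close> generic hyperplanes of a \<open>(k + 1)\<close>-space.  A \<open>k\<close>-sphere is placed there so that
  the signs of the arguments of the ratios \<open>w\<^sub>0, \<dots>, w\<^sub>k\<close> are the signs of the coordinates on the boundary of a cube.
  If it bounded a ball, the arguments would lift to the ball and vanish simultaneously at some point by Brouwer's theorem;
  there all \<open>w\<^sub>j\<close> are positive, although their sum is \<open>-1\<close>.
\<close>

section \<open>Path calculus in topological spaces\<close>

text \<open>Centrality and generation are statements about arbitrary paths, and no presentation of
  the group is at hand. \<open>path_generation\<close> reduces both to paths inside one complex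
  line: a path is pushed towards infinity along a fixed vector, to a region where the statement is
  clear, and only the changes of direction on the way remain. For centrality of one meridian the
  vector is parallel to its hyperplane and transversal to the others, so a line off that hyperplane
  never meets it and carries the others as punctures. For generation the vector is the base point
  itself, and all hyperplanes leave punctures. The obstacle is that punctures may coincide. The line
  is then moved slightly, which the position of the hyperplanes permits, and the loop is followed by
  a square homotopy. For the last claim neither degree nor homology is used: a homotopy of maps of
  the \<open>k\<close>-cube is read as a map on a \<open>(k + 1)\<close>-cube whose last coordinate
  is time, and Brouwer's theorem, derived from Kuhn's lemma, is applied there.\<close>

lemma homotopic_paths_convex_image:
  fixes K :: "'b::real_normed_vector \<Rightarrow> 'a::topological_space"
  assumes "convex C" "continuous_on C K" "K ` C \<subseteq> S" "path \<phi>" "path \<psi>"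
    "path_image \<phi> \<subseteq> C" "path_image \<psi> \<subseteq> C" "pathstart \<phi> = pathstart \<psi>" "pathfinish \<phi> = pathfinish \<psi>"
  shows "homotopic_paths S (K \<circ> \<phi>) (K \<circ> \<psi>)"
proof (rule homotopic_paths_continuous_image)
  show "homotopic_paths C \<phi> \<psi>"
  proof (rule homotopic_paths_linear)
    show "closed_segment (\<phi> t) (\<psi> t) \<subseteq> C" if "t \<in> {0..1}" for t
      using assms that by (intro closed_segment_subset) (auto simp: path_image_def)
  qed (use assms in auto)
qed (use assms in auto)

text \<open>An arrow of the fundamental groupoid of \<open>S\<close>, kept as a path; the
  \<open>hp_\<close> lemmas are the groupoid laws up to homotopy.\<close>

definition arr :: "'a::topological_space set \<Rightarrow> 'a \<Rightarrow> 'a \<Rightarrow> (real \<Rightarrow> 'a) \<Rightarrow> bool" where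
  "arr S a b g \<longleftrightarrow> path g \<and> path_image g \<subseteq> S \<and> pathstart g = a \<and> pathfinish g = b"

lemma arrI:
  assumes "continuous_on {0..1} g" "\<And>t. t \<in> {0..1} \<Longrightarrow> g t \<in> S" "g 0 = a" "g 1 = b"
  shows "arr S a b g"
  using assms by (auto simp: arr_def path_def path_image_def pathstart_def pathfinish_def)

lemma arr_join: "arr S a b g \<Longrightarrow> arr S b c h \<Longrightarrow> arr S a c (g +++ h)"
  by (auto simp: arr_def path_image_join)

lemma arr_rev: "arr S a b g \<Longrightarrow> arr S b a (reversepath g)"
  by (auto simp: arr_def)

lemma arr_const: "a \<in> S \<Longrightarrow> arr S a a (\<lambda>_. a)"
  by (rule arrI) auto

lemma arr_in: "arr S a b g \<Longrightarrow> a \<in> S \<and> b \<in> S"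
  by (auto simp: arr_def path_image_def pathstart_def pathfinish_def)

lemma arr_mem: "arr S a b g \<Longrightarrow> t \<in> {0..1} \<Longrightarrow> g t \<in> S"
  by (auto simp: arr_def path_image_def)

lemma arr_cont: "arr S a b g \<Longrightarrow> continuous_on {0..1} g"
  by (auto simp: arr_def path_def)

lemma arr_ends: "arr S a b g \<Longrightarrow> g 0 = a" "arr S a b g \<Longrightarrow> g 1 = b"
  by (auto simp: arr_def pathstart_def pathfinish_def)

lemma arr_mono: "arr S a b g \<Longrightarrow> S \<subseteq> T \<Longrightarrow> arr T a b g"
  by (auto simp: arr_def)

lemma arr_refl: "arr S a b g \<Longrightarrow> homotopic_paths S g g"
  by (auto simp: arr_def)

lemma arr_homotopic: "arr S a b g \<Longrightarrow> homotopic_paths S g h \<Longrightarrow> arr S a b h"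
  using homotopic_paths_imp_path homotopic_paths_imp_pathfinish homotopic_paths_imp_pathstart
    homotopic_paths_imp_subset unfolding arr_def by metis

lemma homotopic_paths_reparam:
  fixes f g :: "real \<Rightarrow> real"
  assumes "arr S a b h" "path f" "path g" "path_image f \<subseteq> {0..1}" "path_image g \<subseteq> {0..1}"
    "pathstart f = pathstart g" "pathfinish f = pathfinish g"
  shows "homotopic_paths S (h \<circ> f) (h \<circ> g)"
  by (rule homotopic_paths_convex_image[of "{0..1}"]) (use assms in \<open>auto simp: arr_def path_def path_image_def\<close>)

lemma hp_assoc:
  assumes "arr S a b f" "arr S b c g" "arr S c d h"
  shows "homotopic_paths S ((f +++ g) +++ h) (f +++ (g +++ h))"
  using assms by (intro homotopic_paths_sym[OF homotopic_paths_assoc]) (auto simp: arr_def)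

lemma path_image_join_unit:
  fixes f g :: "real \<Rightarrow> real"
  shows "path_image f \<subseteq> T \<Longrightarrow> path_image g \<subseteq> T \<Longrightarrow> path_image (f +++ g) \<subseteq> T"
  using path_image_join_subset[of f g] by blast

lemma path_image_linepath01: "x \<in> {0..1} \<Longrightarrow> y \<in> {0..1} \<Longrightarrow> path_image (linepath x y) \<subseteq> {0..1::real}"
  by (auto simp: closed_segment_eq_real_ivl)

lemma comp_linepath01: "h \<circ> linepath 0 (1::real) = h"
  by (auto simp: linepath_def)

lemma comp_linepath10: "h \<circ> linepath (1::real) 0 = reversepath h"
  by (auto simp: linepath_def reversepath_def)

lemma comp_linepath_same: "h \<circ> linepath x x = (\<lambda>_. h x)"
  by (auto simp: linepath_def algebra_simps)

text \<open>The unit interval is convex, so any detour inside it can be straightened. The unit and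
  inverse laws below are the instances with \<open>x\<close>, \<open>y\<close>, \<open>z\<close>
  among 0 and 1.\<close>

lemma hp_reparam4:
  fixes x y z :: real and h :: "real \<Rightarrow> 'a::topological_space"
  assumes "arr S a b h" "x \<in> {0..1}" "y \<in> {0..1}" "z \<in> {0..1}"
  shows "homotopic_paths S ((h \<circ> linepath x y) +++ (h \<circ> linepath y z)) (h \<circ> linepath x z)"
  unfolding path_compose_join[symmetric]
proof (rule homotopic_paths_reparam[OF assms(1)])
  show "path_image (linepath x y +++ linepath y z) \<subseteq> {0..1}"
    by (intro path_image_join_unit path_image_linepath01 assms)
  show "path_image (linepath x z) \<subseteq> {0..1}"
    by (intro path_image_linepath01 assms)
qed auto

lemma hp_rid: "arr S a b g \<Longrightarrow> homotopic_paths S (g +++ (\<lambda>_. b)) g"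
  using hp_reparam4[of S a b g 0 1 1] by (simp add: comp_linepath01 comp_linepath_same arr_ends)

lemma hp_lid: "arr S a b g \<Longrightarrow> homotopic_paths S ((\<lambda>_. a) +++ g) g"
  using hp_reparam4[of S a b g 0 0 1] by (simp add: comp_linepath01 comp_linepath_same arr_ends)

lemma hp_rinv: "arr S a b g \<Longrightarrow> homotopic_paths S (g +++ reversepath g) (\<lambda>_. a)"
  using hp_reparam4[of S a b g 0 1 0] by (simp add: comp_linepath01 comp_linepath10 comp_linepath_same arr_ends)

lemma hp_linv: "arr S a b g \<Longrightarrow> homotopic_paths S (reversepath g +++ g) (\<lambda>_. b)"
  using hp_reparam4[of S a b g 1 0 1] by (simp add: comp_linepath01 comp_linepath10 comp_linepath_same arr_ends)

lemma hp_join: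
  "homotopic_paths S f f' \<Longrightarrow> homotopic_paths S g g' \<Longrightarrow> arr S a b f \<Longrightarrow> arr S b c g \<Longrightarrow>
    homotopic_paths S (f +++ g) (f' +++ g')"
  by (rule homotopic_paths_join) (auto simp: arr_def)

lemma hp_join_left:
  "homotopic_paths S f f' \<Longrightarrow> arr S a b f \<Longrightarrow> arr S b c g \<Longrightarrow> homotopic_paths S (f +++ g) (f' +++ g)"
  by (rule hp_join[where a=a and b=b and c=c]) (simp_all add: arr_refl del: homotopic_paths_refl)

lemma hp_join_right:
  "homotopic_paths S g g' \<Longrightarrow> arr S a b f \<Longrightarrow> arr S b c g \<Longrightarrow> homotopic_paths S (f +++ g) (f +++ g')"
  by (rule hp_join[where a=a and b=b and c=c]) (simp_all add: arr_refl del: homotopic_paths_refl)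

lemma hp_cancel_rl:
  assumes "arr S a b f" "arr S b c g"
  shows "homotopic_paths S (reversepath f +++ (f +++ g)) g"
proof -
  have "homotopic_paths S (reversepath f +++ (f +++ g)) ((reversepath f +++ f) +++ g)"
    using assms arr_rev hp_assoc homotopic_paths_sym by metis
  also have "homotopic_paths S \<dots> ((\<lambda>_. b) +++ g)"
    using assms by (intro hp_join_left hp_linv) (auto intro: arr_join arr_rev)
  also have "homotopic_paths S \<dots> g" using assms hp_lid by blast
  finally show ?thesis .
qed

lemma hp_cancel_right:
  assumes "arr S a b f" "arr S b c g"
  shows "homotopic_paths S ((f +++ g) +++ reversepath g) f"
proof -
  have "homotopic_paths S ((f +++ g) +++ reversepath g) (f +++ (g +++ reversepath g))"
    using assms arr_rev hp_assoc by metis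
  also have "homotopic_paths S \<dots> (f +++ (\<lambda>_. b))"
    using assms by (intro hp_join_right hp_rinv) (auto intro: arr_join arr_rev)
  also have "homotopic_paths S \<dots> f" using assms hp_rid by blast
  finally show ?thesis .
qed

text \<open>Transport of loops by change of base point: \<open>y\<close> is \<open>x\<close> carried
  along \<open>g\<close>. Written as \<open>x g = g y\<close> it needs no inverse and is what a
  homotopy of loops over \<open>g\<close> yields directly.\<close>

definition Tr :: "'a::topological_space set \<Rightarrow> (real \<Rightarrow> 'a) \<Rightarrow> (real \<Rightarrow> 'a) \<Rightarrow> (real \<Rightarrow> 'a) \<Rightarrow> bool" where
  "Tr S g x y \<longleftrightarrow> (\<exists>a b. arr S a b g \<and> arr S a a x \<and> arr S b b y) \<and> homotopic_paths S (x +++ g) (g +++ y)"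

lemma TrD:
  assumes "Tr S g x y" "arr S a b g"
  shows "arr S a a x" "arr S b b y" "homotopic_paths S (x +++ g) (g +++ y)"
  using assms unfolding Tr_def by (auto simp: arr_def)

lemma TrI:
  assumes "arr S a b g" "arr S a a x" "arr S b b y" "homotopic_paths S (x +++ g) (g +++ y)"
  shows "Tr S g x y"
  using assms unfolding Tr_def by blast

lemma Tr_arr: 
  assumes "Tr S g x y"
  obtains a b where "arr S a b g" "arr S a a x" "arr S b b y"
  using assms unfolding Tr_def by blast

lemma Tr_join:
  assumes "Tr S f x y" "Tr S g y z" "pathfinish f = pathstart g"
  shows "Tr S (f +++ g) x z"
proof -
  obtain a b where A: "arr S a b f" "arr S a a x" "arr S b b y" using assms(1) by (rule Tr_arr)
  obtain c where B: "arr S b c g" "arr S c c z" using assms(2,3) A(1) by (metis Tr_arr arr_def)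
  have "homotopic_paths S (x +++ (f +++ g)) ((x +++ f) +++ g)"
    using A B hp_assoc homotopic_paths_sym by metis
  also have "homotopic_paths S \<dots> ((f +++ y) +++ g)"
    using A B TrD(3)[OF assms(1) A(1)] by (intro hp_join_left) (auto intro: arr_join)
  also have "homotopic_paths S \<dots> (f +++ (y +++ g))" using A B hp_assoc by metis
  also have "homotopic_paths S \<dots> (f +++ (g +++ z))"
    using A B TrD(3)[OF assms(2) B(1)] by (intro hp_join_right) (auto intro: arr_join)
  also have "homotopic_paths S \<dots> ((f +++ g) +++ z)" using A B hp_assoc homotopic_paths_sym by metis
  finally show ?thesis using A B by (intro TrI) (auto intro: arr_join)
qed

lemma Tr_rev:
  assumes "Tr S f x y"
  shows "Tr S (reversepath f) y x"
proof -
  obtain a b where A: "arr S a b f" "arr S a a x" "arr S b b y" using assms(1) by (rule Tr_arr)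
  note A' = A arr_rev[OF A(1)]
  have "homotopic_paths S (y +++ reversepath f) (reversepath f +++ (f +++ (y +++ reversepath f)))"
    using A' by (intro homotopic_paths_sym[OF hp_cancel_rl]) (auto intro: arr_join)
  also have "homotopic_paths S \<dots> (reversepath f +++ ((f +++ y) +++ reversepath f))"
    using A' by (intro hp_join_right homotopic_paths_sym[OF hp_assoc]) (auto intro: arr_join)
  also have "homotopic_paths S \<dots> (reversepath f +++ ((x +++ f) +++ reversepath f))"
    using A' TrD(3)[OF assms A(1)]
    by (intro hp_join_right hp_join_left homotopic_paths_sym[OF TrD(3)[OF assms A(1)]]) (auto intro: arr_join)
  also have "homotopic_paths S \<dots> (reversepath f +++ x)"
    using A' by (intro hp_join_right hp_cancel_right) (auto intro: arr_join)
  finally show ?thesis using A' by (intro TrI) (auto intro: arr_join)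
qed

lemma Tr_homotopic:
  assumes "Tr S f x y" "homotopic_paths S f f'" "homotopic_paths S x x'" "homotopic_paths S y y'"
  shows "Tr S f' x' y'"
proof -
  obtain a b where A: "arr S a b f" "arr S a a x" "arr S b b y" using assms(1) by (rule Tr_arr)
  have B: "arr S a b f'" "arr S a a x'" "arr S b b y'" using A assms arr_homotopic by blast+
  have "homotopic_paths S (x' +++ f') (x +++ f)"
    using A B assms by (intro hp_join[OF homotopic_paths_sym homotopic_paths_sym]) auto
  also have "homotopic_paths S \<dots> (f +++ y)" using TrD(3)[OF assms(1) A(1)] .
  also have "homotopic_paths S \<dots> (f' +++ y')" using A B assms by (intro hp_join) auto
  finally show ?thesis using B by (intro TrI)
qed

text \<open>The two ways round the boundary are homotopic because the square is convex. Moving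
  families of loops enter the groupoid calculus through this lemma.\<close>

lemma square_homotopic:
  fixes K :: "real \<times> real \<Rightarrow> 'a::topological_space"
  assumes "continuous_on ({0..1} \<times> {0..1}) K" "\<And>s t. s \<in> {0..1} \<Longrightarrow> t \<in> {0..1} \<Longrightarrow> K (s,t) \<in> S"
  shows "homotopic_paths S ((\<lambda>t. K (0,t)) +++ (\<lambda>s. K (s,1))) ((\<lambda>s. K (s,0)) +++ (\<lambda>t. K (1,t)))"
proof -
  let ?C = "{0..1::real} \<times> {0..1::real}"
  have 1: "K \<circ> linepath (0,0) (0,1) = (\<lambda>t. K (0,t))" "K \<circ> linepath (0,1) (1,1) = (\<lambda>s. K (s,1))"
   "K \<circ> linepath (0,0) (1,0) = (\<lambda>s. K (s,0))" "K \<circ> linepath (1,0) (1,1) = (\<lambda>t. K (1,t))"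
    by (auto simp: linepath_def algebra_simps)
  have cs: "path_image (linepath x y) \<subseteq> ?C" if "x \<in> ?C" "y \<in> ?C" for x y
    unfolding path_image_linepath by (rule closed_segment_subset[OF that]) (intro convex_Times convex_real_interval)
  have "homotopic_paths S (K \<circ> (linepath (0,0) (0,1) +++ linepath (0,1) (1,1)))
     (K \<circ> (linepath (0,0) (1,0) +++ linepath (1,0) (1,1)))"
  proof (rule homotopic_paths_convex_image[of ?C])
    show "convex ?C" by (intro convex_Times convex_real_interval)
    show "path_image (linepath (0, 0) (0, 1) +++ linepath (0, 1) (1, 1)) \<subseteq> ?C"
      "path_image (linepath (0, 0) (1, 0) +++ linepath (1, 0) (1, 1)) \<subseteq> ?C"
      by (intro order_trans[OF path_image_join_subset] Un_least cs; simp)+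
    show "K ` ?C \<subseteq> S" using assms(2) by auto
  qed (use assms(1) in auto)
  then show ?thesis by (simp add: path_compose_join 1)
qed

lemma continuous_on_slices:
  fixes K :: "real \<times> real \<Rightarrow> 'a::topological_space"
  assumes "continuous_on ({0..1} \<times> {0..1}) K" "u \<in> {0..1}"
  shows "continuous_on {0..1} (\<lambda>t. K (u,t))" "continuous_on {0..1} (\<lambda>s. K (s,u))"
  using assms by (auto intro!: continuous_on_compose2[OF assms(1)] continuous_intros)

lemma Tr_square:
  fixes K :: "real \<times> real \<Rightarrow> 'a::topological_space"
  assumes "continuous_on ({0..1} \<times> {0..1}) K" "\<And>s t. s \<in> {0..1} \<Longrightarrow> t \<in> {0..1} \<Longrightarrow> K (s,t) \<in> S"
    "\<And>s. K (s,0) = g s" "\<And>s. K (s,1) = g s" "\<And>t. K (0,t) = x t" "\<And>t. K (1,t) = y t"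
  shows "Tr S g x y"
proof -
  have g: "g = (\<lambda>s. K (s,0))" "g = (\<lambda>s. K (s,1))" and x: "x = (\<lambda>t. K (0,t))" and y: "y = (\<lambda>t. K (1,t))"
    using assms(3-6) by (auto intro!: ext)
  have e: "K (0,1) = K (0,0)" "K (1,1) = K (1,0)"
    using assms(3,4) by metis+
  have "homotopic_paths S (x +++ g) (g +++ y)"
    using square_homotopic[OF assms(1,2)] unfolding g(2)[symmetric] g(1)[symmetric] x[symmetric] y[symmetric] .
  moreover have "arr S (K (0,0)) (K (1,0)) g"
    unfolding g(1) by (rule arrI) (use continuous_on_slices[OF assms(1)] assms(2) in auto)
  moreover have "arr S (K (0,0)) (K (0,0)) x"
    unfolding x by (rule arrI) (use continuous_on_slices[OF assms(1)] assms(2) e in auto)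
  moreover have "arr S (K (1,0)) (K (1,0)) y"
    unfolding y by (rule arrI) (use continuous_on_slices[OF assms(1)] assms(2) e in auto)
  ultimately show ?thesis by (intro TrI)
qed

subsection \<open>The fundamental groupoid\<close>

definition hc :: "'a::topological_space set \<Rightarrow> (real \<Rightarrow> 'a) \<Rightarrow> (real \<Rightarrow> 'a) set" where
  "hc S g = {h. homotopic_paths S g h}"

definition okp :: "'a::topological_space set \<Rightarrow> (real \<Rightarrow> 'a) \<Rightarrow> bool" where
  "okp S g \<longleftrightarrow> path g \<and> path_image g \<subseteq> S"

definition gok :: "'a::topological_space set \<Rightarrow> (real \<Rightarrow> 'a) set \<Rightarrow> bool" where
  "gok S X \<longleftrightarrow> (\<exists>g. okp S g \<and> X = hc S g)"

definition src :: "(real \<Rightarrow> 'a::topological_space) set \<Rightarrow> 'a" where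
  "src X = pathstart (SOME g. g \<in> X)"

definition tgt :: "(real \<Rightarrow> 'a::topological_space) set \<Rightarrow> 'a" where
  "tgt X = pathfinish (SOME g. g \<in> X)"

text \<open>A total operation on sets of paths, which is composition of classes only if
  \<open>tgt X = src Y\<close>. With \<open>hc_join\<close>, \<open>hc_rev\<close> and
  \<open>hc_const\<close> as rewrite rules, homotopies of concatenated paths become word identities
  for the simplifier.\<close>

definition star :: "'a::topological_space set \<Rightarrow> (real \<Rightarrow> 'a) set \<Rightarrow> (real \<Rightarrow> 'a) set \<Rightarrow> (real \<Rightarrow> 'a) set" where
  "star S X Y = (\<Union>g\<in>X. \<Union>h\<in>Y. hc S (g +++ h))"

definition ginv :: "'a::topological_space set \<Rightarrow> (real \<Rightarrow> 'a) set \<Rightarrow> (real \<Rightarrow> 'a) set" where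
  "ginv S X = hc S (reversepath (SOME g. g \<in> X))"

definition gone :: "'a::topological_space set \<Rightarrow> 'a \<Rightarrow> (real \<Rightarrow> 'a) set" where
  "gone S a = hc S (\<lambda>_. a)"

lemma arr_iff_okp: "arr S a b g \<longleftrightarrow> okp S g \<and> pathstart g = a \<and> pathfinish g = b"
  by (auto simp: arr_def okp_def)

lemma okp_join [simp]: "okp S g \<Longrightarrow> okp S h \<Longrightarrow> pathfinish g = pathstart h \<Longrightarrow> okp S (g +++ h)"
  by (auto simp: okp_def path_image_join)

lemma okp_rev [simp]: "okp S (reversepath g) \<longleftrightarrow> okp S g"
  by (auto simp: okp_def)

lemma okp_const [simp]: "okp S (\<lambda>_. a) \<longleftrightarrow> a \<in> S"
  by (auto simp: okp_def path_def path_image_def)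

lemma pathstart_const [simp]: "pathstart (\<lambda>_. a) = a" and pathfinish_const [simp]: "pathfinish (\<lambda>_. a) = a"
  by (auto simp: pathstart_def pathfinish_def)

lemma hc_eqI:
  assumes "homotopic_paths S g h"
  shows "hc S g = hc S h"
  unfolding hc_def
proof (intro Collect_cong iffI)
  show "homotopic_paths S h k" if "homotopic_paths S g k" for k
    by (rule homotopic_paths_trans[OF homotopic_paths_sym[OF assms] that])
  show "homotopic_paths S g k" if "homotopic_paths S h k" for k
    by (rule homotopic_paths_trans[OF assms that])
qed

lemma hc_eq:
  assumes "okp S g"
  shows "hc S g = hc S h \<longleftrightarrow> homotopic_paths S g h"
proof
  assume "hc S g = hc S h"
  moreover have "g \<in> hc S g" using assms by (simp add: hc_def okp_def)
  ultimately have "g \<in> hc S h" by (simp only:)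
  then show "homotopic_paths S g h" unfolding hc_def by (auto intro: homotopic_paths_sym)
qed (rule hc_eqI)

lemma hc_self: "okp S g \<Longrightarrow> g \<in> hc S g"
  by (simp add: hc_def okp_def)

lemma okp_homotopic: "homotopic_paths S g h \<Longrightarrow> okp S g \<and> okp S h"
  by (simp add: okp_def homotopic_paths_imp_path homotopic_paths_imp_subset)

lemma gok_hc [simp]: "okp S g \<Longrightarrow> gok S (hc S g)"
  by (auto simp: gok_def)

lemma hc_some: "okp S g \<Longrightarrow> homotopic_paths S g (SOME h. h \<in> hc S g)"
  using someI[of "\<lambda>h. h \<in> hc S g" g] hc_self[of S g] unfolding hc_def by simp

lemma src_hc [simp]: "okp S g \<Longrightarrow> src (hc S g) = pathstart g"
  unfolding src_def by (rule homotopic_paths_imp_pathstart[OF hc_some, symmetric])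

lemma tgt_hc [simp]: "okp S g \<Longrightarrow> tgt (hc S g) = pathfinish g"
  unfolding tgt_def by (rule homotopic_paths_imp_pathfinish[OF hc_some, symmetric])

lemma star_hc:
  assumes "okp S g" "okp S h" "pathfinish g = pathstart h"
  shows "star S (hc S g) (hc S h) = hc S (g +++ h)"
proof -
  have "hc S (g' +++ h') = hc S (g +++ h)" if "g' \<in> hc S g" "h' \<in> hc S h" for g' h'
    using that assms by (intro hc_eqI homotopic_paths_sym[OF homotopic_paths_join]) (auto simp: hc_def)
  then have "star S (hc S g) (hc S h) = (\<Union>g'\<in>hc S g. \<Union>h'\<in>hc S h. hc S (g +++ h))"
    unfolding star_def by simp
  then show ?thesis using hc_self[OF assms(1)] hc_self[OF assms(2)] by auto
qed

lemma hc_join [simp]: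
  "okp S g \<Longrightarrow> okp S h \<Longrightarrow> pathfinish g = pathstart h \<Longrightarrow> hc S (g +++ h) = star S (hc S g) (hc S h)"
  by (simp add: star_hc)

lemma hc_rev [simp]: "okp S g \<Longrightarrow> hc S (reversepath g) = ginv S (hc S g)"
  unfolding ginv_def by (intro hc_eqI homotopic_paths_reversepath_D hc_some)

lemma hc_const [simp]: "hc S (\<lambda>_. a) = gone S a"
  by (simp add: gone_def)

lemma gokE:
  assumes "gok S X"
  obtains g where "okp S g" "X = hc S g" "src X = pathstart g" "tgt X = pathfinish g"
  using assms unfolding gok_def by auto

lemma gok_star [simp]:
  assumes "gok S X" "gok S Y" "tgt X = src Y"
  shows "gok S (star S X Y)" "src (star S X Y) = src X" "tgt (star S X Y) = tgt Y"
proof -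
  obtain g where g: "okp S g" "X = hc S g" using assms(1) unfolding gok_def by blast
  obtain h where h: "okp S h" "Y = hc S h" using assms(2) unfolding gok_def by blast
  have gh: "pathfinish g = pathstart h" using assms(3) g h by simp
  have e: "star S X Y = hc S (g +++ h)" unfolding g(2) h(2) by (rule star_hc[OF g(1) h(1) gh])
  have o: "okp S (g +++ h)" by (rule okp_join[OF g(1) h(1) gh])
  show "gok S (star S X Y)" unfolding e by (rule gok_hc[OF o])
  have "src (star S X Y) = pathstart g" by (simp only: e src_hc[OF o] pathstart_join)
  then show "src (star S X Y) = src X" by (simp only: g(2) src_hc[OF g(1)])
  have "tgt (star S X Y) = pathfinish h" by (simp only: e tgt_hc[OF o] pathfinish_join)
  then show "tgt (star S X Y) = tgt Y" by (simp only: h(2) tgt_hc[OF h(1)])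
qed

lemma gok_ginv [simp]:
  assumes "gok S X"
  shows "gok S (ginv S X)" "src (ginv S X) = tgt X" "tgt (ginv S X) = src X"
  using assms by (auto simp del: hc_rev simp: hc_rev[symmetric] elim!: gokE)

lemma gok_gone [simp]: "a \<in> S \<Longrightarrow> gok S (gone S a)" "a \<in> S \<Longrightarrow> src (gone S a) = a" "a \<in> S \<Longrightarrow> tgt (gone S a) = a"
  by (auto simp del: hc_const simp: hc_const[symmetric])

lemma star_assoc:
  assumes "gok S X" "gok S Y" "gok S Z" "tgt X = src Y" "tgt Y = src Z"
  shows "star S (star S X Y) Z = star S X (star S Y Z)"
proof -
  obtain f g h where *: "okp S f" "X = hc S f" "okp S g" "Y = hc S g" "okp S h" "Z = hc S h" using assms by (auto simp: gok_def)
  have "hc S ((f +++ g) +++ h) = hc S (f +++ (g +++ h))"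
    using * assms by (intro hc_eqI hp_assoc) (auto simp: arr_iff_okp)
  then show ?thesis using * assms by simp
qed

lemma star_one [simp]:
  assumes "gok S X"
  shows "src X = a \<Longrightarrow> star S (gone S a) X = X" "tgt X = a \<Longrightarrow> star S X (gone S a) = X"
proof -
  obtain f where *: "okp S f" "X = hc S f" "src X = pathstart f" "tgt X = pathfinish f" using assms by (rule gokE)
  then have "pathstart f \<in> S" "pathfinish f \<in> S" by (auto simp: okp_def)
  moreover have "hc S ((\<lambda>_. pathstart f) +++ f) = hc S f" "hc S (f +++ (\<lambda>_. pathfinish f)) = hc S f"
    using * by (auto intro!: hc_eqI hp_lid hp_rid simp: arr_iff_okp simp del: hc_join)
  ultimately show "src X = a \<Longrightarrow> star S (gone S a) X = X" "tgt X = a \<Longrightarrow> star S X (gone S a) = X"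
    using * by auto
qed

lemma star_inv [simp]:
  assumes "gok S X"
  shows "star S X (ginv S X) = gone S (src X)" "star S (ginv S X) X = gone S (tgt X)"
proof -
  obtain f where *: "okp S f" "X = hc S f" "src X = pathstart f" "tgt X = pathfinish f" using assms by (rule gokE)
  moreover have "hc S (f +++ reversepath f) = hc S (\<lambda>_. pathstart f)" "hc S (reversepath f +++ f) = hc S (\<lambda>_. pathfinish f)"
    using * by (auto intro!: hc_eqI hp_linv hp_rinv simp: arr_iff_okp simp del: hc_join hc_const)
  ultimately show "star S X (ginv S X) = gone S (src X)" "star S (ginv S X) X = gone S (tgt X)" by auto
qed

lemma star_cancel [simp]:
  assumes "gok S X" "gok S Y"
  shows "tgt X = src Y \<Longrightarrow> star S (ginv S X) (star S X Y) = Y"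
    "src X = src Y \<Longrightarrow> star S X (star S (ginv S X) Y) = Y"
  using assms star_assoc[of S "ginv S X" X Y] star_assoc[of S X "ginv S X" Y] by simp_all

lemma ginv_ginv [simp]: "gok S X \<Longrightarrow> ginv S (ginv S X) = X"
  by (auto elim!: gokE simp del: hc_rev simp: hc_rev[symmetric])

lemma ginv_gone [simp]: "a \<in> S \<Longrightarrow> ginv S (gone S a) = gone S a"
  by (simp del: hc_const hc_rev add: hc_const[symmetric] hc_rev[symmetric] reversepath_def)

lemma star_left_cancel:
  assumes "gok S X" "gok S Y" "gok S Z" "tgt X = src Y" "tgt X = src Z" "star S X Y = star S X Z"
  shows "Y = Z"
proof -
  have "Y = star S (ginv S X) (star S X Y)" using assms(1,2,4) by simp
  also have "\<dots> = star S (ginv S X) (star S X Z)" by (simp only: assms(6))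
  also have "\<dots> = Z" using assms(1,3,5) by simp
  finally show ?thesis .
qed

lemma ginv_star [simp]:
  assumes "gok S X" "gok S Y" "tgt X = src Y"
  shows "ginv S (star S X Y) = star S (ginv S Y) (ginv S X)"
proof -
  have "star S (star S X Y) (ginv S (star S X Y)) = gone S (src X)"
    using assms by simp
  also have "\<dots> = star S (star S X Y) (star S (ginv S Y) (ginv S X))"
    using assms star_assoc[of S X Y "star S (ginv S Y) (ginv S X)"] by simp
  finally show ?thesis
    by (rule star_left_cancel[rotated 5]) (use assms in simp_all)
qed

lemma Tr_iff:
  assumes "okp S g" "okp S x" "okp S y" "pathstart x = pathstart g" "pathfinish x = pathstart g"
    "pathstart y = pathfinish g" "pathfinish y = pathfinish g"
  shows "Tr S g x y \<longleftrightarrow> star S (hc S x) (hc S g) = star S (hc S g) (hc S y)"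
proof -
  have a: "arr S (pathstart g) (pathfinish g) g" "arr S (pathstart g) (pathstart g) x"
    "arr S (pathfinish g) (pathfinish g) y"
    using assms by (simp_all add: arr_iff_okp)
  have "Tr S g x y \<longleftrightarrow> homotopic_paths S (x +++ g) (g +++ y)"
    using TrD(3)[OF _ a(1)] TrI[OF a] by blast
  also have "\<dots> \<longleftrightarrow> hc S (x +++ g) = hc S (g +++ y)" using assms by (intro hc_eq[symmetric] okp_join) auto
  also have "\<dots> \<longleftrightarrow> star S (hc S x) (hc S g) = star S (hc S g) (hc S y)"
    using assms by (simp only: hc_join)
  finally show ?thesis .
qed

section \<open>Combinations of vectors\<close>

text \<open>One operation covers addition and scaling: a subspace is a set closed under
  \<open>lin\<close> that contains 0, and a linear form is a map compatible with
  \<open>lin\<close>.\<close>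

definition lin :: "('a \<Rightarrow> complex) \<Rightarrow> complex \<Rightarrow> ('a \<Rightarrow> complex) \<Rightarrow> 'a \<Rightarrow> complex" where
  "lin v c q = (\<lambda>x. v x + c * q x)"

lemma continuous_on_lin [continuous_intros]:
  fixes a b :: "'b::topological_space \<Rightarrow> 'a \<Rightarrow> complex"
  assumes "continuous_on S a" "continuous_on S c" "continuous_on S b"
  shows "continuous_on S (\<lambda>x. lin (a x) (c x) (b x))"
  unfolding lin_def
proof (rule continuous_on_coordinatewise_then_product)
  fix i
  have "continuous_on S (\<lambda>x. a x i)" "continuous_on S (\<lambda>x. b x i)"
    using assms(1,3) by (auto intro: continuous_on_product_then_coordinatewise)
  then show "continuous_on S (\<lambda>x. a x i + c x * b x i)"
    using assms(2) by (intro continuous_on_add continuous_on_mult)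
qed

declare continuous_on_coordinatewise_then_product [continuous_intros del]

lemma lin_0 [simp]: "lin v 0 q = v"
  by (simp add: lin_def)

lemma lin_lin [simp]: "lin (lin v a q) b q = lin v (a + b) q"
  by (auto simp: lin_def algebra_simps)

lemma lin_commute: "lin (lin v a q) b p = lin (lin v b p) a q"
  by (auto simp: lin_def algebra_simps)

section \<open>Complex hyperplane arrangements\<close>

text \<open>A space over an infinite field is not a finite union of proper subspaces: on a line
  \<open>lin u c w\<close>, with \<open>w\<close> outside the newest subspace, each form excludes at
  most one \<open>c\<close>.\<close>

lemma generic_point:
  fixes h :: "'i \<Rightarrow> ('a \<Rightarrow> complex) \<Rightarrow> complex"
  assumes "finite I" and cl: "\<And>u v c. u \<in> U \<Longrightarrow> v \<in> U \<Longrightarrow> lin u c v \<in> U" and "U \<noteq> {}"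
    and "\<And>i. i \<in> I \<Longrightarrow> \<exists>u\<in>U. h i u \<noteq> 0"
    and "\<And>i u v c. i \<in> I \<Longrightarrow> h i (lin u c v) = h i u + c * h i v"
  shows "\<exists>u\<in>U. \<forall>i\<in>I. h i u \<noteq> 0"
  using assms(1,4,5)
proof (induction I rule: finite_induct)
  case empty
  then show ?case using \<open>U \<noteq> {}\<close> by auto
next
  case (insert j I)
  obtain u where u: "u \<in> U" "\<forall>i\<in>I. h i u \<noteq> 0" using insert by blast
  obtain w where w: "w \<in> U" "h j w \<noteq> 0" using insert.prems(1)[of j] by blast
  have "finite (insert (- h j u / h j w) ((\<lambda>i. - h i u / h i w) ` I))" using insert by auto
  then obtain c where c: "c \<notin> insert (- h j u / h j w) ((\<lambda>i. - h i u / h i w) ` I)"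
    using ex_new_if_finite infinite_UNIV_char_0 by blast
  have "h i (lin u c w) \<noteq> 0" if "i \<in> insert j I" for i
  proof (cases "h i w = 0")
    case True
    then show ?thesis using that u w insert.prems(2)[OF that, of u c w] by auto
  next
    case False
    have "c \<noteq> - h i u / h i w" using c that by auto
    then have "c * h i w \<noteq> - h i u" using False by (simp add: field_simps)
    then show ?thesis using insert.prems(2)[OF that, of u c w] by (metis add_eq_0_iff2 minus_minus)
  qed
  then show ?case using cl u w by blast
qed

text \<open>Only the finitely many angles \<open>Arg (-z)\<close> are bad. The bounds within
  \<open>-pi\<close> and \<open>pi\<close> give
  \<open>Arg (cis \<theta>) = \<theta>\<close>.\<close>

lemma generic_angle:
  assumes "finite Z" "0 \<notin> Z" "a < b" "-pi < a" "b < pi"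
  shows "\<exists>\<theta>. a < \<theta> \<and> \<theta> < b \<and> (\<forall>z\<in>Z. z * cis (-\<theta>) \<notin> \<real>\<^sub>\<le>\<^sub>0)"
proof -
  have "infinite ({a<..<b} - (\<lambda>z. Arg (-z)) ` Z)" using assms by simp
  then obtain \<theta> where \<theta>: "\<theta> \<in> {a<..<b} - (\<lambda>z. Arg (-z)) ` Z" using infinite_imp_nonempty by blast
  have "z * cis (-\<theta>) \<notin> \<real>\<^sub>\<le>\<^sub>0" if z: "z \<in> Z" for z
  proof
    assume "z * cis (-\<theta>) \<in> \<real>\<^sub>\<le>\<^sub>0"
    then obtain r where r: "z * cis (-\<theta>) = of_real r" "r \<le> 0" by (auto elim: nonpos_Reals_cases)
    have e: "z = of_real r * cis \<theta>" using r(1) by (metis cis_cnj cis_neq_zero cis_inverse divide_inverse nonzero_eq_divide_eq)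
    have "r < 0" using e r(2) z assms(2) by (cases "r = 0") auto
    have "Arg (-z) = Arg (of_real (-r) * cis \<theta>)" using e by simp
    also have "\<dots> = Arg (cis \<theta>)" using \<open>r < 0\<close> by (intro Arg_times_of_real) auto
    also have "\<dots> = \<theta>" using \<theta> assms by (intro Arg_cis) auto
    finally show False using \<theta> z by auto
  qed
  then show ?thesis using \<theta> by auto
qed

definition ray :: "('a \<Rightarrow> complex) \<Rightarrow> real \<Rightarrow> real \<Rightarrow> ('a \<Rightarrow> complex) \<Rightarrow> real \<Rightarrow> 'a \<Rightarrow> complex" where
  "ray v \<theta> R q = (\<lambda>s. lin v (complex_of_real (s * R) * cis \<theta>) q)"

lemma ray_arr:
  assumes "\<And>s. s \<in> {0..1} \<Longrightarrow> ray v \<theta> R q s \<in> S"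
  shows "arr S v (ray v \<theta> R q 1) (ray v \<theta> R q)"
  using assms by (intro arrI) (auto simp: ray_def intro!: continuous_intros)

text \<open>The forms live on the ambient function space, while the hyperplanes are their kernels in
  the subspace \<open>V\<close>. \<open>f_indep\<close> is the only condition on their mutual
  position; for \<open>j = l\<close> it says that they are distinct.\<close>

locale arrangement =
  fixes V :: "('a \<Rightarrow> complex) set" and J :: "'j set" and f :: "'j \<Rightarrow> ('a \<Rightarrow> complex) \<Rightarrow> complex"
  assumes lin_closed: "\<And>v q c. v \<in> V \<Longrightarrow> q \<in> V \<Longrightarrow> lin v c q \<in> V"
    and zero_closed: "(\<lambda>_. 0) \<in> V"
    and finite_J: "finite J"
    and f_lin [simp]: "\<And>j v c q. j \<in> J \<Longrightarrow> f j (lin v c q) = f j v + c * f j q"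
    and f_cont: "\<And>j. j \<in> J \<Longrightarrow> continuous_on UNIV (f j)"
    and f_nonzero: "\<And>j. j \<in> J \<Longrightarrow> \<exists>v\<in>V. f j v \<noteq> 0"
    and f_indep: "\<And>i j l. i \<in> J \<Longrightarrow> j \<in> J - {i} \<Longrightarrow> l \<in> J - {i} \<Longrightarrow> \<exists>v\<in>V. f i v \<noteq> 0 \<and> f j v = 0 \<and> f l v = 0"
begin

definition M :: "('a \<Rightarrow> complex) set" where
  "M = {v \<in> V. \<forall>j\<in>J. f j v \<noteq> 0}"

lemma M_V: "v \<in> M \<Longrightarrow> v \<in> V"
  by (simp add: M_def)

lemma M_nz: "v \<in> M \<Longrightarrow> j \<in> J \<Longrightarrow> f j v \<noteq> 0"
  by (simp add: M_def)

lemma f_zero: "j \<in> J \<Longrightarrow> f j (\<lambda>_. 0) = 0"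
  using f_lin[of j "\<lambda>_. 0" 1 "\<lambda>_. 0"] by (simp add: lin_def)

lemma continuous_on_f [continuous_intros]:
  "j \<in> J \<Longrightarrow> continuous_on S g \<Longrightarrow> continuous_on S (\<lambda>x. f j (g x))"
  using continuous_on_compose2[OF f_cont] by blast

text \<open>For each time a small range of directions \<open>\<theta>\<close> is admissible for pushing the path towards infinity;
  changing the direction in between costs a path that runs down one ray and up another.\<close>

lemma path_generation:
  assumes q: "q \<in> V" and OM: "\<Omega> \<subseteq> M"
    and far: "\<And>C g \<theta>. compact C \<Longrightarrow> continuous_on C g \<Longrightarrow> g ` C \<subseteq> M \<Longrightarrow> \<bar>\<theta>\<bar> < pi/4 \<Longrightarrow>
          \<exists>R>0. \<forall>t\<in>C::real set. lin (g t) (complex_of_real R * cis \<theta>) q \<in> \<Omega>"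
    and T_hom: "\<And>g h. T g \<Longrightarrow> homotopic_paths M g h \<Longrightarrow> T h"
    and T_join: "\<And>g h. T g \<Longrightarrow> T h \<Longrightarrow> path g \<Longrightarrow> path h \<Longrightarrow> pathfinish g = pathstart h \<Longrightarrow> T (g +++ h)"
    and T_far: "\<And>g a b. arr \<Omega> a b g \<Longrightarrow> T g"
    and T_line: "\<And>v \<theta> \<theta>' R R'. v \<in> M \<Longrightarrow> \<bar>\<theta>\<bar> < pi/4 \<Longrightarrow> \<bar>\<theta>'\<bar> < pi/4 \<Longrightarrow> 0 \<le> R \<Longrightarrow> 0 \<le> R' \<Longrightarrow>
       arr M v (ray v \<theta> R q 1) (ray v \<theta> R q) \<Longrightarrow> arr M v (ray v \<theta>' R' q 1) (ray v \<theta>' R' q) \<Longrightarrow>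
       ray v \<theta> R q 1 \<in> \<Omega> \<Longrightarrow> ray v \<theta>' R' q 1 \<in> \<Omega> \<Longrightarrow>
       T (reversepath (ray v \<theta> R q) +++ ray v \<theta>' R' q)"
    and g: "arr M a b g" and ab: "a \<in> \<Omega>" "b \<in> \<Omega>"
  shows "T g"
proof -
  \<comment> \<open>All admissible final rays are quantified, so the direction may change from one
    subinterval to the next. \<open>P\<close> is shown to be locally constant in
    \<open>t\<close>.\<close>
  define P where "P t \<longleftrightarrow> (\<forall>\<theta> R. \<bar>\<theta>\<bar> < pi/4 \<longrightarrow> 0 \<le> R \<longrightarrow> arr M (g t) (ray (g t) \<theta> R q 1) (ray (g t) \<theta> R q) \<longrightarrow>
      ray (g t) \<theta> R q 1 \<in> \<Omega> \<longrightarrow> T ((g \<circ> linepath 0 t) +++ ray (g t) \<theta> R q))" for t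
  have gM: "g t \<in> M" if "t \<in> {0..1}" for t using arr_mem[OF g that] .
  have gc: "continuous_on {0..1} g" using arr_cont[OF g] .
  have sub: "arr M (g t) (g u) (g \<circ> linepath t u)" if "t \<in> {0..1}" "u \<in> {0..1}" for t u
  proof (rule arrI)
    have *: "linepath t u x \<in> {0..1}" if "x \<in> {0..1}" for x
      using path_image_linepath01[of t u] that \<open>t \<in> _\<close> \<open>u \<in> _\<close> unfolding path_image_def by blast
    show "continuous_on {0..1} (g \<circ> linepath t u)"
      by (intro continuous_on_compose continuous_on_subset[OF gc] continuous_intros) (use * in auto)
    show "(g \<circ> linepath t u) x \<in> M" if "x \<in> {0..1}" for x using gM[OF *[OF that]] by simp
  qed (auto simp: linepath_def)
  have "P 0"
    unfolding P_def
  proof (intro allI impI)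
    fix \<theta> R assume A: "\<bar>\<theta>\<bar> < pi/4" "0 \<le> (R::real)" "arr M (g 0) (ray (g 0) \<theta> R q 1) (ray (g 0) \<theta> R q)"
      "ray (g 0) \<theta> R q 1 \<in> \<Omega>"
    have g0: "g 0 \<in> \<Omega>" "g 0 \<in> M" using arr_ends[OF g] ab OM by auto
    have r0: "ray (g 0) 0 0 q = (\<lambda>_. g 0)" by (auto simp: ray_def)
    \<comment> \<open>Since \<open>g 0\<close> is already far, the ray of length 0 there is
      admissible, and \<open>T_line\<close> compares it with any other ray.\<close>
    have "T (reversepath (ray (g 0) 0 0 q) +++ ray (g 0) \<theta> R q)"
      by (rule T_line) (use A g0 r0 arr_const[OF g0(2)] in auto)
    then show "T ((g \<circ> linepath 0 0) +++ ray (g 0) \<theta> R q)"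
      by (simp add: r0 comp_linepath_same reversepath_def)
  qed
  have step: "\<exists>T. openin (top_of_set {0..1}) T \<and> t0 \<in> T \<and> (\<forall>x\<in>T. \<forall>y\<in>T. P x \<longrightarrow> P y)"
    if t0: "t0 \<in> {0..1}" for t0
  proof -
    \<comment> \<open>Forms that vanish on \<open>q\<close> are constant along rays; only those in
      \<open>I\<close> can obstruct a direction.\<close>
    define I where "I = {j \<in> J. f j q \<noteq> 0}"
    have "finite I" using finite_J I_def by auto
    have z0: "0 \<notin> (\<lambda>j. f j (g t0) / f j q) ` I" using M_nz[OF gM[OF t0]] by (auto simp: I_def)
    \<comment> \<open>The ray from \<open>g t\<close> in direction \<open>\<theta>0\<close> meets
      hyperplane \<open>j\<close> at radius \<open>r\<close> exactly if the rotated quotient equals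
      \<open>-r\<close>. The slit is closed, so a direction good at \<open>t0\<close> stays good
      nearby.\<close>
    have "\<exists>\<theta>0. - (pi/4) < \<theta>0 \<and> \<theta>0 < pi/4 \<and> (\<forall>z\<in>(\<lambda>j. f j (g t0) / f j q) ` I. z * cis (-\<theta>0) \<notin> \<real>\<^sub>\<le>\<^sub>0)"
      by (rule generic_angle) (use z0 \<open>finite I\<close> pi_gt_zero in auto)
    then obtain \<theta>0 where th: "- (pi/4) < \<theta>0" "\<theta>0 < pi/4" "\<forall>z\<in>(\<lambda>j. f j (g t0) / f j q) ` I. z * cis (-\<theta>0) \<notin> \<real>\<^sub>\<le>\<^sub>0"
      by blast
    define B where "B = {t \<in> {0..1}. \<forall>j\<in>I. f j (g t) / f j q * cis (-\<theta>0) \<notin> \<real>\<^sub>\<le>\<^sub>0}"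
    have "openin (top_of_set {0..1}) ({0..1} \<inter> (\<Inter>j\<in>I. {t \<in> {0..1}. f j (g t) / f j q * cis (-\<theta>0) \<in> - \<real>\<^sub>\<le>\<^sub>0}))"
    proof (cases "I = {}")
      case False
      have "openin (top_of_set {0..1}) {t \<in> {0..1}. f j (g t) / f j q * cis (-\<theta>0) \<in> - \<real>\<^sub>\<le>\<^sub>0}" if "j \<in> I" for j
      proof -
        have "continuous_on {0..1} (\<lambda>t. f j (g t) / f j q * cis (-\<theta>0))"
          using that gc by (intro continuous_intros) (auto simp: I_def)
        from continuous_openin_preimage_gen[OF this, of "- \<real>\<^sub>\<le>\<^sub>0"] show ?thesis
          by (simp add: Int_def vimage_def open_Compl)
      qed
      then show ?thesis using False \<open>finite I\<close> by (intro openin_Int openin_INT2) auto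
    qed auto
    moreover have "{0..1} \<inter> (\<Inter>j\<in>I. {t \<in> {0..1}. f j (g t) / f j q * cis (-\<theta>0) \<in> - \<real>\<^sub>\<le>\<^sub>0}) = B"
      by (auto simp: B_def)
    ultimately have "openin (top_of_set {0..1}) B" by simp
    moreover have "t0 \<in> B" using t0 th by (auto simp: B_def)
    ultimately obtain \<delta> where \<delta>: "\<delta> > 0" "ball t0 \<delta> \<inter> {0..1} \<subseteq> B" 
      by (metis openin_contains_ball)
    define N where "N = {0..1} \<inter> ball t0 \<delta>"
    have Ncv: "closed_segment x y \<subseteq> N" if "x \<in> N" "y \<in> N" for x y
      using that unfolding N_def by (intro closed_segment_subset convex_Int convex_real_interval convex_ball) auto
    have "P y" if xy: "x \<in> N" "y \<in> N" "P x" for x y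
      unfolding P_def
    proof (intro allI impI)
      fix \<theta> R assume A: "\<bar>\<theta>\<bar> < pi/4" "0 \<le> (R::real)" "arr M (g y) (ray (g y) \<theta> R q 1) (ray (g y) \<theta> R q)"
        "ray (g y) \<theta> R q 1 \<in> \<Omega>"
      have x01: "x \<in> {0..1}" and y01: "y \<in> {0..1}" using xy N_def by auto
      let ?C = "closed_segment x y"
      have CB: "?C \<subseteq> B" and C01: "?C \<subseteq> {0..1}" using Ncv[OF xy(1,2)] \<delta> N_def by auto
      obtain R1 where R1: "R1 > 0" "\<And>t. t \<in> ?C \<Longrightarrow> lin (g t) (complex_of_real R1 * cis \<theta>0) q \<in> \<Omega>"
      proof -
        have "g ` ?C \<subseteq> M" "\<bar>\<theta>0\<bar> < pi/4" using C01 gM th by auto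
        then show ?thesis using that far[OF compact_segment continuous_on_subset[OF gc C01]] by blast
      qed
      have inM: "lin (g t) (complex_of_real r * cis \<theta>0) q \<in> M" if t: "t \<in> ?C" and r: "r \<ge> 0" for t r
        unfolding M_def
      proof (intro CollectI conjI ballI)
        show "lin (g t) (complex_of_real r * cis \<theta>0) q \<in> V"
          using lin_closed[OF M_V[OF gM] q] t C01 by blast
        fix j assume j: "j \<in> J"
        have gt: "f j (g t) \<noteq> 0" using M_nz[OF gM j] t C01 by blast
        show "f j (lin (g t) (complex_of_real r * cis \<theta>0) q) \<noteq> 0"
        proof (cases "j \<in> I")
          case True
          then have "f j (g t) / f j q * cis (-\<theta>0) \<notin> \<real>\<^sub>\<le>\<^sub>0" using CB t B_def by auto
          moreover have "f j (g t) / f j q * cis (-\<theta>0) = - of_real r"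
            if "f j (g t) + complex_of_real r * cis \<theta>0 * f j q = 0"
          proof -
            have "f j (g t) = - (complex_of_real r * cis \<theta>0 * f j q)" using that by (simp add: add_eq_0_iff2)
            then have "f j (g t) / f j q * cis (-\<theta>0) = - complex_of_real r * (cis \<theta>0 * cis (-\<theta>0))"
              using True by (simp add: I_def)
            then show ?thesis by (simp add: cis_mult)
          qed
          ultimately show ?thesis using j r by (auto simp: complex_nonpos_Reals_iff)
        qed (use gt j in \<open>auto simp: I_def\<close>)
      qed
      define K where "K = (\<lambda>(s,r). lin (g (linepath x y s)) (complex_of_real (r * R1) * cis \<theta>0) q)"
      have lp: "linepath x y s \<in> ?C" if "s \<in> {0..1}" for s
        using that by (metis imageI linepath_image_01)
      have lc: "continuous_on UNIV (linepath x y)" by (auto simp: linepath_def intro!: continuous_intros)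
      have K: "continuous_on ({0..1} \<times> {0..1}) K"
        unfolding K_def case_prod_unfold
        by (intro continuous_intros continuous_on_compose2[OF gc] continuous_on_compose2[OF lc]) (use lp C01 in auto)
      have KM: "K (s,r) \<in> M" if "s \<in> {0..1}" "r \<in> {0..1}" for s r
        using inM[OF lp[OF that(1)], of "r * R1"] that R1 by (simp add: K_def)
      define rx where "rx = ray (g x) \<theta>0 R1 q"
      define ry where "ry = ray (g y) \<theta>0 R1 q"
      define sh where "sh = (\<lambda>s. K (s,1))"
      \<comment> \<open>The strip of rays over the segment from \<open>x\<close> to \<open>y\<close>
        replaces this piece of \<open>g\<close> by the way out along \<open>rx\<close>, across
        inside \<open>\<Omega>\<close> and back along \<open>ry\<close>.\<close>
      have sq: "homotopic_paths M (rx +++ sh) ((g \<circ> linepath x y) +++ ry)"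
        using square_homotopic[OF K KM] by (simp add: K_def rx_def ry_def sh_def ray_def o_def linepath_def)
      have arx: "arr M (g x) (rx 1) rx" 
        unfolding rx_def by (rule ray_arr) (use inM[of x "_ * R1"] R1 in \<open>auto simp: ray_def\<close>)
      have ary: "arr M (g y) (ry 1) ry"
        unfolding ry_def by (rule ray_arr) (use inM[of y "_ * R1"] R1 in \<open>auto simp: ray_def\<close>)
      have ash: "arr \<Omega> (rx 1) (ry 1) sh"
      proof (rule arrI)
        show "continuous_on {0..1} sh" unfolding sh_def using continuous_on_slices[OF K] by auto
        show "sh s \<in> \<Omega>" if "s \<in> {0..1}" for s using R1(2)[OF lp[OF that]] by (simp add: sh_def K_def)
      qed (auto simp: sh_def K_def rx_def ry_def ray_def linepath_def)
      note ashM = arr_mono[OF ash OM]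
      let ?r = "ray (g y) \<theta> R q"
      let ?g0 = "g \<circ> linepath 0 x" and ?gxy = "g \<circ> linepath x y"
      note a0 = sub[of 0 x, OF _ x01, simplified] and axy = sub[OF x01 y01]
      note oks = a0 axy arx ary ashM A(3)
      have e: "hc M ?gxy = star M (hc M rx) (star M (hc M sh) (ginv M (hc M ry)))"
      proof -
        have "star M (hc M rx) (hc M sh) = star M (hc M ?gxy) (hc M ry)"
          using hc_eqI[OF sq] oks by (simp add: arr_iff_okp)
        then have "star M (star M (hc M ?gxy) (hc M ry)) (ginv M (hc M ry)) = star M (star M (hc M rx) (hc M sh)) (ginv M (hc M ry))"
          by simp
        then show ?thesis using oks by (simp add: arr_iff_okp star_assoc)
      qed
      have "hc M (g \<circ> linepath 0 y) = hc M (?g0 +++ ?gxy)"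
        by (rule hc_eqI[OF homotopic_paths_sym[OF hp_reparam4[OF g _ x01 y01]]]) auto
      then have "hc M ((g \<circ> linepath 0 y) +++ ?r) = hc M ((?g0 +++ rx) +++ (sh +++ (reversepath ry +++ ?r)))"
        using oks e sub[of 0 y] y01 by (simp add: arr_iff_okp star_assoc)
      moreover have "okp M ((g \<circ> linepath 0 y) +++ ?r)"
        using oks sub[of 0 y] y01 by (simp add: arr_iff_okp)
      ultimately have H: "homotopic_paths M ((g \<circ> linepath 0 y) +++ ?r) ((?g0 +++ rx) +++ (sh +++ (reversepath ry +++ ?r)))"
        by (simp add: hc_eq del: hc_join)
      have "T (?g0 +++ rx)"
        using xy(3) th R1 arx arr_in[OF ash] unfolding P_def rx_def by auto
      moreover have "T sh" using T_far ash by blast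
      moreover have "T (reversepath ry +++ ?r)"
        unfolding ry_def by (rule T_line) (use A th R1 ary arr_in[OF ash] gM[OF y01] in \<open>auto simp: ry_def\<close>)
      ultimately have "T ((?g0 +++ rx) +++ (sh +++ (reversepath ry +++ ?r)))"
        using oks by (intro T_join[of "?g0 +++ rx"] T_join[of sh]) (auto simp: arr_iff_okp okp_def)
      then show "T ((g \<circ> linepath 0 y) +++ ray (g y) \<theta> R q)"
        using T_hom homotopic_paths_sym[OF H] by blast
    qed
    moreover have "openin (top_of_set {0..1}) N" "t0 \<in> N"
      using t0 \<delta> by (auto simp: N_def openin_open_Int)
    ultimately show ?thesis by blast
  qed
  have "P 1"
    by (rule connected_induction_simple[of "{0..1::real}" 0 1]) (use step \<open>P 0\<close> in auto)
  have "b \<in> M" using ab OM by auto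
  have r1: "ray b 0 0 q = (\<lambda>_. b)" using arr_ends[OF g] by (auto simp: ray_def)
  have "T (g +++ (\<lambda>_. b))"
    using \<open>P 1\<close>[unfolded P_def, rule_format, of 0 0] arr_const[OF \<open>b \<in> M\<close>] ab arr_ends[OF g]
    using pi_gt_zero by (simp add: r1 comp_linepath01)
  then show "T g" using T_hom hp_rid[OF g] by blast
qed

end

subsection \<open>Meridians are central\<close>

text \<open>A radial push: inside the disc of radius \<open>\<rho>\<close> about a puncture each
  point moves outwards to the circle. The discs are disjoint because punctures are
  \<open>2 * \<rho>\<close> apart, and the straight homotopy meets no puncture.\<close>

lemma push_off:
  fixes P :: "complex set"
  assumes "finite P" "\<rho> > 0" and sep: "\<And>x y. x \<in> P \<Longrightarrow> y \<in> P \<Longrightarrow> x \<noteq> y \<Longrightarrow> 2 * \<rho> \<le> cmod (x - y)"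
    and c: "path c" "path_image c \<subseteq> - P" and ends: "\<And>x. x \<in> P \<Longrightarrow> \<rho> \<le> cmod (c 0 - x) \<and> \<rho> \<le> cmod (c 1 - x)"
  obtains d where "homotopic_paths (-P) c d" "\<And>x t. x \<in> P \<Longrightarrow> t \<in> {0..1} \<Longrightarrow> \<rho> \<le> cmod (d t - x)"
proof -
  \<comment> \<open>The stretching that brings \<open>z\<close> to distance \<open>\<rho>\<close>
    from \<open>x\<close>. It vanishes outside the disc, so at most one term of the sum in
    \<open>r\<close> is nonzero.\<close>
  define k where "k z x = max 0 (\<rho> - cmod (z - x)) / cmod (z - x)" for z x
  define r where "r z = z + (\<Sum>x\<in>P. of_real (k z x) * (z - x))" for z
  have far: "r z = z" if "\<And>x. x \<in> P \<Longrightarrow> \<rho> \<le> cmod (z - x)" for z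
  proof -
    have "k z x = 0" if "x \<in> P" for x using \<open>\<And>x. x \<in> P \<Longrightarrow> \<rho> \<le> cmod (z - x)\<close>[OF that] by (simp add: k_def)
    then have "(\<Sum>x\<in>P. complex_of_real (k z x) * (z - x)) = 0" by simp
    then show ?thesis by (simp add: r_def)
  qed
  have near: "r z = z + of_real (k z x) * (z - x) \<and> (\<forall>y\<in>P-{x}. \<rho> < cmod (z - y))" if "x \<in> P" "cmod (z - x) < \<rho>" for z x
  proof -
    have o: "\<rho> < cmod (z - y)" if "y \<in> P - {x}" for y
    proof -
      have "2 * \<rho> \<le> cmod (x - y)" using sep[of x y] that \<open>x \<in> P\<close> by auto
      also have "\<dots> \<le> cmod (z - x) + cmod (z - y)"
        using norm_triangle_ineq4[of "z - y" "z - x"] by (simp add: algebra_simps)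
      finally show ?thesis using \<open>cmod (z - x) < \<rho>\<close> by simp
    qed
    have "(\<Sum>y\<in>P. of_real (k z y) * (z - y)) = of_real (k z x) * (z - x) + (\<Sum>y\<in>P-{x}. of_real (k z y) * (z - y))"
      using assms(1) that(1) by (rule sum.remove)
    also have "(\<Sum>y\<in>P-{x}. of_real (k z y) * (z - y)) = 0"
      using o by (intro sum.neutral) (auto simp: k_def)
    finally show ?thesis using o by (simp add: r_def)
  qed
  have seg: "closed_segment z (r z) \<subseteq> -P \<and> (\<forall>x\<in>P. \<rho> \<le> cmod (r z - x))" if z: "z \<notin> P" for z
  proof (cases "\<exists>x\<in>P. cmod (z - x) < \<rho>")
    case True
    then obtain x where x: "x \<in> P" "cmod (z - x) < \<rho>" by blast
    have zx: "cmod (z - x) > 0" using z x by auto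
    have k: "k z x = (\<rho> - cmod (z - x)) / cmod (z - x)" "k z x \<ge> 0" using x zx by (auto simp: k_def)
    have rr: "r z = z + of_real (k z x) * (z - x)" using near[OF x] by simp
    have w: "cmod (w - x) > 0 \<and> cmod (w - x) \<le> \<rho>" if wz: "w \<in> closed_segment z (r z)" for w
    proof -
      obtain u where u: "0 \<le> u" "u \<le> 1" "w = (1 - u) *\<^sub>R z + u *\<^sub>R r z" using wz unfolding in_segment(1) by blast
      have "w - x = of_real (1 + u * k z x) * (z - x)" unfolding u rr by (simp add: scaleR_conv_of_real algebra_simps)
      then have e: "cmod (w - x) = (1 + u * k z x) * cmod (z - x)" using k(2) u by (simp add: norm_mult del: of_real_add of_real_mult)
      have "0 \<le> u * k z x" "u * k z x \<le> k z x" using u k(2) by (auto intro: mult_nonneg_nonneg mult_left_le_one_le)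
      then have "1 * cmod (z - x) \<le> cmod (w - x)" "cmod (w - x) \<le> (1 + k z x) * cmod (z - x)"
        unfolding e using zx by (auto intro!: mult_right_mono)
      moreover have "(1 + k z x) * cmod (z - x) = \<rho>" using zx by (simp add: k field_simps)
      ultimately show ?thesis using zx by auto
    qed
    have "w \<notin> P" if "w \<in> closed_segment z (r z)" for w
      using w[OF that] sep[of w x] x(1) assms(2) by auto
    moreover have "\<rho> \<le> cmod (r z - y)" if "y \<in> P" for y
    proof (cases "y = x")
      case True
      have "r z - x = of_real (1 + k z x) * (z - x)" unfolding rr by (simp add: algebra_simps)
      then have "cmod (r z - x) = (1 + k z x) * cmod (z - x)" using k(2) by (simp add: norm_mult del: of_real_add)
      then show ?thesis using zx True by (simp add: k field_simps)
    next
      case False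
      have "2 * \<rho> \<le> cmod (x - y)" using sep[of x y] that x False by auto
      also have "\<dots> \<le> cmod (r z - x) + cmod (r z - y)"
        using norm_triangle_ineq4[of "r z - y" "r z - x"] by (simp add: algebra_simps)
      finally show ?thesis using w[of "r z"] by auto
    qed
    ultimately show ?thesis by blast
  next
    case False
    then have "r z = z" using far[of z] by force
    then show ?thesis using z False by force
  qed
  have k_cont: "continuous_on (-P) r"
    unfolding r_def k_def by (intro continuous_intros) auto
  have cP: "c t \<notin> P" if "t \<in> {0..1}" for t using c(2) that unfolding path_image_def by blast
  have "homotopic_paths (-P) c (r \<circ> c)"
  proof (rule homotopic_paths_linear)
    show "path (r \<circ> c)" using c k_cont by (intro path_continuous_image continuous_on_subset[OF k_cont])
    show "pathstart (r \<circ> c) = pathstart c" "pathfinish (r \<circ> c) = pathfinish c"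
      using far ends by (auto simp: pathstart_def pathfinish_def)
  qed (use c seg cP in auto)
  then show ?thesis using that[of "r \<circ> c"] seg cP by auto
qed

lemma Tr_homotopic_path:
  assumes "Tr S f x y" "homotopic_paths S f f'"
  shows "Tr S f' x y"
proof -
  obtain a b where "arr S a b f" "arr S a a x" "arr S b b y" using assms(1) by (rule Tr_arr)
  then show ?thesis using Tr_homotopic[OF assms arr_refl arr_refl] by blast
qed

context arrangement
begin

text \<open>\<open>v\<close> is the point \<open>hz j p v\<close> of the \<open>j\<close>-th
  hyperplane plus \<open>zc j p v\<close> times \<open>p\<close>. \<open>rot\<close> turns the
  second summand once around; for admissible \<open>v\<close> this is a meridian based at
  \<open>v\<close>.\<close>

definition zc :: "'j \<Rightarrow> ('a \<Rightarrow> complex) \<Rightarrow> ('a \<Rightarrow> complex) \<Rightarrow> complex" where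
  "zc j p v = f j v / f j p"

definition hz :: "'j \<Rightarrow> ('a \<Rightarrow> complex) \<Rightarrow> ('a \<Rightarrow> complex) \<Rightarrow> 'a \<Rightarrow> complex" where
  "hz j p v = lin v (- zc j p v) p"

definition rot :: "'j \<Rightarrow> ('a \<Rightarrow> complex) \<Rightarrow> ('a \<Rightarrow> complex) \<Rightarrow> real \<Rightarrow> 'a \<Rightarrow> complex" where
  "rot j p v t = lin v ((cis (2 * pi * t) - 1) * zc j p v) p"

text \<open>Points around which the circle parallel to \<open>p\<close> and centred on the \<open>j\<close>-th hyperplane bounds a disc that meets no other hyperplane.\<close>

definition Adm :: "'j \<Rightarrow> ('a \<Rightarrow> complex) \<Rightarrow> ('a \<Rightarrow> complex) set" where
  "Adm j p = {v \<in> V. f j v \<noteq> 0 \<and> (\<forall>l\<in>J-{j}. cmod (zc j p v * f l p) < cmod (f l (hz j p v)))}"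

end

locale meridian = arrangement V J f for V :: "('a \<Rightarrow> complex) set" and J :: "'j set" and f +
  fixes j p
  assumes j: "j \<in> J" and p: "p \<in> V" and fjp: "f j p \<noteq> 0"
begin

lemma zc_lin: "zc j p (lin v c q) = zc j p v + c * zc j p q"
  using j by (simp add: zc_def add_divide_distrib)

lemma zc_p: "zc j p p = 1"
  using fjp by (simp add: zc_def)

lemma continuous_on_zc [continuous_intros]: "continuous_on S g \<Longrightarrow> continuous_on S (\<lambda>x. zc j p (g x))"
  unfolding zc_def using j fjp by (intro continuous_intros) auto

lemma continuous_on_rot: "continuous_on S g \<Longrightarrow> continuous_on S h \<Longrightarrow> continuous_on S (\<lambda>x. rot j p (g x) (h x))"
  unfolding rot_def cis_conv_exp by (intro continuous_intros)

lemma f_hz: "l \<in> J \<Longrightarrow> f l (hz j p v) = f l v - zc j p v * f l p"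
  by (simp add: hz_def)

lemma f_rot: "l \<in> J \<Longrightarrow> f l (rot j p v t) = f l (hz j p v) + cis (2 * pi * t) * (zc j p v * f l p)"
  by (simp add: rot_def f_hz algebra_simps)

lemma fj_rot: "f j (rot j p v t) = cis (2 * pi * t) * f j v"
  using j fjp by (simp add: rot_def zc_def algebra_simps)

lemma rot_0 [simp]: "rot j p v 0 = v" and rot_1 [simp]: "rot j p v 1 = v"
  by (simp_all add: rot_def)

text \<open>Rotation preserves the modulus of the second summand in \<open>f_rot\<close>.
  Admissibility keeps it below that of the first, so the two cannot cancel.\<close>

lemma rot_Adm_M:
  assumes "v \<in> Adm j p"
  shows "rot j p v t \<in> M"
  unfolding M_def
proof (intro CollectI conjI ballI)
  show "rot j p v t \<in> V" using assms p by (auto simp: rot_def Adm_def intro: lin_closed)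
  fix l assume l: "l \<in> J"
  show "f l (rot j p v t) \<noteq> 0"
  proof (cases "l = j")
    case True
    then show ?thesis using assms fj_rot by (simp add: Adm_def)
  next
    case False
    then have "cmod (zc j p v * f l p) < cmod (f l (hz j p v))" using assms l by (auto simp: Adm_def)
    moreover have "cmod (cis (2 * pi * t) * (zc j p v * f l p)) = cmod (zc j p v * f l p)" by (simp add: norm_mult)
    ultimately have "f l (hz j p v) \<noteq> - (cis (2 * pi * t) * (zc j p v * f l p))" by (metis norm_minus_cancel order_less_irrefl)
    then show ?thesis using f_rot[OF l, of v t] by (simp add: add_eq_0_iff2)
  qed
qed

lemma Adm_M: "v \<in> Adm j p \<Longrightarrow> v \<in> M"
  using rot_Adm_M[of v 0] by simp

lemma rot_arr: "v \<in> Adm j p \<Longrightarrow> arr M v v (rot j p v)"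
  by (rule arrI) (auto simp: rot_Adm_M intro!: continuous_on_rot[OF continuous_on_const continuous_on_id])

text \<open>The circles based at the points of \<open>g\<close> sweep out a square whose two
  horizontal sides are both \<open>g\<close>.\<close>

lemma rot_path:
  assumes "arr (Adm j p) a b g"
  shows "Tr M g (rot j p a) (rot j p b)"
proof (rule Tr_square)
  show "continuous_on ({0..1} \<times> {0..1}) (\<lambda>(s,t). rot j p (g s) t)"
    unfolding case_prod_unfold
    by (intro continuous_on_rot continuous_on_compose2[OF arr_cont[OF assms]] continuous_intros) auto
qed (use assms arr_ends[OF assms] in \<open>auto intro!: rot_Adm_M arr_mem[OF assms]\<close>)

end

text \<open>On a line \<open>lin v c q\<close> with variable \<open>c\<close> the form
  \<open>f j\<close> is constant, and every other hyperplane leaves exactly one puncture,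
  \<open>c = - gq l v\<close>.\<close>

locale pencil = meridian V J f j p for V :: "('a \<Rightarrow> complex) set" and J :: "'j set" and f and j and p +
  fixes q
  assumes q: "q \<in> V" and fjq: "f j q = 0" and flq: "\<And>l. l \<in> J - {j} \<Longrightarrow> f l q \<noteq> 0"
begin

definition gq :: "'j \<Rightarrow> ('a \<Rightarrow> complex) \<Rightarrow> complex" where
  "gq l v = f l v / f l q"

text \<open>The region far out in direction \<open>q\<close>. The factor 2 leaves a strict
  inequality at the centre \<open>hz j p v\<close> after one triangle inequality, whence
  \<open>Om_Adm\<close>. On each line the condition is an intersection of half-planes.\<close>

definition Om :: "('a \<Rightarrow> complex) set" where
  "Om = {v \<in> V. f j v \<noteq> 0 \<and> (\<forall>l\<in>J-{j}. 2 * cmod (zc j p v * gq l p) < Re (gq l v))}"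

lemma gq_lin: "l \<in> J \<Longrightarrow> gq l (lin v c u) = gq l v + c * gq l u"
  by (simp add: gq_def add_divide_distrib)

lemma gq_q: "l \<in> J - {j} \<Longrightarrow> gq l q = 1"
  using flq by (simp add: gq_def)

lemma gq_linq: "l \<in> J - {j} \<Longrightarrow> gq l (lin v c q) = gq l v + c"
  using gq_q by (simp add: gq_lin)

lemma continuous_on_gq [continuous_intros]: "l \<in> J - {j} \<Longrightarrow> continuous_on S g \<Longrightarrow> continuous_on S (\<lambda>x. gq l (g x))"
  unfolding gq_def using flq by (intro continuous_intros) auto

lemma zc_linq: "zc j p (lin v c q) = zc j p v"
  using fjq j by (simp add: zc_def)

lemma fj_linq: "f j (lin v c q) = f j v"
  using fjq j by simp

lemma linq_M: "lin v c q \<in> M \<longleftrightarrow> lin v c q \<in> V \<and> f j v \<noteq> 0 \<and> (\<forall>l\<in>J-{j}. gq l v + c \<noteq> 0)"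
proof -
  have "f l (lin v c q) \<noteq> 0 \<longleftrightarrow> gq l v + c \<noteq> 0" if "l \<in> J - {j}" for l
    using gq_linq[OF that, of v c] flq[OF that] by (auto simp: gq_def)
  then have A: "(\<forall>l\<in>J-{j}. f l (lin v c q) \<noteq> 0) \<longleftrightarrow> (\<forall>l\<in>J-{j}. gq l v + c \<noteq> 0)"
    by (intro ball_cong) auto
  have "lin v c q \<in> M \<longleftrightarrow> lin v c q \<in> V \<and> f j (lin v c q) \<noteq> 0 \<and> (\<forall>l\<in>J-{j}. f l (lin v c q) \<noteq> 0)"
    using j unfolding M_def by blast
  then show ?thesis by (simp only: fj_linq A)
qed

lemma Om_Adm: "Om \<subseteq> Adm j p"
proof
  fix v assume v: "v \<in> Om"
  have "cmod (zc j p v * f l p) < cmod (f l (hz j p v))" if l: "l \<in> J - {j}" for l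
  proof -
    have "2 * cmod (zc j p v * gq l p) < Re (gq l v)" using v l by (auto simp: Om_def)
    also have "\<dots> \<le> cmod (gq l v)" by (rule complex_Re_le_cmod)
    also have "\<dots> \<le> cmod (gq l v - zc j p v * gq l p) + cmod (zc j p v * gq l p)"
      by (metis diff_add_cancel norm_triangle_ineq)
    finally have "cmod (zc j p v * gq l p) < cmod (gq l v - zc j p v * gq l p)" by simp
    moreover have "gq l v - zc j p v * gq l p = f l (hz j p v) / f l q" "zc j p v * gq l p = zc j p v * f l p / f l q"
      using l by (auto simp: gq_def f_hz diff_divide_distrib)
    ultimately show ?thesis using flq[OF l] by (simp add: norm_divide divide_less_cancel)
  qed
  then show "v \<in> Adm j p" using v by (auto simp: Om_def Adm_def)
qed

lemma Om_M: "Om \<subseteq> M"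
  using Om_Adm Adm_M by blast

lemma Om_linq: "lin v c q \<in> Om \<longleftrightarrow> lin v c q \<in> V \<and> f j v \<noteq> 0 \<and> (\<forall>l\<in>J-{j}. 2 * cmod (zc j p v * gq l p) < Re (gq l v) + Re c)"
  unfolding Om_def using fj_linq zc_linq by (auto simp: gq_linq)

lemma Om_bound:
  assumes "compact C" "continuous_on C (g :: 'c::topological_space \<Rightarrow> _)" "\<And>t. t \<in> C \<Longrightarrow> g t \<in> V \<and> f j (g t) \<noteq> 0"
  obtains B where "B > 0" "\<And>t c. t \<in> C \<Longrightarrow> B \<le> Re c \<Longrightarrow> lin (g t) c q \<in> Om"
proof -
  have "\<exists>b. \<forall>t\<in>C. 2 * cmod (zc j p (g t) * gq l p) - Re (gq l (g t)) < b" if l: "l \<in> J - {j}" for l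
  proof -
    have "compact ((\<lambda>t. 2 * cmod (zc j p (g t) * gq l p) - Re (gq l (g t))) ` C)"
      using assms l by (intro compact_continuous_image continuous_intros)
    then have "bounded ((\<lambda>t. 2 * cmod (zc j p (g t) * gq l p) - Re (gq l (g t))) ` C)" by (rule compact_imp_bounded)
    then obtain b where "\<forall>x\<in>(\<lambda>t. 2 * cmod (zc j p (g t) * gq l p) - Re (gq l (g t))) ` C. \<bar>x\<bar> \<le> b"
      unfolding bounded_real by blast
    then show ?thesis by (intro exI[of _ "b+1"]) fastforce
  qed
  then obtain b where b: "\<And>l t. l \<in> J - {j} \<Longrightarrow> t \<in> C \<Longrightarrow> 2 * cmod (zc j p (g t) * gq l p) - Re (gq l (g t)) < b l" by metis
  define B where "B = Max (insert 1 (b ` (J - {j})))"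
  have B: "1 \<le> B" "\<And>l. l \<in> J - {j} \<Longrightarrow> b l \<le> B" using finite_J by (auto simp: B_def)
  show ?thesis
  proof (rule that[of B])
    fix t c assume "t \<in> C" "B \<le> Re c"
    then show "lin (g t) c q \<in> Om" unfolding Om_linq using assms(3) q b B(2) by (fastforce intro: lin_closed)
  qed (use B in auto)
qed

text \<open>Centrality restricted to one line: however a path between far points winds around the
  punctures, it carries meridian to meridian.\<close>

definition LP :: "('a \<Rightarrow> complex) \<Rightarrow> bool" where
  "LP v \<longleftrightarrow> (\<forall>c. path c \<longrightarrow> (\<forall>t\<in>{0..1}. lin v (c t) q \<in> M) \<longrightarrow> lin v (c 0) q \<in> Om \<longrightarrow> lin v (c 1) q \<in> Om \<longrightarrow>
     Tr M (\<lambda>t. lin v (c t) q) (rot j p (lin v (c 0) q)) (rot j p (lin v (c 1) q)))"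

lemma line_arr:
  assumes "path c" "\<And>t. t \<in> {0..1} \<Longrightarrow> lin v (c t) q \<in> S"
  shows "arr S (lin v (c 0) q) (lin v (c 1) q) (\<lambda>t. lin v (c t) q)"
  using assms by (intro arrI continuous_intros) (auto simp: path_def)

lemma Tr_conj:
  assumes "Tr M g1 x x'" "Tr M (g1 +++ (g +++ g2)) x y" "Tr M g2 y' y" "arr M a' a g1" "arr M a b g" "arr M b b' g2"
  shows "Tr M g x' y'"
proof -
  have o: "okp M g1" "okp M g2" "okp M g" "okp M x" "okp M y" "okp M x'" "okp M y'"
    and e: "pathstart g1 = a'" "pathfinish g1 = a" "pathstart g = a" "pathfinish g = b" "pathstart g2 = b" "pathfinish g2 = b'"
      "pathstart x = a'" "pathfinish x = a'" "pathstart x' = a" "pathfinish x' = a"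
      "pathstart y' = b" "pathfinish y' = b" "pathstart y = b'" "pathfinish y = b'"
    using assms(4-6) TrD[OF assms(1,4)] TrD[OF assms(3,6)] by (auto simp: arr_iff_okp)
  have "Tr M (reversepath g1 +++ ((g1 +++ (g +++ g2)) +++ reversepath g2)) x' y'"
    using o e by (intro Tr_join[OF Tr_rev[OF assms(1)] Tr_join[OF assms(2) Tr_rev[OF assms(3)]]]) simp_all
  moreover have "homotopic_paths M (reversepath g1 +++ ((g1 +++ (g +++ g2)) +++ reversepath g2)) g"
    using o e by (subst hc_eq[symmetric]) (simp_all add: star_assoc)
  ultimately show ?thesis by (rule Tr_homotopic) (use o in \<open>auto simp: okp_def\<close>)
qed

text \<open>The far part of a line is convex, so the ends of any path can be joined to one fixed far
  point inside \<open>Om\<close>, where \<open>rot_path\<close> carries the meridian along.\<close>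

lemma LP_from_far:
  assumes v: "v \<in> V" "f j v \<noteq> 0" and S: "lin v (complex_of_real S) q \<in> Om"
    and *: "\<And>c. path c \<Longrightarrow> (\<And>t. t \<in> {0..1} \<Longrightarrow> lin v (c t) q \<in> M) \<Longrightarrow> c 0 = of_real S \<Longrightarrow> c 1 = of_real S \<Longrightarrow>
      Tr M (\<lambda>t. lin v (c t) q) (rot j p (lin v (of_real S) q)) (rot j p (lin v (of_real S) q))"
  shows "LP v"
  unfolding LP_def
proof (intro allI impI)
  fix c assume c: "path c" "\<forall>t\<in>{0..1}. lin v (c t) q \<in> M" "lin v (c 0) q \<in> Om" "lin v (c 1) q \<in> Om"
  have cv: "convex {z. lin v z q \<in> Om}"
  proof -
    have "{z. lin v z q \<in> Om} = (\<Inter>l\<in>J-{j}. {z. 2 * cmod (zc j p v * gq l p) - Re (gq l v) < Re z})"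
      by (auto simp: Om_linq lin_closed[OF v(1) q] v(2) algebra_simps)
    also have "convex \<dots>" by (intro convex_INT ballI convex_halfspace_Re_gt)
    finally show ?thesis .
  qed
  have seg: "arr Om (lin v x q) (lin v y q) (\<lambda>t. lin v (linepath x y t) q)" if "lin v x q \<in> Om" "lin v y q \<in> Om" for x y
  proof -
    have "linepath x y t \<in> {z. lin v z q \<in> Om}" if "t \<in> {0..1}" for t
      unfolding linepath_def using that \<open>lin v x q \<in> Om\<close> \<open>lin v y q \<in> Om\<close> by (intro convexD_alt[OF cv]) auto
    then show ?thesis using line_arr[of "linepath x y" v Om] by (simp add: linepath_0' linepath_1')
  qed
  let ?l1 = "linepath (of_real S) (c 0)" and ?l2 = "linepath (c 1) (of_real S)" and ?L = "\<lambda>z. lin v z q"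
  let ?c = "?l1 +++ (c +++ ?l2)"
  have e: "(\<lambda>t. ?L (?c t)) = (\<lambda>t. ?L (?l1 t)) +++ ((\<lambda>t. ?L (c t)) +++ (\<lambda>t. ?L (?l2 t)))"
    by (auto simp: joinpaths_def)
  note s1 = seg[OF S c(3)] and s2 = seg[OF c(4) S]
  note m = arr_mono[OF s1 Om_M] line_arr[OF c(1), of v M, OF c(2)[rule_format]] arr_mono[OF s2 Om_M]
  have A: "arr M (lin v (of_real S) q) (lin v (of_real S) q) (\<lambda>t. ?L (?c t))"
    unfolding e by (rule arr_join[OF m(1) arr_join[OF m(2) m(3)]])
  have "Tr M (\<lambda>t. ?L (?c t)) (rot j p (lin v (of_real S) q)) (rot j p (lin v (of_real S) q))"
  proof (rule *)
    have "pathstart c = c 0" "pathfinish c = c 1" by (simp_all add: pathstart_def pathfinish_def)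
    then show "path ?c" using c(1) by simp
    show "?c 0 = of_real S" "?c 1 = of_real S"
      using pathstart_join[of ?l1 "c +++ ?l2"] pathfinish_join[of ?l1 "c +++ ?l2"] by (auto simp: pathstart_def pathfinish_def joinpaths_def linepath_def)
  qed (use arr_mem[OF A] in auto)
  then show "Tr M (\<lambda>t. ?L (c t)) (rot j p (?L (c 0))) (rot j p (?L (c 1)))"
    unfolding e
    by (rule Tr_conj[OF rot_path[OF arr_mono[OF s1 Om_Adm]] _ rot_path[OF arr_mono[OF s2 Om_Adm]] m])
qed

text \<open>Away from the discs of radius \<open>\<rho>\<close> around the punctures, the line may be moved by less than \<open>\<rho>\<close>.\<close>

lemma push_line:
  assumes v: "v \<in> V" "f j v \<noteq> 0" and "\<rho> > 0"
    and sep: "\<And>l m. l \<in> J - {j} \<Longrightarrow> m \<in> J - {j} \<Longrightarrow> l \<noteq> m \<Longrightarrow> 2 * \<rho> \<le> cmod (gq l v - gq m v)"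
    and c: "path c" "\<And>t. t \<in> {0..1} \<Longrightarrow> lin v (c t) q \<in> M" "c 0 = of_real S" "c 1 = of_real S"
    and S: "\<And>l. l \<in> J - {j} \<Longrightarrow> \<rho> \<le> cmod (of_real S + gq l v)"
  shows "\<exists>d. homotopic_paths M (\<lambda>t. lin v (c t) q) (\<lambda>t. lin v (d t) q) \<and> path d \<and> d 0 = of_real S \<and> d 1 = of_real S \<and>
    (\<forall>l\<in>J-{j}. \<forall>t\<in>{0..1}. \<rho> \<le> cmod (gq l v + d t))"
proof -
  let ?P = "(\<lambda>l. - gq l v) ` (J - {j})"
  have cP: "path_image c \<subseteq> - ?P"
    using c(2) unfolding linq_M path_image_def by force
  obtain d where d: "homotopic_paths (-?P) c d" "\<And>x t. x \<in> ?P \<Longrightarrow> t \<in> {0..1} \<Longrightarrow> \<rho> \<le> cmod (d t - x)"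
  proof (rule push_off[of ?P \<rho> c])
    show "2 * \<rho> \<le> cmod (x - y)" if xy: "x \<in> ?P" "y \<in> ?P" "x \<noteq> y" for x y
    proof -
      obtain l where l: "l \<in> J - {j}" "x = - gq l v" using xy(1) by blast
      obtain m where m: "m \<in> J - {j}" "y = - gq m v" using xy(2) by blast
      have "l \<in> J - {j}" "m \<in> J - {j}" "l \<noteq> m" "x = - gq l v" "y = - gq m v" using l m xy(3) by auto
      then show ?thesis using sep[of m l] by simp
    qed
    show "\<rho> \<le> cmod (c 0 - x) \<and> \<rho> \<le> cmod (c 1 - x)" if xP: "x \<in> ?P" for x
    proof -
      obtain l where l: "l \<in> J - {j}" "x = - gq l v" using xP by blast
      then show ?thesis using S[OF l(1)] c(3,4) by simp
    qed
  qed (use finite_J \<open>\<rho> > 0\<close> c cP in auto)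
  have "homotopic_paths M ((\<lambda>z. lin v z q) \<circ> c) ((\<lambda>z. lin v z q) \<circ> d)"
  proof (rule homotopic_paths_continuous_image[OF d(1)])
    show "continuous_on (- ?P) (\<lambda>z. lin v z q)" by (intro continuous_intros)
    show "(\<lambda>z. lin v z q) \<in> - ?P \<rightarrow> M"
    proof
      fix z assume z: "z \<in> - ?P"
      have "gq l v + z \<noteq> 0" if "l \<in> J - {j}" for l
      proof
        assume "gq l v + z = 0"
        then have "z = - gq l v" by (simp add: add_eq_0_iff)
        then show False using z that by blast
      qed
      then show "lin v z q \<in> M" unfolding linq_M using lin_closed[OF v(1) q] v(2) by blast
    qed
  qed
  moreover have "d 0 = of_real S" "d 1 = of_real S" "path d"
    using c homotopic_paths_imp_pathstart[OF d(1)] homotopic_paths_imp_pathfinish[OF d(1)] homotopic_paths_imp_path[OF d(1)]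
    by (auto simp: pathstart_def pathfinish_def)
  moreover have "\<rho> \<le> cmod (gq l v + d t)" if "l \<in> J - {j}" "t \<in> {0..1}" for l t
    using d(2)[of "- gq l v" t] that by (auto simp: add.commute)
  ultimately show ?thesis unfolding o_def by blast
qed

lemma Om_bound_single:
  assumes v: "v \<in> V" "f j v \<noteq> 0"
  obtains B where "B > 0" "\<And>c. B \<le> Re c \<Longrightarrow> lin v c q \<in> Om"
proof -
  obtain B where "B > 0" "\<And>t c. t \<in> {0::real} \<Longrightarrow> B \<le> Re c \<Longrightarrow> lin v c q \<in> Om"
    by (rule Om_bound[of "{0::real}" "\<lambda>_. v"]) (use assms in auto)
  then show ?thesis using that by blast
qed

lemma far_from_punctures:
  obtains B where "\<And>l S. l \<in> J - {j} \<Longrightarrow> B \<le> S \<Longrightarrow> \<rho> \<le> cmod (complex_of_real S + gq l v)"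
proof
  fix l S assume l: "l \<in> J - {j}" and S: "\<rho> + Max (insert 0 ((\<lambda>l. cmod (gq l v)) ` (J - {j}))) \<le> S"
  have "cmod (gq l v) \<le> Max (insert 0 ((\<lambda>l. cmod (gq l v)) ` (J - {j})))" using l finite_J by auto
  then have "\<rho> \<le> S - cmod (gq l v)" using S by simp
  also have "\<dots> \<le> cmod (complex_of_real S) - cmod (gq l v)" by simp
  also have "\<dots> \<le> cmod (complex_of_real S + gq l v)" by (metis norm_diff_ineq)
  finally show "\<rho> \<le> cmod (complex_of_real S + gq l v)" .
qed

text \<open>The loop \<open>d\<close> is kept while the line moves from \<open>w 0\<close> to
  \<open>w 1\<close>. Its base point stays in \<open>Om\<close>, so the conjugating side path
  respects meridians, and the transport known on the last line comes back to the first.\<close>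

lemma LP_move:
  assumes w: "continuous_on {0..1::real} w" and d: "path d" "d 0 = of_real S" "d 1 = of_real S"
    and KM': "\<And>s t. s \<in> {0..1} \<Longrightarrow> t \<in> {0..1} \<Longrightarrow> lin (w s) (d t) q \<in> M"
    and SO: "\<And>s. s \<in> {0..1} \<Longrightarrow> lin (w s) (of_real S) q \<in> Om"
    and LP1: "LP (w 1)"
  shows "Tr M (\<lambda>t. lin (w 0) (d t) q) (rot j p (lin (w 0) (of_real S) q)) (rot j p (lin (w 0) (of_real S) q))"
proof -
  define K where "K = (\<lambda>(s,t). lin (w s) (d t) q)"
  have Kc: "continuous_on ({0..1} \<times> {0..1}) K"
    unfolding K_def case_prod_unfold
    by (intro continuous_intros continuous_on_compose2[OF w] continuous_on_compose2[OF d(1)[unfolded path_def]]) auto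
  have KM: "K (s,t) \<in> M" if "s \<in> {0..1}" "t \<in> {0..1}" for s t
    using KM'[OF that] by (simp add: K_def)
  let ?side = "\<lambda>s. lin (w s) (of_real S) q"
  let ?x = "rot j p (lin (w 0) (of_real S) q)" and ?y = "rot j p (lin (w 1) (of_real S) q)"
  have side: "arr Om (?side 0) (?side 1) ?side"
    using SO by (intro arrI continuous_intros w(1)) auto
  have T1: "Tr M ?side ?x ?y" using rot_path[OF arr_mono[OF side Om_Adm]] by simp
  have T2: "Tr M (\<lambda>t. lin (w 1) (d t) q) ?y ?y"
    using LP1[unfolded LP_def, rule_format, of d] d KM[of 1] arr_in[OF side] by (auto simp: K_def)
  have a0: "arr M (?side 0) (?side 0) (\<lambda>t. lin (w 0) (d t) q)"
    using line_arr[of d "w 0" M] d KM[of 0] by (auto simp: K_def)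
  have a1: "arr M (?side 1) (?side 1) (\<lambda>t. lin (w 1) (d t) q)"
    using line_arr[of d "w 1" M] d KM[of 1] by (auto simp: K_def)
  have as: "arr M (?side 0) (?side 1) ?side" using arr_mono[OF side Om_M] .
  have "homotopic_paths M ((\<lambda>t. K (0,t)) +++ (\<lambda>s. K (s,1))) ((\<lambda>s. K (s,0)) +++ (\<lambda>t. K (1,t)))"
    by (rule square_homotopic[OF Kc KM])
  then have sq: "homotopic_paths M ((\<lambda>t. lin (w 0) (d t) q) +++ ?side) (?side +++ (\<lambda>t. lin (w 1) (d t) q))"
    by (simp add: K_def d(2,3))
  have "homotopic_paths M (((\<lambda>t. lin (w 0) (d t) q) +++ ?side) +++ reversepath ?side) (\<lambda>t. lin (w 0) (d t) q)"
    by (rule hp_cancel_right[OF a0 as])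
  then have "homotopic_paths M ((?side +++ (\<lambda>t. lin (w 1) (d t) q)) +++ reversepath ?side) (\<lambda>t. lin (w 0) (d t) q)"
    by (rule homotopic_paths_trans[OF homotopic_paths_sym[OF hp_join_left[OF sq arr_join[OF a0 as] arr_rev[OF as]]]])
  note H = this
  have T3: "Tr M ((?side +++ (\<lambda>t. lin (w 1) (d t) q)) +++ reversepath ?side) ?x ?x"
    by (intro Tr_join[OF Tr_join[OF T1 T2]] Tr_rev[OF T1]) (use d(2,3) in \<open>auto simp: pathstart_def pathfinish_def reversepath_def joinpaths_def\<close>)
  show "Tr M (\<lambda>t. lin (w 0) (d t) q) ?x ?x"
    by (rule Tr_homotopic[OF T3 H]) (use TrD(1)[OF T1 as] in \<open>auto simp: arr_def\<close>)
qed

text \<open>Once a loop has been pushed to distance \<open>\<rho>\<close> from the punctures of the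
  first line, punctures moving by less than \<open>\<rho>\<close> never reach it.\<close>

lemma LP_transfer:
  assumes "\<rho> > 0" and w: "continuous_on {0..1::real} w" "\<And>s. s \<in> {0..1} \<Longrightarrow> w s \<in> V \<and> f j (w s) \<noteq> 0"
    and sep: "\<And>l m. l \<in> J - {j} \<Longrightarrow> m \<in> J - {j} \<Longrightarrow> l \<noteq> m \<Longrightarrow> 2 * \<rho> \<le> cmod (gq l (w 0) - gq m (w 0))"
    and near: "\<And>l s. l \<in> J - {j} \<Longrightarrow> s \<in> {0..1} \<Longrightarrow> cmod (gq l (w s) - gq l (w 0)) < \<rho>"
    and LP1: "LP (w 1)"
  shows "LP (w 0)"
proof -
  obtain B where B: "B > 0" "\<And>t c. t \<in> {0..1} \<Longrightarrow> B \<le> Re c \<Longrightarrow> lin (w t) c q \<in> Om"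
    using Om_bound[of "{0..1::real}" w] w by auto
  obtain B' where B': "\<And>l S. l \<in> J - {j} \<Longrightarrow> B' \<le> S \<Longrightarrow> \<rho> \<le> cmod (complex_of_real S + gq l (w 0))"
    using far_from_punctures by blast
  define S where "S = max B B'"
  have hS: "\<rho> \<le> cmod (complex_of_real S + gq l (w 0))" if "l \<in> J - {j}" for l
    using B'[OF that] by (simp add: S_def)
  have v: "w 0 \<in> V" "f j (w 0) \<noteq> 0" using w(2)[of 0] by auto
  show ?thesis
  proof (rule LP_from_far[OF v])
    show "lin (w 0) (complex_of_real S) q \<in> Om" using B(2)[of 0] by (simp add: S_def)
    fix c assume c: "path c" "\<And>t. t \<in> {0..1} \<Longrightarrow> lin (w 0) (c t) q \<in> M" "c 0 = of_real S" "c 1 = of_real S"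
    from push_line[OF v \<open>\<rho> > 0\<close> sep c hS]
    obtain d where D: "homotopic_paths M (\<lambda>t. lin (w 0) (c t) q) (\<lambda>t. lin (w 0) (d t) q) \<and> path d \<and> d 0 = of_real S \<and> d 1 = of_real S \<and>
      (\<forall>l\<in>J-{j}. \<forall>t\<in>{0..1}. \<rho> \<le> cmod (gq l (w 0) + d t))" ..
    then have d: "homotopic_paths M (\<lambda>t. lin (w 0) (c t) q) (\<lambda>t. lin (w 0) (d t) q)" "path d" "d 0 = of_real S" "d 1 = of_real S"
      "\<And>l t. l \<in> J - {j} \<Longrightarrow> t \<in> {0..1} \<Longrightarrow> \<rho> \<le> cmod (gq l (w 0) + d t)"
      by simp_all
    have KM: "lin (w s) (d t) q \<in> M" if "s \<in> {0..1}" "t \<in> {0..1}" for s t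
    proof -
      have "gq l (w s) + d t \<noteq> 0" if l: "l \<in> J - {j}" for l
      proof
        assume "gq l (w s) + d t = 0"
        then have "gq l (w 0) + d t = - (gq l (w s) - gq l (w 0))" by (simp add: add_eq_0_iff2 algebra_simps)
        then have "cmod (gq l (w 0) + d t) = cmod (gq l (w s) - gq l (w 0))" by (metis norm_minus_cancel)
        then show False using d(5)[OF l \<open>t \<in> _\<close>] near[OF l \<open>s \<in> _\<close>] by simp
      qed
      then show ?thesis unfolding linq_M using w(2)[OF \<open>s \<in> _\<close>] q lin_closed by auto
    qed
    have "Tr M (\<lambda>t. lin (w 0) (d t) q) (rot j p (lin (w 0) (of_real S) q)) (rot j p (lin (w 0) (of_real S) q))"
      by (rule LP_move[OF w(1) d(2-4) KM _ LP1]) (use B(2) S_def in auto)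
    then show "Tr M (\<lambda>t. lin (w 0) (c t) q) (rot j p (lin (w 0) (of_real S) q)) (rot j p (lin (w 0) (of_real S) q))"
      by (rule Tr_homotopic_path[OF _ homotopic_paths_sym[OF d(1)]])
  qed
qed

text \<open>Close to the \<open>j\<close>-th hyperplane, circle and loop together sweep out a torus
  in \<open>M\<close>: the factor \<open>cis (2*pi*t) - 1\<close> has modulus at most 2, so turning
  the circle shifts each puncture by less than \<open>\<rho>\<close>.\<close>

lemma LP_small:
  assumes "\<rho> > 0" and v: "v \<in> V" "f j v \<noteq> 0"
    and sep: "\<And>l m. l \<in> J - {j} \<Longrightarrow> m \<in> J - {j} \<Longrightarrow> l \<noteq> m \<Longrightarrow> 2 * \<rho> \<le> cmod (gq l v - gq m v)"
    and small: "\<And>l. l \<in> J - {j} \<Longrightarrow> 2 * cmod (zc j p v * gq l p) < \<rho>"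
  shows "LP v"
proof -
  obtain B where B: "B > 0" "\<And>c. B \<le> Re c \<Longrightarrow> lin v c q \<in> Om"
    using Om_bound_single[OF v] by auto
  obtain B' where B': "\<And>l S. l \<in> J - {j} \<Longrightarrow> B' \<le> S \<Longrightarrow> \<rho> \<le> cmod (complex_of_real S + gq l v)"
    using far_from_punctures by blast
  define S where "S = max B B'"
  have hS: "\<rho> \<le> cmod (complex_of_real S + gq l v)" if "l \<in> J - {j}" for l
    using B'[OF that] by (simp add: S_def)
  show ?thesis
  proof (rule LP_from_far[OF v])
    show SO: "lin v (complex_of_real S) q \<in> Om" using B(2) by (simp add: S_def)
    fix c assume c: "path c" "\<And>t. t \<in> {0..1} \<Longrightarrow> lin v (c t) q \<in> M" "c 0 = of_real S" "c 1 = of_real S"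
    from push_line[OF v \<open>\<rho> > 0\<close> sep c hS]
    obtain d where D: "homotopic_paths M (\<lambda>t. lin v (c t) q) (\<lambda>t. lin v (d t) q) \<and> path d \<and> d 0 = of_real S \<and> d 1 = of_real S \<and>
      (\<forall>l\<in>J-{j}. \<forall>t\<in>{0..1}. \<rho> \<le> cmod (gq l v + d t))" ..
    then have d: "homotopic_paths M (\<lambda>t. lin v (c t) q) (\<lambda>t. lin v (d t) q)" "path d" "d 0 = of_real S" "d 1 = of_real S"
      "\<And>l t. l \<in> J - {j} \<Longrightarrow> t \<in> {0..1} \<Longrightarrow> \<rho> \<le> cmod (gq l v + d t)"
      by simp_all
    let ?x = "rot j p (lin v (of_real S) q)"
    have "Tr M (\<lambda>t. lin v (d t) q) ?x ?x"
    proof (rule Tr_square)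
      show "continuous_on ({0..1} \<times> {0..1}) (\<lambda>(s,t). rot j p (lin v (d s) q) t)"
        unfolding case_prod_unfold
        by (intro continuous_on_rot continuous_intros continuous_on_compose2[OF d(2)[unfolded path_def]]) auto
      fix s t :: real assume st: "s \<in> {0..1}" "t \<in> {0..1}"
      have r: "rot j p (lin v (d s) q) t = lin (lin v ((cis (2*pi*t) - 1) * zc j p v) p) (d s) q"
        unfolding rot_def zc_linq by (rule lin_commute)
      have "gq l v + ((cis (2*pi*t) - 1) * zc j p v) * gq l p + d s \<noteq> 0" if l: "l \<in> J - {j}" for l
      proof
        assume "gq l v + ((cis (2*pi*t) - 1) * zc j p v) * gq l p + d s = 0"
        then have "gq l v + d s = - ((cis (2*pi*t) - 1) * (zc j p v * gq l p))" by (simp add: add_eq_0_iff2 algebra_simps)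
        then have "cmod (gq l v + d s) = cmod (cis (2*pi*t) - 1) * cmod (zc j p v * gq l p)" by (metis norm_minus_cancel norm_mult)
        also have "\<dots> \<le> 2 * cmod (zc j p v * gq l p)"
          using norm_triangle_ineq4[of "cis (2*pi*t)" 1] by (intro mult_right_mono) auto
        finally show False using d(5)[OF l st(1)] small[OF l] by simp
      qed
      moreover have "f j (lin v ((cis (2*pi*t) - 1) * zc j p v) p) \<noteq> 0"
        using fj_rot[of v t] v by (simp add: rot_def)
      ultimately show "(case (s,t) of (s,t) \<Rightarrow> rot j p (lin v (d s) q) t) \<in> M"
        unfolding prod.case r linq_M using v p q by (auto simp: gq_lin intro!: lin_closed)
    qed (use d(3,4) in auto)
    then show "Tr M (\<lambda>t. lin v (c t) q) ?x ?x"
      by (rule Tr_homotopic[OF _ homotopic_paths_sym[OF d(1)]]) (use rot_arr SO Om_Adm in \<open>auto simp: arr_def\<close>)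
  qed
qed

end

section \<open>Deforming lines with distinct or coinciding punctures\<close>

lemma uniform_nonzero:
  fixes h :: "'i \<Rightarrow> real \<Rightarrow> complex"
  assumes "finite I" "\<And>i. i \<in> I \<Longrightarrow> continuous_on {0..1} (h i)" "\<And>i t. i \<in> I \<Longrightarrow> t \<in> {0..1} \<Longrightarrow> h i t \<noteq> 0"
  shows "\<exists>\<delta>>0. \<forall>i\<in>I. \<forall>t\<in>{0..1}. \<delta> \<le> cmod (h i t)"
  using assms
proof (induction I rule: finite_induct)
  case (insert i I)
  obtain d where d: "d > 0" "\<forall>i\<in>I. \<forall>t\<in>{0..1}. d \<le> cmod (h i t)" using insert by force
  have "continuous_on {0..1} (\<lambda>t. cmod (h i t))" using insert by (intro continuous_intros) auto
  then obtain t0 where t0: "t0 \<in> {0..1}" "\<forall>t\<in>{0..1}. cmod (h i t0) \<le> cmod (h i t)"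
    using continuous_attains_inf[of "{0..1::real}" "\<lambda>t. cmod (h i t)"] by auto
  have "cmod (h i t0) > 0" using insert.prems(2)[of i t0] t0 by simp
  then show ?case using d t0 by (intro exI[of _ "min d (cmod (h i t0))"]) (auto intro: min.coboundedI1 min.coboundedI2)
qed (auto intro: exI[of _ 1])

lemma small_scalar:
  fixes a :: "'i \<Rightarrow> complex"
  assumes "finite I" "\<epsilon> > 0"
  shows "\<exists>r>0. \<forall>i\<in>I. \<forall>z. cmod z < r \<longrightarrow> cmod (z * a i) < \<epsilon>"
proof -
  define R where "R = 1 + (\<Sum>i\<in>I. cmod (a i))"
  have R: "R > 0" "\<And>i. i \<in> I \<Longrightarrow> cmod (a i) \<le> R"
    using sum_nonneg[of I "\<lambda>i. cmod (a i)"] member_le_sum[of _ I "\<lambda>i. cmod (a i)"] assms(1)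
    by (auto simp: R_def intro: add_increasing) 
  have "cmod (z * a i) < \<epsilon>" if "i \<in> I" "cmod z < \<epsilon> / R" for i z
  proof -
    have "cmod (z * a i) \<le> cmod z * R" using R(2)[OF that(1)] by (auto simp: norm_mult intro: mult_left_mono)
    also have "\<dots> < \<epsilon>" using that(2) R(1) by (simp add: field_simps)
    finally show ?thesis .
  qed
  then show ?thesis using R(1) assms(2) by (intro exI[of _ "\<epsilon> / R"]) auto
qed

lemma ball_minus_finite:
  assumes "finite B" "r > 0"
  obtains z :: complex where "cmod (z - z0) < r" "z \<notin> B"
proof -
  have "infinite (ball z0 r)" using assms(2) uncountable_ball[of r z0] countable_finite by blast
  then have "infinite (ball z0 r - B)" using assms(1) by simp
  then obtain z where "z \<in> ball z0 r - B" using infinite_imp_nonempty by blast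
  then show ?thesis using that[of z] by (auto simp: dist_norm norm_minus_commute)
qed

lemma ray_line: "ray v \<theta> R q = (\<lambda>z. lin v z q) \<circ> linepath 0 (of_real R * cis \<theta>)"
  by (rule ext) (simp add: ray_def linepath_def scaleR_conv_of_real mult.assoc)

context pencil
begin

text \<open>The line approaches the hyperplane: \<open>zc\<close> is scaled by a complex
  \<open>\<tau>\<close>, from 1 to nearly 0, where \<open>LP_small\<close> applies. Only finitely
  many \<open>\<tau>\<close> are excluded; the rest of the plane is connected, and
  \<open>LP_transfer\<close> makes the property locally constant on it.\<close>

lemma LP_distinct:
  assumes v: "v \<in> V" "f j v \<noteq> 0"
    and d1: "\<And>l m. l \<in> J - {j} \<Longrightarrow> m \<in> J - {j} \<Longrightarrow> l \<noteq> m \<Longrightarrow> gq l v \<noteq> gq m v"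
    and d2: "\<And>l m. l \<in> J - {j} \<Longrightarrow> m \<in> J - {j} \<Longrightarrow> l \<noteq> m \<Longrightarrow> gq l (hz j p v) \<noteq> gq m (hz j p v)"
  shows "LP v"
proof -
  define z where "z = zc j p v"
  define w where "w \<tau> = lin (hz j p v) (\<tau> * z) p" for \<tau>
  define D where "D = {lm \<in> (J-{j}) \<times> (J-{j}). fst lm \<noteq> snd lm}"
  define \<Theta> where "\<Theta> = {\<tau>. \<tau> \<noteq> 0 \<and> (\<forall>lm\<in>D. gq (fst lm) (w \<tau>) \<noteq> gq (snd lm) (w \<tau>))}"
  have finD: "finite D" "finite (J - {j})" using finite_J by (auto simp: D_def)
  have z0: "z \<noteq> 0" using v fjp by (simp add: z_def zc_def)
  have w1: "w 1 = v" by (simp add: w_def hz_def z_def)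
  have wV: "w \<tau> \<in> V" for \<tau> using v p by (auto simp: w_def hz_def intro!: lin_closed)
  have fw: "f j (w \<tau>) = \<tau> * z * f j p" for \<tau> using j fjp by (simp add: w_def f_hz zc_def)
  have zcw: "zc j p (w \<tau>) = \<tau> * z" for \<tau> using fw fjp by (simp add: zc_def)
  have gw: "gq l (w \<tau>) = gq l (hz j p v) + \<tau> * (z * gq l p)" if "l \<in> J" for l \<tau>
    using that by (simp add: w_def gq_lin)
  have wc: "continuous_on S (\<lambda>x. w (g x))" if "continuous_on S g" for S and g :: "real \<Rightarrow> complex"
    unfolding w_def by (intro continuous_intros that)
  \<comment> \<open>The value of \<open>\<tau>\<close> at which the punctures of \<open>l\<close>
    and \<open>m\<close> coincide. By \<open>d2\<close> they differ at \<open>\<tau> = 0\<close>, so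
    they do not coincide identically.\<close>
  let ?bad = "\<lambda>(l,m). - (gq l (hz j p v) - gq m (hz j p v)) / (z * (gq l p - gq m p))"
  have "- \<Theta> \<subseteq> insert 0 (?bad ` D)"
  proof
    fix \<tau> assume "\<tau> \<in> - \<Theta>"
    then consider "\<tau> = 0" | l m where "(l,m) \<in> D" "gq l (w \<tau>) = gq m (w \<tau>)" by (auto simp: \<Theta>_def)
    then show "\<tau> \<in> insert 0 (?bad ` D)"
    proof cases
      case 2
      then have lm: "l \<in> J - {j}" "m \<in> J - {j}" "l \<noteq> m" by (auto simp: D_def)
      have e: "gq l (hz j p v) + \<tau> * (z * gq l p) = gq m (hz j p v) + \<tau> * (z * gq m p)"
        using 2(2) gw lm by auto
      have "gq l p \<noteq> gq m p" using e d2[OF lm] by auto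
      moreover have "\<tau> * (z * (gq l p - gq m p)) = - (gq l (hz j p v) - gq m (hz j p v))"
        using e by (simp add: algebra_simps)
      ultimately have "\<tau> = ?bad (l,m)" using z0 by (simp add: eq_divide_eq)
      then show ?thesis using 2(1) by blast
    qed simp
  qed
  then have fin: "finite (- \<Theta>)" using finD(1) finite_subset by blast
  then have conn: "connected \<Theta>"
    using path_connected_complement_countable[of "- \<Theta>"] by (auto simp: countable_finite path_connected_imp_connected)
  \<comment> \<open>A separation of \<open>4 * \<rho>\<close> leaves at least
    \<open>2 * \<rho>\<close> after two punctures have moved by less than \<open>\<rho>/2\<close>
    each.\<close>
  have sepD: "\<exists>\<rho>>0. \<forall>lm\<in>D. 4 * \<rho> \<le> cmod (gq (fst lm) u - gq (snd lm) u)" if "\<forall>lm\<in>D. gq (fst lm) u \<noteq> gq (snd lm) u" for u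
  proof -
    have "\<exists>\<delta>>0. \<forall>i\<in>D. \<forall>t\<in>{0..1::real}. \<delta> \<le> cmod (gq (fst i) u - gq (snd i) u)"
      by (rule uniform_nonzero) (use that finD in auto)
    then obtain \<delta> where "\<delta> > 0" "\<forall>i\<in>D. \<delta> \<le> cmod (gq (fst i) u - gq (snd i) u)" by (metis atLeastAtMost_iff order_refl zero_le_one)
    then show ?thesis by (intro exI[of _ "\<delta>/4"]) auto
  qed
  have sep_near: "2 * \<rho> \<le> cmod (gq l y - gq m y)"
    if "4 * \<rho> \<le> cmod (gq l x - gq m x)" "cmod (gq l y - gq l x) < \<rho>/2" "cmod (gq m y - gq m x) < \<rho>/2" for \<rho> l m x y
  proof -
    have "gq l x - gq m x = (gq l y - gq m y) - ((gq l y - gq l x) - (gq m y - gq m x))" by simp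
    then have "cmod (gq l x - gq m x) \<le> cmod (gq l y - gq m y) + (cmod (gq l y - gq l x) + cmod (gq m y - gq m x))"
      by (metis norm_triangle_ineq4 order_trans add_left_mono)
    then show ?thesis using that zero_le_power2 norm_ge_zero[of "gq l y - gq l x"] by linarith
  qed
  have "1 \<in> \<Theta>" using d1 by (auto simp: \<Theta>_def D_def w1)
  moreover have "\<exists>\<tau>\<in>\<Theta>. LP (w \<tau>)"
  proof -
    have "\<forall>lm\<in>D. gq (fst lm) (hz j p v) \<noteq> gq (snd lm) (hz j p v)" using d2 by (auto simp: D_def)
    then obtain \<rho> where \<rho>: "\<rho> > 0" "\<forall>lm\<in>D. 4 * \<rho> \<le> cmod (gq (fst lm) (hz j p v) - gq (snd lm) (hz j p v))" using sepD by blast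
    obtain r where r: "r > 0" "\<forall>l\<in>J-{j}. \<forall>\<tau>. cmod \<tau> < r \<longrightarrow> cmod (\<tau> * (z * gq l p)) < \<rho>/2"
      using small_scalar[of "J-{j}" "\<rho>/2" "\<lambda>l. z * gq l p"] finD \<rho> by auto
    obtain \<tau> where t: "cmod (\<tau> - 0) < r" "\<tau> \<notin> - \<Theta>" by (rule ball_minus_finite[OF fin r(1)])
    have sm: "cmod (\<tau> * (z * gq l p)) < \<rho>/2" if "l \<in> J - {j}" for l using r(2) t that by simp
    have "LP (w \<tau>)"
    proof (rule LP_small[OF \<rho>(1) wV])
      show "f j (w \<tau>) \<noteq> 0" using t z0 fjp by (auto simp: fw \<Theta>_def)
      show "2 * \<rho> \<le> cmod (gq l (w \<tau>) - gq m (w \<tau>))" if "l \<in> J - {j}" "m \<in> J - {j}" "l \<noteq> m" for l m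
      proof (rule sep_near)
        show "4 * \<rho> \<le> cmod (gq l (hz j p v) - gq m (hz j p v))" using \<rho>(2) that by (auto simp: D_def)
      qed (use sm that in \<open>auto simp: gw\<close>)
      show "2 * cmod (zc j p (w \<tau>) * gq l p) < \<rho>" if "l \<in> J - {j}" for l using sm[OF that] by (simp add: zcw mult.assoc)
    qed
    then show ?thesis using t by auto
  qed
  moreover have "\<exists>T. openin (top_of_set \<Theta>) T \<and> \<tau>0 \<in> T \<and> (\<forall>x\<in>T. \<forall>y\<in>T. LP (w x) \<longrightarrow> LP (w y))" if t0: "\<tau>0 \<in> \<Theta>" for \<tau>0
  proof -
    obtain \<rho> where \<rho>: "\<rho> > 0" "\<forall>lm\<in>D. 4 * \<rho> \<le> cmod (gq (fst lm) (w \<tau>0) - gq (snd lm) (w \<tau>0))"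
      using sepD[of "w \<tau>0"] t0 by (auto simp: \<Theta>_def)
    obtain r where r: "r > 0" "\<forall>l\<in>J-{j}. \<forall>\<tau>. cmod \<tau> < r \<longrightarrow> cmod (\<tau> * (z * gq l p)) < \<rho>/2"
      using small_scalar[of "J-{j}" "\<rho>/2" "\<lambda>l. z * gq l p"] finD \<rho> by auto
    \<comment> \<open>The ball must avoid \<open>\<tau> = 0\<close>, where \<open>w \<tau>\<close>
      lies on the \<open>j\<close>-th hyperplane.\<close>
    define r' where "r' = min r (cmod \<tau>0)"
    have r': "r' > 0" "r' \<le> r" using r t0 by (auto simp: r'_def \<Theta>_def)
    have nz: "x \<noteq> 0" if "x \<in> ball \<tau>0 r'" for x using that by (auto simp: r'_def dist_norm)
    have dg: "cmod (gq l (w x) - gq l (w \<tau>0)) < \<rho>/2" if "x \<in> ball \<tau>0 r'" "l \<in> J - {j}" for x l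
    proof -
      have "gq l (w x) - gq l (w \<tau>0) = (x - \<tau>0) * (z * gq l p)" using that gw by (simp add: algebra_simps)
      then show ?thesis using r(2) that r'(2) by (auto simp: dist_norm norm_minus_commute)
    qed
    have "LP (w y)" if x: "x \<in> ball \<tau>0 r'" and y: "y \<in> ball \<tau>0 r'" and L: "LP (w x)" for x y
    proof -
      have lb: "linepath y x s \<in> ball \<tau>0 r'" if "s \<in> {0..1}" for s
        unfolding linepath_def using that x y by (intro convexD_alt[OF convex_ball]) auto
      have "LP (w (linepath y x 0))"
      proof (rule LP_transfer[OF \<rho>(1)])
        show "continuous_on {0..1} (\<lambda>s. w (linepath y x s))" by (intro wc continuous_on_linepath)
        show "w (linepath y x s) \<in> V \<and> f j (w (linepath y x s)) \<noteq> 0" if "s \<in> {0..1}" for s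
          using wV nz[OF lb[OF that]] z0 fjp by (simp add: fw)
        show "2 * \<rho> \<le> cmod (gq l (w (linepath y x 0)) - gq m (w (linepath y x 0)))" if "l \<in> J - {j}" "m \<in> J - {j}" "l \<noteq> m" for l m
          by (rule sep_near[of \<rho> l "w \<tau>0" m]) (use \<rho>(2) that dg lb[of 0] in \<open>auto simp: D_def\<close>)
        show "cmod (gq l (w (linepath y x s)) - gq l (w (linepath y x 0))) < \<rho>" if "l \<in> J - {j}" "s \<in> {0..1}" for l s
        proof -
          have "cmod (gq l (w (linepath y x s)) - gq l (w (linepath y x 0))) \<le>
             cmod (gq l (w (linepath y x s)) - gq l (w \<tau>0)) + cmod (gq l (w (linepath y x 0)) - gq l (w \<tau>0))"
            using norm_triangle_ineq4[of "gq l (w (linepath y x s)) - gq l (w \<tau>0)" "gq l (w (linepath y x 0)) - gq l (w \<tau>0)"] by simp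
          then show ?thesis using dg[OF lb[OF that(2)] that(1)] dg[OF lb[of 0] that(1)] by simp
        qed
        show "LP (w (linepath y x 1))" using L by (simp add: linepath_1')
      qed
      then show ?thesis by (simp add: linepath_0')
    qed
    then have "\<forall>x\<in>\<Theta> \<inter> ball \<tau>0 r'. \<forall>y\<in>\<Theta> \<inter> ball \<tau>0 r'. LP (w x) \<longrightarrow> LP (w y)" by blast
    moreover have "openin (top_of_set \<Theta>) (\<Theta> \<inter> ball \<tau>0 r')" by (simp add: openin_open_Int)
    moreover have "\<tau>0 \<in> \<Theta> \<inter> ball \<tau>0 r'" using t0 r'(1) by simp
    ultimately show ?thesis by (intro exI[of _ "\<Theta> \<inter> ball \<tau>0 r'"] conjI)
  qed
  moreover note step = calculation
  obtain \<tau> where "\<tau> \<in> \<Theta>" "LP (w \<tau>)" using step(2) by blast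
  then have "LP (w 1)"
    by (rule connected_induction_simple[OF conn, where P = "\<lambda>\<tau>. LP (w \<tau>)", OF _ step(1)]) (rule step(3))
  then show ?thesis by (simp add: w1)
qed

text \<open>Coinciding punctures are pulled apart by a small motion along a vector \<open>e\<close>
  of the \<open>j\<close>-th hyperplane; the given loop is compact and is not hit. Such an
  \<open>e\<close> exists because the other hyperplanes have pairwise distinct traces on the
  \<open>j\<close>-th one, which is what \<open>f_indep\<close> says for three different
  forms.\<close>

lemma LP_all:
  assumes v: "v \<in> V" "f j v \<noteq> 0"
  shows "LP v"
proof -
  define D where "D = {lm \<in> (J-{j}) \<times> (J-{j}). fst lm \<noteq> snd lm}"
  have finD: "finite D" "finite (J - {j})" using finite_J by (auto simp: D_def)
  have "\<exists>e\<in>{u \<in> V. f j u = 0}. \<forall>lm\<in>D. (\<lambda>lm u. gq (fst lm) u - gq (snd lm) u) lm e \<noteq> 0"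
  proof (rule generic_point)
    show "{u \<in> V. f j u = 0} \<noteq> {}" using zero_closed f_zero[OF j] by blast
    show "\<exists>u\<in>{u \<in> V. f j u = 0}. gq (fst lm) u - gq (snd lm) u \<noteq> 0" if "lm \<in> D" for lm
    proof -
      have lm: "fst lm \<in> J" "fst lm \<noteq> j" "snd lm \<in> J" "snd lm \<noteq> j" "fst lm \<noteq> snd lm" using that by (auto simp: D_def)
      then obtain u where "u \<in> V" "f (fst lm) u \<noteq> 0" "f j u = 0" "f (snd lm) u = 0"
        using f_indep[of "fst lm" j "snd lm"] j by auto
      then show ?thesis using flq[of "fst lm"] lm by (auto simp: gq_def)
    qed
  qed (use finD j in \<open>auto simp: gq_lin D_def algebra_simps intro: lin_closed\<close>)
  then obtain e where e: "e \<in> V" "f j e = 0" "\<And>l m. l \<in> J - {j} \<Longrightarrow> m \<in> J - {j} \<Longrightarrow> l \<noteq> m \<Longrightarrow> gq l e \<noteq> gq m e"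
    by (auto simp: D_def)
  obtain B where B: "B > 0" "\<And>c. B \<le> Re c \<Longrightarrow> lin v c q \<in> Om" using Om_bound_single[OF v] by auto
  \<comment> \<open>One unit beyond the bound, so that \<open>S\<close> remains far while the
    punctures move by less than 1.\<close>
  define S where "S = B + 1"
  show ?thesis
  proof (rule LP_from_far[OF v])
    show "lin v (complex_of_real S) q \<in> Om" using B(2) by (simp add: S_def)
    fix c assume c: "path c" "\<And>t. t \<in> {0..1} \<Longrightarrow> lin v (c t) q \<in> M" "c 0 = of_real S" "c 1 = of_real S"
    have "\<exists>\<delta>>0. \<forall>l\<in>J-{j}. \<forall>t\<in>{0..1}. \<delta> \<le> cmod (gq l v + c t)"
      by (rule uniform_nonzero) (use finD c(1,2) in \<open>auto simp: path_def linq_M intro!: continuous_intros\<close>)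
    then obtain \<delta> where \<delta>: "\<delta> > 0" "\<And>l t. l \<in> J-{j} \<Longrightarrow> t \<in> {0..1} \<Longrightarrow> \<delta> \<le> cmod (gq l v + c t)" by blast
    obtain r where r: "r > 0" "\<forall>l\<in>J-{j}. \<forall>\<tau>. cmod \<tau> < r \<longrightarrow> cmod (\<tau> * gq l e) < min \<delta> 1"
      using small_scalar[of "J-{j}" "min \<delta> 1" "\<lambda>l. gq l e"] finD \<delta> by auto
    let ?bad = "\<lambda>u (l,m). - (gq l u - gq m u) / (gq l e - gq m e)"
    have "finite (?bad v ` D \<union> ?bad (hz j p v) ` D)" using finD by blast
    then obtain \<eta> where \<eta>: "cmod (\<eta> - 0) < r" "\<eta> \<notin> ?bad v ` D \<union> ?bad (hz j p v) ` D"
      by (rule ball_minus_finite[OF _ r(1)])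
    have dist: "gq l u + \<eta> * gq l e \<noteq> gq m u + \<eta> * gq m e"
      if "l \<in> J - {j}" "m \<in> J - {j}" "l \<noteq> m" "\<eta> \<notin> ?bad u ` D" for l m u
    proof
      assume a: "gq l u + \<eta> * gq l e = gq m u + \<eta> * gq m e"
      then have "\<eta> * (gq l e - gq m e) = - (gq l u - gq m u)" by (simp add: algebra_simps)
      then have "\<eta> = ?bad u (l,m)" using e(3)[OF that(1-3)] by (simp add: eq_divide_eq)
      moreover have "(l,m) \<in> D" using that by (auto simp: D_def)
      ultimately show False using that(4) by blast
    qed
    define v' where "v' s = lin v (of_real s * \<eta>) e" for s
    have v': "v' s \<in> V" "f j (v' s) = f j v" "zc j p (v' s) = zc j p v" for s
      using v e j by (auto simp: v'_def zc_lin zc_def intro: lin_closed)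
    have gv': "gq l (v' s) = gq l v + of_real s * (\<eta> * gq l e)" if "l \<in> J - {j}" for l s using that by (simp add: v'_def gq_lin)
    have small: "cmod (of_real s * (\<eta> * gq l e)) < min \<delta> 1" if "l \<in> J - {j}" "s \<in> {0..1}" for l s
    proof -
      have "cmod (of_real s * (\<eta> * gq l e)) \<le> 1 * cmod (\<eta> * gq l e)" unfolding norm_mult[of "of_real s"] using that by (intro mult_right_mono) auto
      also have "\<dots> < min \<delta> 1" using r(2) \<eta>(1) that by auto
      finally show ?thesis .
    qed
    have LP1: "LP (v' 1)"
    proof (rule LP_distinct)
      show "v' 1 \<in> V" "f j (v' 1) \<noteq> 0" using v' v by auto
      show "gq l (v' 1) \<noteq> gq m (v' 1)" if "l \<in> J - {j}" "m \<in> J - {j}" "l \<noteq> m" for l m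
        using dist[OF that, of v] \<eta>(2) that by (simp add: gv')
      have h': "hz j p (v' 1) = lin (hz j p v) \<eta> e"
        unfolding hz_def v'(3) by (simp add: v'_def lin_commute)
      show "gq l (hz j p (v' 1)) \<noteq> gq m (hz j p (v' 1))" if "l \<in> J - {j}" "m \<in> J - {j}" "l \<noteq> m" for l m
        using dist[OF that, of "hz j p v"] \<eta>(2) that by (simp add: h' gq_lin)
    qed
    have KM: "lin (v' s) (c t) q \<in> M" if "s \<in> {0..1}" "t \<in> {0..1}" for s t
    proof -
      have "gq l (v' s) + c t \<noteq> 0" if l: "l \<in> J - {j}" for l
      proof
        assume "gq l (v' s) + c t = 0"
        then have "(gq l v + c t) + of_real s * (\<eta> * gq l e) = 0" unfolding gv'[OF l] by (simp add: add_ac)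
        then have "gq l v + c t = - (of_real s * (\<eta> * gq l e))" by (simp add: add_eq_0_iff2)
        then have "cmod (gq l v + c t) = cmod (of_real s * (\<eta> * gq l e))" by (metis norm_minus_cancel)
        then show False using \<delta>(2)[OF l \<open>t \<in> _\<close>] small[OF l \<open>s \<in> _\<close>] by simp
      qed
      then show ?thesis unfolding linq_M using lin_closed[OF v'(1) q] v'(2) v(2) by auto
    qed
    have SO: "lin (v' s) (of_real S) q \<in> Om" if s: "s \<in> {0..1}" for s
    proof -
      have "2 * cmod (zc j p (v' s) * gq l p) < Re (gq l (v' s)) + Re (complex_of_real S)" if l: "l \<in> J - {j}" for l
      proof -
        have "2 * cmod (zc j p v * gq l p) < Re (gq l v) + B" using B(2)[of "of_real B"] l unfolding Om_linq by auto
        moreover have "\<bar>Re (of_real s * (\<eta> * gq l e))\<bar> < 1" using abs_Re_le_cmod[of "of_real s * (\<eta> * gq l e)"] small[OF l s] by linarith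
        ultimately show ?thesis unfolding gv'[OF l] v'(3) S_def plus_complex.sel by simp
      qed
      then show ?thesis unfolding Om_linq using lin_closed[OF v'(1) q] v'(2) v(2) by auto
    qed
    have v'c: "continuous_on {0..1} v'" unfolding v'_def by (intro continuous_intros)
    have v'0: "v' 0 = v" by (simp add: v'_def)
    show "Tr M (\<lambda>t. lin v (c t) q) (rot j p (lin v (of_real S) q)) (rot j p (lin v (of_real S) q))"
      using LP_move[OF v'c c(1,3,4) KM SO LP1] by (simp add: v'0)
  qed
qed

text \<open>\<open>path_generation\<close> with transport of the meridian as \<open>T\<close>: a
  change of direction at \<open>v\<close> takes place in the line through \<open>v\<close> parallel
  to \<open>q\<close> and is covered by \<open>LP_all\<close>.\<close>

lemma Tr_Om:
  assumes g: "arr M a b g" and "a \<in> Om" "b \<in> Om"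
  shows "Tr M g (rot j p a) (rot j p b)"
proof -
  have "Tr M g (rot j p (g 0)) (rot j p (g 1))"
  proof (rule path_generation[where \<Omega> = Om and T = "\<lambda>g. Tr M g (rot j p (g 0)) (rot j p (g 1))", OF q Om_M _ _ _ _ _ g assms(2,3)])
    fix C :: "real set" and g \<theta>
    assume C: "compact C" "continuous_on C g" "g ` C \<subseteq> M" "\<bar>\<theta>\<bar> < pi/4"
    have gM: "g t \<in> V \<and> f j (g t) \<noteq> 0" if "t \<in> C" for t using C(3) that j unfolding M_def by blast
    obtain B where B: "B > 0" "\<And>t c. t \<in> C \<Longrightarrow> B \<le> Re c \<Longrightarrow> lin (g t) c q \<in> Om"
      using Om_bound[OF C(1,2) gM] by blast
    \<comment> \<open>Directions stay within \<open>pi/4\<close>, so \<open>cos \<theta>\<close> is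
      at least 1/2, and radius \<open>2 * B\<close> gives real part at least
      \<open>B\<close>.\<close>
    have "cos (pi/3) \<le> cos \<theta>" using C(4) pi_gt_zero cos_monotone_0_pi_le[of "\<bar>\<theta>\<bar>" "pi/3"] by simp
    then have "B \<le> Re (of_real (2 * B) * cis \<theta>)" using B(1) by (simp add: cos_60)
    then show "\<exists>R>0. \<forall>t\<in>C. lin (g t) (complex_of_real R * cis \<theta>) q \<in> Om" using B by (intro exI[of _ "2*B"]) auto
  next
    fix g h assume A: "Tr M g (rot j p (g 0)) (rot j p (g 1))" and H: "homotopic_paths M g h"
    have "g 0 = h 0" "g 1 = h 1"
      using homotopic_paths_imp_pathstart[OF H] homotopic_paths_imp_pathfinish[OF H] by (auto simp: pathstart_def pathfinish_def)
    then show "Tr M h (rot j p (h 0)) (rot j p (h 1))"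
      using Tr_homotopic_path[OF A H] by simp
  next
    fix g h assume A: "Tr M g (rot j p (g 0)) (rot j p (g 1))" "Tr M h (rot j p (h 0)) (rot j p (h 1))" "pathfinish g = pathstart h"
    then have "g 1 = h 0" by (simp add: pathstart_def pathfinish_def)
    then have "Tr M (g +++ h) (rot j p (g 0)) (rot j p (h 1))" using Tr_join[OF A(1), of h] A by simp
    moreover have "(g +++ h) 0 = g 0" "(g +++ h) 1 = h 1" by (auto simp: joinpaths_def)
    ultimately show "Tr M (g +++ h) (rot j p ((g +++ h) 0)) (rot j p ((g +++ h) 1))" by simp
  next
    fix g a b assume A: "arr Om a b g"
    then show "Tr M g (rot j p (g 0)) (rot j p (g 1))"
      using rot_path[OF arr_mono[OF A Om_Adm]] arr_ends[OF A] by simp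
  next
    fix v \<theta> \<theta>' R R'
    assume A: "v \<in> M" "0 \<le> R" "0 \<le> R'" "arr M v (ray v \<theta> R q 1) (ray v \<theta> R q)" "arr M v (ray v \<theta>' R' q 1) (ray v \<theta>' R' q)"
       "ray v \<theta> R q 1 \<in> Om" "ray v \<theta>' R' q 1 \<in> Om"
    let ?c = "reversepath (linepath 0 (of_real R * cis \<theta>)) +++ linepath 0 (of_real R' * cis \<theta>')"
    let ?g = "reversepath (ray v \<theta> R q) +++ ray v \<theta>' R' q"
    have e: "?g = (\<lambda>t. lin v (?c t) q)"
      unfolding ray_line path_compose_reversepath[symmetric] path_compose_join[symmetric] by (simp add: o_def)
    have gM: "arr M (ray v \<theta> R q 1) (ray v \<theta>' R' q 1) ?g" using A by (intro arr_join arr_rev)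
    have "LP v" using A(1) j by (intro LP_all) (auto simp: M_def)
    moreover have "path ?c" by simp
    moreover have "lin v (?c t) q \<in> M" if "t \<in> {0..1}" for t using arr_mem[OF gM that] unfolding e .
    moreover have "lin v (?c 0) q \<in> Om" "lin v (?c 1) q \<in> Om" using arr_ends[OF gM] A unfolding e by auto
    ultimately have "Tr M (\<lambda>t. lin v (?c t) q) (rot j p (lin v (?c 0) q)) (rot j p (lin v (?c 1) q))"
      unfolding LP_def by blast
    then show "Tr M ?g (rot j p (?g 0)) (rot j p (?g 1))" unfolding e .
  qed
  then show ?thesis using arr_ends[OF g] by simp
qed


end

context pencil
begin

text \<open>First the circle shrinks about its centre, then it moves out along \<open>q\<close>. The
  hypothesis keeps the ray of centres off the other hyperplanes, and a small enough circle can
  follow.\<close>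

lemma reach_Om:
  assumes a: "a \<in> Adm j p" and nr: "\<And>l. l \<in> J - {j} \<Longrightarrow> gq l (hz j p a) \<notin> \<real>\<^sub>\<le>\<^sub>0"
  obtains a' g where "a' \<in> Om" "arr (Adm j p) a a' g"
proof -
  define h where "h = hz j p a"
  define z where "z = zc j p a"
  have aV: "a \<in> V" and fa: "f j a \<noteq> 0" and adm: "\<And>l. l \<in> J - {j} \<Longrightarrow> cmod (z * f l p) < cmod (f l h)"
    using a by (auto simp: Adm_def h_def z_def)
  have hV: "h \<in> V" using aV p by (simp add: h_def hz_def lin_closed)
  have z0: "z \<noteq> 0" using fa fjp by (simp add: z_def zc_def)
  have fh: "f j h = 0" using j fjp by (simp add: h_def f_hz zc_def)
  have ah: "a = lin h z p" by (simp add: h_def z_def hz_def)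
  \<comment> \<open>For \<open>y\<close> off the slit, a positive lower bound for the distance from
    0 to the ray that starts at \<open>y\<close> and runs to the right.\<close>
  define dl where "dl y = (if Im y \<noteq> 0 then \<bar>Im y\<bar> else Re y)" for y
  have dl: "dl (gq l h) > 0 \<and> (\<forall>s\<ge>0. dl (gq l h) \<le> cmod (gq l h + of_real s))" if "l \<in> J - {j}" for l
  proof -
    have n: "\<not> (Im (gq l h) = 0 \<and> Re (gq l h) \<le> 0)" using nr[OF that] by (auto simp: complex_nonpos_Reals_iff h_def)
    have "dl (gq l h) \<le> cmod (gq l h + of_real s)" if "s \<ge> 0" for s
    proof (cases "Im (gq l h) = 0")
      case True
      have "Re (gq l h) \<le> Re (gq l h + of_real s)" using that by simp
      also have "\<dots> \<le> cmod (gq l h + of_real s)" by (rule complex_Re_le_cmod)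
      finally show ?thesis using True by (simp add: dl_def)
    next
      case False
      then show ?thesis using abs_Im_le_cmod[of "gq l h + of_real s"] by (simp add: dl_def)
    qed
    then show ?thesis using n by (auto simp: dl_def)
  qed
  define \<delta> where "\<delta> = Min (insert 1 ((\<lambda>l. dl (gq l h)) ` (J-{j})))"
  have \<delta>: "\<delta> > 0" "\<And>l. l \<in> J - {j} \<Longrightarrow> \<delta> \<le> dl (gq l h)"
    using finite_J dl by (auto simp: \<delta>_def)
  have "\<exists>r>0. \<forall>l\<in>J-{j}. \<forall>w. cmod w < r \<longrightarrow> cmod (w * (z * gq l p)) < \<delta>"
    by (rule small_scalar) (use finite_J \<delta> in auto)
  then obtain r where r: "r > 0" "\<forall>l\<in>J-{j}. \<forall>w. cmod w < r \<longrightarrow> cmod (w * (z * gq l p)) < \<delta>" by blast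
  define \<epsilon> where "\<epsilon> = min 1 (r/2)"
  have \<epsilon>: "0 < \<epsilon>" "\<epsilon> \<le> 1" "\<epsilon> < r" using r(1) by (auto simp: \<epsilon>_def)
  have zl: "zc j p (lin h c p) = c" for c using fh by (simp add: zc_lin zc_p) (simp add: zc_def fh)
  have hl: "hz j p (lin h c p) = h" for c by (simp add: hz_def zl)
  define a1 where "a1 = lin h (of_real \<epsilon> * z) p"
  have a1V: "a1 \<in> V" using hV p by (simp add: a1_def lin_closed)
  have fa1: "f j a1 \<noteq> 0" using fh z0 fjp \<epsilon> j by (simp add: a1_def)
  obtain B where B: "B > 0" "\<And>c. B \<le> Re c \<Longrightarrow> lin a1 c q \<in> Om" using Om_bound_single[OF a1V fa1] by auto
  define g1 where "g1 = (\<lambda>s. lin h (of_real (1 - s * (1 - \<epsilon>)) * z) p)"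
  define g2 where "g2 = (\<lambda>s. lin a1 (of_real (s * B)) q)"
  have A1: "arr (Adm j p) a a1 g1"
  proof (rule arrI)
    show "continuous_on {0..1} g1" unfolding g1_def by (intro continuous_intros)
    show "g1 0 = a" "g1 1 = a1" by (simp_all add: g1_def ah a1_def)
    fix s :: real assume s: "s \<in> {0..1}"
    define u where "u = 1 - s * (1 - \<epsilon>)"
    have "s * (1 - \<epsilon>) \<le> 1 - \<epsilon>" "0 \<le> s * (1 - \<epsilon>)" using s \<epsilon> by (auto simp: mult_left_le_one_le)
    then have u: "0 < u" "u \<le> 1" using \<epsilon> by (auto simp: u_def)
    have e: "g1 s = lin h (of_real u * z) p" by (simp add: g1_def u_def)
    have "cmod (of_real u * z * f l p) < cmod (f l h)" if l: "l \<in> J - {j}" for l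
    proof -
      have "cmod (of_real u * z * f l p) = u * cmod (z * f l p)" using u by (simp add: norm_mult)
      also have "\<dots> \<le> 1 * cmod (z * f l p)" using u by (intro mult_right_mono) auto
      finally show ?thesis using adm[OF l] by simp
    qed
    then show "g1 s \<in> Adm j p"
      unfolding Adm_def mem_Collect_eq e zl hl using lin_closed[OF hV p] fh z0 fjp j u by simp
  qed
  have A2: "arr (Adm j p) a1 (lin a1 (of_real B) q) g2"
  proof (rule arrI)
    show "continuous_on {0..1} g2" unfolding g2_def by (intro continuous_intros)
    show "g2 0 = a1" "g2 1 = lin a1 (of_real B) q" by (simp_all add: g2_def)
    fix s :: real assume s: "s \<in> {0..1}"
    have zz: "zc j p (g2 s) = of_real \<epsilon> * z" by (simp add: g2_def zc_linq a1_def zl)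
    have hh: "hz j p (g2 s) = lin h (of_real (s * B)) q"
      unfolding hz_def zz by (simp add: g2_def a1_def lin_commute[of _ _ q])
    have "cmod (of_real \<epsilon> * z * f l p) < cmod (f l (lin h (of_real (s * B)) q))" if l: "l \<in> J - {j}" for l
    proof -
      have "cmod (of_real \<epsilon> * (z * gq l p)) < \<delta>" using r(2) l \<epsilon> by auto
      also have "\<dots> \<le> cmod (gq l h + of_real (s * B))" 
      proof -
        have "0 \<le> s * B" using s B(1) by simp
        then show ?thesis using \<delta>(2)[OF l] dl[OF l] by force
      qed
      also have "gq l h + of_real (s * B) = f l (lin h (of_real (s * B)) q) / f l q"
        using l flq[OF l] by (simp add: gq_def add_divide_distrib)
      also have "of_real \<epsilon> * (z * gq l p) = of_real \<epsilon> * z * f l p / f l q" by (simp add: gq_def)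
      finally show ?thesis using flq[OF l] by (simp add: norm_divide divide_less_cancel del: f_lin)
    qed
    then show "g2 s \<in> Adm j p"
      unfolding Adm_def mem_Collect_eq zz hh unfolding g2_def fj_linq using lin_closed[OF a1V q] fa1 by simp
  qed
  show ?thesis using that[OF B(2)[of "of_real B"] arr_join[OF A1 A2]] by simp
qed

end

context meridian
begin

text \<open>The circle around the \<open>j\<close>-th hyperplane is transported to itself along every path: its class is central.\<close>

theorem rot_transport:
  assumes a: "a \<in> Adm j p" and b: "b \<in> Adm j p" and g: "arr M a b g"
  shows "Tr M g (rot j p a) (rot j p b)"
proof -
  have "\<exists>u\<in>{u \<in> V. f j u = 0}. \<forall>l\<in>J-{j}. f l u \<noteq> 0"
  proof (rule generic_point)
    show "{u \<in> V. f j u = 0} \<noteq> {}" using zero_closed f_zero[OF j] by blast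
    show "\<exists>u\<in>{u \<in> V. f j u = 0}. f l u \<noteq> 0" if "l \<in> J - {j}" for l
      using f_indep[of l j j] that j by auto
  qed (use finite_J j in \<open>auto intro: lin_closed\<close>)
  then obtain q0 where q0: "q0 \<in> V" "f j q0 = 0" "\<And>l. l \<in> J - {j} \<Longrightarrow> f l q0 \<noteq> 0" by blast
  let ?Z = "(\<lambda>l. f l (hz j p a) / f l q0) ` (J-{j}) \<union> (\<lambda>l. f l (hz j p b) / f l q0) ` (J-{j})"
  have nz: "f l (hz j p x) \<noteq> 0" if "x \<in> Adm j p" "l \<in> J - {j}" for x l
  proof -
    have "cmod (zc j p x * f l p) < cmod (f l (hz j p x))" using that by (auto simp: Adm_def)
    then show ?thesis by auto
  qed
  have Z0: "0 \<notin> ?Z"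
  proof
    assume "0 \<in> ?Z"
    then obtain l where l: "l \<in> J - {j}" and "f l (hz j p a) / f l q0 = 0 \<or> f l (hz j p b) / f l q0 = 0"
      unfolding Un_iff image_iff by (metis (no_types))
    then show False using nz[OF a l] nz[OF b l] q0(3)[OF l] by auto
  qed
  \<comment> \<open>One rotation of \<open>q0\<close> makes the same pencil suit both
    \<open>a\<close> and \<open>b\<close>: the quotients belonging to both centres avoid the
    slit.\<close>
  have "\<exists>\<theta>. 0 < \<theta> \<and> \<theta> < 1 \<and> (\<forall>z\<in>?Z. z * cis (-\<theta>) \<notin> \<real>\<^sub>\<le>\<^sub>0)"
    by (rule generic_angle) (use finite_J Z0 pi_gt3 in auto)
  then obtain \<theta> where \<theta>: "\<And>z. z \<in> ?Z \<Longrightarrow> z * cis (-\<theta>) \<notin> \<real>\<^sub>\<le>\<^sub>0" by blast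
  define q where "q = lin (\<lambda>_. 0) (cis \<theta>) q0"
  have fq: "f l q = cis \<theta> * f l q0" if "l \<in> J" for l using that f_zero[OF that] by (simp add: q_def)
  interpret P: pencil V J f j p q
  proof unfold_locales
    show "q \<in> V" unfolding q_def by (rule lin_closed[OF zero_closed q0(1)])
    show "f j q = 0" using fq[OF j] q0(2) by simp
    show "f l q \<noteq> 0" if "l \<in> J - {j}" for l using fq[of l] q0(3)[OF that] that by simp
  qed
  have gq: "P.gq l (hz j p x) = f l (hz j p x) / f l q0 * cis (-\<theta>)" if "l \<in> J - {j}" for l x
  proof -
    have "l \<in> J" using that by simp
    show ?thesis unfolding P.gq_def fq[OF \<open>l \<in> J\<close>] divide_inverse inverse_mult_distrib cis_inverse by (simp only: mult_ac)
  qed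
  have nra: "P.gq l (hz j p a) \<notin> \<real>\<^sub>\<le>\<^sub>0" and nrb: "P.gq l (hz j p b) \<notin> \<real>\<^sub>\<le>\<^sub>0" if "l \<in> J - {j}" for l
    unfolding gq[OF that] by (rule \<theta>; use that in blast)+
  obtain a' ga where A: "a' \<in> P.Om" "arr (Adm j p) a a' ga" using P.reach_Om[OF a nra] by blast
  obtain b' gb where B: "b' \<in> P.Om" "arr (Adm j p) b b' gb" using P.reach_Om[OF b nrb] by blast
  have AM: "Adm j p \<subseteq> M" using Adm_M by blast
  note am = arr_mono[OF A(2) AM] and bm = arr_mono[OF B(2) AM]
  have T: "Tr M (reversepath ga +++ (g +++ gb)) (rot j p a') (rot j p b')"
    by (rule P.Tr_Om[OF arr_join[OF arr_rev[OF am] arr_join[OF g bm]] A(1) B(1)])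
  show ?thesis
    by (rule P.Tr_conj[OF Tr_rev[OF rot_path[OF A(2)]] T rot_path[OF B(2)] arr_rev[OF am] g bm])
qed

end

subsection \<open>Meridians generate\<close>

lemma lin_arr:
  assumes "path c" "\<And>t. t \<in> {0..1} \<Longrightarrow> lin v (c t) p \<in> S"
  shows "arr S (lin v (c 0) p) (lin v (c 1) p) (\<lambda>t. lin v (c t) p)"
  using assms by (intro arrI continuous_intros) (auto simp: path_def)

text \<open>By periodicity every unit interval gives the same loop, so the path up to
  \<open>m\<close> is the \<open>m\<close>-th power of one turn, run backwards if \<open>m\<close>
  is negative.\<close>

lemma linepath_circle_power:
  fixes E :: "real \<Rightarrow> 'a::topological_space"
  assumes c: "continuous_on UNIV E" and S: "\<And>x. E x \<in> S" and per: "\<And>x. E (x + 1) = E x"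
    and P1: "P (hc S (E \<circ> linepath 0 1))"
    and Pone: "P (gone S (E 0))" and Pstar: "\<And>X Y. P X \<Longrightarrow> P Y \<Longrightarrow> P (star S X Y)" and Pinv: "\<And>X. P X \<Longrightarrow> P (ginv S X)"
  shows "P (hc S (E \<circ> linepath 0 (of_int m)))"
proof -
  have pern: "E (x + real n) = E x" for x n
  proof (induction n)
    case (Suc n)
    have "E (x + real (Suc n)) = E ((x + real n) + 1)" by (simp add: algebra_simps)
    then show ?case using per Suc by simp
  qed simp
  have ok: "okp S (E \<circ> linepath x y)" for x y
    using S by (auto simp: okp_def path_image_def intro!: path_continuous_image continuous_on_subset[OF c])
  have N: "P (hc S (E \<circ> linepath 0 (real n)))" for n
  proof (induction n)
    case 0
    then show ?case using Pone by (simp add: comp_linepath_same)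
  next
    case (Suc n)
    have "homotopic_paths S (E \<circ> (linepath 0 (real n) +++ linepath (real n) (real (Suc n)))) (E \<circ> linepath 0 (real (Suc n)))"
      by (rule homotopic_paths_convex_image[of UNIV]) (use c S in auto)
    then have "hc S (E \<circ> linepath 0 (real (Suc n))) = hc S ((E \<circ> linepath 0 (real n)) +++ (E \<circ> linepath (real n) (real (Suc n))))"
      unfolding path_compose_join by (rule hc_eqI[symmetric])
    also have "\<dots> = star S (hc S (E \<circ> linepath 0 (real n))) (hc S (E \<circ> linepath (real n) (real (Suc n))))"
      by (rule hc_join[OF ok ok]) (simp add: pathfinish_compose pathstart_compose)
    also have "E \<circ> linepath (real n) (real (Suc n)) = E \<circ> linepath 0 1"
    proof
      fix t
      have "linepath (real n) (real (Suc n)) t = t + real n" by (simp add: linepath_def algebra_simps)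
      then show "(E \<circ> linepath (real n) (real (Suc n))) t = (E \<circ> linepath 0 1) t" using pern[of t n] by (simp add: linepath_def)
    qed
    finally have e: "hc S (E \<circ> linepath 0 (real (Suc n))) = star S (hc S (E \<circ> linepath 0 (real n))) (hc S (E \<circ> linepath 0 1))" .
    show ?case unfolding e by (rule Pstar[OF Suc P1])
  qed
  show ?thesis
  proof (cases "m \<ge> 0")
    case True
    then show ?thesis using N[of "nat m"] by simp
  next
    case False
    define n where "n = nat (- m)"
    have m: "of_int m = - real n" using False by (simp add: n_def)
    have "E \<circ> linepath 0 (of_int m) = reversepath (E \<circ> linepath 0 (real n))"
    proof
      fix t
      have "E (- (t * real n)) = E (- (t * real n) + real n)" by (rule pern[symmetric])
      also have "- (t * real n) + real n = (1 - t) * real n" by (simp add: algebra_simps)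
      finally show "(E \<circ> linepath 0 (of_int m)) t = reversepath (E \<circ> linepath 0 (real n)) t"
        by (simp add: m reversepath_def linepath_def)
    qed
    then show ?thesis using Pinv[OF N[of n]] ok by simp
  qed
qed

locale based = arrangement V J f for V :: "('a \<Rightarrow> complex) set" and J :: "'j set" and f +
  fixes p
  assumes pM: "p \<in> M"
begin

lemma pV: "p \<in> V" and fp: "l \<in> J \<Longrightarrow> f l p \<noteq> 0"
  using pM by (auto simp: M_def)

lemma meridian: "j \<in> J \<Longrightarrow> meridian V J f j p"
  by unfold_locales (auto simp: pV fp)

definition xl :: "'j \<Rightarrow> ('a \<Rightarrow> complex) \<Rightarrow> complex" where
  "xl l v = f l v / f l p"

text \<open>A cone that is star-shaped about \<open>p\<close> and plays the part of a thick base
  point: paths with both ends in it have classes at \<open>p\<close>.\<close>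

definition Omp :: "('a \<Rightarrow> complex) set" where
  "Omp = {v \<in> V. \<forall>l\<in>J. 0 < Re (xl l v)}"

lemma xl_lin: "l \<in> J \<Longrightarrow> xl l (lin v c u) = xl l v + c * xl l u"
  by (simp add: xl_def add_divide_distrib)

lemma xl_p: "l \<in> J \<Longrightarrow> xl l p = 1"
  using fp by (simp add: xl_def)

lemma xl_linp: "l \<in> J \<Longrightarrow> xl l (lin v c p) = xl l v + c"
  by (simp add: xl_lin xl_p)

lemma M_iff: "v \<in> M \<longleftrightarrow> v \<in> V \<and> (\<forall>l\<in>J. xl l v \<noteq> 0)"
  using fp by (simp add: M_def xl_def)

lemma Omp_M: "Omp \<subseteq> M"
  by (force simp: Omp_def M_iff)

lemma p_Omp: "p \<in> Omp"
  using pV by (simp add: Omp_def xl_p)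

lemma linp_M: "v \<in> V \<Longrightarrow> lin v c p \<in> M \<longleftrightarrow> (\<forall>l\<in>J. xl l v + c \<noteq> 0)"
  using lin_closed[OF _ pV] by (simp add: M_iff xl_linp)

lemma linp_Omp: "v \<in> V \<Longrightarrow> lin v c p \<in> Omp \<longleftrightarrow> (\<forall>l\<in>J. 0 < Re (xl l v) + Re c)"
  using lin_closed[OF _ pV] by (simp add: Omp_def xl_linp)

definition seg :: "('a \<Rightarrow> complex) \<Rightarrow> real \<Rightarrow> 'a \<Rightarrow> complex" where
  "seg a t = lin p (of_real t) (lin a (-1) p)"

lemma seg_shrink: "lin p 1 (lin a (-1) p) = a"
  by (auto simp: lin_def)

lemma shrink_Omp:
  assumes "a \<in> Omp" "0 \<le> t" "t \<le> 1"
  shows "lin p (of_real t) (lin a (-1) p) \<in> Omp"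
  unfolding Omp_def
proof (intro CollectI conjI ballI)
  have aV: "a \<in> V" using assms by (simp add: Omp_def)
  show "lin p (of_real t) (lin a (-1) p) \<in> V" by (intro lin_closed pV aV)
  fix l assume l: "l \<in> J"
  have "xl l (lin p (of_real t) (lin a (-1) p)) = of_real (1 - t) + of_real t * xl l a"
    using l by (simp add: xl_lin xl_p algebra_simps)
  moreover have "0 < (1 - t) + t * Re (xl l a)"
  proof (cases "t = 0")
    case False
    have "0 < Re (xl l a)" using assms l by (simp add: Omp_def)
    then have "0 < t * Re (xl l a)" using False assms by simp
    then show ?thesis using assms by simp
  qed simp
  ultimately show "0 < Re (xl l (lin p (of_real t) (lin a (-1) p)))" by simp
qed

lemma seg_arr: "a \<in> Omp \<Longrightarrow> arr Omp p a (seg a)"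
  unfolding seg_def by (rule arrI) (auto simp: seg_shrink shrink_Omp intro!: continuous_intros)

lemma seg_arrM: "a \<in> Omp \<Longrightarrow> arr M p a (seg a)"
  by (rule arr_mono[OF seg_arr Omp_M])

definition Mer :: "(real \<Rightarrow> 'a \<Rightarrow> complex) set set" where
  "Mer = {star M (hc M g) (star M (hc M (rot j p a)) (ginv M (hc M g))) | j a g. j \<in> J \<and> a \<in> Adm j p \<and> arr M p a g}"

inductive_set Gen :: "(real \<Rightarrow> 'a \<Rightarrow> complex) set set" where
  Gen_one: "gone M p \<in> Gen"
| Gen_mer: "X \<in> Mer \<Longrightarrow> X \<in> Gen"
| Gen_star: "X \<in> Gen \<Longrightarrow> Y \<in> Gen \<Longrightarrow> star M X Y \<in> Gen"
| Gen_inv: "X \<in> Gen \<Longrightarrow> ginv M X \<in> Gen"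

lemma rot_arr': "j \<in> J \<Longrightarrow> a \<in> Adm j p \<Longrightarrow> arr M a a (rot j p a)"
  by (rule meridian.rot_arr[OF meridian])

lemma Mer_ok:
  assumes "X \<in> Mer"
  shows "gok M X \<and> src X = p \<and> tgt X = p"
proof -
  obtain j a g where "j \<in> J" "a \<in> Adm j p" "arr M p a g" and X: "X = star M (hc M g) (star M (hc M (rot j p a)) (ginv M (hc M g)))"
    using assms by (auto simp: Mer_def)
  then show ?thesis using rot_arr'[of j a] by (simp add: arr_iff_okp)
qed

lemma Gen_ok: "X \<in> Gen \<Longrightarrow> gok M X \<and> src X = p \<and> tgt X = p"
  by (induction rule: Gen.induct) (simp_all add: Mer_ok pM)

text \<open>Membership in \<open>Gen\<close> for loops based elsewhere. Because all tails
  \<open>g\<close> are quantified, the property moves along any path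
  (\<open>LG_move\<close>).\<close>

definition LG :: "('a \<Rightarrow> complex) \<Rightarrow> (real \<Rightarrow> 'a \<Rightarrow> complex) set \<Rightarrow> bool" where
  "LG a X \<longleftrightarrow> gok M X \<and> src X = a \<and> tgt X = a \<and>
     (\<forall>g. arr M p a g \<longrightarrow> star M (hc M g) (star M X (ginv M (hc M g))) \<in> Gen)"

lemma LG_star:
  assumes "LG a X" "LG a Y"
  shows "LG a (star M X Y)"
proof -
  have "star M (hc M g) (star M (star M X Y) (ginv M (hc M g))) \<in> Gen" if g: "arr M p a g" for g
  proof -
    have "star M (star M (hc M g) (star M X (ginv M (hc M g)))) (star M (hc M g) (star M Y (ginv M (hc M g)))) \<in> Gen"
      by (rule Gen_star) (use assms g in \<open>auto simp: LG_def\<close>)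
    then show ?thesis using assms g by (simp add: LG_def arr_iff_okp star_assoc)
  qed
  then show ?thesis using assms by (simp add: LG_def)
qed

lemma LG_inv:
  assumes "LG a X"
  shows "LG a (ginv M X)"
proof -
  have "star M (hc M g) (star M (ginv M X) (ginv M (hc M g))) \<in> Gen" if g: "arr M p a g" for g
  proof -
    have "ginv M (star M (hc M g) (star M X (ginv M (hc M g)))) \<in> Gen"
      by (rule Gen_inv) (use assms g in \<open>auto simp: LG_def\<close>)
    then show ?thesis using assms g by (simp add: LG_def arr_iff_okp star_assoc)
  qed
  then show ?thesis using assms by (simp add: LG_def)
qed

lemma LG_one: "a \<in> M \<Longrightarrow> LG a (gone M a)"
  by (simp add: LG_def arr_iff_okp Gen_one)

lemma LG_rot:
  assumes "j \<in> J" "a \<in> Adm j p"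
  shows "LG a (hc M (rot j p a))"
proof -
  have "star M (hc M g) (star M (hc M (rot j p a)) (ginv M (hc M g))) \<in> Gen" if "arr M p a g" for g
    by (rule Gen_mer) (use assms that in \<open>unfold Mer_def, blast\<close>)
  then show ?thesis using rot_arr'[OF assms] by (simp add: LG_def arr_iff_okp)
qed

lemma LG_move:
  assumes d: "arr M a b d" and X: "LG b X"
  shows "LG a (star M (hc M d) (star M X (ginv M (hc M d))))"
proof -
  have "star M (hc M g) (star M (star M (hc M d) (star M X (ginv M (hc M d)))) (ginv M (hc M g))) \<in> Gen" if g: "arr M p a g" for g
  proof -
    have "star M (hc M (g +++ d)) (star M X (ginv M (hc M (g +++ d)))) \<in> Gen"
      using arr_join[OF g d] X unfolding LG_def by blast
    then show ?thesis using X g d by (simp add: LG_def arr_iff_okp star_assoc)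
  qed
  then show ?thesis using X d by (simp add: LG_def arr_iff_okp)
qed

text \<open>A path between far points is closed up by segments from \<open>p\<close>. By
  \<open>far_class\<close>, paths inside \<open>Omp\<close> close up to the trivial class.\<close>

definition TT :: "(real \<Rightarrow> 'a \<Rightarrow> complex) \<Rightarrow> bool" where
  "TT g \<longleftrightarrow> okp M g \<and> pathstart g \<in> Omp \<and> pathfinish g \<in> Omp \<and>
     star M (hc M (seg (pathstart g))) (star M (hc M g) (ginv M (hc M (seg (pathfinish g))))) \<in> Gen"

lemma TT_homotopic: "TT g \<Longrightarrow> homotopic_paths M g h \<Longrightarrow> TT h"
  unfolding TT_def using okp_homotopic[of M g h] hc_eqI[of M g h] homotopic_paths_imp_pathstart[of M g h]
    homotopic_paths_imp_pathfinish[of M g h] by simp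

lemma seg_ok: "a \<in> Omp \<Longrightarrow> okp M (seg a)" "a \<in> Omp \<Longrightarrow> pathstart (seg a) = p" "a \<in> Omp \<Longrightarrow> pathfinish (seg a) = a"
  using seg_arrM[of a] by (simp_all add: arr_iff_okp)

lemma TT_join:
  assumes "TT g" "TT h" "pathfinish g = pathstart h"
  shows "TT (g +++ h)"
proof -
  have "star M (star M (hc M (seg (pathstart g))) (star M (hc M g) (ginv M (hc M (seg (pathfinish g))))))
     (star M (hc M (seg (pathstart h))) (star M (hc M h) (ginv M (hc M (seg (pathfinish h)))))) \<in> Gen"
    by (rule Gen_star) (use assms in \<open>auto simp: TT_def\<close>)
  then show ?thesis using assms by (simp add: TT_def seg_ok star_assoc)
qed

lemma TT_rev:
  assumes "TT g"
  shows "TT (reversepath g)"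
proof -
  have "ginv M (star M (hc M (seg (pathstart g))) (star M (hc M g) (ginv M (hc M (seg (pathfinish g)))))) \<in> Gen"
    by (rule Gen_inv) (use assms in \<open>auto simp: TT_def\<close>)
  then show ?thesis using assms by (simp add: TT_def seg_ok star_assoc)
qed

text \<open>Shrinking towards \<open>p\<close> fills the triangle formed by the two segments and
  \<open>g\<close> inside \<open>Omp\<close>.\<close>

lemma far_class:
  assumes g: "arr Omp a b g"
  shows "star M (hc M (seg a)) (hc M g) = hc M (seg b)"
proof -
  define K where "K = (\<lambda>(s,t). lin p (of_real s) (lin (g t) (-1) p))"
  have gO: "g t \<in> Omp" if "t \<in> {0..1}" for t using arr_mem[OF g that] .
  have Kc: "continuous_on ({0..1} \<times> {0..1}) K"
    unfolding K_def case_prod_unfold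
    by (intro continuous_intros continuous_on_compose2[OF arr_cont[OF g]]) auto
  have "homotopic_paths M ((\<lambda>t. K (0,t)) +++ (\<lambda>s. K (s,1))) ((\<lambda>s. K (s,0)) +++ (\<lambda>t. K (1,t)))"
  proof (rule square_homotopic[OF Kc])
    show "K (s,t) \<in> M" if "s \<in> {0..1}" "t \<in> {0..1}" for s t
      using shrink_Omp[OF gO[OF that(2)]] that(1) Omp_M by (auto simp: K_def)
  qed
  moreover have "(\<lambda>t. K (0,t)) = (\<lambda>_. p)" "(\<lambda>s. K (s,1)) = seg b" "(\<lambda>s. K (s,0)) = seg a" "(\<lambda>t. K (1,t)) = g"
    using arr_ends[OF g] by (auto simp: K_def seg_def seg_shrink)
  ultimately have "homotopic_paths M ((\<lambda>_. p) +++ seg b) (seg a +++ g)" by simp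
  then have "hc M ((\<lambda>_. p) +++ seg b) = hc M (seg a +++ g)" by (rule hc_eqI)
  then show ?thesis using arr_in[OF g] arr_mono[OF g Omp_M] by (simp add: seg_ok pM arr_iff_okp)
qed

lemma TT_far:
  assumes g: "arr Omp a b g"
  shows "TT g"
proof -
  have ab: "a \<in> Omp" "b \<in> Omp" "pathstart g = a" "pathfinish g = b" "okp M g"
    using arr_in[OF g] arr_mono[OF g Omp_M] g by (auto simp: arr_iff_okp)
  have "star M (star M (hc M (seg a)) (hc M g)) (ginv M (hc M (seg b))) = gone M p"
    unfolding far_class[OF g] using ab by (simp add: seg_ok)
  then have "star M (hc M (seg a)) (star M (hc M g) (ginv M (hc M (seg b)))) = gone M p"
    using ab by (simp add: seg_ok star_assoc)
  then show ?thesis using ab Gen_one by (simp add: TT_def)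
qed

text \<open>The far path \<open>w\<close> closes up trivially, so the class of \<open>g\<close> is
  decided by the loop that runs along \<open>g\<close> and returns along \<open>w\<close>.\<close>

lemma TT_LG:
  assumes g: "arr M a b g" and w: "arr Omp a b w" and L: "LG a (star M (hc M g) (ginv M (hc M w)))"
  shows "TT g"
proof -
  have ab: "a \<in> Omp" "b \<in> Omp" using arr_in[OF w] by auto
  note o = g[unfolded arr_iff_okp] arr_mono[OF w Omp_M, unfolded arr_iff_okp]
  have 1: "star M (hc M (seg a)) (star M (star M (hc M g) (ginv M (hc M w))) (ginv M (hc M (seg a)))) \<in> Gen"
    using L seg_arrM[OF ab(1)] unfolding LG_def by blast
  have "star M (hc M w) (ginv M (hc M (seg b))) = ginv M (hc M (seg a))"
  proof -
    have "star M (ginv M (hc M (seg a))) (star M (hc M (seg a)) (hc M w)) = star M (ginv M (hc M (seg a))) (hc M (seg b))"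
      unfolding far_class[OF w] ..
    then have "hc M w = star M (ginv M (hc M (seg a))) (hc M (seg b))" using o ab by (simp add: seg_ok)
    then show ?thesis using o ab by (simp add: seg_ok star_assoc)
  qed
  then have "ginv M (hc M (seg a)) = star M (hc M w) (ginv M (hc M (seg b)))" ..
  with 1 have "star M (hc M (seg a)) (star M (star M (hc M g) (ginv M (hc M w))) (star M (hc M w) (ginv M (hc M (seg b))))) \<in> Gen"
    by simp
  then have "star M (hc M (seg a)) (star M (hc M g) (ginv M (hc M (seg b)))) \<in> Gen"
    using o ab by (simp add: seg_ok star_assoc)
  then show ?thesis using o ab by (simp add: TT_def)
qed

text \<open>The logarithm \<open>q\<close> of the loop about the puncture \<open>s\<close> is first moved to the left, which shrinks the loop,
  and then straightened inside a half-plane.\<close>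

lemma puncture_loop:
  assumes v: "v \<in> V" and j: "j \<in> J" and s: "s = - xl j v" and "\<rho> > 0"
    and star: "\<And>y t. y \<in> D \<Longrightarrow> 0 \<le> t \<Longrightarrow> t \<le> 1 \<Longrightarrow> s + of_real t * (y - s) \<in> D"
    and DM: "\<And>y. y \<noteq> s \<Longrightarrow> y \<in> D \<or> cmod (y - s) < \<rho> \<Longrightarrow> lin v y p \<in> M"
    and others: "\<And>l. l \<in> J - {j} \<Longrightarrow> \<rho> \<le> cmod (xl l v + s)"
    and l: "path lop" "\<And>t. t \<in> {0..1} \<Longrightarrow> lop t \<in> D \<and> lop t \<noteq> s" "lop 0 = lop 1"
  shows "LG (lin v (lop 0) p) (hc M (\<lambda>t. lin v (lop t) p))"
proof -
  interpret m: meridian V J f j p by (rule meridian[OF j])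
  have simg: "s \<notin> path_image lop"
  proof
    assume "s \<in> path_image lop"
    then obtain t where t: "t \<in> {0..1}" "s = lop t" unfolding path_image_def by blast
    then show False using l(2)[OF t(1)] by simp
  qed
  \<comment> \<open>In the logarithm about \<open>s\<close> the loop becomes a path whose ends
    differ by \<open>2 pi i\<close> times the winding number.\<close>
  obtain q where q: "path q" "pathfinish q - pathstart q = 2 * of_real pi * \<i> * winding_number lop s"
    "\<And>t. t \<in> {0..1} \<Longrightarrow> lop t = s + exp (q t)"
    using winding_number_as_continuous_log[OF l(1) simg] by metis
  have "winding_number lop s \<in> \<int>"
    by (rule integer_winding_number[OF l(1) _ simg]) (use l(3) in \<open>simp add: pathstart_def pathfinish_def\<close>)
  then obtain m where m: "winding_number lop s = of_int m" by (auto elim: Ints_cases)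
  have q1: "q 1 = q 0 + 2 * of_real pi * \<i> * of_int m" using q(2) unfolding m pathstart_def pathfinish_def by (simp add: algebra_simps)
  have "bounded (path_image lop)" using l(1) by (simp add: compact_imp_bounded compact_path_image)
  then obtain C where C: "C > 0" "\<And>y. y \<in> path_image lop \<Longrightarrow> cmod (y - s) < C"
    by (metis bounded_subset_ballD dist_commute dist_norm in_mono mem_ball)
  \<comment> \<open>A shift by \<open>\<Lambda>\<close> multiplies the distance to \<open>s\<close>,
    which is below \<open>C\<close>, by \<open>\<rho> / (\<rho> + C)\<close> and so brings the loop
    within \<open>\<rho>\<close> of the puncture.\<close>
  define \<Lambda> where "\<Lambda> = ln (1 + C/\<rho>)"
  have \<Lambda>: "\<Lambda> > 0" "exp \<Lambda> = 1 + C/\<rho>" using C(1) \<open>\<rho> > 0\<close> by (auto simp: \<Lambda>_def add_pos_pos)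
  have small: "cmod (exp (q t - of_real \<Lambda>)) < \<rho>" if t: "t \<in> {0..1}" for t
  proof -
    have "lop t \<in> path_image lop" unfolding path_image_def using t by (rule imageI)
    then have 1: "cmod (exp (q t)) < C" using q(3)[OF t] C(2)[of "lop t"] by simp
    have "C + \<rho> \<noteq> 0" using C(1) \<open>\<rho> > 0\<close> by simp
    then have 2: "exp (- \<Lambda>) = \<rho> / (\<rho> + C)" using \<open>\<rho> > 0\<close> by (simp add: exp_minus \<Lambda>(2) field_simps)
    have "cmod (exp (q t - of_real \<Lambda>)) = cmod (exp (q t)) * exp (- \<Lambda>)"
      by (simp only: norm_exp_eq_Re) (simp add: exp_diff exp_minus divide_inverse)
    also have "\<dots> < C * (\<rho> / (\<rho> + C))"
      unfolding 2 using 1 C(1) \<open>\<rho> > 0\<close> by (intro mult_strict_right_mono) auto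
    also have "\<dots> < \<rho>" using C(1) \<open>\<rho> > 0\<close> by (simp add: field_simps)
    finally show ?thesis .
  qed
  have qc: "continuous_on {0..1} q" using q(1) by (simp add: path_def)
  \<comment> \<open>During the shift every point runs on the segment from the loop towards
    \<open>s\<close>, which lies in \<open>D\<close> because \<open>D\<close> is star-shaped about
    \<open>s\<close>.\<close>
  define K where "K = (\<lambda>(x,t). lin v (s + exp (q t - of_real (x * \<Lambda>))) p)"
  have Kc: "continuous_on ({0..1} \<times> {0..1}) K"
    unfolding K_def case_prod_unfold
    by (intro continuous_intros continuous_on_compose2[OF qc]) auto
  have KM: "K (x,t) \<in> M" if "x \<in> {0..1}" "t \<in> {0..1}" for x t
  proof -
    have "s + exp (q t - of_real (x * \<Lambda>)) = s + of_real (exp (- (x * \<Lambda>))) * (lop t - s)"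
      using q(3)[OF that(2)] by (simp add: exp_diff exp_minus exp_of_real divide_inverse mult.commute del: of_real_mult)
    moreover have "\<dots> \<in> D" using that \<Lambda>(1) l(2)[OF that(2)] by (intro star) auto
    ultimately show ?thesis unfolding K_def prod.case by (intro DM) auto
  qed
  have e01: "exp (q 1 - c) = exp (q 0 - c)" for c
  proof -
    have "exp (q 1 - c) = exp (q 0 - c) * exp (2 * of_int m * of_real pi * \<i>)" unfolding q1 exp_add[symmetric] by (simp add: algebra_simps)
    moreover have "exp (2 * of_int m * of_real pi * \<i>) = 1" using exp_integer_2pi[of "of_int m"] by simp
    ultimately show ?thesis by simp
  qed
  define a1 where "a1 = lin v (s + exp (q 0 - of_real \<Lambda>)) p"
  let ?L = "\<lambda>t. lin v (lop t) p" and ?g = "\<lambda>x. K (x,0)" and ?l = "\<lambda>t. K (1,t)"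
  have okg: "arr M (?L 0) a1 ?g"
  proof (rule arrI)
    show "continuous_on {0..1} ?g" by (rule continuous_on_slices(2)[OF Kc]) simp
    show "?g 0 = ?L 0" "?g 1 = a1" using q(3)[of 0] by (simp_all add: K_def a1_def)
  qed (rule KM, simp_all)
  have okl: "arr M a1 a1 ?l"
  proof (rule arrI)
    show "continuous_on {0..1} ?l" by (rule continuous_on_slices(1)[OF Kc]) simp
    show "?l 0 = a1" "?l 1 = a1" by (simp_all add: K_def a1_def e01)
  qed (rule KM, simp_all)
  have okL: "arr M (?L 0) (?L 0) ?L"
    using lin_arr[OF l(1), of v p M] l(2,3) DM by auto
  have K0: "homotopic_paths M ?L (\<lambda>t. K (0,t))"
    by (rule homotopic_paths_eq) (use okL q(3) in \<open>auto simp: arr_def K_def\<close>)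
  have "homotopic_paths M ((\<lambda>t. K (0,t)) +++ (\<lambda>s. K (s,1))) (?g +++ ?l)"
    by (rule square_homotopic[OF Kc KM])
  moreover have "(\<lambda>s. K (s,1)) = ?g" by (auto simp: K_def e01)
  moreover have "arr M (?L 0) (?L 0) (\<lambda>t. K (0,t))" by (rule arr_homotopic[OF okL K0])
  ultimately have "hc M ((\<lambda>t. K (0,t)) +++ ?g) = hc M (?g +++ ?l)" "okp M (\<lambda>t. K (0,t))" "pathstart (\<lambda>t. K (0,t)) = ?L 0" "pathfinish (\<lambda>t. K (0,t)) = ?L 0"
    by (simp_all add: hc_eqI arr_iff_okp del: hc_join)
  then have "star M (hc M (\<lambda>t. K (0,t))) (hc M ?g) = star M (hc M ?g) (hc M ?l)"
    using okg okl by (simp add: arr_iff_okp)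
  then have "star M (hc M ?L) (hc M ?g) = star M (hc M ?g) (hc M ?l)" unfolding hc_eqI[OF K0] .
  then have "star M (star M (hc M ?L) (hc M ?g)) (ginv M (hc M ?g)) = star M (star M (hc M ?g) (hc M ?l)) (ginv M (hc M ?g))" by simp
  then have eL: "hc M ?L = star M (hc M ?g) (star M (hc M ?l) (ginv M (hc M ?g)))"
    using okg okl okL by (simp add: arr_iff_okp star_assoc)
  define z0 where "z0 = q 0 - of_real \<Lambda>"
  define E where "E x = lin v (s + exp (z0 + 2 * of_real pi * \<i> * of_real x)) p" for x :: real
  \<comment> \<open>The logarithms of the punctured disc of radius \<open>\<rho>\<close> form a
    half-plane; its convexity straightens the path to \<open>m\<close> turns of a circle.\<close>
  let ?C = "{z. Re z < ln \<rho>}"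
  have CM: "lin v (s + exp z) p \<in> M" if "z \<in> ?C" for z
  proof (rule DM)
    have "cmod (exp z) < exp (ln \<rho>)" using that by (simp add: norm_exp_eq_Re)
    then show "s + exp z \<in> D \<or> cmod (s + exp z - s) < \<rho>" using \<open>\<rho> > 0\<close> by simp
  qed simp
  have qC: "q t - of_real \<Lambda> \<in> ?C" if "t \<in> {0..1}" for t
  proof -
    have "exp (Re (q t - of_real \<Lambda>)) < exp (ln \<rho>)" using small[OF that] \<open>\<rho> > 0\<close> by (simp add: norm_exp_eq_Re)
    then show ?thesis by (simp only: exp_less_cancel_iff mem_Collect_eq)
  qed
  have z0C: "z0 + 2 * of_real pi * \<i> * of_real x \<in> ?C" for x using qC[of 0] by (simp add: z0_def)
  have "homotopic_paths M ((\<lambda>z. lin v (s + exp z) p) \<circ> (\<lambda>t. q t - of_real \<Lambda>)) ((\<lambda>z. lin v (s + exp z) p) \<circ> (\<lambda>t. z0 + 2 * of_real pi * \<i> * of_real (linepath 0 (of_int m) t)))"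
  proof (rule homotopic_paths_convex_image[of ?C])
    show "convex ?C" by (rule convex_halfspace_Re_lt)
    show "continuous_on ?C (\<lambda>z. lin v (s + exp z) p)" by (intro continuous_intros)
    show "path (\<lambda>t. q t - of_real \<Lambda>)" unfolding path_def by (intro continuous_intros qc)
    show "path (\<lambda>t. z0 + 2 * of_real pi * \<i> * of_real (linepath 0 (of_int m) t))"
      unfolding path_def linepath_def by (intro continuous_intros)
    show "path_image (\<lambda>t. q t - of_real \<Lambda>) \<subseteq> ?C" using qC unfolding path_image_def by blast
    show "path_image (\<lambda>t. z0 + 2 * of_real pi * \<i> * of_real (linepath 0 (of_int m) t)) \<subseteq> ?C"
      using z0C unfolding path_image_def by blast
  qed (use CM in \<open>auto simp: pathstart_def pathfinish_def z0_def q1 linepath_def\<close>)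
  moreover have "(\<lambda>z. lin v (s + exp z) p) \<circ> (\<lambda>t. q t - of_real \<Lambda>) = ?l" by (auto simp: K_def)
  moreover have "(\<lambda>z. lin v (s + exp z) p) \<circ> (\<lambda>t. z0 + 2 * of_real pi * \<i> * of_real (linepath 0 (of_int m) t)) = E \<circ> linepath 0 (of_int m)"
    by (auto simp: E_def)
  ultimately have hl: "hc M ?l = hc M (E \<circ> linepath 0 (of_int m))" by (simp add: hc_eqI)
  have a1z: "zc j p a1 = exp z0"
  proof -
    have "zc j p a1 = xl j a1" by (simp add: zc_def xl_def)
    also have "\<dots> = exp z0" unfolding a1_def using j by (simp add: xl_linp s z0_def)
    finally show ?thesis .
  qed
  have E0: "E 0 = a1" by (simp add: E_def a1_def z0_def)
  have a1Adm: "a1 \<in> Adm j p"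
  proof -
    have "a1 \<in> V" unfolding a1_def by (rule lin_closed[OF v pV])
    moreover have "f j a1 \<noteq> 0" using a1z by (auto simp: zc_def)
    moreover have "cmod (zc j p a1 * f l p) < cmod (f l (hz j p a1))" if l: "l \<in> J - {j}" for l
    proof -
      have "hz j p a1 = lin v s p" unfolding hz_def a1z by (simp add: a1_def z0_def)
      then have "f l (hz j p a1) = (xl l v + s) * f l p" using l fp[of l] by (simp add: xl_def algebra_simps)
      moreover have "cmod (exp z0) < cmod (xl l v + s)" using small[of 0] others[OF l] by (simp add: z0_def)
      ultimately show ?thesis unfolding a1z using fp[of l] l by (simp add: norm_mult)
    qed
    ultimately show ?thesis by (simp add: Adm_def)
  qed
  have E1: "E \<circ> linepath 0 1 = rot j p a1"
  proof
    fix t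
    have "exp (z0 + 2 * of_real pi * \<i> * of_real t) = cis (2 * pi * t) * exp z0"
      by (simp add: exp_add cis_conv_exp mult_ac)
    then show "(E \<circ> linepath 0 1) t = rot j p a1 t"
      by (simp add: E_def rot_def a1z linepath_def) (simp add: a1_def z0_def algebra_simps)
  qed
  have "LG a1 (hc M (E \<circ> linepath 0 (of_int m)))"
  proof (rule linepath_circle_power)
    show "continuous_on UNIV E" unfolding E_def by (intro continuous_intros)
    show "E x \<in> M" for x unfolding E_def by (rule CM[OF z0C])
    show "E (x + 1) = E x" for x
    proof -
      have "exp (z0 + 2 * of_real pi * \<i> * of_real (x + 1)) = exp ((z0 + 2 * of_real pi * \<i> * of_real x) + 2 * of_real pi * \<i>)"
        by (simp add: algebra_simps)
      also have "\<dots> = exp (z0 + 2 * of_real pi * \<i> * of_real x)" by (simp add: exp_add)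
      finally show ?thesis by (simp add: E_def)
    qed
    show "LG a1 (hc M (E \<circ> linepath 0 1))" unfolding E1 by (rule LG_rot[OF j a1Adm])
    show "LG a1 (gone M (E 0))" unfolding E0 by (rule LG_one) (use arr_in[OF okl] in simp)
  qed (auto intro: LG_star LG_inv)
  then have "LG a1 (hc M ?l)" unfolding hl .
  then show ?thesis unfolding eL by (rule LG_move[OF okg])
qed

end

section \<open>Sectors between two rays\<close>

definition Sec :: "real \<Rightarrow> real \<Rightarrow> complex set" where
  "Sec \<sigma> \<tau> = {y. 0 \<le> Re y \<and> \<sigma> * Re y \<le> Im y \<and> Im y \<le> \<tau> * Re y}"

lemma convex_Sec: "convex (Sec \<sigma> \<tau>)"
proof (rule convexI)
  fix x y :: complex and u v :: real
  assume A: "x \<in> Sec \<sigma> \<tau>" "y \<in> Sec \<sigma> \<tau>" "0 \<le> u" "0 \<le> v" "u + v = 1"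
  have "u * (\<sigma> * Re x) \<le> u * Im x" "v * (\<sigma> * Re y) \<le> v * Im y" "u * Im x \<le> u * (\<tau> * Re x)" "v * Im y \<le> v * (\<tau> * Re y)"
    using A by (auto simp: Sec_def intro: mult_left_mono)
  then show "u *\<^sub>R x + v *\<^sub>R y \<in> Sec \<sigma> \<tau>"
    using A by (simp add: Sec_def algebra_simps)
qed

lemma linepath_in_convex: "convex C \<Longrightarrow> x \<in> C \<Longrightarrow> y \<in> C \<Longrightarrow> t \<in> {0..1} \<Longrightarrow> linepath x y t \<in> C"
  unfolding linepath_def by (rule convexD_alt) auto

context based
begin

text \<open>The piece left over by \<open>path_generation\<close>: down one ray to \<open>v\<close>
  and up another, in the line through \<open>v\<close> parallel to \<open>p\<close>, whose punctures
  are the numbers \<open>- xl l v\<close>.\<close>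

definition vpath :: "('a \<Rightarrow> complex) \<Rightarrow> complex \<Rightarrow> complex \<Rightarrow> real \<Rightarrow> 'a \<Rightarrow> complex" where
  "vpath v A B = reversepath ((\<lambda>z. lin v z p) \<circ> linepath 0 A) +++ ((\<lambda>z. lin v z p) \<circ> linepath 0 B)"

definition spoke :: "('a \<Rightarrow> complex) \<Rightarrow> complex \<Rightarrow> bool" where
  "spoke v A \<longleftrightarrow> (\<forall>t\<in>{0..1}. lin v (linepath 0 A t) p \<in> M) \<and> lin v A p \<in> Omp"

lemma spoke_arr: "spoke v A \<Longrightarrow> arr M v (lin v A p) ((\<lambda>z. lin v z p) \<circ> linepath 0 A)"
  using lin_arr[of "linepath 0 A" v p M] by (simp add: spoke_def o_def linepath_0' linepath_1')

lemma vpath_arr: "spoke v A \<Longrightarrow> spoke v B \<Longrightarrow> arr M (lin v A p) (lin v B p) (vpath v A B)"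
  unfolding vpath_def by (rule arr_join[OF arr_rev[OF spoke_arr] spoke_arr])

lemma spokeI:
  assumes v: "v \<in> M" and A: "lin v A p \<in> Omp" and n: "\<And>l s. l \<in> J \<Longrightarrow> 0 < s \<Longrightarrow> s \<le> 1 \<Longrightarrow> - xl l v \<noteq> of_real s * A"
  shows "spoke v A"
proof -
  have vV: "v \<in> V" using v by (rule M_V)
  have "lin v (linepath 0 A t) p \<in> M" if t: "t \<in> {0..1}" for t
    unfolding linp_M[OF vV]
  proof
    fix l assume l: "l \<in> J"
    have e: "linepath 0 A t = of_real t * A" by (simp add: linepath_def scaleR_conv_of_real)
    show "xl l v + linepath 0 A t \<noteq> 0"
    proof (cases "t = 0")
      case True
      then show ?thesis using v l by (simp add: e M_iff)
    next
      case False
      then have "- xl l v \<noteq> of_real t * A" using n[OF l, of t] t by simp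
      then show ?thesis unfolding e by (metis add.inverse_inverse add_eq_0_iff2 equation_minus_iff)
    qed
  qed
  then show ?thesis using A by (simp add: spoke_def)
qed

lemma TT_rev_iff: "okp M g \<Longrightarrow> TT (reversepath g) \<Longrightarrow> TT g"
  using TT_rev[of "reversepath g"] by simp

lemma vpath_rev: "reversepath (vpath v A B) = vpath v B A"
  by (simp add: vpath_def reversepath_joinpaths pathstart_compose)

text \<open>The inserted spoke to \<open>C\<close> is run out and back again and cancels.\<close>

lemma vpath_split:
  assumes "spoke v A" "spoke v B" "spoke v C" "TT (vpath v A C)" "TT (vpath v C B)"
  shows "TT (vpath v A B)"
proof -
  note o = assms(1-3)[THEN spoke_arr, unfolded arr_iff_okp]
  have t: "TT (vpath v A C +++ vpath v C B)"
    by (rule TT_join[OF assms(4,5)]) (use vpath_arr[OF assms(1,3)] vpath_arr[OF assms(3,2)] in \<open>simp add: arr_iff_okp\<close>)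
  have "hc M (vpath v A C +++ vpath v C B) = hc M (vpath v A B)"
    using o unfolding vpath_def by (simp add: star_assoc)
  moreover have "okp M (vpath v A C +++ vpath v C B)" using t by (simp add: TT_def)
  ultimately have "homotopic_paths M (vpath v A C +++ vpath v C B) (vpath v A B)" by (simp add: hc_eq del: hc_join)
  then show ?thesis by (rule TT_homotopic[OF t])
qed

definition slope :: "complex \<Rightarrow> real" where
  "slope y = Im y / Re y"

lemma linepath_Sec:
  assumes "0 < Re A" "0 < Re B" "slope A \<le> slope B"
  shows "A \<in> Sec (slope A) (slope B)" "B \<in> Sec (slope A) (slope B)" "0 \<in> Sec (slope A) (slope B)"
proof -
  have "slope A * Re A = Im A" "slope B * Re B = Im B" using assms by (auto simp: slope_def)
  moreover have "slope A * Re A \<le> slope B * Re A" "slope A * Re B \<le> slope B * Re B" using assms by (auto intro: mult_right_mono)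
  ultimately show "A \<in> Sec (slope A) (slope B)" "B \<in> Sec (slope A) (slope B)" "0 \<in> Sec (slope A) (slope B)"
    using assms by (auto simp: Sec_def)
qed

lemma convex_linp_Omp: "v \<in> V \<Longrightarrow> convex {z. lin v z p \<in> Omp}"
proof -
  assume v: "v \<in> V"
  have "{z. lin v z p \<in> Omp} = (\<Inter>l\<in>J. {z. - Re (xl l v) < Re z})"
  proof -
    have iff: "0 < Re (xl l v) + Re z \<longleftrightarrow> - Re (xl l v) < Re z" for l z by linarith
    show ?thesis unfolding linp_Omp[OF v] iff by auto
  qed
  also have "convex \<dots>" by (intro convex_INT convex_halfspace_Re_gt)
  finally show ?thesis .
qed

text \<open>The far segment from \<open>A\<close> to \<open>B\<close> closes the path to a loop in
  the sector. Without a puncture there it contracts by convexity; with a single one the sector is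
  star-shaped about it, and \<open>puncture_loop\<close> applies.\<close>

lemma TT_vpath_base:
  assumes v: "v \<in> V" and A: "spoke v A" "0 < Re A" and B: "spoke v B" "0 < Re B" and AB: "slope A \<le> slope B"
    and one: "\<And>l m. l \<in> J \<Longrightarrow> m \<in> J \<Longrightarrow> - xl l v \<in> Sec (slope A) (slope B) \<Longrightarrow> - xl m v \<in> Sec (slope A) (slope B) \<Longrightarrow> l = m"
    and dist: "\<And>l m. l \<in> J \<Longrightarrow> m \<in> J \<Longrightarrow> l \<noteq> m \<Longrightarrow> xl l v \<noteq> xl m v"
  shows "TT (vpath v A B)"
proof -
  let ?D = "Sec (slope A) (slope B)" and ?L = "\<lambda>z. lin v z p"
  note cD = convex_Sec[of "slope A" "slope B"] and D = linepath_Sec[OF A(2) B(2) AB]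
  let ?V = "reversepath (linepath 0 A) +++ linepath 0 B" and ?W = "linepath A B"
  have eV: "vpath v A B = ?L \<circ> ?V"
    unfolding vpath_def path_compose_join path_compose_reversepath ..
  have aW: "arr Omp (?L A) (?L B) (?L \<circ> ?W)"
  proof -
    have "lin v (linepath A B t) p \<in> Omp" if "t \<in> {0..1}" for t
      using linepath_in_convex[OF convex_linp_Omp[OF v], of A B t] that A(1) B(1) by (simp add: spoke_def)
    then show ?thesis using lin_arr[of "linepath A B" v p Omp] by (simp add: o_def linepath_0' linepath_1')
  qed
  have aV: "arr M (?L A) (?L B) (?L \<circ> ?V)" using vpath_arr[OF A(1) B(1)] unfolding eV .
  have imD: "path_image (linepath x y) \<subseteq> ?D" if "x \<in> ?D" "y \<in> ?D" for x y
    unfolding path_image_linepath using that cD by (rule closed_segment_subset)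
  have VD: "path_image ?V \<subseteq> ?D" using imD[OF D(1,3)] imD[OF D(3,2)] by (simp add: path_image_join)
  show ?thesis
  proof (cases "\<exists>j\<in>J. - xl j v \<in> ?D")
    case False
    have DM: "?L ` ?D \<subseteq> M"
    proof
      fix x assume "x \<in> ?L ` ?D"
      then obtain z where z: "z \<in> ?D" "x = ?L z" by blast
      have "xl l v + z \<noteq> 0" if "l \<in> J" for l
      proof
        assume "xl l v + z = 0"
        then have "z = - xl l v" by (simp add: add_eq_0_iff)
        then show False using z False that by blast
      qed
      then show "x \<in> M" unfolding z(2) linp_M[OF v] by blast
    qed
    have "homotopic_paths M (?L \<circ> ?W) (?L \<circ> ?V)"
      by (rule homotopic_paths_convex_image[OF cD _ DM])
         (use VD imD[OF D(1,2)] in \<open>auto intro!: continuous_intros simp del: path_image_linepath\<close>)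
    then show ?thesis unfolding eV by (rule TT_homotopic[OF TT_far[OF aW]])
  next
    case True
    then obtain j where j: "j \<in> J" "- xl j v \<in> ?D" by blast
    define s where "s = - xl j v"
    have fin: "finite ((\<lambda>l. cmod (xl l v + s)) ` (J - {j}))" using finite_J by simp
    define \<rho> where "\<rho> = Min (insert 1 ((\<lambda>l. cmod (xl l v + s)) ` (J - {j})))"
    have ne: "xl l v + s \<noteq> 0" if "l \<in> J - {j}" for l using dist[of l j] that j(1) by (auto simp: s_def)
    have \<rho>: "\<rho> > 0" "\<And>l. l \<in> J - {j} \<Longrightarrow> \<rho> \<le> cmod (xl l v + s)"
      unfolding \<rho>_def using finite_J ne by auto
    let ?l = "?V +++ reversepath ?W"
    have ends: "?L (?l 0) = ?L A" "?l 0 = ?l 1" "?l 0 = A"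
      by (simp_all add: joinpaths_def reversepath_def linepath_def)
    have el: "(\<lambda>t. ?L (?l t)) = (?L \<circ> ?V) +++ reversepath (?L \<circ> ?W)"
      unfolding path_compose_reversepath[symmetric] path_compose_join[symmetric] by (simp only: o_def)
    have al: "arr M (?L A) (?L A) ((?L \<circ> ?V) +++ reversepath (?L \<circ> ?W))"
      by (rule arr_join[OF aV arr_rev[OF arr_mono[OF aW Omp_M]]])
    have "LG (lin v (?l 0) p) (hc M (\<lambda>t. lin v (?l t) p))"
    proof (rule puncture_loop[OF v j(1) s_def \<rho>(1)])
      show "s + of_real t * (y - s) \<in> ?D" if "y \<in> ?D" "0 \<le> t" "t \<le> 1" for y t
        using convexD_alt[OF cD j(2) that(1) that(2,3)] by (simp add: s_def scaleR_conv_of_real algebra_simps)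
      show "lin v y p \<in> M" if "y \<noteq> s" "y \<in> ?D \<or> cmod (y - s) < \<rho>" for y
        unfolding linp_M[OF v]
      proof
        fix l assume l: "l \<in> J"
        show "xl l v + y \<noteq> 0"
        proof
          assume "xl l v + y = 0"
          then have y: "y = - xl l v" by (simp add: add_eq_0_iff)
          then have lj: "l \<noteq> j" using that(1) by (auto simp: s_def)
          then have "- xl l v \<notin> ?D" using one[OF l j(1) _ j(2)] by blast
          then have "cmod (- xl l v - s) < \<rho>" using that(2) y by blast
          moreover have "- xl l v - s = - (xl l v + s)" by simp
          ultimately have "cmod (xl l v + s) < \<rho>" by (simp only: norm_minus_cancel)
          moreover have "\<rho> \<le> cmod (xl l v + s)" using \<rho>(2)[of l] lj l by simp
          ultimately show False by simp
        qed
      qed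
      show "\<rho> \<le> cmod (xl l v + s)" if "l \<in> J - {j}" for l by (rule \<rho>(2)[OF that])
      show "path ?l" by simp
      show "?l 0 = ?l 1" by (rule ends(2))
      show "?l t \<in> ?D \<and> ?l t \<noteq> s" if t: "t \<in> {0..1}" for t
      proof
        have "path_image ?l \<subseteq> ?D" using VD imD[OF D(2,1)] by (simp add: path_image_join del: path_image_linepath)
        then show "?l t \<in> ?D" using t unfolding path_image_def by blast
        have "?L (?l t) \<in> M" using arr_mem[OF al t] unfolding el[symmetric] .
        then have "xl j v + ?l t \<noteq> 0" using j(1) unfolding linp_M[OF v] by blast
        then show "?l t \<noteq> s" by (auto simp: s_def)
      qed
    qed
    then have L: "LG (?L A) (hc M ((?L \<circ> ?V) +++ reversepath (?L \<circ> ?W)))" unfolding el ends(3) .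
    have "hc M ((?L \<circ> ?V) +++ reversepath (?L \<circ> ?W)) = star M (hc M (?L \<circ> ?V)) (ginv M (hc M (?L \<circ> ?W)))"
      using aV[unfolded arr_iff_okp] arr_mono[OF aW Omp_M, unfolded arr_iff_okp] by simp
    with L show ?thesis unfolding eV by (intro TT_LG[OF aV aW]) simp
  qed
qed

lemma spoke_exists:
  assumes v: "v \<in> M" and \<mu>: "\<And>l. l \<in> J \<Longrightarrow> slope (- xl l v) \<noteq> \<mu>"
  obtains C where "spoke v C" "0 < Re C" "slope C = \<mu>"
proof -
  have vV: "v \<in> V" using v by (rule M_V)
  define R where "R = 1 + (\<Sum>l\<in>J. cmod (xl l v))"
  have R: "R > 0" unfolding R_def by (intro add_pos_nonneg sum_nonneg) auto
  have Rl: "0 < Re (xl l v) + R" if "l \<in> J" for l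
  proof -
    have "cmod (xl l v) \<le> (\<Sum>l\<in>J. cmod (xl l v))" using finite_J that by (intro member_le_sum) auto
    then show ?thesis using abs_Re_le_cmod[of "xl l v"] by (simp add: R_def)
  qed
  let ?C = "Complex R (\<mu> * R)"
  have sl: "slope (of_real s * ?C) = \<mu>" if "s > 0" for s using that R by (simp add: slope_def)
  have "spoke v ?C"
  proof (rule spokeI[OF v])
    show "lin v ?C p \<in> Omp" unfolding linp_Omp[OF vV] using Rl by simp
    show "- xl l v \<noteq> of_real s * ?C" if "l \<in> J" "0 < s" "s \<le> 1" for l s
      using \<mu>[OF that(1)] sl[OF that(2)] by metis
  qed
  then show ?thesis using that[of ?C] sl[of 1] R by simp
qed

text \<open>The hypothesis \<open>gen\<close> says that no two punctures lie on one real line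
  through 0, so those in the sector have different slopes. A spoke of intermediate slope cuts the
  sector into two with fewer punctures.\<close>

lemma TT_vpath_generic:
  assumes v: "v \<in> M" and gen: "\<And>l m. l \<in> J \<Longrightarrow> m \<in> J \<Longrightarrow> l \<noteq> m \<Longrightarrow> Im (xl l v * cnj (xl m v)) \<noteq> 0"
    and "spoke v A" "0 < Re A" "spoke v B" "0 < Re B" "slope A \<le> slope B"
  shows "TT (vpath v A B)"
  using assms(3-)
proof (induction "card {l \<in> J. - xl l v \<in> Sec (slope A) (slope B)}" arbitrary: A B rule: less_induct)
  case less
  let ?N = "\<lambda>A B. {l \<in> J. - xl l v \<in> Sec (slope A) (slope B)}"
  have vV: "v \<in> V" using v by (rule M_V)
  have dist: "xl l v \<noteq> xl m v" if "l \<in> J" "m \<in> J" "l \<noteq> m" for l m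
    using gen[OF that] by (auto simp: complex_mult_cnj)
  show ?case
  proof (cases "\<exists>l m. l \<in> ?N A B \<and> m \<in> ?N A B \<and> l \<noteq> m")
    case False
    then show ?thesis using less.prems dist by (intro TT_vpath_base[OF vV]) auto
  next
    case True
    define y where "y l = - xl l v" for l
    have pos: "Re (y l) > 0" if "l \<in> ?N A B" for l
    proof -
      have "y l \<in> Sec (slope A) (slope B)" "y l \<noteq> 0" using that v by (auto simp: y_def M_iff)
      then show ?thesis by (auto simp: Sec_def complex_eq_iff less_le)
    qed
    obtain l m where lm: "l \<in> ?N A B" "m \<in> ?N A B" "slope (y l) < slope (y m)"
    proof -
      obtain l m where 1: "l \<in> ?N A B" "m \<in> ?N A B" "l \<noteq> m" using True by blast
      have "slope (y l) \<noteq> slope (y m)"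
      proof
        assume "slope (y l) = slope (y m)"
        then have "Im (y l) * Re (y m) = Im (y m) * Re (y l)" using pos[OF 1(1)] pos[OF 1(2)] by (simp add: slope_def field_simps)
        then have "Im (xl l v * cnj (xl m v)) = 0" by (simp add: y_def algebra_simps)
        then show False using gen[of l m] 1 by blast
      qed
      then show ?thesis using that[of l m] that[of m l] 1 by (cases "slope (y l) < slope (y m)") auto
    qed
    \<comment> \<open>The new slope avoids those of all punctures, inside the sector or not, so that
      its ray is clear.\<close>
    have "infinite ({slope (y l)<..<slope (y m)} - (\<lambda>i. slope (y i)) ` J)" using lm(3) finite_J by simp
    then obtain \<mu> where \<mu>0: "\<mu> \<in> {slope (y l)<..<slope (y m)} - (\<lambda>i. slope (y i)) ` J" using infinite_imp_nonempty by blast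
    then have \<mu>: "slope (y l) < \<mu>" "\<mu> < slope (y m)" "\<And>i. i \<in> J \<Longrightarrow> slope (- xl i v) \<noteq> \<mu>" by (auto simp: y_def)
    obtain C where C: "spoke v C" "0 < Re C" "slope C = \<mu>" by (rule spoke_exists[OF v \<mu>(3)])
    have sl: "slope A \<le> slope (y i)" "slope (y i) \<le> slope B" if "i \<in> ?N A B" for i
      using that pos[OF that] by (auto simp: Sec_def slope_def y_def field_simps)
    have AC: "slope A \<le> slope C" and CB: "slope C \<le> slope B"
      using sl[OF lm(1)] sl[OF lm(2)] \<mu>(1,2) unfolding C(3) by linarith+
    have memAC: "m \<notin> ?N A C"
    proof
      assume "m \<in> ?N A C"
      then have "Im (y m) \<le> \<mu> * Re (y m)" by (simp add: Sec_def y_def C(3))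
      then have "slope (y m) \<le> \<mu>" using pos[OF lm(2)] by (simp add: slope_def divide_le_eq)
      then show False using \<mu>(2) by simp
    qed
    have memCB: "l \<notin> ?N C B"
    proof
      assume "l \<in> ?N C B"
      then have "\<mu> * Re (y l) \<le> Im (y l)" by (simp add: Sec_def y_def C(3))
      then have "\<mu> \<le> slope (y l)" using pos[OF lm(1)] by (simp add: slope_def le_divide_eq)
      then show False using \<mu>(1) by simp
    qed
    have sub: "Sec a c \<subseteq> Sec a b" "Sec c b \<subseteq> Sec a b" if "a \<le> c" "c \<le> b" for a b c
      using that mult_right_mono[of c b] mult_right_mono[of a c] by (force simp: Sec_def)+
    have s1: "?N A C \<subset> ?N A B" using sub(1)[OF AC CB] memAC lm(2) by blast
    have s2: "?N C B \<subset> ?N A B" using sub(2)[OF AC CB] memCB lm(1) by blast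
    have fin: "finite (?N A B)" using finite_J by simp
    show ?thesis
    proof (rule vpath_split[OF less.prems(1) less.prems(3) C(1)])
      show "TT (vpath v A C)" by (rule less.hyps[OF psubset_card_mono[OF fin s1] less.prems(1,2) C(1,2) AC])
      show "TT (vpath v C B)" by (rule less.hyps[OF psubset_card_mono[OF fin s2] C(1,2) less.prems(3,4) CB])
    qed
  qed
qed

lemma TT_vpath_generic':
  assumes v: "v \<in> M" and gen: "\<And>l m. l \<in> J \<Longrightarrow> m \<in> J \<Longrightarrow> l \<noteq> m \<Longrightarrow> Im (xl l v * cnj (xl m v)) \<noteq> 0"
    and A: "spoke v A" "0 < Re A" and B: "spoke v B" "0 < Re B"
  shows "TT (vpath v A B)"
proof (cases "slope A \<le> slope B")
  case True
  then show ?thesis by (intro TT_vpath_generic[OF v gen A B]) auto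
next
  case False
  then have "TT (vpath v B A)" by (intro TT_vpath_generic[OF v gen B A]) auto
  then have "TT (reversepath (vpath v A B))" unfolding vpath_rev .
  then show ?thesis by (rule TT_rev_iff[rotated]) (use vpath_arr[OF A(1) B(1)] in \<open>simp add: arr_iff_okp\<close>)
qed

text \<open>As in \<open>LP_move\<close>, now with two ends: both spokes stay clear while
  \<open>v\<close> moves, so the end points trace far paths, which close up trivially.\<close>

lemma TT_move:
  assumes w: "continuous_on {0..1::real} w" and A: "\<And>s. s \<in> {0..1} \<Longrightarrow> spoke (w s) A" and B: "\<And>s. s \<in> {0..1} \<Longrightarrow> spoke (w s) B"
    and T: "TT (vpath (w 1) A B)"
  shows "TT (vpath (w 0) A B)"
proof -
  let ?c = "reversepath (linepath 0 A) +++ linepath 0 B"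
  have e: "vpath v A B = (\<lambda>t. lin v (?c t) p)" for v
    unfolding vpath_def path_compose_reversepath[symmetric] path_compose_join[symmetric] by (simp only: o_def)
  have cc: "continuous_on {0..1} ?c"
    using path_join_eq[of "reversepath (linepath 0 A)" "linepath 0 B"] by (simp add: path_def[symmetric])
  define K where "K = (\<lambda>(s,t). lin (w s) (?c t) p)"
  have Kc: "continuous_on ({0..1} \<times> {0..1}) K"
    unfolding K_def case_prod_unfold
    by (intro continuous_intros continuous_on_compose2[OF w] continuous_on_compose2[OF cc]) auto
  have KM: "K (s,t) \<in> M" if "s \<in> {0..1}" "t \<in> {0..1}" for s t
    using arr_mem[OF vpath_arr[OF A[OF that(1)] B[OF that(1)]] that(2)] by (simp add: K_def e)
  have c01: "?c 0 = A" "?c 1 = B" by (simp_all add: joinpaths_def reversepath_def linepath_def)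
  let ?a = "\<lambda>s. lin (w s) A p" and ?b = "\<lambda>s. lin (w s) B p"
  have sa: "arr Omp (?a 0) (?a 1) ?a" and sb: "arr Omp (?b 0) (?b 1) ?b"
    using A B by (auto intro!: arrI continuous_intros w simp: spoke_def)
  have i01: "0 \<in> {0..1::real}" "1 \<in> {0..1::real}" by auto
  note v0 = vpath_arr[OF A[OF i01(1)] B[OF i01(1)]] and v1 = vpath_arr[OF A[OF i01(2)] B[OF i01(2)]]
  have "homotopic_paths M ((\<lambda>t. K (0,t)) +++ (\<lambda>s. K (s,1))) ((\<lambda>s. K (s,0)) +++ (\<lambda>t. K (1,t)))"
    by (rule square_homotopic[OF Kc KM])
  then have sq: "homotopic_paths M (vpath (w 0) A B +++ ?b) (?a +++ vpath (w 1) A B)"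
    by (simp only: K_def e c01 prod.case)
  have T1: "TT ((?a +++ vpath (w 1) A B) +++ reversepath ?b)"
    by (intro TT_join[OF TT_join[OF TT_far[OF sa] T] TT_rev[OF TT_far[OF sb]]])
       (use v1 in \<open>auto simp: arr_iff_okp pathfinish_def[of ?a] pathfinish_def[of ?b]\<close>)
  have sbM: "arr M (?b 0) (?b 1) ?b" by (rule arr_mono[OF sb Omp_M])
  have "homotopic_paths M ((?a +++ vpath (w 1) A B) +++ reversepath ?b) ((vpath (w 0) A B +++ ?b) +++ reversepath ?b)"
    by (rule homotopic_paths_sym[OF hp_join_left[OF sq arr_join[OF v0 sbM] arr_rev[OF sbM]]])
  also have "homotopic_paths M \<dots> (vpath (w 0) A B)" by (rule hp_cancel_right[OF v0 sbM])
  finally show ?thesis by (rule TT_homotopic[OF T1])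
qed

text \<open>Three generic choices: a vector where the values \<open>xl l\<close> differ, a rotation
  after which their imaginary parts differ, and a real multiple of \<open>p\<close>. The last adds
  \<open>\<rho>\<close> to all values and changes \<open>Im (x * cnj y)\<close> by
  \<open>\<rho> * (Im x - Im y)\<close>.\<close>

lemma generic_direction:
  "\<exists>e\<in>V. \<forall>l\<in>J. \<forall>m\<in>J. l \<noteq> m \<longrightarrow> Im (xl l e * cnj (xl m e)) \<noteq> 0"
proof -
  define D where "D = {lm \<in> J \<times> J. fst lm \<noteq> snd lm}"
  have finD: "finite D" using finite_J by (auto simp: D_def)
  have "\<exists>e\<in>V. \<forall>lm\<in>D. (\<lambda>lm u. xl (fst lm) u - xl (snd lm) u) lm e \<noteq> 0"
  proof (rule generic_point)
    show "V \<noteq> {}" using zero_closed by blast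
    show "\<exists>u\<in>V. xl (fst lm) u - xl (snd lm) u \<noteq> 0" if "lm \<in> D" for lm
    proof -
      have lm: "fst lm \<in> J" "snd lm \<in> J" "fst lm \<noteq> snd lm" using that by (auto simp: D_def)
      then obtain u where "u \<in> V" "f (fst lm) u \<noteq> 0" "f (snd lm) u = 0"
        using f_indep[of "fst lm" "snd lm" "snd lm"] by auto
      then show ?thesis using fp[of "fst lm"] lm by (intro bexI[of _ u]) (auto simp: xl_def)
    qed
  qed (use finD in \<open>auto simp: xl_lin D_def algebra_simps intro: lin_closed\<close>)
  then obtain e0 where e0: "e0 \<in> V" "\<And>l m. l \<in> J \<Longrightarrow> m \<in> J \<Longrightarrow> l \<noteq> m \<Longrightarrow> xl l e0 \<noteq> xl m e0" by (auto simp: D_def)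
  let ?Z = "(\<lambda>lm. xl (fst lm) e0 - xl (snd lm) e0) ` D"
  have "0 \<notin> ?Z" using e0(2) by (force simp: D_def)
  have "\<exists>\<theta>. 0 < \<theta> \<and> \<theta> < 1 \<and> (\<forall>z\<in>?Z. z * cis (-\<theta>) \<notin> \<real>\<^sub>\<le>\<^sub>0)"
    by (rule generic_angle) (use finD \<open>0 \<notin> ?Z\<close> pi_gt3 in auto)
  then obtain \<theta> where \<theta>: "\<And>z. z \<in> ?Z \<Longrightarrow> z * cis (-\<theta>) \<notin> \<real>\<^sub>\<le>\<^sub>0" by blast
  define e1 where "e1 = lin (\<lambda>_. 0) (cis (-\<theta>)) e0"
  have e1V: "e1 \<in> V" unfolding e1_def by (rule lin_closed[OF zero_closed e0(1)])
  have xe1: "xl l e1 = cis (-\<theta>) * xl l e0" if "l \<in> J" for l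
    using that f_zero[OF that] by (simp add: e1_def xl_def)
  have Im1: "Im (xl l e1) \<noteq> Im (xl m e1)" if "l \<in> J" "m \<in> J" "l \<noteq> m" for l m
  proof
    assume "Im (xl l e1) = Im (xl m e1)"
    moreover have "(l,m) \<in> D" "(m,l) \<in> D" using that by (auto simp: D_def)
    then have "(xl l e0 - xl m e0) * cis (-\<theta>) \<notin> \<real>\<^sub>\<le>\<^sub>0" "(xl m e0 - xl l e0) * cis (-\<theta>) \<notin> \<real>\<^sub>\<le>\<^sub>0"
      using \<theta> by force+
    then have "xl l e1 - xl m e1 \<notin> \<real>\<^sub>\<le>\<^sub>0" "xl m e1 - xl l e1 \<notin> \<real>\<^sub>\<le>\<^sub>0"
      using that by (simp_all add: xe1 algebra_simps)
    ultimately show False by (simp add: complex_nonpos_Reals_iff)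
  qed
  let ?bad = "\<lambda>(l,m). - Im (xl l e1 * cnj (xl m e1)) / (Im (xl l e1) - Im (xl m e1))"
  obtain \<rho> :: real where \<rho>: "\<rho> \<notin> ?bad ` D" using ex_new_if_finite[OF infinite_UNIV_char_0 finite_imageI[OF finD]] by blast
  show ?thesis
  proof (intro bexI ballI impI)
    show "lin e1 (of_real \<rho>) p \<in> V" by (rule lin_closed[OF e1V pV])
    fix l m assume lm: "l \<in> J" "m \<in> J" "l \<noteq> m"
    have "Im (xl l (lin e1 (of_real \<rho>) p) * cnj (xl m (lin e1 (of_real \<rho>) p))) =
       Im (xl l e1 * cnj (xl m e1)) + \<rho> * (Im (xl l e1) - Im (xl m e1))"
      using lm by (simp add: xl_linp algebra_simps)
    moreover have "\<rho> \<noteq> ?bad (l,m)" using \<rho> lm by (auto simp: D_def)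
    then have "\<rho> * (Im (xl l e1) - Im (xl m e1)) \<noteq> - Im (xl l e1 * cnj (xl m e1))"
      using Im1[OF lm] by (simp add: eq_divide_eq)
    ultimately show "Im (xl l (lin e1 (of_real \<rho>) p) * cnj (xl m (lin e1 (of_real \<rho>) p))) \<noteq> 0" by linarith
  qed
qed

lemma spoke_stable:
  assumes v: "v \<in> V" and e: "e \<in> V" and A: "spoke v A"
  shows "\<exists>r>0. \<forall>\<eta>. cmod \<eta> < r \<longrightarrow> spoke (lin v \<eta> e) A"
proof -
  have "\<exists>\<delta>>0. \<forall>l\<in>J. \<forall>t\<in>{0..1}. \<delta> \<le> cmod (xl l v + linepath 0 A t)"
  proof (rule uniform_nonzero[OF finite_J])
    show "continuous_on {0..1} (\<lambda>t. xl l v + linepath 0 A t)" for l by (intro continuous_intros continuous_on_linepath)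
    show "xl l v + linepath 0 A t \<noteq> 0" if "l \<in> J" "t \<in> {0..1}" for l t
      using A that unfolding spoke_def linp_M[OF v] by blast
  qed
  then obtain \<delta> where \<delta>: "\<delta> > 0" "\<And>l t. l \<in> J \<Longrightarrow> t \<in> {0..1} \<Longrightarrow> \<delta> \<le> cmod (xl l v + linepath 0 A t)" by blast
  define d where "d = Min (insert 1 ((\<lambda>l. Re (xl l v) + Re A) ` J))"
  have dl: "0 < Re (xl l v) + Re A" if "l \<in> J" for l using A that unfolding spoke_def linp_Omp[OF v] by blast
  have d: "d > 0" "\<And>l. l \<in> J \<Longrightarrow> d \<le> Re (xl l v) + Re A" unfolding d_def using finite_J dl by auto
  obtain r where r: "r > 0" "\<forall>l\<in>J. \<forall>\<eta>. cmod \<eta> < r \<longrightarrow> cmod (\<eta> * xl l e) < min \<delta> d"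
    using small_scalar[OF finite_J, of "min \<delta> d" "\<lambda>l. xl l e"] \<delta>(1) d(1) by auto
  have "spoke (lin v \<eta> e) A" if \<eta>: "cmod \<eta> < r" for \<eta>
  proof -
    have V': "lin v \<eta> e \<in> V" by (rule lin_closed[OF v e])
    have sm: "cmod (\<eta> * xl l e) < \<delta>" "cmod (\<eta> * xl l e) < d" if "l \<in> J" for l using r(2) that \<eta> by auto
    have "xl l (lin v \<eta> e) + linepath 0 A t \<noteq> 0" if "l \<in> J" "t \<in> {0..1}" for l t
    proof
      assume "xl l (lin v \<eta> e) + linepath 0 A t = 0"
      then have "(xl l v + linepath 0 A t) + \<eta> * xl l e = 0" using that by (simp add: xl_lin add_ac)
      then have "xl l v + linepath 0 A t = - (\<eta> * xl l e)" by (simp add: add_eq_0_iff2)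
      then have "cmod (xl l v + linepath 0 A t) = cmod (\<eta> * xl l e)" by (metis norm_minus_cancel)
      then show False using \<delta>(2)[OF that] sm(1)[OF that(1)] by simp
    qed
    moreover have "0 < Re (xl l (lin v \<eta> e)) + Re A" if "l \<in> J" for l
      using d(2)[OF that] sm(2)[OF that] abs_Re_le_cmod[of "\<eta> * xl l e"] that by (simp add: xl_lin)
    ultimately show ?thesis unfolding spoke_def linp_M[OF V'] linp_Omp[OF V'] by blast
  qed
  then show ?thesis using r(1) by blast
qed

text \<open>Along \<open>v\<close> plus a real multiple \<open>x\<close> of \<open>e\<close> the
  quantities required by \<open>TT_vpath_generic\<close> are quadratic polynomials in
  \<open>x\<close>, with leading coefficient nonzero by the choice of \<open>e\<close>. A small
  generic \<open>x\<close> makes the punctures generic without touching the two spokes.\<close>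

lemma TT_vpath:
  assumes v: "v \<in> M" and A: "spoke v A" "0 < Re A" and B: "spoke v B" "0 < Re B"
  shows "TT (vpath v A B)"
proof -
  have vV: "v \<in> V" using v by (rule M_V)
  obtain e where e: "e \<in> V" "\<And>l m. l \<in> J \<Longrightarrow> m \<in> J \<Longrightarrow> l \<noteq> m \<Longrightarrow> Im (xl l e * cnj (xl m e)) \<noteq> 0"
    using generic_direction by blast
  obtain r1 where r1: "r1 > 0" "\<And>\<eta>. cmod \<eta> < r1 \<Longrightarrow> spoke (lin v \<eta> e) A" using spoke_stable[OF vV e(1) A(1)] by blast
  obtain r2 where r2: "r2 > 0" "\<And>\<eta>. cmod \<eta> < r2 \<Longrightarrow> spoke (lin v \<eta> e) B" using spoke_stable[OF vV e(1) B(1)] by blast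
  define D where "D = {lm \<in> J \<times> J. fst lm \<noteq> snd lm}"
  have finD: "finite D" using finite_J by (auto simp: D_def)
  define P where "P = (\<lambda>(l,m). [: Im (xl l v * cnj (xl m v)), Im (xl l v * cnj (xl m e) + xl l e * cnj (xl m v)), Im (xl l e * cnj (xl m e)) :])"
  have "finite (\<Union>lm\<in>D. {x. poly (P lm) x = 0})"
  proof (rule finite_UN_I[OF finD])
    fix lm assume "lm \<in> D"
    then have "P lm \<noteq> 0" using e(2)[of "fst lm" "snd lm"] by (auto simp: P_def D_def split: prod.splits)
    then show "finite {x. poly (P lm) x = 0}" by (rule poly_roots_finite)
  qed
  moreover have "infinite {0<..<min r1 r2}" using r1(1) r2(1) by simp
  ultimately have "infinite ({0<..<min r1 r2} - (\<Union>lm\<in>D. {x. poly (P lm) x = 0}))" by simp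
  then obtain x where x: "x \<in> {0<..<min r1 r2} - (\<Union>lm\<in>D. {x. poly (P lm) x = 0})" using infinite_imp_nonempty by blast
  define w where "w s = lin v (of_real (s * x)) e" for s
  have sx: "cmod (of_real (s * x)) < r1" "cmod (of_real (s * x)) < r2" if "s \<in> {0..1}" for s
  proof -
    have "cmod (of_real (s * x)) = s * x" using that x by (simp add: abs_mult del: of_real_mult)
    also have "\<dots> \<le> 1 * x" using that x by (intro mult_right_mono) auto
    finally show "cmod (of_real (s * x)) < r1" "cmod (of_real (s * x)) < r2" using x by auto
  qed
  have "TT (vpath (w 0) A B)"
  proof (rule TT_move)
    show "continuous_on {0..1} w" unfolding w_def by (intro continuous_intros)
    show sA: "spoke (w s) A" if "s \<in> {0..1}" for s unfolding w_def by (rule r1(2)[OF sx(1)[OF that]])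
    show sB: "spoke (w s) B" if "s \<in> {0..1}" for s unfolding w_def by (rule r2(2)[OF sx(2)[OF that]])
    show "TT (vpath (w 1) A B)"
    proof (rule TT_vpath_generic'[OF _ _ sA A(2) sB B(2)])
      show "w 1 \<in> M" using arr_in[OF spoke_arr[OF sA[of 1]]] by simp
      fix l m assume lm: "l \<in> J" "m \<in> J" "l \<noteq> m"
      then have "(l,m) \<in> D" by (simp add: D_def)
      then have "poly (P (l,m)) x \<noteq> 0" using x by blast
      moreover have "Im (xl l (w 1) * cnj (xl m (w 1))) = poly (P (l,m)) x"
        using lm by (simp add: w_def xl_lin P_def algebra_simps)
      ultimately show "Im (xl l (w 1) * cnj (xl m (w 1))) \<noteq> 0" by simp
    qed auto
  qed
  then show ?thesis by (simp add: w_def)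
qed

lemma Gen_all:
  assumes g: "arr M p p g"
  shows "hc M g \<in> Gen"
proof -
  have "TT g"
  proof (rule path_generation[where \<Omega> = Omp and T = TT, OF pV Omp_M _ _ _ _ _ g p_Omp p_Omp])
    fix C :: "real set" and g \<theta>
    assume C: "compact C" "continuous_on C g" "g ` C \<subseteq> M" "\<bar>\<theta>\<bar> < pi/4"
    have gV: "g t \<in> V" if "t \<in> C" for t using C(3) that unfolding M_def by blast
    have "\<exists>b. \<forall>t\<in>C. - Re (xl l (g t)) < b" if l: "l \<in> J" for l
    proof -
      have "compact ((\<lambda>t. - Re (xl l (g t))) ` C)"
        unfolding xl_def using C l fp[OF l] by (intro compact_continuous_image continuous_intros) auto
      then have "bounded ((\<lambda>t. - Re (xl l (g t))) ` C)" by (rule compact_imp_bounded)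
      then obtain b where "\<forall>x\<in>(\<lambda>t. - Re (xl l (g t))) ` C. \<bar>x\<bar> \<le> b" unfolding bounded_real by blast
      then show ?thesis by (intro exI[of _ "b+1"]) fastforce
    qed
    then obtain b where b: "\<And>l t. l \<in> J \<Longrightarrow> t \<in> C \<Longrightarrow> - Re (xl l (g t)) < b l" by metis
    define B where "B = Max (insert 1 (b ` J))"
    have B: "1 \<le> B" "\<And>l. l \<in> J \<Longrightarrow> b l \<le> B" using finite_J by (auto simp: B_def)
    have "cos (pi/3) \<le> cos \<theta>" using C(4) pi_gt_zero cos_monotone_0_pi_le[of "\<bar>\<theta>\<bar>" "pi/3"] by simp
    then have BR: "B \<le> Re (of_real (2 * B) * cis \<theta>)" using B(1) by (simp add: cos_60)
    have "lin (g t) (of_real (2 * B) * cis \<theta>) p \<in> Omp" if t: "t \<in> C" for t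
      unfolding linp_Omp[OF gV[OF t]]
    proof
      fix l assume l: "l \<in> J"
      show "0 < Re (xl l (g t)) + Re (of_real (2 * B) * cis \<theta>)" using b[OF l t] B(2)[OF l] BR by linarith
    qed
    then show "\<exists>R>0. \<forall>t\<in>C. lin (g t) (complex_of_real R * cis \<theta>) p \<in> Omp" using B(1) by (intro exI[of _ "2*B"]) auto
  next
    fix g h assume "TT g" "homotopic_paths M g h" then show "TT h" by (rule TT_homotopic)
  next
    fix g h assume "TT g" "TT h" "pathfinish g = pathstart h" then show "TT (g +++ h)" by (rule TT_join)
  next
    fix g a b assume "arr Omp a b g" then show "TT g" by (rule TT_far)
  next
    fix v \<theta> \<theta>' R R'
    assume A: "v \<in> M" "\<bar>\<theta>\<bar> < pi/4" "\<bar>\<theta>'\<bar> < pi/4" "0 \<le> R" "0 \<le> R'" "arr M v (ray v \<theta> R p 1) (ray v \<theta> R p)" "arr M v (ray v \<theta>' R' p 1) (ray v \<theta>' R' p)"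
       "ray v \<theta> R p 1 \<in> Omp" "ray v \<theta>' R' p 1 \<in> Omp"
    have vV: "v \<in> V" using A(1) by (rule M_V)
    have sp: "spoke v (of_real R * cis \<theta>)" if "arr M v (ray v \<theta> R p 1) (ray v \<theta> R p)" "ray v \<theta> R p 1 \<in> Omp" for R \<theta>
      using arr_mem[OF that(1)] that(2) unfolding spoke_def ray_line by (simp add: linepath_1')
    have e: "reversepath (ray v \<theta> R p) +++ ray v \<theta>' R' p = vpath v (of_real R * cis \<theta>) (of_real R' * cis \<theta>')"
      by (simp add: vpath_def ray_line)
    have pos: "0 < Re (of_real R * cis \<theta>)" if "R > 0" "\<bar>\<theta>\<bar> < pi/4" for R \<theta>
      using that by (auto intro!: mult_pos_pos cos_gt_zero_pi)
    \<comment> \<open>A ray of length 0 is outside the scope of \<open>TT_vpath\<close>, which needs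
      positive real parts. But then \<open>v\<close> itself is far, and convexity keeps the whole
      path in \<open>Omp\<close>.\<close>
    have one: "TT (vpath v A B) \<and> TT (vpath v B A)" if AB: "spoke v A" "spoke v B" "A = 0" for A B
    proof -
      have O: "lin v t p \<in> Omp" if "t \<in> closed_segment 0 B" for t
        using closed_segment_subset[OF _ _ convex_linp_Omp[OF vV], of 0 B] AB that by (auto simp: spoke_def)
      have "lin v (linepath 0 B t) p \<in> Omp" if "t \<in> {0..1}" for t
        using O[of "linepath 0 B t"] linepath_in_path[OF that, of 0 B] by simp
      then have "arr Omp v (lin v B p) ((\<lambda>z. lin v z p) \<circ> linepath 0 B)"
        using lin_arr[of "linepath 0 B" v p Omp] by (simp add: o_def linepath_0' linepath_1')
      moreover have vO: "v \<in> Omp" using O[of 0] by simp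
      ultimately have "TT (vpath v A B)"
        unfolding vpath_def AB(3) by (intro TT_far[of v "lin v B p"] arr_join[of Omp v v] arr_rev)
          (auto simp: comp_linepath_same arr_const)
      then show ?thesis using TT_rev[of "vpath v A B"] by (simp add: vpath_rev)
    qed
    show "TT (reversepath (ray v \<theta> R p) +++ ray v \<theta>' R' p)"
      unfolding e
    proof (cases "R = 0 \<or> R' = 0")
      case True
      then show "TT (vpath v (of_real R * cis \<theta>) (of_real R' * cis \<theta>'))"
        using one[OF sp[OF A(6,8)] sp[OF A(7,9)]] one[OF sp[OF A(7,9)] sp[OF A(6,8)]] by auto
    next
      case False
      then show "TT (vpath v (of_real R * cis \<theta>) (of_real R' * cis \<theta>'))"
        using A by (intro TT_vpath[OF A(1)] sp pos) auto
    qed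
  qed
  moreover have "seg p = (\<lambda>_. p)" by (auto simp: seg_def lin_def)
  ultimately have "star M (gone M p) (star M (hc M g) (ginv M (gone M p))) \<in> Gen"
    using g by (simp only: TT_def arr_iff_okp hc_const)
  moreover have "star M (gone M p) (star M (hc M g) (ginv M (gone M p))) = hc M g"
    using g by (simp add: arr_iff_okp pM)
  ultimately show ?thesis by simp
qed

end

subsection \<open>The group of loop classes\<close>

declare One_nat_def [simp del]

text \<open>The vertex group of the groupoid. All computations take place here;
  \<open>loop_group_iso\<close> passes to the cubical \<open>fundamental_group\<close>.\<close>

definition loop_group :: "'a::topological_space set \<Rightarrow> 'a \<Rightarrow> (real \<Rightarrow> 'a) set monoid" where
  "loop_group S p = \<lparr>carrier = {X. gok S X \<and> src X = p \<and> tgt X = p}, mult = star S, one = gone S p\<rparr>"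

lemma loop_group_sel [simp]:
  "carrier (loop_group S p) = {X. gok S X \<and> src X = p \<and> tgt X = p}"
  "X \<otimes>\<^bsub>loop_group S p\<^esub> Y = star S X Y" "\<one>\<^bsub>loop_group S p\<^esub> = gone S p"
  by (simp_all add: loop_group_def)

lemma group_loop_group: "p \<in> S \<Longrightarrow> group (loop_group S p)"
proof (rule groupI)
  fix X assume "p \<in> S" "X \<in> carrier (loop_group S p)"
  then have "ginv S X \<in> carrier (loop_group S p) \<and> ginv S X \<otimes>\<^bsub>loop_group S p\<^esub> X = \<one>\<^bsub>loop_group S p\<^esub>" by simp
  then show "\<exists>Y\<in>carrier (loop_group S p). Y \<otimes>\<^bsub>loop_group S p\<^esub> X = \<one>\<^bsub>loop_group S p\<^esub>" by blast
qed (simp_all add: star_assoc)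

lemma inv_loop_group: "p \<in> S \<Longrightarrow> X \<in> carrier (loop_group S p) \<Longrightarrow> inv\<^bsub>loop_group S p\<^esub> X = ginv S X"
  by (rule group.inv_equality[OF group_loop_group]) auto

lemma loop_class_obtain:
  assumes "X \<in> carrier (loop_group S p)"
  obtains g where "arr S p p g" "X = hc S g"
proof -
  have X: "gok S X" "src X = p" "tgt X = p" using assms by auto
  obtain g where "okp S g" "X = hc S g" "src X = pathstart g" "tgt X = pathfinish g" using X(1) by (rule gokE)
  then show ?thesis using that[of g] X(2,3) by (simp add: arr_iff_okp)
qed

text \<open>Points of \<open>cube 1\<close> are functions restricted to \<open>{..<1}\<close> and
  not reals; \<open>emb1\<close> and evaluation at 0 identify the two.\<close>

definition emb1 :: "real \<Rightarrow> nat \<Rightarrow> real" where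
  "emb1 t = (\<lambda>i\<in>{..<1}. t)"

lemma emb1_0 [simp]: "emb1 t 0 = t"
  by (simp add: emb1_def)

lemma topspace_cube: "topspace (cube m) = {..<m} \<rightarrow>\<^sub>E {0..1}"
  by (simp add: cube_def)

lemma emb1_topspace: "t \<in> {0..1} \<Longrightarrow> emb1 t \<in> topspace (cube 1)"
  by (auto simp: topspace_cube emb1_def)

lemma emb1_eq: "x \<in> topspace (cube 1) \<Longrightarrow> emb1 (x 0) = x"
  by (auto simp: topspace_cube emb1_def PiE_def extensional_def fun_eq_iff)

lemma continuous_map_emb1: "continuous_map (top_of_set {0..1}) (cube 1) emb1"
  unfolding cube_def continuous_map_componentwise
  by (auto simp: emb1_def continuous_map_id[unfolded id_def])

lemma continuous_map_coord0: "continuous_map (cube 1) (top_of_set {0..1}) (\<lambda>x. x 0)"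
  unfolding cube_def by (rule continuous_map_product_projection) simp

lemma boundary1: "x \<in> cube_boundary 1 \<longleftrightarrow> x \<in> topspace (cube 1) \<and> (x 0 = 0 \<or> x 0 = 1)"
  by (auto simp: cube_boundary_def)

lemma spheroid_up:
  assumes "arr S p p g"
  shows "(\<lambda>x. g (x 0)) \<in> spheroids 1 (top_of_set S) p"
proof -
  have "continuous_map (top_of_set {0..1}) (top_of_set S) g"
    using arr_cont[OF assms] arr_mem[OF assms] by (auto simp: continuous_map_in_subtopology)
  then have "continuous_map (cube 1) (top_of_set S) (g \<circ> (\<lambda>x. x 0))"
    using continuous_map_compose[OF continuous_map_coord0] by blast
  then show ?thesis using arr_ends[OF assms] by (auto simp: spheroids_def o_def boundary1)
qed

lemma spheroid_down:
  assumes "f \<in> spheroids 1 (top_of_set S) p"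
  shows "arr S p p (\<lambda>t. f (emb1 t))"
proof (rule arrI)
  have "continuous_map (cube 1) (top_of_set S) f" using assms by (simp add: spheroids_def)
  then have c: "continuous_map (top_of_set {0..1}) (top_of_set S) (f \<circ> emb1)"
    by (rule continuous_map_compose[OF continuous_map_emb1])
  then show "continuous_on {0..1} (\<lambda>t. f (emb1 t))"
    unfolding continuous_map_in_subtopology o_def by auto
  show "f (emb1 t) \<in> S" if "t \<in> {0..1}" for t
    using c that unfolding continuous_map_in_subtopology o_def by auto
  show "f (emb1 0) = p" "f (emb1 1) = p"
    using assms emb1_topspace[of 0] emb1_topspace[of 1] by (auto simp: spheroids_def boundary1)
qed

abbreviation sph_rel :: "nat \<Rightarrow> 'a topology \<Rightarrow> 'a \<Rightarrow> ((nat \<Rightarrow> real) \<Rightarrow> 'a) \<Rightarrow> ((nat \<Rightarrow> real) \<Rightarrow> 'a) \<Rightarrow> bool" where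
  "sph_rel m X p \<equiv> homotopic_with (\<lambda>h. \<forall>x\<in>cube_boundary m. h x = p) (cube m) X"

lemma sph_rel_eq:
  assumes "f \<in> spheroids m X p" "\<And>x. x \<in> topspace (cube m) \<Longrightarrow> f x = g x"
  shows "sph_rel m X p f g"
  by (rule homotopic_with_equal) (use assms in \<open>auto simp: spheroids_def cube_boundary_def\<close>)

lemma sph_rel_spheroids:
  assumes "sph_rel m X p f g"
  shows "f \<in> spheroids m X p" "g \<in> spheroids m X p"
  using homotopic_with_imp_continuous_maps[OF assms] homotopic_with_imp_property[OF assms]
  by (auto simp: spheroids_def)

lemma spheroid_class_eq:
  assumes "sph_rel m X p f g"
  shows "spheroid_class m X p f = spheroid_class m X p g"
  unfolding spheroid_class_def
proof (intro Collect_cong iffI)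
  show "sph_rel m X p g h" if "sph_rel m X p f h" for h
    by (rule homotopic_with_trans[OF homotopic_with_symD[OF assms] that])
  show "sph_rel m X p f h" if "sph_rel m X p g h" for h
    by (rule homotopic_with_trans[OF assms that])
qed

lemma spheroid_class_self: "f \<in> spheroids m X p \<Longrightarrow> f \<in> spheroid_class m X p f"
  by (simp add: spheroid_class_def spheroids_def)

lemma spheroid_class_iff:
  assumes "f \<in> spheroids m X p" "g \<in> spheroids m X p"
  shows "spheroid_class m X p f = spheroid_class m X p g \<longleftrightarrow> sph_rel m X p f g"
proof
  assume "spheroid_class m X p f = spheroid_class m X p g"
  then have "g \<in> spheroid_class m X p f" using spheroid_class_self[OF assms(2)] by simp
  then show "sph_rel m X p f g" by (simp add: spheroid_class_def)
qed (rule spheroid_class_eq)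

lemma sph_rel_down:
  assumes "sph_rel 1 (top_of_set S) p f g"
  shows "homotopic_paths S (\<lambda>t. f (emb1 t)) (\<lambda>t. g (emb1 t))"
proof -
  have "homotopic_with (\<lambda>h. pathstart h = p \<and> pathfinish h = p) (top_of_set {0..1}) (top_of_set S) (f \<circ> emb1) (g \<circ> emb1)"
  proof (rule homotopic_with_compose_continuous_map_right[OF assms continuous_map_emb1])
    show "pathstart (j \<circ> emb1) = p \<and> pathfinish (j \<circ> emb1) = p" if "\<forall>x\<in>cube_boundary 1. j x = p" for j
      using that emb1_topspace[of 0] emb1_topspace[of 1] by (auto simp: boundary1 pathstart_def pathfinish_def)
  qed
  moreover have "pathstart (f \<circ> emb1) = p" "pathfinish (f \<circ> emb1) = p"
    using homotopic_with_imp_property[OF calculation] by auto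
  ultimately show ?thesis unfolding homotopic_paths_def by (simp add: o_def)
qed

lemma sph_rel_up:
  assumes "homotopic_paths S g h" "arr S p p g"
  shows "sph_rel 1 (top_of_set S) p (\<lambda>x. g (x 0)) (\<lambda>x. h (x 0))"
proof -
  have "homotopic_with (\<lambda>r. pathstart r = p \<and> pathfinish r = p) (top_of_set {0..1}) (top_of_set S) g h"
    using assms unfolding homotopic_paths_def by (simp add: arr_def)
  then have "sph_rel 1 (top_of_set S) p (g \<circ> (\<lambda>x. x 0)) (h \<circ> (\<lambda>x. x 0))"
    by (rule homotopic_with_compose_continuous_map_right[OF _ continuous_map_coord0])
       (auto simp: boundary1 pathstart_def pathfinish_def)
  then show ?thesis by (simp add: o_def)
qed

definition loop_class :: "'a::topological_space set \<Rightarrow> 'a \<Rightarrow> (real \<Rightarrow> 'a) \<Rightarrow> ((nat \<Rightarrow> real) \<Rightarrow> 'a) set" where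
  "loop_class S p g = spheroid_class 1 (top_of_set S) p (\<lambda>x. g (x 0))"

lemma loop_class_iff:
  assumes "arr S p p g" "arr S p p h"
  shows "loop_class S p g = loop_class S p h \<longleftrightarrow> homotopic_paths S g h"
  unfolding loop_class_def spheroid_class_iff[OF spheroid_up[OF assms(1)] spheroid_up[OF assms(2)]]
proof
  assume "sph_rel 1 (top_of_set S) p (\<lambda>x. g (x 0)) (\<lambda>x. h (x 0))"
  from sph_rel_down[OF this] show "homotopic_paths S g h" by simp
next
  assume "homotopic_paths S g h"
  then show "sph_rel 1 (top_of_set S) p (\<lambda>x. g (x 0)) (\<lambda>x. h (x 0))" by (rule sph_rel_up[OF _ assms(1)])
qed

lemma loop_class_of:
  assumes "f \<in> spheroids 1 (top_of_set S) p"
  shows "spheroid_class 1 (top_of_set S) p f = loop_class S p (\<lambda>t. f (emb1 t))"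
  unfolding loop_class_def
  by (rule spheroid_class_eq[OF sph_rel_eq[OF assms]]) (simp add: emb1_eq)

lemma spheroid_join_down: "(\<lambda>t. spheroid_join f g (emb1 t)) = (\<lambda>t. f (emb1 t)) +++ (\<lambda>t. g (emb1 t))"
proof -
  have "(emb1 t)(0 := s) = emb1 s" for t s by (auto simp: emb1_def fun_eq_iff)
  then show ?thesis by (auto simp: spheroid_join_def joinpaths_def)
qed

lemma spheroid_join_in:
  assumes "f \<in> spheroids 1 (top_of_set S) p" "g \<in> spheroids 1 (top_of_set S) p"
  shows "spheroid_join f g \<in> spheroids 1 (top_of_set S) p"
proof -
  have "arr S p p (\<lambda>t. spheroid_join f g (emb1 t))"
    unfolding spheroid_join_down by (rule arr_join[OF spheroid_down[OF assms(1)] spheroid_down[OF assms(2)]])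
  then have "(\<lambda>x. spheroid_join f g (emb1 (x 0))) \<in> spheroids 1 (top_of_set S) p" by (rule spheroid_up)
  then show ?thesis
    using sph_rel_spheroids(2)[OF sph_rel_eq[of "\<lambda>x. spheroid_join f g (emb1 (x 0))" 1 "top_of_set S" p "spheroid_join f g"]]
    by (simp add: emb1_eq)
qed

lemma loop_class_mult:
  assumes "arr S p p g" "arr S p p h"
  shows "loop_class S p g \<otimes>\<^bsub>fundamental_group (top_of_set S) p\<^esub> loop_class S p h = loop_class S p (g +++ h)"
proof -
  let ?X = "top_of_set S"
  have "spheroid_class 1 ?X p (spheroid_join u w) = loop_class S p (g +++ h)"
    if "u \<in> loop_class S p g" "w \<in> loop_class S p h" for u w
  proof -
    have r: "sph_rel 1 ?X p (\<lambda>x. g (x 0)) u" "sph_rel 1 ?X p (\<lambda>x. h (x 0)) w"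
      using that by (auto simp: loop_class_def spheroid_class_def)
    note s = sph_rel_spheroids(2)[OF r(1)] sph_rel_spheroids(2)[OF r(2)]
    note d = spheroid_down[OF s(1)] spheroid_down[OF s(2)]
    have "homotopic_paths S g (\<lambda>t. u (emb1 t))" "homotopic_paths S h (\<lambda>t. w (emb1 t))"
      using sph_rel_down[OF r(1)] sph_rel_down[OF r(2)] by simp_all
    then have "homotopic_paths S (g +++ h) ((\<lambda>t. u (emb1 t)) +++ (\<lambda>t. w (emb1 t)))"
      using assms by (rule hp_join)
    then have "loop_class S p (g +++ h) = loop_class S p ((\<lambda>t. u (emb1 t)) +++ (\<lambda>t. w (emb1 t)))"
      using loop_class_iff[OF arr_join[OF assms] arr_join[OF d]] by simp
    then show ?thesis using loop_class_of[OF spheroid_join_in[OF s]] by (simp add: spheroid_join_down)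
  qed
  moreover have "(\<lambda>x. g (x 0)) \<in> loop_class S p g" "(\<lambda>x. h (x 0)) \<in> loop_class S p h"
    unfolding loop_class_def by (intro spheroid_class_self spheroid_up assms)+
  ultimately show ?thesis unfolding homotopy_group_def by auto
qed

lemma loop_group_iso:
  assumes p: "p \<in> S"
  shows "loop_group S p \<cong> fundamental_group (top_of_set S) p"
proof -
  \<comment> \<open>The union is over representatives that all give one and the same cubical class,
    by \<open>loop_class_iff\<close>.\<close>
  define \<phi> where "\<phi> X = (\<Union>g\<in>X. loop_class S p g)" for X
  have \<phi>: "\<phi> (hc S g) = loop_class S p g" if g: "arr S p p g" for g
  proof -
    have "loop_class S p h = loop_class S p g" if "h \<in> hc S g" for h
      using that loop_class_iff[OF g arr_homotopic[OF g]] by (auto simp: hc_def)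
    then have "\<phi> (hc S g) = (\<Union>h\<in>hc S g. loop_class S p g)" unfolding \<phi>_def by simp
    moreover have "g \<in> hc S g" by (rule hc_self) (use g in \<open>simp add: arr_iff_okp\<close>)
    ultimately show ?thesis by auto
  qed
  have "\<phi> \<in> hom (loop_group S p) (fundamental_group (top_of_set S) p)"
  proof (rule homI)
    fix X assume "X \<in> carrier (loop_group S p)"
    then obtain g where "arr S p p g" "X = hc S g" by (rule loop_class_obtain)
    then show "\<phi> X \<in> carrier (fundamental_group (top_of_set S) p)"
      using spheroid_up[of S p g] by (simp add: \<phi> homotopy_group_def loop_class_def)
  next
    fix X Y assume XY: "X \<in> carrier (loop_group S p)" "Y \<in> carrier (loop_group S p)"
    obtain g where g: "arr S p p g" "X = hc S g" using XY(1) by (rule loop_class_obtain)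
    obtain h where h: "arr S p p h" "Y = hc S h" using XY(2) by (rule loop_class_obtain)
    have "star S X Y = hc S (g +++ h)" using g h by (simp add: arr_iff_okp)
    then show "\<phi> (X \<otimes>\<^bsub>loop_group S p\<^esub> Y) = \<phi> X \<otimes>\<^bsub>fundamental_group (top_of_set S) p\<^esub> \<phi> Y"
      by (simp add: \<phi>[OF arr_join[OF g(1) h(1)]] g(2) h(2) \<phi>[OF g(1)] \<phi>[OF h(1)] loop_class_mult[OF g(1) h(1)] del: hc_join)
  qed
  moreover have "inj_on \<phi> (carrier (loop_group S p))"
  proof (rule inj_onI)
    fix X Y assume XY: "X \<in> carrier (loop_group S p)" "Y \<in> carrier (loop_group S p)" "\<phi> X = \<phi> Y"
    obtain g where g: "arr S p p g" "X = hc S g" using XY(1) by (rule loop_class_obtain)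
    obtain h where h: "arr S p p h" "Y = hc S h" using XY(2) by (rule loop_class_obtain)
    have "loop_class S p g = loop_class S p h" using XY(3) by (simp add: g(2) h(2) \<phi>[OF g(1)] \<phi>[OF h(1)])
    then show "X = Y" unfolding g(2) h(2) loop_class_iff[OF g(1) h(1)] by (rule hc_eqI)
  qed
  moreover have "\<phi> ` carrier (loop_group S p) = carrier (fundamental_group (top_of_set S) p)"
  proof
    show "\<phi> ` carrier (loop_group S p) \<subseteq> carrier (fundamental_group (top_of_set S) p)"
      using calculation(1) by (auto simp: hom_def)
    show "carrier (fundamental_group (top_of_set S) p) \<subseteq> \<phi> ` carrier (loop_group S p)"
    proof
      fix A assume "A \<in> carrier (fundamental_group (top_of_set S) p)"
      then obtain u where u: "u \<in> spheroids 1 (top_of_set S) p" "A = spheroid_class 1 (top_of_set S) p u"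
        by (auto simp: homotopy_group_def)
      note d = spheroid_down[OF u(1)]
      have "A = \<phi> (hc S (\<lambda>t. u (emb1 t)))" unfolding u(2) loop_class_of[OF u(1)] \<phi>[OF d] ..
      moreover have "hc S (\<lambda>t. u (emb1 t)) \<in> carrier (loop_group S p)" using d by (simp add: arr_iff_okp)
      ultimately show "A \<in> \<phi> ` carrier (loop_group S p)" by blast
    qed
  qed
  ultimately show ?thesis unfolding is_iso_def iso_def bij_betw_def by blast
qed

subsection \<open>The fundamental group of the complement\<close>

text \<open>With \<open>c = exp L\<close> the factor is deformed to 1 through
  \<open>exp ((1 - s) L)\<close>, which never vanishes.\<close>

lemma winding_number_circle:
  assumes "c \<noteq> 0"
  shows "winding_number (\<lambda>t. c * cis (2 * pi * t)) 0 = 1"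
proof -
  obtain L where L: "c = exp L" using assms by (metis exp_Ln)
  have "homotopic_loops (-{0}) (\<lambda>t. c * cis (2 * pi * t)) (circlepath 0 1)"
    unfolding homotopic_loops
  proof (intro exI conjI)
    let ?h = "\<lambda>(s,t). exp (of_real (1 - s) * L) * cis (2 * pi * t)"
    show "continuous_on ({0..1} \<times> {0..1}) ?h"
      unfolding case_prod_unfold cis_conv_exp by (intro continuous_intros)
    show "?h \<in> {0..1} \<times> {0..1} \<rightarrow> - {0}" by auto
    show "\<forall>x\<in>{0..1}. ?h (0, x) = c * cis (2 * pi * x)" by (simp add: L)
    show "\<forall>x\<in>{0..1}. ?h (1, x) = circlepath 0 1 x" by (simp add: circlepath cis_conv_exp mult_ac)
    show "\<forall>t\<in>{0..1}. pathfinish (?h \<circ> Pair t) = pathstart (?h \<circ> Pair t)" by (simp add: pathfinish_def pathstart_def)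
  qed
  then have "winding_number (\<lambda>t. c * cis (2 * pi * t)) 0 = winding_number (circlepath 0 1) 0"
    by (rule winding_number_homotopic_loops)
  then show ?thesis by (simp add: winding_number_circlepath_centre)
qed

declare One_nat_def [simp]

context arrangement
begin

definition wnum :: "'j \<Rightarrow> (real \<Rightarrow> 'a \<Rightarrow> complex) set \<Rightarrow> complex" where
  "wnum j X = winding_number (f j \<circ> (SOME g. g \<in> X)) 0"

lemma f_path:
  assumes "j \<in> J" "okp M g"
  shows "path (f j \<circ> g)" "0 \<notin> path_image (f j \<circ> g)"
proof -
  show "path (f j \<circ> g)" using assms f_cont
    by (intro path_continuous_image) (auto simp: okp_def intro: continuous_on_subset)
  show "0 \<notin> path_image (f j \<circ> g)"
    using assms M_nz[OF _ assms(1)] by (force simp: okp_def path_image_def)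
qed

lemma wnum_hc:
  assumes "j \<in> J" "okp M g"
  shows "wnum j (hc M g) = winding_number (f j \<circ> g) 0"
proof -
  have "homotopic_paths (-{0}) (f j \<circ> g) (f j \<circ> (SOME h. h \<in> hc M g))"
  proof (rule homotopic_paths_continuous_image[OF hc_some[OF assms(2)]])
    show "continuous_on M (f j)" by (rule continuous_on_subset[OF f_cont[OF assms(1)]]) simp
    show "f j \<in> M \<rightarrow> - {0}" using M_nz assms(1) by auto
  qed
  then show ?thesis unfolding wnum_def by (rule winding_number_homotopic_paths[symmetric])
qed

lemma wnum_star:
  assumes "j \<in> J" "gok M X" "gok M Y" "tgt X = src Y"
  shows "wnum j (star M X Y) = wnum j X + wnum j Y"
proof -
  obtain g where g: "okp M g" "X = hc M g" "tgt X = pathfinish g" using assms(2) by (rule gokE)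
  obtain h where h: "okp M h" "Y = hc M h" "src Y = pathstart h" using assms(3) by (rule gokE)
  have gh: "pathfinish g = pathstart h" using assms(4) g(3) h(3) by simp
  have "wnum j (star M X Y) = winding_number (f j \<circ> (g +++ h)) 0"
    unfolding g(2) h(2) star_hc[OF g(1) h(1) gh] by (rule wnum_hc[OF assms(1) okp_join[OF g(1) h(1) gh]])
  also have "\<dots> = winding_number (f j \<circ> g) 0 + winding_number (f j \<circ> h) 0"
    unfolding path_compose_join by (intro winding_number_join f_path assms(1) g h) (simp add: pathfinish_compose pathstart_compose gh)
  finally show ?thesis unfolding g(2) h(2) wnum_hc[OF assms(1) g(1)] wnum_hc[OF assms(1) h(1)] .
qed

lemma wnum_ginv:
  assumes "j \<in> J" "gok M X"
  shows "wnum j (ginv M X) = - wnum j X"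
proof -
  obtain g where g: "okp M g" "X = hc M g" using assms(2) by (rule gokE)
  have "wnum j (ginv M X) = wnum j (hc M (reversepath g))" using g by simp
  also have "\<dots> = winding_number (f j \<circ> reversepath g) 0" using g by (intro wnum_hc assms(1)) simp
  also have "\<dots> = - winding_number (f j \<circ> g) 0"
    unfolding path_compose_reversepath by (intro winding_number_reversepath f_path assms(1) g)
  finally show ?thesis unfolding g(2) wnum_hc[OF assms(1) g(1)] .
qed

text \<open>For \<open>i\<close> other than \<open>j\<close>, admissibility places the image of the
  circle under \<open>f i\<close> in a disc that misses 0.\<close>

lemma wnum_rot:
  assumes j: "j \<in> J" and i: "i \<in> J" and p: "p \<in> M" and a: "a \<in> Adm j p"
  shows "wnum i (hc M (rot j p a)) = (if i = j then 1 else 0)"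
proof -
  interpret m: meridian V J f j p
    by unfold_locales (use j p M_V M_nz in auto)
  have ok: "okp M (rot j p a)" "pathfinish (rot j p a) = pathstart (rot j p a)"
    using m.rot_arr[OF a] by (simp_all add: arr_iff_okp)
  show ?thesis
  proof (cases "i = j")
    case True
    have "f j \<circ> rot j p a = (\<lambda>t. f j a * cis (2 * pi * t))" by (auto simp: m.fj_rot mult.commute)
    moreover have "f j a \<noteq> 0" using a by (simp add: Adm_def)
    ultimately show ?thesis using True wnum_hc[OF j ok(1)] winding_number_circle by simp
  next
    case False
    have "cmod (zc j p a * f i p) < cmod (f i (hz j p a))" using a i False by (auto simp: Adm_def)
    then have im: "path_image (f i \<circ> rot j p a) \<subseteq> ball (f i (hz j p a)) (cmod (f i (hz j p a)))"
      by (auto simp: path_image_def m.f_rot[OF i] dist_norm norm_mult)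
    have "winding_number (f i \<circ> rot j p a) 0 = 0"
      by (rule winding_number_zero_outside[OF f_path(1)[OF i ok(1)] convex_ball _ _ im])
         (use ok(2) in \<open>auto simp: pathfinish_compose pathstart_compose\<close>)
    then show ?thesis using False wnum_hc[OF i ok(1)] by simp
  qed
qed

end

context based
begin

text \<open>A point of the hyperplane on no other one is displaced by a small multiple of
  \<open>p\<close>. The complex line through the result and \<open>p\<close> meets the arrangement
  in finitely many points, which a path in that line can avoid.\<close>

lemma Adm_exists:
  assumes j: "j \<in> J"
  obtains a g where "a \<in> Adm j p" "arr M p a g"
proof -
  interpret m: meridian V J f j p by (rule meridian[OF j])
  have "\<exists>u\<in>{u \<in> V. f j u = 0}. \<forall>l\<in>J-{j}. f l u \<noteq> 0"
  proof (rule generic_point)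
    show "{u \<in> V. f j u = 0} \<noteq> {}" using zero_closed f_zero[OF j] by blast
    show "\<exists>u\<in>{u \<in> V. f j u = 0}. f l u \<noteq> 0" if "l \<in> J - {j}" for l
      using f_indep[of l j j] that j by auto
  qed (use finite_J j in \<open>auto intro: lin_closed\<close>)
  then obtain h where h: "h \<in> V" "f j h = 0" "\<And>l. l \<in> J - {j} \<Longrightarrow> f l h \<noteq> 0" by blast
  define \<delta> where "\<delta> = Min (insert 1 ((\<lambda>l. cmod (f l h)) ` (J-{j})))"
  have \<delta>: "\<delta> > 0" "\<And>l. l \<in> J - {j} \<Longrightarrow> \<delta> \<le> cmod (f l h)"
    unfolding \<delta>_def using finite_J h(3) by auto
  have "\<exists>r>0. \<forall>l\<in>J. \<forall>z. cmod z < r \<longrightarrow> cmod (z * f l p) < \<delta>"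
    by (rule small_scalar[OF finite_J \<delta>(1)])
  then obtain r where r: "r > 0" "\<And>l z. l \<in> J \<Longrightarrow> cmod z < r \<Longrightarrow> cmod (z * f l p) < \<delta>" by blast
  define z where "z = complex_of_real (r/2)"
  have z: "z \<noteq> 0" "cmod z < r" using r(1) by (auto simp: z_def)
  define a where "a = lin h z p"
  have za: "zc j p a = z" using h(2) fp[OF j] j by (simp add: a_def zc_def)
  have ha: "hz j p a = h" unfolding hz_def za by (simp add: a_def)
  have aV: "a \<in> V" unfolding a_def by (rule lin_closed[OF h(1) pV])
  have fa: "f j a \<noteq> 0" using h(2) fp[OF j] j z(1) by (simp add: a_def)
  have "cmod (z * f l p) < cmod (f l h)" if "l \<in> J - {j}" for l
    using r(2)[of l z] \<delta>(2)[OF that] z(2) that by simp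
  then have aA: "a \<in> Adm j p" unfolding Adm_def mem_Collect_eq za ha using aV fa by blast
  have aM: "a \<in> M" using m.Adm_M[OF aA] .
  define d where "d = lin a (-1) p"
  have ad: "lin p 1 d = a" by (auto simp: d_def lin_def)
  have dV: "d \<in> V" unfolding d_def by (rule lin_closed[OF aV pV])
  \<comment> \<open>A form with \<open>f l d = 0\<close> puts the value 0 into \<open>?B\<close>
    through division by 0. The parameters 0 and 1 belong to \<open>p\<close> and \<open>a\<close>,
    which lie in \<open>M\<close>, and are taken out again below.\<close>
  let ?B = "(\<lambda>l. - f l p / f l d) ` J"
  have mem: "lin p \<tau> d \<in> M" if nb: "\<tau> \<notin> ?B - {0,1}" for \<tau>
  proof -
    consider "\<tau> = 0" | "\<tau> = 1" | "\<tau> \<notin> ?B" using nb by blast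
    then show ?thesis
    proof cases
      case 3
      have "f l p + \<tau> * f l d \<noteq> 0" if l: "l \<in> J" for l
      proof
        assume e: "f l p + \<tau> * f l d = 0"
        then have "f l d \<noteq> 0" using fp[OF l] by auto
        then have "\<tau> = - f l p / f l d" using e by (simp add: eq_divide_eq add_eq_0_iff2)
        then show False using 3 l by blast
      qed
      then show ?thesis using lin_closed[OF pV dV] by (simp add: M_def)
    qed (use pM aM ad in simp_all)
  qed
  have pc: "path_connected (- (?B - {0,1}))"
    by (rule path_connected_complement_countable) (use finite_J in \<open>auto simp: countable_finite\<close>)
  have m01: "0 \<in> - (?B - {0,1})" "1 \<in> - (?B - {0,1})" by auto
  have "\<exists>c. path c \<and> path_image c \<subseteq> - (?B - {0,1}) \<and> pathstart c = 0 \<and> pathfinish c = 1"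
    by (rule bspec[OF bspec[OF pc[unfolded path_connected_def] m01(1)] m01(2)])
  then obtain c where c: "path c" "path_image c \<subseteq> - (?B - {0,1})" "pathstart c = 0" "pathfinish c = 1"
    by (elim exE conjE)
  have c01: "c 0 = 0" "c 1 = 1" using c(3,4) by (simp_all add: pathstart_def pathfinish_def)
  have cm: "lin p (c t) d \<in> M" if "t \<in> {0..1}" for t
  proof (rule mem)
    have "c t \<in> path_image c" unfolding path_image_def using that by (rule imageI)
    then show "c t \<notin> ?B - {0,1}" using c(2) by blast
  qed
  have "arr M p a (\<lambda>t. lin p (c t) d)"
    using lin_arr[OF c(1), of p d M, OF cm] by (simp add: c01 ad)
  with aA show ?thesis by (rule that)
qed

text \<open>\<open>rot_transport\<close> along the path back over \<open>g\<close> and out over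
  \<open>h\<close> makes base point and tail irrelevant.\<close>

lemma Mer_unique:
  assumes j: "j \<in> J" and a: "a \<in> Adm j p" "arr M p a g" and b: "b \<in> Adm j p" "arr M p b h"
  shows "star M (hc M g) (star M (hc M (rot j p a)) (ginv M (hc M g))) =
     star M (hc M h) (star M (hc M (rot j p b)) (ginv M (hc M h)))"
proof -
  interpret m: meridian V J f j p by (rule meridian[OF j])
  note o = a(2) b(2) m.rot_arr[OF a(1)] m.rot_arr[OF b(1)]
  note o' = o[unfolded arr_iff_okp]
  let ?G = "hc M g" and ?H = "hc M h" and ?A = "hc M (rot j p a)" and ?B = "hc M (rot j p b)"
  have "Tr M (reversepath g +++ h) (rot j p a) (rot j p b)"
    by (rule m.rot_transport[OF a(1) b(1) arr_join[OF arr_rev[OF a(2)] b(2)]])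
  then have "star M ?A (hc M (reversepath g +++ h)) = star M (hc M (reversepath g +++ h)) ?B"
    using o' by (subst (asm) Tr_iff) simp_all
  then have "star M ?A (star M (ginv M ?G) ?H) = star M (ginv M ?G) (star M ?H ?B)"
    using o' by (simp add: star_assoc)
  then have "star M ?G (star M (star M ?A (star M (ginv M ?G) ?H)) (ginv M ?H)) =
     star M ?G (star M (star M (ginv M ?G) (star M ?H ?B)) (ginv M ?H))" by simp
  then show ?thesis using o' by (simp add: star_assoc)
qed

text \<open>Conjugation by \<open>Y\<close> merely lengthens the tail from \<open>g\<close> to
  \<open>y +++ g\<close>, which \<open>Mer_unique\<close> does not notice.\<close>

lemma Mer_central:
  assumes X: "X \<in> Mer" and Y: "gok M Y" "src Y = p" "tgt Y = p"
  shows "star M X Y = star M Y X"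
proof -
  obtain j a g where j: "j \<in> J" and a: "a \<in> Adm j p" "arr M p a g"
    and Xe: "X = star M (hc M g) (star M (hc M (rot j p a)) (ginv M (hc M g)))"
    using X unfolding Mer_def by blast
  obtain y where y: "okp M y" "Y = hc M y" "src Y = pathstart y" "tgt Y = pathfinish y" using Y(1) by (rule gokE)
  interpret m: meridian V J f j p by (rule meridian[OF j])
  note o' = a(2)[unfolded arr_iff_okp] m.rot_arr[OF a(1), unfolded arr_iff_okp] y(1) y(3,4)[symmetric]
  have ay: "arr M p p y" using y Y by (simp add: arr_iff_okp)
  have ag: "arr M p a (y +++ g)" by (rule arr_join[OF ay a(2)])
  have "X = star M (hc M (y +++ g)) (star M (hc M (rot j p a)) (ginv M (hc M (y +++ g))))"
    unfolding Xe by (rule Mer_unique[OF j a a(1) ag])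
  also have "\<dots> = star M Y (star M X (ginv M Y))"
    unfolding Xe y(2) using o' Y y by (simp add: star_assoc)
  finally have e: "X = star M Y (star M X (ginv M Y))" .
  have Xo: "gok M X" "src X = p" "tgt X = p" using Mer_ok[OF X] by auto
  have "star M X Y = star M (star M Y (star M X (ginv M Y))) Y" using e by simp
  also have "\<dots> = star M Y X" using Xo Y by (simp add: star_assoc)
  finally show ?thesis .
qed

lemma Gen_comm:
  assumes "X \<in> Gen" and Y: "gok M Y" "src Y = p" "tgt Y = p"
  shows "star M X Y = star M Y X"
  using assms(1)
proof induction
  case Gen_one
  then show ?case using Y by simp
next
  case (Gen_mer X)
  then show ?case using Mer_central Y by blast
next
  case (Gen_star X Z)
  note o = Gen_ok[OF Gen_star.hyps(1)] Gen_ok[OF Gen_star.hyps(2)]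
  have "star M (star M X Z) Y = star M X (star M Z Y)" using o Y by (simp add: star_assoc)
  also have "\<dots> = star M (star M X Y) Z" unfolding Gen_star.IH(2) using o Y by (simp add: star_assoc)
  also have "\<dots> = star M Y (star M X Z)" unfolding Gen_star.IH(1) using o Y by (simp add: star_assoc)
  finally show ?case .
next
  case (Gen_inv X)
  note o = Gen_ok[OF Gen_inv.hyps]
  have "star M X (star M (ginv M X) Y) = Y" using o Y by simp
  also have "\<dots> = star M (star M Y X) (ginv M X)" using o Y by (simp add: star_assoc)
  also have "\<dots> = star M X (star M Y (ginv M X))" unfolding Gen_inv.IH[symmetric] using o Y by (simp add: star_assoc)
  finally show ?case by (rule star_left_cancel[rotated 5]) (use o Y in simp_all)
qed

theorem loop_group_free: "loop_group M p \<cong> free_Abelian_group J"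
proof -
  let ?L = "loop_group M p" and ?F = "free_Abelian_group J"
  interpret L: group ?L by (rule group_loop_group[OF pM])
  have car: "carrier ?L \<subseteq> Gen"
  proof
    fix X assume "X \<in> carrier ?L"
    then obtain g where "arr M p p g" "X = hc M g" by (rule loop_class_obtain)
    then show "X \<in> Gen" using Gen_all by simp
  qed
  have "comm_group ?L"
  proof (rule L.group_comm_groupI)
    fix X Y assume "X \<in> carrier ?L" "Y \<in> carrier ?L"
    then show "X \<otimes>\<^bsub>?L\<^esub> Y = Y \<otimes>\<^bsub>?L\<^esub> X" using Gen_comm[of X Y] car by auto
  qed
  then interpret L: comm_group ?L .
  have "\<exists>X. X \<in> Mer \<and> (\<forall>i\<in>J. wnum i X = (if i = j then 1 else 0)) \<and>
      (\<forall>a g. a \<in> Adm j p \<longrightarrow> arr M p a g \<longrightarrow> star M (hc M g) (star M (hc M (rot j p a)) (ginv M (hc M g))) = X)"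
    if j: "j \<in> J" for j
  proof -
    obtain a g where a: "a \<in> Adm j p" "arr M p a g" by (rule Adm_exists[OF j])
    interpret m: meridian V J f j p by (rule meridian[OF j])
    note o = a(2)[unfolded arr_iff_okp] m.rot_arr[OF a(1), unfolded arr_iff_okp]
    let ?X = "star M (hc M g) (star M (hc M (rot j p a)) (ginv M (hc M g)))"
    have "wnum i ?X = (if i = j then 1 else 0)" if i: "i \<in> J" for i
      using o wnum_rot[OF j i pM a(1)] by (simp add: wnum_star[OF i] wnum_ginv[OF i])
    moreover have "?X \<in> Mer" unfolding Mer_def using j a by blast
    ultimately show ?thesis using Mer_unique[OF j _ _ a] by blast
  qed
  then obtain X where X: "\<And>j. j \<in> J \<Longrightarrow> X j \<in> Mer" "\<And>j i. j \<in> J \<Longrightarrow> i \<in> J \<Longrightarrow> wnum i (X j) = (if i = j then 1 else 0)"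
    "\<And>j a g. j \<in> J \<Longrightarrow> a \<in> Adm j p \<Longrightarrow> arr M p a g \<Longrightarrow> star M (hc M g) (star M (hc M (rot j p a)) (ginv M (hc M g))) = X j"
    by metis
  have XL: "X ` J \<subseteq> carrier ?L" using X(1) Mer_ok by auto
  obtain h where h: "h \<in> hom ?F ?L" "\<And>j. j \<in> J \<Longrightarrow> h (frag_of j) = X j"
    using L.free_Abelian_group_universal[OF XL] by blast
  interpret F: group ?F by simp
  interpret h: group_hom ?F ?L h by unfold_locales (rule h(1))
  have hL: "gok M (h c) \<and> src (h c) = p \<and> tgt (h c) = p" if "Poly_Mapping.keys c \<subseteq> J" for c
    using h.hom_closed[of c] that by simp
  \<comment> \<open>Differences are the inductive step of
    \<open>free_Abelian_group_induct\<close>.\<close>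
  have hdiff: "h (x - y) = star M (h x) (ginv M (h y))" if "Poly_Mapping.keys x \<subseteq> J" "Poly_Mapping.keys y \<subseteq> J" for x y
  proof -
    have c: "x \<in> carrier ?F" "y \<in> carrier ?F" using that by simp_all
    have "h (x - y) = h (x \<otimes>\<^bsub>?F\<^esub> inv\<^bsub>?F\<^esub> y)" using that by simp
    also have "\<dots> = h x \<otimes>\<^bsub>?L\<^esub> h (inv\<^bsub>?F\<^esub> y)" by (rule h.hom_mult[OF c(1) F.inv_closed[OF c(2)]])
    also have "h (inv\<^bsub>?F\<^esub> y) = inv\<^bsub>?L\<^esub> (h y)" by (rule h.hom_inv[OF c(2)])
    finally have "h (x - y) = h x \<otimes>\<^bsub>?L\<^esub> inv\<^bsub>?L\<^esub> (h y)" .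
    then show ?thesis using inv_loop_group[OF pM, of "h y"] hL[OF that(2)] by simp
  qed
  \<comment> \<open>The winding numbers read off the coefficients of a formal sum; this is the
    injectivity of \<open>h\<close>.\<close>
  have wh: "wnum i (h c) = of_int (poly_mapping.lookup c i)" if i: "i \<in> J" and c: "Poly_Mapping.keys c \<subseteq> J" for i c
  proof (rule free_Abelian_group_induct[OF c])
    have "h 0 = gone M p" using h.hom_one by simp
    moreover have "wnum i (star M (gone M p) (gone M p)) = wnum i (gone M p) + wnum i (gone M p)"
      by (rule wnum_star[OF i]) (simp_all add: pM)
    ultimately show "wnum i (h 0) = of_int (poly_mapping.lookup 0 i)" using pM by simp
  next
    fix x y :: "'j \<Rightarrow>\<^sub>0 int"
    assume xy: "Poly_Mapping.keys x \<subseteq> J" "Poly_Mapping.keys y \<subseteq> J"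
      "wnum i (h x) = of_int (poly_mapping.lookup x i)" "wnum i (h y) = of_int (poly_mapping.lookup y i)"
    then show "wnum i (h (x - y)) = of_int (poly_mapping.lookup (x - y) i)"
      using hL[OF xy(1)] hL[OF xy(2)] by (simp add: hdiff wnum_star[OF i] wnum_ginv[OF i] lookup_minus)
  next
    fix j assume "j \<in> J"
    then show "wnum i (h (frag_of j)) = of_int (poly_mapping.lookup (frag_of j) i)"
      using X(2)[of j i] i h(2)[of j] by (simp add: lookup_frag_of)
  qed
  have "inj_on h (carrier ?F)"
  proof (rule inj_onI)
    fix c d assume cd: "c \<in> carrier ?F" "d \<in> carrier ?F" "h c = h d"
    have "poly_mapping.lookup c i = poly_mapping.lookup d i" for i
    proof (cases "i \<in> J")
      case True
      have "complex_of_int (poly_mapping.lookup c i) = of_int (poly_mapping.lookup d i)"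
        using wh[OF True, of c] wh[OF True, of d] cd by simp
      then show ?thesis by simp
    next
      case False
      then have "i \<notin> Poly_Mapping.keys c" "i \<notin> Poly_Mapping.keys d" using cd by auto
      then show ?thesis by (simp add: in_keys_iff)
    qed
    then show "c = d" by (rule poly_mapping_eqI)
  qed
  moreover have "h ` carrier ?F = carrier ?L"
  proof
    show "h ` carrier ?F \<subseteq> carrier ?L" using h.hom_closed by blast
    have "Y \<in> h ` carrier ?F" if "Y \<in> Gen" for Y
      using that
    proof induction
      case Gen_one
      have "h 0 = gone M p" using h.hom_one by simp
      then show ?case by (metis F.one_closed image_eqI one_free_Abelian_group)
    next
      case (Gen_mer Y)
      then obtain j a g where j: "j \<in> J" and a: "a \<in> Adm j p" "arr M p a g"
        and Y: "Y = star M (hc M g) (star M (hc M (rot j p a)) (ginv M (hc M g)))"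
        unfolding Mer_def by blast
      have "Y = h (frag_of j)" unfolding Y X(3)[OF j a] h(2)[OF j] ..
      then show ?case using j by (intro image_eqI[of _ h "frag_of j"]) auto
    next
      case (Gen_star Y Z)
      then obtain c d where cd: "c \<in> carrier ?F" "d \<in> carrier ?F" "Y = h c" "Z = h d" by blast
      have "star M Y Z = h (c \<otimes>\<^bsub>?F\<^esub> d)" using h.hom_mult[OF cd(1,2)] cd(3,4) by simp
      then show ?case using imageI[OF F.m_closed[OF cd(1,2)], of h] by (simp only:)
    next
      case (Gen_inv Y)
      then obtain c where c: "c \<in> carrier ?F" "Y = h c" by blast
      have "h (0 - c) = star M (h 0) (ginv M (h c))" using c(1) by (intro hdiff) auto
      moreover have "h 0 = gone M p" using h.hom_one by simp
      ultimately have "ginv M Y = h (- c)" using c hL[of c] by simp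
      then show ?case using c by (intro image_eqI[of _ h "- c"]) auto
    qed
    then show "carrier ?L \<subseteq> h ` carrier ?F" using car by blast
  qed
  ultimately have "?F \<cong> ?L" unfolding is_iso_def iso_def bij_betw_def using h(1) by blast
  then show ?thesis by (rule F.iso_sym)
qed

theorem fundamental_group_free: "fundamental_group (top_of_set M) p \<cong> free_Abelian_group J"
  using group.iso_sym[OF group_loop_group[OF pM] loop_group_iso[OF pM]] loop_group_free by (rule iso_trans)

end

section \<open>The Specht module of a hook\<close>

subsection \<open>Alternating sums\<close>

text \<open>The determinant of the matrix with entry \<open>m p i\<close> in row \<open>p\<close>
  and column \<open>i\<close>, both numbered from 0 to \<open>k\<close>.\<close>

definition alt_sum :: "nat \<Rightarrow> (nat \<Rightarrow> nat \<Rightarrow> complex) \<Rightarrow> complex" where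
  "alt_sum k m = (\<Sum>\<pi> | \<pi> permutes {..k}. of_int (sign \<pi>) * (\<Prod>i\<le>k. m (\<pi> i) i))"

lemma permutation_of_permutes: "\<pi> permutes {..k::nat} \<Longrightarrow> permutation \<pi>"
  by (rule permutation_permutes[THEN iffD2]) (auto intro: exI[of _ "{..k}"])

text \<open>Composition with the transposition permutes the summands and reverses every sign, so the
  sum equals its negative.\<close>

lemma alternating_sum_zero:
  fixes g :: "(nat \<Rightarrow> nat) \<Rightarrow> complex"
  assumes "j \<le> k" "c \<le> k" "j \<noteq> c" and g: "\<And>\<pi>. \<pi> permutes {..k} \<Longrightarrow> g (\<pi> \<circ> Transposition.transpose j c) = g \<pi>"
  shows "(\<Sum>\<pi> | \<pi> permutes {..k}. of_int (sign \<pi>) * g \<pi>) = 0"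
proof -
  let ?t = "Transposition.transpose j c"
  have t: "?t permutes {..k}" using assms by (intro permutes_swap_id) auto
  have "(\<Sum>\<pi> | \<pi> permutes {..k}. of_int (sign \<pi>) * g \<pi>) = (\<Sum>\<pi> | \<pi> permutes {..k}. of_int (sign (\<pi> \<circ> ?t)) * g (\<pi> \<circ> ?t))"
    by (rule sum_permutations_compose_right[OF t])
  also have "\<dots> = (\<Sum>\<pi> | \<pi> permutes {..k}. - (of_int (sign \<pi>) * g \<pi>))"
  proof (rule sum.cong[OF refl])
    fix \<pi> assume "\<pi> \<in> {\<pi>. \<pi> permutes {..k}}"
    then have \<pi>: "\<pi> permutes {..k}" by simp
    have "sign (\<pi> \<circ> ?t) = - sign \<pi>"
      using sign_compose[OF permutation_of_permutes[OF \<pi>] permutation_swap_id[of j c]] assms(3) by (simp add: sign_swap_id)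
    then show "of_int (sign (\<pi> \<circ> ?t)) * g (\<pi> \<circ> ?t) = - (of_int (sign \<pi>) * g \<pi> :: complex)" using g[OF \<pi>] by simp
  qed
  finally show ?thesis by (simp add: sum_negf)
qed

lemma alt_sum_compose:
  assumes t: "\<tau> permutes {..k}"
  shows "alt_sum k (\<lambda>i. m (\<tau> i)) = of_int (sign \<tau>) * alt_sum k m"
proof -
  have "alt_sum k (\<lambda>i. m (\<tau> i)) = (\<Sum>\<pi> | \<pi> permutes {..k}. of_int (sign \<tau>) * (of_int (sign (\<tau> \<circ> \<pi>)) * (\<Prod>i\<le>k. m ((\<tau> \<circ> \<pi>) i) i)))"
    unfolding alt_sum_def
  proof (rule sum.cong[OF refl])
    fix \<pi> assume "\<pi> \<in> {\<pi>. \<pi> permutes {..k}}"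
    then have "sign (\<tau> \<circ> \<pi>) = sign \<tau> * sign \<pi>"
      using t by (intro sign_compose permutation_of_permutes) auto
    then have "sign \<tau> * sign (\<tau> \<circ> \<pi>) = sign \<pi>" by (simp add: mult.assoc[symmetric])
    then have "complex_of_int (sign \<pi>) = of_int (sign \<tau>) * of_int (sign (\<tau> \<circ> \<pi>))" by (metis of_int_mult)
    then show "of_int (sign \<pi>) * (\<Prod>i\<le>k. m (\<tau> (\<pi> i)) i) = of_int (sign \<tau>) * (of_int (sign (\<tau> \<circ> \<pi>)) * (\<Prod>i\<le>k. m ((\<tau> \<circ> \<pi>) i) i))"
      by (simp add: mult.assoc)
  qed
  also have "\<dots> = of_int (sign \<tau>) * (\<Sum>\<pi> | \<pi> permutes {..k}. of_int (sign (\<tau> \<circ> \<pi>)) * (\<Prod>i\<le>k. m ((\<tau> \<circ> \<pi>) i) i))"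
    by (simp add: sum_distrib_left)
  also have "(\<Sum>\<pi> | \<pi> permutes {..k}. of_int (sign (\<tau> \<circ> \<pi>)) * (\<Prod>i\<le>k. m ((\<tau> \<circ> \<pi>) i) i)) = alt_sum k m"
    unfolding alt_sum_def by (rule setum_permutations_compose_left[OF t, symmetric])
  finally show ?thesis .
qed

text \<open>Replacing the rows one at a time by \<open>y\<close> amounts to weighting the columns by \<open>y\<close>; replacing a column by the all-one
  column, the sum of all columns, does not change the alternating sum.\<close>

lemma alt_sum_replace_rows:
  assumes rows: "\<And>i. i \<le> k \<Longrightarrow> (\<Sum>c\<le>k. m i c) = 1" and y: "(\<Sum>c\<le>k. y c) = 1"
  shows "(\<Sum>p\<le>k. alt_sum k (m(p := y))) = alt_sum k m"
proof -
  \<comment> \<open>The determinant after column \<open>j\<close> has been replaced by ones.\<close>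
  define A where "A j = (\<Sum>\<pi> | \<pi> permutes {..k}. of_int (sign \<pi>) * (\<Prod>i\<in>{..k}-{j}. m (\<pi> i) i))" for j
  have prod_split: "(\<Prod>i\<le>k. h i) = h j * (\<Prod>i\<in>{..k}-{j}. h i)" if "j \<le> k" for h :: "nat \<Rightarrow> complex" and j
    using that by (simp add: prod.remove)
  have "(\<Sum>p\<le>k. alt_sum k (m(p := y))) = (\<Sum>\<pi> | \<pi> permutes {..k}. \<Sum>p\<le>k. of_int (sign \<pi>) * (\<Prod>i\<le>k. (m(p := y)) (\<pi> i) i))"
    unfolding alt_sum_def by (rule sum.swap)
  also have "\<dots> = (\<Sum>\<pi> | \<pi> permutes {..k}. \<Sum>j\<le>k. of_int (sign \<pi>) * (y j * (\<Prod>i\<in>{..k}-{j}. m (\<pi> i) i)))"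
  proof (rule sum.cong[OF refl])
    fix \<pi> assume "\<pi> \<in> {\<pi>. \<pi> permutes {..k}}"
    then have \<pi>: "\<pi> permutes {..k}" by simp
    \<comment> \<open>The replaced row is renamed \<open>p = \<pi> j\<close>, so that the product
      takes it in column \<open>j\<close>.\<close>
    have "(\<Sum>p\<le>k. of_int (sign \<pi>) * (\<Prod>i\<le>k. (m(p := y)) (\<pi> i) i)) = (\<Sum>j\<le>k. of_int (sign \<pi>) * (\<Prod>i\<le>k. (m(\<pi> j := y)) (\<pi> i) i))"
      using sum.permute[OF \<pi>, of "\<lambda>p. of_int (sign \<pi>) * (\<Prod>i\<le>k. (m(p := y)) (\<pi> i) i) :: complex"] by (simp add: o_def)
    also have "\<dots> = (\<Sum>j\<le>k. of_int (sign \<pi>) * (y j * (\<Prod>i\<in>{..k}-{j}. m (\<pi> i) i)))"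
    proof (rule sum.cong[OF refl])
      fix j assume j: "j \<in> {..k}"
      have "(\<Prod>i\<in>{..k}-{j}. (m(\<pi> j := y)) (\<pi> i) i) = (\<Prod>i\<in>{..k}-{j}. m (\<pi> i) i)"
        by (rule prod.cong[OF refl]) (use permutes_inj[OF \<pi>] in \<open>auto simp: inj_eq\<close>)
      then show "of_int (sign \<pi>) * (\<Prod>i\<le>k. (m(\<pi> j := y)) (\<pi> i) i) = of_int (sign \<pi>) * (y j * (\<Prod>i\<in>{..k}-{j}. m (\<pi> i) i))"
        using prod_split[of j "\<lambda>i. (m(\<pi> j := y)) (\<pi> i) i"] j by simp
    qed
    finally show "(\<Sum>p\<le>k. of_int (sign \<pi>) * (\<Prod>i\<le>k. (m(p := y)) (\<pi> i) i)) = (\<Sum>j\<le>k. of_int (sign \<pi>) * (y j * (\<Prod>i\<in>{..k}-{j}. m (\<pi> i) i)))" .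
  qed
  also have "\<dots> = (\<Sum>j\<le>k. y j * A j)"
    unfolding A_def sum_distrib_left by (subst sum.swap) (simp add: mult.left_commute)
  also have "\<dots> = (\<Sum>j\<le>k. y j * alt_sum k m)"
  proof (rule sum.cong[OF refl])
    fix j assume "j \<in> {..k}"
    then have j: "j \<le> k" by simp
    have "A j = (\<Sum>\<pi> | \<pi> permutes {..k}. \<Sum>c\<le>k. of_int (sign \<pi>) * (m (\<pi> j) c * (\<Prod>i\<in>{..k}-{j}. m (\<pi> i) i)))"
      unfolding A_def
    proof (rule sum.cong[OF refl])
      fix \<pi> assume "\<pi> \<in> {\<pi>. \<pi> permutes {..k}}"
      then have "\<pi> j \<le> k" using j permutes_in_image[of \<pi> "{..k}" j] by auto
      then have "of_int (sign \<pi>) * (\<Prod>i\<in>{..k}-{j}. m (\<pi> i) i) = (\<Sum>c\<le>k. m (\<pi> j) c) * (of_int (sign \<pi>) * (\<Prod>i\<in>{..k}-{j}. m (\<pi> i) i))"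
        by (simp add: rows)
      also have "\<dots> = (\<Sum>c\<le>k. of_int (sign \<pi>) * (m (\<pi> j) c * (\<Prod>i\<in>{..k}-{j}. m (\<pi> i) i)))"
        unfolding sum_distrib_right by (rule sum.cong[OF refl]) (rule mult.left_commute)
      finally show "of_int (sign \<pi>) * (\<Prod>i\<in>{..k}-{j}. m (\<pi> i) i) = (\<Sum>c\<le>k. of_int (sign \<pi>) * (m (\<pi> j) c * (\<Prod>i\<in>{..k}-{j}. m (\<pi> i) i)))" .
    qed
    also have "\<dots> = (\<Sum>c\<le>k. \<Sum>\<pi> | \<pi> permutes {..k}. of_int (sign \<pi>) * (m (\<pi> j) c * (\<Prod>i\<in>{..k}-{j}. m (\<pi> i) i)))"
      by (rule sum.swap)
    also have "\<dots> = (\<Sum>\<pi> | \<pi> permutes {..k}. of_int (sign \<pi>) * (m (\<pi> j) j * (\<Prod>i\<in>{..k}-{j}. m (\<pi> i) i)))"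
    proof -
      \<comment> \<open>For \<open>c\<close> other than \<open>j\<close> the column \<open>c\<close>
        occurs twice in this determinant.\<close>
      have "(\<Sum>\<pi> | \<pi> permutes {..k}. of_int (sign \<pi>) * (m (\<pi> j) c * (\<Prod>i\<in>{..k}-{j}. m (\<pi> i) i))) = 0" if c: "c \<in> {..k} - {j}" for c
      proof (rule alternating_sum_zero[of j k c])
        fix \<pi> assume \<pi>: "\<pi> permutes {..k}"
        let ?t = "Transposition.transpose j c"
        have s: "(\<Prod>i\<in>{..k}-{j}. h i) = h c * (\<Prod>i\<in>{..k}-{j}-{c}. h i)" for h :: "nat \<Rightarrow> complex"
          using c by (intro prod.remove) auto
        have "(\<Prod>i\<in>{..k}-{j}-{c}. m ((\<pi> \<circ> ?t) i) i) = (\<Prod>i\<in>{..k}-{j}-{c}. m (\<pi> i) i)"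
          by (rule prod.cong[OF refl]) (auto simp: transpose_apply_other)
        then show "m ((\<pi> \<circ> ?t) j) c * (\<Prod>i\<in>{..k}-{j}. m ((\<pi> \<circ> ?t) i) i) = m (\<pi> j) c * (\<Prod>i\<in>{..k}-{j}. m (\<pi> i) i)"
          unfolding s[of "\<lambda>i. m ((\<pi> \<circ> ?t) i) i"] s[of "\<lambda>i. m (\<pi> i) i"] by simp
      qed (use j c in auto)
      then show ?thesis using j by (subst sum.remove[of _ j]) auto
    qed
    also have "\<dots> = alt_sum k m"
      unfolding alt_sum_def using prod_split[OF j, of "\<lambda>i. m (\<pi> i) i" for \<pi>] by simp
    finally show "y j * A j = y j * alt_sum k m" by simp
  qed
  also have "\<dots> = alt_sum k m" using y by (simp add: sum_distrib_right[symmetric])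
  finally show ?thesis .
qed

subsection \<open>Polytabloids of hook shape\<close>

locale hook =
  fixes n k :: nat
  assumes k1: "1 < k" and kn: "k < n"
begin

text \<open>The tabloids of hook shape: every row below the top one has a single cell, and the top
  row takes the remaining entries.\<close>

definition TB :: "(nat \<Rightarrow> nat) set" where
  "TB = {r \<in> {1..n} \<rightarrow>\<^sub>E {..k}. \<forall>i\<in>{1..k}. \<exists>!x. x \<in> {1..n} \<and> r x = i}"

text \<open>The polytabloid of any tableau with first column \<open>a\<close>
  (\<open>polytabloid_hook\<close>). The coefficient of \<open>r\<close> is the determinant of the
  incidence matrix between column entries and rows. Only the values of \<open>a\<close> on
  \<open>{..k}\<close> count (\<open>PT_cong\<close>).\<close>

definition PT :: "(nat \<Rightarrow> nat) \<Rightarrow> tabloid_vector" where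
  "PT a r = (if r \<in> TB then alt_sum k (\<lambda>p i. if r (a p) = i then 1 else 0) else 0)"

definition columns :: "(nat \<Rightarrow> nat) set" where
  "columns = {a. inj_on a {..k} \<and> a ` {..k} \<subseteq> {1..n}}"

lemma finite_TB: "finite TB"
  unfolding TB_def by (rule finite_subset[of _ "{1..n} \<rightarrow>\<^sub>E {..k}"]) (auto intro: finite_PiE)

lemma PT_cong:
  assumes "\<And>i. i \<le> k \<Longrightarrow> a i = b i"
  shows "PT a = PT b"
proof
  fix r
  have "alt_sum k (\<lambda>p i. if r (a p) = i then 1 else 0) = alt_sum k (\<lambda>p i. if r (b p) = i then 1 else 0)"
    unfolding alt_sum_def
  proof (rule sum.cong[OF refl])
    fix \<pi> assume "\<pi> \<in> {\<pi>. \<pi> permutes {..k}}"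
    then have "\<pi> i \<le> k" if "i \<le> k" for i using that permutes_in_image[of \<pi> "{..k}" i] by auto
    then show "of_int (sign \<pi>) * (\<Prod>i\<le>k. if r (a (\<pi> i)) = i then 1 else 0) = of_int (sign \<pi>) * (\<Prod>i\<le>k. if r (b (\<pi> i)) = i then 1 else (0::complex))"
      using assms by (intro arg_cong2[of _ _ _ _ "(*)"] prod.cong) auto
  qed
  then show "PT a r = PT b r" by (simp add: PT_def)
qed

lemma PT_compose: "\<tau> permutes {..k} \<Longrightarrow> PT (a \<circ> \<tau>) = lin (\<lambda>_. 0) (of_int (sign \<tau>)) (PT a)"
  using alt_sum_compose[of \<tau> k "\<lambda>p i. if r (a p) = i then 1 else 0" for r] by (auto simp: PT_def lin_def)

lemma PT_transpose:
  assumes "i \<le> k" "j \<le> k" "i \<noteq> j"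
  shows "PT (a \<circ> Transposition.transpose i j) = lin (\<lambda>_. 0) (-1) (PT a)"
proof -
  have "Transposition.transpose i j permutes {..k}" using assms by (intro permutes_swap_id) auto
  from PT_compose[OF this] show ?thesis using assms(3) by (simp add: sign_swap_id)
qed

lemma TB_row: "r \<in> TB \<Longrightarrow> x \<in> {1..n} \<Longrightarrow> r x \<le> k"
  by (auto simp: TB_def)

lemma TB_I:
  assumes "r \<in> {1..n} \<rightarrow>\<^sub>E {..k}" "\<And>i. i \<in> {1..k} \<Longrightarrow> \<exists>!x. x \<in> {1..n} \<and> r x = i"
  shows "r \<in> TB"
  unfolding TB_def by (intro CollectI conjI ballI assms)

lemma TB_outside: "r \<in> TB \<Longrightarrow> x \<notin> {1..n} \<Longrightarrow> r x = undefined"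
  unfolding TB_def by (drule CollectD, drule conjunct1, rule PiE_arb)

lemma TB_ex1: "r \<in> TB \<Longrightarrow> i \<in> {1..k} \<Longrightarrow> \<exists>!x. x \<in> {1..n} \<and> r x = i"
  unfolding TB_def by (drule CollectD, drule conjunct2, erule bspec)

text \<open>A Garnir relation. Each entry lies in exactly one row of \<open>r\<close>, so all rows
  of the incidence matrix sum to 1, and so does the new row belonging to \<open>x\<close>.\<close>

lemma PT_replace:
  assumes a: "a ` {..k} \<subseteq> {1..n}" and x: "x \<in> {1..n}"
  shows "(\<Sum>i\<le>k. PT (a(i := x)) r) = PT a r"
proof (cases "r \<in> TB")
  case True
  let ?m = "\<lambda>p i. if r (a p) = i then 1 else (0::complex)" and ?y = "\<lambda>i. if r x = i then 1 else (0::complex)"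
  have e: "(\<lambda>p i. if r ((a(q := x)) p) = i then 1 else 0) = ?m(q := ?y)" for q by (auto simp: fun_eq_iff)
  have "(\<Sum>p\<le>k. alt_sum k (?m(p := ?y))) = alt_sum k ?m"
  proof (rule alt_sum_replace_rows)
    show "(\<Sum>c\<le>k. ?m i c) = 1" if "i \<le> k" for i using TB_row[OF True, of "a i"] a that by auto
    show "(\<Sum>c\<le>k. ?y c) = 1" using TB_row[OF True x] by auto
  qed
  then show ?thesis using True unfolding PT_def e by simp
qed (simp add: PT_def)

lemma TB_compose:
  assumes \<sigma>: "\<sigma> permutes {1..n}" and r: "r \<in> TB"
  shows "r \<circ> \<sigma> \<in> TB"
proof -
  have inn: "\<sigma> x \<in> {1..n} \<longleftrightarrow> x \<in> {1..n}" for x by (rule permutes_in_image[OF \<sigma>])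
  have "r \<circ> \<sigma> \<in> {1..n} \<rightarrow>\<^sub>E {..k}"
  proof (rule PiE_I)
    show "(r \<circ> \<sigma>) x \<in> {..k}" if "x \<in> {1..n}" for x using TB_row[OF r inn[THEN iffD2, OF that]] by simp
    show "(r \<circ> \<sigma>) x = undefined" if "x \<notin> {1..n}" for x
      using TB_outside[OF r that] permutes_not_in[OF \<sigma> that] by simp
  qed
  moreover have "\<exists>!x. x \<in> {1..n} \<and> (r \<circ> \<sigma>) x = i" if i: "i \<in> {1..k}" for i
  proof -
    have "\<exists>!x. x \<in> {1..n} \<and> r x = i" by (rule TB_ex1[OF r i])
    then obtain x where x: "x \<in> {1..n} \<and> r x = i" "\<forall>y. y \<in> {1..n} \<and> r y = i \<longrightarrow> y = x" by (elim ex1E)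
    obtain z where z: "x = \<sigma> z" using permutes_surj[OF \<sigma>] by (rule surjE)
    show ?thesis
    proof (rule ex1I[of _ z])
      show "z \<in> {1..n} \<and> (r \<circ> \<sigma>) z = i" using x unfolding z inn by simp
      show "y = z" if "y \<in> {1..n} \<and> (r \<circ> \<sigma>) y = i" for y
      proof -
        have "\<sigma> y \<in> {1..n} \<and> r (\<sigma> y) = i" using that inn[THEN iffD2, of y] by simp
        then have "\<sigma> y = \<sigma> z" using x(2) z by blast
        then show ?thesis by (rule injD[OF permutes_inj[OF \<sigma>]])
      qed
    qed
  qed
  ultimately show ?thesis by (rule TB_I)
qed

lemma TB_unique:
  assumes r: "r \<in> TB" and xy: "x \<in> {1..n}" "y \<in> {1..n}" "r x = r y" "r x \<noteq> 0"
  shows "x = y"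
proof -
  have "r x \<in> {1..k}" using TB_row[OF r xy(1)] xy(4) by simp
  then have "\<exists>!z. z \<in> {1..n} \<and> r z = r x" by (rule TB_ex1[OF r])
  then obtain z where "\<forall>w. w \<in> {1..n} \<and> r w = r x \<longrightarrow> w = z" by (elim ex1E)
  then have "x = z" "y = z" using xy by auto
  then show ?thesis by simp
qed

lemma TB_compose_iff:
  assumes \<sigma>: "\<sigma> permutes {1..n}"
  shows "r \<circ> \<sigma> \<in> TB \<longleftrightarrow> r \<in> TB"
proof
  assume "r \<circ> \<sigma> \<in> TB"
  then have "(r \<circ> \<sigma>) \<circ> inv_into UNIV \<sigma> \<in> TB" by (rule TB_compose[OF permutes_inv[OF \<sigma>]])
  then show "r \<in> TB" by (simp add: comp_assoc permutes_inv_o(1)[OF \<sigma>])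
qed (rule TB_compose[OF \<sigma>])

lemma perm_action_PT: "\<sigma> permutes {1..n} \<Longrightarrow> perm_action \<sigma> (PT a) = PT (\<sigma> \<circ> a)"
  by (auto simp: perm_action_def PT_def TB_compose_iff fun_eq_iff)

lemma hook_nth: "i \<le> k \<Longrightarrow> hook_partition n k ! i = (if i = 0 then n - k else 1)"
  by (auto simp: hook_partition_def nth_Cons split: nat.splits)

lemma hook_diagram: "young_diagram (hook_partition n k) = {(0, j) | j. j < n - k} \<union> {(i, 0) | i. i \<le> k}"
proof -
  have "length (hook_partition n k) = Suc k" by (simp add: hook_partition_def)
  then have "(i, j) \<in> young_diagram (hook_partition n k) \<longleftrightarrow> i \<le> k \<and> j < (if i = 0 then n - k else 1)" for i j
    using hook_nth[of i] by (auto simp: young_diagram_def less_Suc_eq_le)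
  then show ?thesis using kn by (auto split: if_splits)
qed

text \<open>Only the first column has more than one cell, so the column stabilizer is the symmetric
  group on its entries, a copy of that on \<open>{..k}\<close> by way of \<open>a\<close>.\<close>

lemma polytabloid_hook:
  assumes t: "t \<in> tableaux n (hook_partition n k)" and a: "\<And>i. i \<le> k \<Longrightarrow> a i \<in> {1..n} \<and> t (a i) = (i, 0)"
  shows "polytabloid n t = PT a"
proof
  fix r
  let ?Y = "young_diagram (hook_partition n k)" and ?A = "a ` {..k}" and ?tab = "tabloid n t"
  have bij: "bij_betw t {1..n} ?Y" using t by (simp add: tableaux_def)
  have inj: "inj_on t {1..n}" using bij by (rule bij_betw_imp_inj_on)
  have tY: "t x \<in> ?Y" if "x \<in> {1..n}" for x using bij that by (rule bij_betwE[rule_format])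
  have tk: "fst (t x) \<le> k" if "x \<in> {1..n}" for x using tY[OF that] by (auto simp: hook_diagram)
  have A: "?A \<subseteq> {1..n}" using a by auto
  have ainj: "inj_on a {..k}" 
  proof (rule inj_onI)
    fix i j assume "i \<in> {..k}" "j \<in> {..k}" "a i = a j"
    then have "(i, 0) = (j, 0::nat)" using a[THEN conjunct2, of i, symmetric] a[THEN conjunct2, of j] by (simp only: atMost_iff)
    then show "i = j" by simp
  qed
  have col0: "x \<in> ?A" if "x \<in> {1..n}" "snd (t x) = 0" for x
  proof -
    obtain i j where ij: "t x = (i, j)" by fastforce
    have "fst (t x) \<le> k" "t x = (fst (t x), 0)" using tY[OF that(1)] that(2) by (auto simp: hook_diagram ij)
    then have "t x = t (a (fst (t x)))" using a[OF \<open>fst (t x) \<le> k\<close>] by simp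
    then have "x = a (fst (t x))" using inj that(1) a[OF \<open>fst (t x) \<le> k\<close>] by (auto dest: inj_onD)
    then show ?thesis using \<open>fst (t x) \<le> k\<close> by blast
  qed
  have out: "fst (t x) = 0 \<and> snd (t x) \<noteq> 0" if "x \<in> {1..n}" "x \<notin> ?A" for x
    using tY[OF that(1)] col0[OF that(1)] that(2) by (auto simp: hook_diagram)
  have CS: "column_stabilizer n t = {\<sigma>. \<sigma> permutes ?A}"
  proof (intro equalityI subsetI CollectI)
    fix \<sigma> assume "\<sigma> \<in> column_stabilizer n t"
    then have \<sigma>: "\<sigma> permutes {1..n}" "\<And>x. x \<in> {1..n} \<Longrightarrow> snd (t (\<sigma> x)) = snd (t x)" by (auto simp: column_stabilizer_def)
    have "\<sigma> x = x" if x: "x \<in> {1..n} - ?A" for x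
    proof -
      have s: "\<sigma> x \<in> {1..n}" using permutes_in_image[OF \<sigma>(1)] x by blast
      have "snd (t (\<sigma> x)) \<noteq> 0" using out[of x] \<sigma>(2)[of x] x by auto
      then have "fst (t (\<sigma> x)) = 0" using tY[OF s] by (auto simp: hook_diagram)
      then have "t (\<sigma> x) = t x" using out[of x] \<sigma>(2)[of x] x by (auto simp: prod_eq_iff)
      then show ?thesis using inj s x by (auto dest: inj_onD)
    qed
    then show "\<sigma> permutes ?A" by (rule permutes_superset[OF \<sigma>(1)])
  next
    fix \<sigma> assume "\<sigma> \<in> {\<sigma>. \<sigma> permutes ?A}"
    then have \<sigma>: "\<sigma> permutes ?A" by simp
    have "snd (t (\<sigma> x)) = snd (t x)" if "x \<in> {1..n}" for x
    proof (cases "x \<in> ?A")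
      case True
      then have "\<sigma> x \<in> ?A" using permutes_in_image[OF \<sigma>] by blast
      then show ?thesis using True a by auto
    qed (simp add: permutes_not_in[OF \<sigma>])
    then show "\<sigma> \<in> column_stabilizer n t" using permutes_subset[OF \<sigma> A] by (simp add: column_stabilizer_def)
  qed
  have tabA: "?tab (a i) = i" if "i \<le> k" for i using a[OF that] by (simp add: tabloid_def)
  have tab0: "?tab x = 0" if "x \<in> {1..n}" "x \<notin> ?A" for x using out[OF that] that(1) by (simp add: tabloid_def)
  have tabTB: "?tab \<in> TB"
  proof -
    have "?tab \<in> {1..n} \<rightarrow>\<^sub>E {..k}"
      unfolding tabloid_def by (rule restrict_PiE[THEN iffD2]) (use tk in auto)
    moreover have "\<exists>!x. x \<in> {1..n} \<and> ?tab x = i" if i: "i \<in> {1..k}" for i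
    proof (rule ex1I[of _ "a i"])
      show "a i \<in> {1..n} \<and> ?tab (a i) = i" using a tabA i by auto
      show "x = a i" if x: "x \<in> {1..n} \<and> ?tab x = i" for x
      proof -
        have "x \<in> ?A" using tab0[of x] x i by auto
        then show ?thesis using x tabA by auto
      qed
    qed
    ultimately show ?thesis by (rule TB_I)
  qed
  show "polytabloid n t r = PT a r"
  proof (cases "r \<in> TB")
    case False
    have "r \<noteq> ?tab \<circ> inv_into UNIV \<sigma>" if "\<sigma> permutes ?A" for \<sigma>
      using False TB_compose[OF permutes_inv[OF permutes_subset[OF that A]] tabTB] by metis
    then show ?thesis using False by (simp add: polytabloid_def PT_def CS)
  next
    case True
    let ?\<Phi> = "map_permutation {..k} a"
    have ba: "bij_betw a {..k} ?A" using ainj by (rule inj_on_imp_bij_betw)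
    have bij\<Phi>: "bij_betw ?\<Phi> {\<pi>. \<pi> permutes {..k}} {\<sigma>. \<sigma> permutes ?A}"
    proof (rule bij_betw_byWitness[where f' = "map_permutation ?A (inv_into {..k} a)"])
      show "\<forall>\<pi>\<in>{\<pi>. \<pi> permutes {..k}}. map_permutation ?A (inv_into {..k} a) (?\<Phi> \<pi>) = \<pi>"
        using ba ainj by (auto intro!: map_permutation_compose_inv)
      show "\<forall>\<sigma>\<in>{\<sigma>. \<sigma> permutes ?A}. ?\<Phi> (map_permutation ?A (inv_into {..k} a) \<sigma>) = \<sigma>"
        using bij_betw_inv_into[OF ba] ainj by (auto intro!: map_permutation_compose_inv simp: f_inv_into_f)
      show "?\<Phi> ` {\<pi>. \<pi> permutes {..k}} \<subseteq> {\<sigma>. \<sigma> permutes ?A}"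
        using map_permutation_permutes[OF ba] by auto
      show "map_permutation ?A (inv_into {..k} a) ` {\<sigma>. \<sigma> permutes ?A} \<subseteq> {\<pi>. \<pi> permutes {..k}}"
        using map_permutation_permutes[OF bij_betw_inv_into[OF ba]] by auto
    qed
    have "polytabloid n t r = (\<Sum>\<pi> | \<pi> permutes {..k}. of_int (sign (?\<Phi> \<pi>)) * (if r = ?tab \<circ> inv_into UNIV (?\<Phi> \<pi>) then 1 else 0))"
      unfolding polytabloid_def CS by (rule sum.reindex_bij_betw[OF bij\<Phi>, symmetric])
    also have "\<dots> = (\<Sum>\<pi> | \<pi> permutes {..k}. of_int (sign \<pi>) * (\<Prod>i\<le>k. if r (a (\<pi> i)) = i then 1 else 0))"
    proof (rule sum.cong[OF refl])
      fix \<pi> assume "\<pi> \<in> {\<pi>. \<pi> permutes {..k}}"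
      then have \<pi>: "\<pi> permutes {..k}" by simp
      define \<sigma> where "\<sigma> = ?\<Phi> \<pi>"
      have \<sigma>: "\<sigma> permutes ?A" using bij\<Phi> \<pi> by (auto simp: \<sigma>_def bij_betw_def)
      have \<sigma>n: "\<sigma> permutes {1..n}" by (rule permutes_subset[OF \<sigma> A])
      have \<sigma>a: "\<sigma> (a i) = a (\<pi> i)" if "i \<le> k" for i
        unfolding \<sigma>_def using map_permutation_apply[OF ainj, of i \<pi>] that by simp
      have "sign \<sigma> = sign \<pi>" unfolding \<sigma>_def using sign_map_permutation[OF ainj \<pi>] by simp
      \<comment> \<open>Agreement on the column entries suffices: they already occupy all rows below
        the top, which forces the other entries of the tabloid \<open>r\<close> into row 0.\<close>
      moreover have "r = ?tab \<circ> inv_into UNIV \<sigma> \<longleftrightarrow> (\<forall>i\<le>k. r (a (\<pi> i)) = i)"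
      proof
        assume r: "r = ?tab \<circ> inv_into UNIV \<sigma>"
        show "\<forall>i\<le>k. r (a (\<pi> i)) = i"
          using tabA by (simp add: r \<sigma>a[symmetric] permutes_inverses(2)[OF \<sigma>n])
      next
        assume R: "\<forall>i\<le>k. r (a (\<pi> i)) = i"
        have "r (\<sigma> z) = ?tab z" for z
        proof -
          consider "z \<in> ?A" | "z \<in> {1..n}" "z \<notin> ?A" | "z \<notin> {1..n}" by blast
          then show ?thesis
          proof cases
            case 1
            then show ?thesis using R \<sigma>a tabA by auto
          next
            case 2
            have "r z = 0"
            proof (rule ccontr)
              assume "r z \<noteq> 0"
              then have i: "r z \<in> {1..k}" using TB_row[OF True 2(1)] by auto
              have "\<pi> (r z) \<le> k" using i permutes_in_image[OF \<pi>, of "r z"] by auto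
              then have "a (\<pi> (r z)) \<in> {1..n}" "a (\<pi> (r z)) \<in> ?A" using a by auto
              moreover have "r (a (\<pi> (r z))) = r z" using R i by auto
              ultimately have "z = a (\<pi> (r z))" using TB_unique[OF True 2(1), of "a (\<pi> (r z))"] \<open>r z \<noteq> 0\<close> by simp
              then show False using 2(2) \<open>a (\<pi> (r z)) \<in> ?A\<close> by simp
            qed
            then show ?thesis using permutes_not_in[OF \<sigma> 2(2)] tab0[OF 2] by simp
          next
            case 3
            then show ?thesis using permutes_not_in[OF \<sigma>n 3] TB_outside[OF True 3] 3
              by (simp add: tabloid_def del: atLeastAtMost_iff)
          qed
        qed
        then have "(r \<circ> \<sigma>) \<circ> inv_into UNIV \<sigma> = ?tab \<circ> inv_into UNIV \<sigma>" 
          by (intro arg_cong[where f = "\<lambda>g. g \<circ> inv_into UNIV \<sigma>"]) (simp add: fun_eq_iff)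
        then show "r = ?tab \<circ> inv_into UNIV \<sigma>" by (simp add: comp_assoc permutes_inv_o(1)[OF \<sigma>n])
      qed
      moreover have "(\<Prod>i\<le>k. if r (a (\<pi> i)) = i then 1 else (0::complex)) = (if \<forall>i\<le>k. r (a (\<pi> i)) = i then 1 else 0)"
        by (auto intro: prod.neutral)
      ultimately show "of_int (sign (?\<Phi> \<pi>)) * (if r = ?tab \<circ> inv_into UNIV (?\<Phi> \<pi>) then 1 else 0) =
          of_int (sign \<pi>) * (\<Prod>i\<le>k. if r (a (\<pi> i)) = i then 1 else (0::complex))"
        unfolding \<sigma>_def by simp
    qed
    finally show ?thesis using True by (simp add: PT_def alt_sum_def)
  qed
qed

lemma card_hook_row: "card {(0::nat, j) | j. 1 \<le> j \<and> j < n - k} = n - k - 1"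
proof -
  have "{(0::nat, j) | j. 1 \<le> j \<and> j < n - k} = Pair 0 ` {1..<n-k}" by auto
  then show ?thesis by (simp add: card_image inj_on_def)
qed

lemma tableau_exists:
  assumes a: "a \<in> columns"
  shows "\<exists>t\<in>tableaux n (hook_partition n k). \<forall>i\<le>k. a i \<in> {1..n} \<and> t (a i) = (i, 0)"
proof -
  let ?A = "a ` {..k}" and ?R = "{(0::nat, j) | j. 1 \<le> j \<and> j < n - k}" and ?Y = "young_diagram (hook_partition n k)"
  have inj: "inj_on a {..k}" and A: "?A \<subseteq> {1..n}" using a by (auto simp: columns_def)
  have cA: "card ?A = Suc k" using inj by (simp add: card_image)
  have "card ({1..n} - ?A) = card ?R"
    unfolding card_hook_row using A cA by (simp add: card_Diff_subset)
  moreover have "finite ?R" by (rule finite_subset[of _ "{0} \<times> {..<n-k}"]) auto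
  ultimately obtain h where h: "bij_betw h ({1..n} - ?A) ?R"
    using finite_same_card_bij[of "{1..n} - ?A" ?R] by auto
  define t where "t x = (if x \<in> ?A then (inv_into {..k} a x, 0) else if x \<in> {1..n} then h x else undefined)" for x
  have ta: "t (a i) = (i, 0)" if "i \<le> k" for i using that inj by (simp add: t_def)
  have b1: "bij_betw t ?A {(i, 0::nat) | i. i \<le> k}"
  proof (rule bij_betw_imageI)
    show "inj_on t ?A" using ta by (auto intro!: inj_onI)
    show "t ` ?A = {(i, 0) | i. i \<le> k}" using ta by force
  qed
  have b2: "bij_betw t ({1..n} - ?A) ?R" using h by (rule bij_betw_cong[THEN iffD1, rotated]) (auto simp: t_def)
  have "bij_betw t (?A \<union> ({1..n} - ?A)) ({(i, 0::nat) | i. i \<le> k} \<union> ?R)"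
    by (rule bij_betw_combine[OF b1 b2]) auto
  moreover have "?A \<union> ({1..n} - ?A) = {1..n}" using A by auto
  moreover have "{(i, 0::nat) | i. i \<le> k} \<union> ?R = ?Y" using kn by (auto simp: hook_diagram)
  ultimately have bt: "bij_betw t {1..n} ?Y" by simp
  have "t \<in> {1..n} \<rightarrow>\<^sub>E ?Y"
  proof (rule PiE_I)
    show "t x \<in> ?Y" if "x \<in> {1..n}" for x using bij_betwE[OF bt] that by blast
    show "t x = undefined" if "x \<notin> {1..n}" for x using that A by (auto simp: t_def)
  qed
  then have "t \<in> tableaux n (hook_partition n k)" using bt by (simp add: tableaux_def)
  then show ?thesis using ta A by blast
qed

lemma specht_hook: "specht_module n (hook_partition n k) = cfun.span (PT ` columns)"
proof -
  have "polytabloid n ` tableaux n (hook_partition n k) = PT ` columns"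
  proof (intro equalityI subsetI)
    fix v assume "v \<in> polytabloid n ` tableaux n (hook_partition n k)"
    then obtain t where t: "t \<in> tableaux n (hook_partition n k)" "v = polytabloid n t" by blast
    have bij: "bij_betw t {1..n} (young_diagram (hook_partition n k))" using t(1) by (simp add: tableaux_def)
    define a where "a i = inv_into {1..n} t (i, 0)" for i
    have a: "a i \<in> {1..n} \<and> t (a i) = (i, 0)" if "i \<le> k" for i
    proof -
      have "(i, 0) \<in> t ` {1..n}" using bij that by (auto simp: bij_betw_def hook_diagram)
      then show ?thesis unfolding a_def by (simp add: f_inv_into_f inv_into_into del: atLeastAtMost_iff)
    qed
    have "a \<in> columns" using a by (auto simp: columns_def intro!: inj_onI dest!: arg_cong[where f = t])
    then show "v \<in> PT ` columns" using polytabloid_hook[OF t(1) a] t(2) by blast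
  next
    fix v assume "v \<in> PT ` columns"
    then obtain a where a: "a \<in> columns" "v = PT a" by blast
    obtain t where t: "t \<in> tableaux n (hook_partition n k)" "\<forall>i\<le>k. a i \<in> {1..n} \<and> t (a i) = (i, 0)"
      using tableau_exists[OF a(1)] by (elim bexE)
    show "v \<in> polytabloid n ` tableaux n (hook_partition n k)"
    proof (rule image_eqI[OF _ t(1)])
      show "v = polytabloid n t" unfolding a(2) by (rule polytabloid_hook[OF t(1), symmetric]) (use t(2) in blast)
    qed
  qed
  then show ?thesis by (simp add: specht_module_def)
qed

end

section \<open>Spans of functions and orthogonal projection\<close>

lemma span_lin:
  assumes "v \<in> cfun.span S" "q \<in> cfun.span S"
  shows "lin v c q \<in> cfun.span S"
proof -
  have "lin v c q = v + (\<lambda>x. c * q x)" by (simp add: lin_def fun_eq_iff)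
  then show ?thesis using cfun.span_add[OF assms(1) cfun.span_scale[OF assms(2)]] by simp
qed

lemma span_zero_fun: "(\<lambda>_. 0) \<in> cfun.span S"
  using cfun.span_zero[of S] by (simp add: zero_fun_def)

lemma span_lin_induct [consumes 1, case_names zero lin]:
  assumes v: "v \<in> cfun.span S" and "P (\<lambda>_. 0)" and step: "\<And>v c q. P v \<Longrightarrow> q \<in> S \<Longrightarrow> P (lin v c q)"
  shows "P v"
  using v
proof (induct rule: cfun.span_induct_alt)
  case base
  then show ?case using assms(2) by (simp add: zero_fun_def)
next
  case (step c x y)
  have "(\<lambda>xa. c * x xa) + y = lin y c x" by (simp add: lin_def fun_eq_iff)
  then show ?case using assms(3)[OF step(2,1)] by simp
qed

lemma lin_closed_sum:
  assumes "(\<lambda>_. 0) \<in> U" "\<And>v c q. v \<in> U \<Longrightarrow> q \<in> U \<Longrightarrow> lin v c q \<in> U" and "finite A" "\<And>i. i \<in> A \<Longrightarrow> g i \<in> U"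
  shows "(\<lambda>x. \<Sum>i\<in>A. g i x) \<in> U"
  using assms(3,4)
proof (induct A rule: finite_induct)
  case (insert i A)
  have "(\<lambda>x. \<Sum>i\<in>insert i A. g i x) = lin (\<lambda>x. \<Sum>i\<in>A. g i x) 1 (g i)"
    using insert(1,2) by (simp add: lin_def fun_eq_iff)
  then show ?case using insert assms(2) by simp
qed (use assms(1) in simp)

lemma span_subset_lin_closed:
  assumes "S \<subseteq> U" "(\<lambda>_. 0) \<in> U" "\<And>v c q. v \<in> U \<Longrightarrow> q \<in> U \<Longrightarrow> lin v c q \<in> U"
  shows "cfun.span S \<subseteq> U"
proof
  fix v assume "v \<in> cfun.span S"
  then show "v \<in> U" by (induct rule: span_lin_induct) (use assms in blast)+
qed

text \<open>Gram--Schmidt.  In the degenerate case the quotient by \<open>0\<close> is \<open>0\<close>, which is the right coefficient.\<close>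

lemma orthogonal_projection:
  fixes w :: "'a \<Rightarrow> complex"
  assumes "finite C" and T: "finite T"
  shows "\<exists>v\<in>cfun.span C. \<forall>c\<in>C. (\<Sum>r\<in>T. cnj (c r) * (w r - v r)) = 0"
  using assms(1)
proof (induct C arbitrary: w rule: finite_induct)
  case empty
  show ?case using span_zero_fun[of "{}"] by blast
next
  case (insert c C)
  let ?ip = "\<lambda>c w. \<Sum>r\<in>T. cnj (c r) * w r"
  obtain p where p: "p \<in> cfun.span C" "\<forall>d\<in>C. (\<Sum>r\<in>T. cnj (d r) * (c r - p r)) = 0" using insert(3)[of c] by blast
  obtain v where v: "v \<in> cfun.span C" "\<forall>d\<in>C. (\<Sum>r\<in>T. cnj (d r) * (w r - v r)) = 0" using insert(3)[of w] by blast
  \<comment> \<open>The part of \<open>c\<close> orthogonal to the earlier vectors; adding a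
    multiple of it to \<open>v\<close> does not disturb the equations already solved.\<close>
  define e where "e = lin c (-1) p"
  define z where "z = ?ip e (lin w (-1) v) / ?ip e e"
  define v' where "v' = lin v z e"
  have CC: "cfun.span C \<subseteq> cfun.span (insert c C)" by (rule cfun.span_mono) blast
  have ein: "e \<in> cfun.span (insert c C)"
    unfolding e_def by (rule span_lin) (use p CC cfun.span_base[of c "insert c C"] in auto)
  have v'in: "v' \<in> cfun.span (insert c C)"
    unfolding v'_def by (rule span_lin[OF _ ein]) (use v CC in auto)
  have lin2: "?ip d (lin x a y) = ?ip d x + a * ?ip d y" for d x y a
    by (simp add: lin_def algebra_simps sum.distrib sum_distrib_left)
  have lin1: "?ip (lin x a y) d = ?ip x d + cnj a * ?ip y d" for d x y a
    by (simp add: lin_def algebra_simps sum.distrib sum_distrib_left)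
  have eC: "?ip d e = 0" if "d \<in> C" for d using p(2) that by (simp add: e_def lin_def)
  have wC: "?ip d (lin w (-1) v) = 0" if "d \<in> C" for d using v(2) that by (simp add: lin_def)
  have dC: "?ip d (lin w (-1) v') = 0" if "d \<in> C" for d
    using eC[OF that] wC[OF that] by (simp only: v'_def lin2) simp
  have eps: "?ip e (lin w (-1) v') = 0"
  proof (cases "?ip e e = 0")
    \<comment> \<open>Then \<open>e\<close> vanishes on \<open>T\<close>, and the equation holds
      trivially.\<close>
    case True
    have "?ip e e = of_real (\<Sum>r\<in>T. (cmod (e r))\<^sup>2)"
      unfolding of_real_sum by (rule sum.cong[OF refl]) (simp only: complex_norm_square mult.commute)
    then have "(\<Sum>r\<in>T. (cmod (e r))\<^sup>2) = 0" using True by (metis of_real_eq_0_iff)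
    then have "\<forall>r\<in>T. (cmod (e r))\<^sup>2 = 0" using T by (subst (asm) sum_nonneg_eq_0_iff) auto
    then show ?thesis by simp
  next
    case False
    have "?ip e (lin w (-1) v') = ?ip e (lin w (-1) v) - z * ?ip e e"
      by (simp only: v'_def lin2) simp
    then show ?thesis using False by (simp add: z_def)
  qed
  have "?ip q (lin w (-1) v') = 0" if "q \<in> cfun.span C" for q
    using that
  proof (induct rule: span_lin_induct)
    case (lin v c q)
    then show ?case unfolding lin1 using dC by simp
  qed simp
  moreover have "c = lin e 1 p" by (simp add: e_def lin_def fun_eq_iff)
  ultimately have "?ip c (lin w (-1) v') = 0" using lin1[of e 1 p "lin w (-1) v'"] eps p(1) by simp
  then have "\<forall>d\<in>insert c C. ?ip d (lin w (-1) v') = 0" using dC by blast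
  then show ?case using v'in by (intro bexI[of _ v']) (simp_all add: lin_def)
qed

context hook
begin

abbreviation V :: "tabloid_vector set" where "V \<equiv> specht_module n (hook_partition n k)"

text \<open>The pairing is bilinear, to give a linear form; since \<open>PT b\<close> is real
  (\<open>cnj_PT\<close>), it agrees with the Hermitian pairing of
  \<open>orthogonal_projection\<close>.\<close>

definition fn :: "(nat \<Rightarrow> nat) \<Rightarrow> tabloid_vector \<Rightarrow> complex" where
  "fn b v = (\<Sum>r\<in>TB. PT b r * v r)"

lemma V_lin: "v \<in> V \<Longrightarrow> q \<in> V \<Longrightarrow> lin v c q \<in> V"
  unfolding specht_hook by (rule span_lin)

lemma V_zero: "(\<lambda>_. 0) \<in> V"
  unfolding specht_hook by (rule span_zero_fun)

lemma V_PT: "b \<in> columns \<Longrightarrow> PT b \<in> V"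
  unfolding specht_hook by (rule cfun.span_base) simp

lemma V_induct [consumes 1, case_names zero lin]:
  assumes "v \<in> V" "P (\<lambda>_. 0)" "\<And>v c b. P v \<Longrightarrow> b \<in> columns \<Longrightarrow> P (lin v c (PT b))"
  shows "P v"
  using assms(1) unfolding specht_hook
proof (induct rule: span_lin_induct)
  case (lin v c q)
  then show ?case using assms(3) by auto
qed (rule assms(2))

lemma perm_action_lin: "perm_action \<sigma> (lin v c q) = lin (perm_action \<sigma> v) c (perm_action \<sigma> q)"
  by (simp add: perm_action_def lin_def)

lemma columns_compose: "\<sigma> permutes {1..n} \<Longrightarrow> b \<in> columns \<Longrightarrow> \<sigma> \<circ> b \<in> columns"
proof -
  assume \<sigma>: "\<sigma> permutes {1..n}" and b: "b \<in> columns"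
  have "inj_on (\<sigma> \<circ> b) {..k}"
    using b permutes_inj[OF \<sigma>] by (intro comp_inj_on) (auto simp: columns_def intro: inj_on_subset)
  moreover have "(\<sigma> \<circ> b) ` {..k} \<subseteq> \<sigma> ` {1..n}" using b unfolding columns_def image_comp[symmetric] by blast
  ultimately show ?thesis unfolding columns_def permutes_image[OF \<sigma>] by blast
qed

lemma V_perm_action:
  assumes \<sigma>: "\<sigma> permutes {1..n}" and v: "v \<in> V"
  shows "perm_action \<sigma> v \<in> V"
  using v
proof (induct rule: V_induct)
  case zero
  then show ?case using V_zero by (simp add: perm_action_def)
next
  case (lin v c b)
  then show ?case
    unfolding perm_action_lin perm_action_PT[OF \<sigma>] by (intro V_lin V_PT columns_compose[OF \<sigma>])
qed

lemma fn_lin [simp]: "fn b (lin v c q) = fn b v + c * fn b q"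
  by (simp add: fn_def lin_def algebra_simps sum.distrib sum_distrib_left)

lemma fn_zero [simp]: "fn b (\<lambda>_. 0) = 0"
  by (simp add: fn_def)

lemma continuous_on_fn: "continuous_on UNIV (fn b)"
  unfolding fn_def by (intro continuous_intros continuous_on_product_coordinates)

lemma fn_cong: "(\<And>i. i \<le> k \<Longrightarrow> a i = b i) \<Longrightarrow> fn a v = fn b v"
  using PT_cong[of a b] by (simp add: fn_def)

lemma fn_compose: "\<tau> permutes {..k} \<Longrightarrow> fn (b \<circ> \<tau>) v = of_int (sign \<tau>) * fn b v"
  by (simp add: fn_def PT_compose lin_def sum_distrib_left mult.assoc)

lemma fn_transpose:
  assumes "i \<le> k" "j \<le> k" "i \<noteq> j"
  shows "fn (b \<circ> Transposition.transpose i j) v = - fn b v"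
  unfolding fn_def PT_transpose[OF assms] by (simp add: lin_def sum_negf)

lemma fn_replace:
  assumes "b ` {..k} \<subseteq> {1..n}" "x \<in> {1..n}"
  shows "(\<Sum>i\<le>k. fn (b(i := x)) v) = fn b v"
proof -
  have "(\<Sum>i\<le>k. fn (b(i := x)) v) = (\<Sum>r\<in>TB. (\<Sum>i\<le>k. PT (b(i := x)) r) * v r)"
    unfolding fn_def sum_distrib_right by (rule sum.swap)
  then show ?thesis unfolding PT_replace[OF assms] by (simp add: fn_def)
qed

lemma fn_perm_action:
  assumes \<sigma>: "\<sigma> permutes {1..n}"
  shows "fn (\<sigma> \<circ> b) (perm_action \<sigma> v) = fn b v"
proof -
  have "bij_betw (\<lambda>r. r \<circ> \<sigma>) TB TB"
    by (rule bij_betw_byWitness[where f' = "\<lambda>r. r \<circ> inv_into UNIV \<sigma>"])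
      (auto simp: comp_assoc permutes_inv_o[OF \<sigma>] TB_compose[OF \<sigma>] TB_compose[OF permutes_inv[OF \<sigma>]])
  from sum.reindex_bij_betw[OF this, of "\<lambda>r. PT b r * v r"]
  show ?thesis unfolding fn_def perm_action_PT[OF \<sigma>, symmetric] by (simp add: perm_action_def)
qed

lemma cnj_PT: "cnj (PT b r) = PT b r"
  by (simp add: PT_def alt_sum_def if_distrib[of cnj] cong: if_cong)

subsection \<open>Dual vectors\<close>

text \<open>The tabloid with \<open>s i\<close> alone in row \<open>i\<close> for \<open>i\<close>
  from 1 to \<open>k\<close>. The entry \<open>s 0\<close> leaves no trace, being one of many in the
  top row; it becomes the entry \<open>y\<close> of \<open>separating_vector\<close>.\<close>

definition rho :: "(nat \<Rightarrow> nat) \<Rightarrow> nat \<Rightarrow> nat" where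
  "rho s = restrict (\<lambda>x. if x \<in> s ` {1..k} then inv_into {1..k} s x else 0) {1..n}"

lemma rho_eq_iff:
  assumes s: "s \<in> columns" and i: "i \<in> {1..k}" and x: "x \<in> {1..n}"
  shows "rho s x = i \<longleftrightarrow> x = s i"
proof -
  have inj: "inj_on s {1..k}" using s by (auto simp: columns_def intro: inj_on_subset)
  show ?thesis
  proof (cases "x \<in> s ` {1..k}")
    case True
    then obtain j where j: "j \<in> {1..k}" "x = s j" by blast
    then have "rho s x = j" using inj x unfolding rho_def by (simp del: atLeastAtMost_iff)
    then show ?thesis using j i inj by (auto dest: inj_onD)
  next
    case False
    then have "rho s x = 0" using x unfolding rho_def by (simp del: atLeastAtMost_iff)
    then show ?thesis using False i by auto
  qed
qed

lemma rho_TB: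
  assumes s: "s \<in> columns"
  shows "rho s \<in> TB"
proof (rule TB_I)
  have "inv_into {1..k} s x \<in> {1..k}" if "x \<in> s ` {1..k}" for x by (rule inv_into_into[OF that])
  then show "rho s \<in> {1..n} \<rightarrow>\<^sub>E {..k}" unfolding rho_def by auto
  have sn: "s i \<in> {1..n}" if "i \<in> {1..k}" for i using s that unfolding columns_def by auto
  show "\<exists>!x. x \<in> {1..n} \<and> rho s x = i" if i: "i \<in> {1..k}" for i
    by (rule ex1I[of _ "s i"]) (use rho_eq_iff[OF s i] sn[OF i] in blast)+
qed

text \<open>No entry of the column \<open>b\<close> lies in row \<open>i\<close> of the tabloid, so
  the incidence matrix has a zero column.\<close>

lemma PT_rho_zero:
  assumes s: "s \<in> columns" and b: "b ` {..k} \<subseteq> {1..n}" and i: "i \<in> {1..k}" "s i \<notin> b ` {..k}"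
  shows "PT b (rho s) = 0"
proof -
  have "(\<Prod>i\<le>k. if rho s (b (\<pi> i)) = i then 1 else (0::complex)) = 0" if \<pi>: "\<pi> permutes {..k}" for \<pi>
  proof -
    have "\<pi> i \<in> {..k}" using i(1) permutes_in_image[OF \<pi>, of i] by auto
    then have "b (\<pi> i) \<in> {1..n}" "b (\<pi> i) \<noteq> s i" using b i(2) by (blast, metis image_eqI)
    then have "rho s (b (\<pi> i)) \<noteq> i" using rho_eq_iff[OF s i(1)] by blast
    then show ?thesis using i(1) by (intro prod_zero) auto
  qed
  then have "alt_sum k (\<lambda>p i. if rho s (b p) = i then 1 else 0) = 0"
    unfolding alt_sum_def by (intro sum.neutral ballI) (simp only: mem_Collect_eq mult_zero_right)
  then show ?thesis by (simp add: PT_def)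
qed

text \<open>The incidence matrix is the identity matrix.\<close>

lemma PT_rho_one:
  assumes s: "s \<in> columns"
  shows "PT s (rho s) = 1"
proof -
  have inj: "inj_on s {..k}" and sn: "\<And>i. i \<le> k \<Longrightarrow> s i \<in> {1..n}" using s by (auto simp: columns_def)
  have 0: "rho s (s 0) = 0"
  proof (rule ccontr)
    assume c: "rho s (s 0) \<noteq> 0"
    have "rho s (s 0) \<le> k" by (rule TB_row[OF rho_TB[OF s] sn]) simp
    then have i: "rho s (s 0) \<in> {1..k}" using c by simp
    then have "s 0 = s (rho s (s 0))" using rho_eq_iff[OF s i sn[of 0]] by simp
    then show False using inj_onD[OF inj, of 0 "rho s (s 0)"] c i by simp
  qed
  have e: "(\<Prod>i\<le>k. if rho s (s (\<pi> i)) = i then 1 else (0::complex)) = (if \<pi> = id then 1 else 0)"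
    if \<pi>: "\<pi> permutes {..k}" for \<pi>
  proof (cases "\<pi> = id")
    case True
    have "rho s (s i) = i" if "i \<le> k" for i
      using 0 rho_eq_iff[OF s, of i "s i"] sn[OF that] that by (cases "i = 0") auto
    then show ?thesis using True by simp
  next
    case False
    have "\<exists>i\<in>{1..k}. \<pi> i \<noteq> i"
    proof (rule ccontr)
      assume "\<not> ?thesis"
      then have "\<pi> i = i" if "i \<in> {..k} - {0}" for i using that by auto
      then have "\<pi> permutes {0}" using permutes_superset[OF \<pi>, of "{0}"] by blast
      then show False using False by simp
    qed
    then obtain i where i: "i \<in> {1..k}" "\<pi> i \<noteq> i" by blast
    have \<pi>i: "\<pi> i \<le> k" using i(1) permutes_in_image[OF \<pi>, of i] by auto
    then have "s (\<pi> i) \<noteq> s i" using inj_onD[OF inj, of "\<pi> i" i] i by auto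
    then have "rho s (s (\<pi> i)) \<noteq> i" using rho_eq_iff[OF s i(1) sn[OF \<pi>i]] by blast
    then have "(\<Prod>i\<le>k. if rho s (s (\<pi> i)) = i then 1 else (0::complex)) = 0"
      using i(1) by (intro prod_zero) auto
    then show ?thesis using False by (simp only: if_False)
  qed
  have "alt_sum k (\<lambda>p i. if rho s (s p) = i then 1 else 0) = (\<Sum>\<pi> | \<pi> permutes {..k}. if \<pi> = id then 1 else 0)"
    unfolding alt_sum_def by (rule sum.cong[OF refl]) (simp add: e del: prod_eq_1_iff)
  also have "\<dots> = 1" by (subst sum.delta) (auto simp: finite_permutations permutes_id)
  finally show ?thesis using rho_TB[OF s] by (simp add: PT_def)
qed

lemma finite_polytabloids: "finite (PT ` columns)"
proof (rule finite_subset)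
  show "PT ` columns \<subseteq> PT ` ({..k} \<rightarrow>\<^sub>E {1..n})"
  proof
    fix v assume "v \<in> PT ` columns"
    then obtain b where b: "b \<in> columns" "v = PT b" by blast
    have "v = PT (restrict b {..k})" unfolding b(2) by (rule PT_cong) simp
    moreover have "restrict b {..k} \<in> {..k} \<rightarrow>\<^sub>E {1..n}" using b(1) unfolding columns_def restrict_PiE by blast
    ultimately show "v \<in> PT ` ({..k} \<rightarrow>\<^sub>E {1..n})" by (rule image_eqI)
  qed
qed (auto intro: finite_PiE)

text \<open>The vector is the orthogonal projection of a single tabloid to the Specht module.\<close>

lemma dual_vector:
  assumes s: "s \<in> columns"
  obtains v where "v \<in> V" "\<And>c. c \<in> columns \<Longrightarrow> fn c v = PT c (rho s)"
proof -
  obtain v where v: "v \<in> cfun.span (PT ` columns)"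
    "\<forall>c\<in>PT ` columns. (\<Sum>r\<in>TB. cnj (c r) * ((if r = rho s then 1 else 0) - v r)) = 0"
    using orthogonal_projection[OF finite_polytabloids finite_TB, of "\<lambda>r. if r = rho s then 1 else 0"] by (elim bexE)
  have "fn c v = PT c (rho s)" if c: "c \<in> columns" for c
  proof -
    have "(\<Sum>r\<in>TB. PT c r * ((if r = rho s then 1 else 0) - v r)) = 0" using v(2) c by (simp add: cnj_PT)
    then have "fn c v = (\<Sum>r\<in>TB. PT c r * (if r = rho s then 1 else 0))"
      unfolding right_diff_distrib sum_subtractf fn_def by simp
    also have "\<dots> = (\<Sum>r\<in>TB. if r = rho s then PT c r else 0)" by (rule sum.cong) auto
    also have "\<dots> = PT c (rho s)" using finite_TB rho_TB[OF s] by (simp add: sum.delta')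
    finally show ?thesis .
  qed
  then show ?thesis using that[of v] v(1) specht_hook by blast
qed

subsection \<open>The linear forms of an arrangement\<close>

definition J :: "nat set set" where
  "J = {B. B \<subseteq> {1..n} \<and> card B = Suc k}"

text \<open>An arbitrary enumeration. Another one changes the form at most by a sign
  (\<open>same_image\<close>), so the kernel depends on \<open>B\<close> alone.\<close>

definition en :: "nat set \<Rightarrow> nat \<Rightarrow> nat" where
  "en B = (SOME b. bij_betw b {..k} B)"

abbreviation F :: "nat set \<Rightarrow> tabloid_vector \<Rightarrow> complex" where "F B \<equiv> fn (en B)"

lemma finite_J: "finite J"
  unfolding J_def by (rule finite_subset[of _ "Pow {1..n}"]) auto

lemma J_finite: "B \<in> J \<Longrightarrow> finite B"
  unfolding J_def by (auto intro: finite_subset)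

lemma en_bij: assumes "B \<in> J" shows "bij_betw (en B) {..k} B"
proof -
  have "\<exists>b. bij_betw b {..k} B"
    using J_finite[OF assms] assms by (intro finite_same_card_bij) (auto simp: J_def)
  then show ?thesis unfolding en_def by (rule someI_ex)
qed

lemma columns_bij: "B \<in> J \<Longrightarrow> bij_betw b {..k} B \<Longrightarrow> b \<in> columns"
  unfolding columns_def J_def bij_betw_def by blast

lemma columns_J: "b \<in> columns \<Longrightarrow> b ` {..k} \<in> J"
  unfolding columns_def J_def by (simp add: card_image)

lemma columns_image_bij: "b \<in> columns \<Longrightarrow> bij_betw b {..k} (b ` {..k})"
  unfolding columns_def bij_betw_def by blast

lemma same_image:
  assumes b: "bij_betw b {..k} B" and c: "bij_betw c {..k} B"
  obtains s where "s * s = (1::complex)" "\<And>v. fn b v = s * fn c v" "PT b = lin (\<lambda>_. 0) s (PT c)"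
proof -
  define \<pi> where "\<pi> i = (if i \<in> {..k} then inv_into {..k} c (b i) else i)" for i
  have "bij_betw (inv_into {..k} c \<circ> b) {..k} {..k}"
    by (rule bij_betw_trans[OF b bij_betw_inv_into[OF c]])
  then have "bij_betw \<pi> {..k} {..k}" by (rule bij_betw_cong[THEN iffD1, rotated]) (simp add: \<pi>_def)
  then have \<pi>: "\<pi> permutes {..k}" by (rule bij_imp_permutes) (simp add: \<pi>_def)
  have cb: "b i = (c \<circ> \<pi>) i" if "i \<le> k" for i
    using that bij_betw_inv_into_right[OF c, of "b i"] bij_betwE[OF b] by (simp add: \<pi>_def)
  have 1: "PT b = lin (\<lambda>_. 0) (of_int (sign \<pi>)) (PT c)" using PT_cong[of b "c \<circ> \<pi>", OF cb] PT_compose[OF \<pi>, of c] by simp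
  have 2: "fn b v = of_int (sign \<pi>) * fn c v" for v using fn_cong[of b "c \<circ> \<pi>", OF cb] fn_compose[OF \<pi>, of c v] by simp
  have "of_int (sign \<pi>) * of_int (sign \<pi>) = (1::complex)" unfolding of_int_mult[symmetric] by simp
  from that[OF this 2 1] show ?thesis .
qed

lemma F_zero_iff:
  assumes B: "B \<in> J" and b: "bij_betw b {..k} B"
  shows "fn b v = 0 \<longleftrightarrow> F B v = 0"
proof -
  obtain s where s: "s * s = (1::complex)" "fn b v = s * F B v"
    using same_image[OF b en_bij[OF B]] by metis
  then have "s \<noteq> 0" by auto
  then show ?thesis using s(2) by simp
qed

text \<open>The dual vector of an enumeration of \<open>B\<close> that starts with \<open>y\<close>:
  it pairs to 0 with every column that misses one of the other entries.\<close>

lemma separating_vector: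
  assumes B: "B \<in> J" and y: "y \<in> B"
  obtains v where "v \<in> V" "F B v \<noteq> 0" "\<And>C. C \<in> J \<Longrightarrow> \<not> B - {y} \<subseteq> C \<Longrightarrow> F C v = 0"
proof -
  have "y \<in> en B ` {..k}" using en_bij[OF B] y by (simp add: bij_betw_def)
  then obtain i where i: "i \<le> k" "en B i = y" by auto
  define s where "s = en B \<circ> Transposition.transpose 0 i"
  have tr: "Transposition.transpose 0 i permutes {..k}" using i by (intro permutes_swap_id) auto
  have s: "bij_betw s {..k} B" unfolding s_def by (rule bij_betw_trans[OF permutes_imp_bij[OF tr] en_bij[OF B]])
  have sc: "s \<in> columns" by (rule columns_bij[OF B s])
  have s0: "s 0 = y" using i by (simp add: s_def)
  obtain v where v: "v \<in> V" "\<And>c. c \<in> columns \<Longrightarrow> fn c v = PT c (rho s)" using dual_vector[OF sc] by blast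
  have "fn s v \<noteq> 0" using v(2)[OF sc] PT_rho_one[OF sc] by simp
  then have 1: "F B v \<noteq> 0" using F_zero_iff[OF B s] by simp
  have 2: "F C v = 0" if C: "C \<in> J" "\<not> B - {y} \<subseteq> C" for C
  proof -
    have cc: "en C \<in> columns" by (rule columns_bij[OF C(1) en_bij[OF C(1)]])
    have im: "en C ` {..k} = C" using en_bij[OF C(1)] by (simp add: bij_betw_def)
    obtain x where x: "x \<in> B" "x \<noteq> y" "x \<notin> C" using C(2) by blast
    obtain j where j: "j \<le> k" "s j = x" using s x(1) unfolding bij_betw_def by auto
    then have "j \<in> {1..k}" using x(2) s0 by (cases "j = 0") auto
    then have "PT (en C) (rho s) = 0"
      using PT_rho_zero[OF sc, of "en C" j] im x(3) j(2) C(1) by (simp add: J_def)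
    then show ?thesis using v(2)[OF cc] by simp
  qed
  show ?thesis by (rule that[OF v(1) 1 2])
qed

lemma J_bad_points:
  assumes B: "B \<in> J" and C: "C \<in> J" "C \<noteq> B" and "B - {y} \<subseteq> C" "B - {y'} \<subseteq> C"
  shows "y = y'"
proof (rule ccontr)
  assume "y \<noteq> y'"
  then have "B \<subseteq> C" using assms by blast
  then have "B = C" using card_subset_eq[OF J_finite[OF C(1)]] B C(1) by (simp add: J_def)
  then show False using C(2) by simp
qed

text \<open>A set of the same size other than \<open>B\<close> contains \<open>B - {y}\<close> for
  at most one \<open>y\<close>. As \<open>1 < k\<close>, the set \<open>B\<close> has at least three
  elements, so some \<open>y\<close> is good for both \<open>C\<close> and \<open>D\<close>.\<close>

lemma forms_independent:
  assumes B: "B \<in> J" and C: "C \<in> J" "C \<noteq> B" and D: "D \<in> J" "D \<noteq> B"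
  shows "\<exists>v\<in>V. F B v \<noteq> 0 \<and> F C v = 0 \<and> F D v = 0"
proof -
  have "\<exists>y\<in>B. \<not> B - {y} \<subseteq> C \<and> \<not> B - {y} \<subseteq> D"
  proof (rule ccontr)
    assume no: "\<not> ?thesis"
    obtain c where c: "\<forall>y. B - {y} \<subseteq> C \<longrightarrow> y = c" using J_bad_points[OF B C] by blast
    obtain d where d: "\<forall>y. B - {y} \<subseteq> D \<longrightarrow> y = d" using J_bad_points[OF B D] by blast
    have "B \<subseteq> {c, d}" using no c d by blast
    then have "card B \<le> card {c, d}" by (intro card_mono) auto
    also have "\<dots> \<le> 2" by (simp add: card_insert_if)
    finally show False using B k1 by (simp add: J_def)
  qed
  then obtain y where y: "y \<in> B" "\<not> B - {y} \<subseteq> C" "\<not> B - {y} \<subseteq> D" by blast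
  obtain v where v: "v \<in> V" "F B v \<noteq> 0" "\<And>C. C \<in> J \<Longrightarrow> \<not> B - {y} \<subseteq> C \<Longrightarrow> F C v = 0"
    using separating_vector[OF B y(1)] by blast
  show ?thesis using v(1,2) v(3)[OF C(1) y(2)] v(3)[OF D(1) y(3)] by blast
qed

lemma form_nonzero:
  assumes B: "B \<in> J"
  shows "\<exists>v\<in>V. F B v \<noteq> 0"
proof -
  have "B \<noteq> {}" using B by (auto simp: J_def)
  then obtain y where "y \<in> B" by blast
  from separating_vector[OF B this] show ?thesis by metis
qed

definition K :: "nat set \<Rightarrow> tabloid_vector set" where
  "K B = {v \<in> V. F B v = 0}"

lemma inj_K: "inj_on K J"
proof (rule inj_onI, rule ccontr)
  fix B C assume *: "B \<in> J" "C \<in> J" "K B = K C" "B \<noteq> C"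
  obtain v where "v \<in> V" "F B v \<noteq> 0" "F C v = 0" using forms_independent[OF *(1,2) _ *(2)] *(4) by blast
  then have "v \<in> K C" "v \<notin> K B" by (simp_all add: K_def)
  then show False using *(3) by simp
qed

end

context hook
begin

lemma K_lin: "v \<in> K B \<Longrightarrow> q \<in> K B \<Longrightarrow> lin v c q \<in> K B"
  by (simp add: K_def V_lin)

lemma K_zero: "(\<lambda>_. 0) \<in> K B"
  by (simp add: K_def V_zero)

subsection \<open>The hyperplane of a Young subgroup\<close>

lemma transposition_in_block:
  assumes "Transposition.transpose x y permutes B" "x \<noteq> y"
  shows "x \<in> B" "y \<in> B"
proof -
  show "x \<in> B" using permutes_not_in[OF assms(1), of x] assms(2) by auto
  show "y \<in> B" using permutes_not_in[OF assms(1), of y] assms(2) by auto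
qed

text \<open>Swapping two entries of the column reverses the sign of the form, so on a fixed vector
  it equals its own negative.\<close>

lemma fixed_subset_K:
  assumes B: "B \<in> J" and \<tau>: "\<tau> \<in> transpositions n" "\<tau> permutes B"
  shows "fixed_subspace n (hook_partition n k) \<tau> \<subseteq> K B"
proof
  fix v assume v: "v \<in> fixed_subspace n (hook_partition n k) \<tau>"
  obtain x y where xy: "\<tau> = Transposition.transpose x y" "x \<in> {1..n}" "y \<in> {1..n}" "x \<noteq> y"
    using \<tau>(1) unfolding transpositions_def by blast
  have \<tau>n: "\<tau> permutes {1..n}" unfolding xy(1) by (rule permutes_swap_id[OF xy(2,3)])
  have "x \<in> en B ` {..k}" "y \<in> en B ` {..k}"
    using transposition_in_block[of x y B] \<tau>(2) xy(1,4) en_bij[OF B] by (simp_all add: bij_betw_def)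
  then obtain i j where ij: "i \<le> k" "j \<le> k" "x = en B i" "y = en B j" by auto
  have inj: "inj_on (en B) {..k}" using en_bij[OF B] by (simp add: bij_betw_def)
  have ne: "i \<noteq> j" using ij xy(4) by auto
  have eq: "(\<tau> \<circ> en B) l = (en B \<circ> Transposition.transpose i j) l" if "l \<le> k" for l
    using inj_onD[OF inj, of l i] inj_onD[OF inj, of l j] that ij
    by (auto simp: xy(1) Transposition.transpose_def)
  have "F B v = fn (\<tau> \<circ> en B) (perm_action \<tau> v)" by (rule fn_perm_action[OF \<tau>n, symmetric])
  also have "perm_action \<tau> v = v" using v by (simp add: fixed_subspace_def)
  also have "fn (\<tau> \<circ> en B) v = fn (en B \<circ> Transposition.transpose i j) v" by (rule fn_cong[OF eq])
  also have "\<dots> = - F B v" by (rule fn_transpose[OF ij(1,2) ne])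
  finally have "F B v = 0" by simp
  then show "v \<in> K B" using v by (simp add: K_def fixed_subspace_def)
qed

lemma transposition_sign: "\<tau> \<in> transpositions n \<Longrightarrow> sign \<tau> = -1"
  by (auto simp: transpositions_def sign_swap_id)

lemma transposition_permutes: "\<tau> \<in> transpositions n \<Longrightarrow> \<tau> permutes {1..n}"
  by (auto simp: transpositions_def intro!: permutes_swap_id simp del: atLeastAtMost_iff)

lemma transposition_involution: "\<tau> \<in> transpositions n \<Longrightarrow> \<tau> \<circ> \<tau> = id"
  by (auto simp: transpositions_def)

text \<open>For a transposition \<open>\<tau>\<close> in \<open>T\<close> the vector
  \<open>w + \<tau> w\<close> is fixed by \<open>\<tau>\<close>, so \<open>\<tau>\<close> acts as -1
  modulo the sum of fixed subspaces; products then act by their sign.\<close>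

lemma perm_action_modulo:
  assumes T: "T \<subseteq> transpositions n" and \<sigma>: "\<sigma> \<in> generate (sym_group n) T" and v: "v \<in> V"
  shows "lin (perm_action \<sigma> v) (- of_int (sign \<sigma>)) v \<in> intrinsic_hyperplane n (hook_partition n k) T"
proof -
  let ?H = "intrinsic_hyperplane n (hook_partition n k) T"
  have Hlin: "lin x c y \<in> ?H" if "x \<in> ?H" "y \<in> ?H" for x y c
    using that unfolding intrinsic_hyperplane_def by (rule span_lin)
  have incl: "lin (perm_action \<tau> w) (- of_int (sign \<tau>)) w \<in> ?H" if \<tau>: "\<tau> \<in> T" and w: "w \<in> V" for \<tau> w
  proof -
    have \<tau>t: "\<tau> \<in> transpositions n" using \<tau> T by blast
    have "perm_action \<tau> (perm_action \<tau> w) = w"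
      using transposition_involution[OF \<tau>t] by (simp add: perm_action_def comp_assoc)
    then have "perm_action \<tau> (lin (perm_action \<tau> w) 1 w) = lin (perm_action \<tau> w) 1 w"
      unfolding perm_action_lin by (simp add: lin_def add.commute)
    moreover have "lin (perm_action \<tau> w) 1 w \<in> V" using V_lin[OF V_perm_action[OF transposition_permutes[OF \<tau>t] w] w] .
    ultimately have "lin (perm_action \<tau> w) 1 w \<in> fixed_subspace n (hook_partition n k) \<tau>" by (simp add: fixed_subspace_def)
    then have "lin (perm_action \<tau> w) 1 w \<in> ?H" unfolding intrinsic_hyperplane_def using \<tau> by (intro cfun.span_base) blast
    then show ?thesis by (simp add: transposition_sign[OF \<tau>t])
  qed
  have "\<sigma> permutes {1..n} \<and> (\<forall>w\<in>V. lin (perm_action \<sigma> w) (- of_int (sign \<sigma>)) w \<in> ?H)"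
    using \<sigma>
  proof (induct rule: generate.induct)
    case one
    have e: "lin (perm_action id w) (- of_int (sign id)) w = (\<lambda>_. 0)" for w by (simp add: perm_action_def lin_def)
    show ?case
      unfolding sym_group_one intrinsic_hyperplane_def e by (intro conjI ballI permutes_id span_zero_fun)
  next
    case (incl h)
    then show ?case using \<open>\<And>w \<tau>. \<tau> \<in> T \<Longrightarrow> w \<in> V \<Longrightarrow> lin (perm_action \<tau> w) (- of_int (sign \<tau>)) w \<in> ?H\<close> T transposition_permutes by blast
  next
    case (inv h)
    then have ht: "h \<in> transpositions n" using T by blast
    have "inv_into UNIV h = h" by (rule inv_unique_comp) (rule transposition_involution[OF ht])+
    then have "inv\<^bsub>sym_group n\<^esub> h = h" using transposition_permutes[OF ht] by (simp add: sym_group_carrier)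
    then show ?case using incl[OF inv] transposition_permutes[OF ht] by simp
  next
    case (eng g h)
    have s: "sign (g \<circ> h) = sign g * sign h"
      using eng by (intro sign_compose) (auto simp: permutation_permutes)
    have "lin (perm_action (g \<circ> h) w) (- of_int (sign (g \<circ> h))) w \<in> ?H" if w: "w \<in> V" for w
    proof -
      have "perm_action h w \<in> V" using V_perm_action eng w by blast
      then have "lin (perm_action g (perm_action h w)) (- of_int (sign g)) (perm_action h w) \<in> ?H"
        and "lin (perm_action h w) (- of_int (sign h)) w \<in> ?H"
        using eng w by blast+
      then have "lin (lin (perm_action g (perm_action h w)) (- of_int (sign g)) (perm_action h w)) (of_int (sign g))
          (lin (perm_action h w) (- of_int (sign h)) w) \<in> ?H"
        by (rule Hlin)
      moreover have "lin (lin (perm_action g (perm_action h w)) (- of_int (sign g)) (perm_action h w)) (of_int (sign g))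
          (lin (perm_action h w) (- of_int (sign h)) w) = lin (perm_action (g \<circ> h) w) (- of_int (sign (g \<circ> h))) w"
        unfolding s by (simp add: lin_def perm_action_def fun_eq_iff algebra_simps comp_assoc)
      ultimately show ?thesis by simp
    qed
    then show ?case unfolding sym_group_mult using permutes_compose[of h "{1..n}" g] eng(2,4) by blast
  qed
  then show ?thesis using v by blast
qed

text \<open>Modulo the sum of fixed subspaces every polytabloid is a multiple of
  \<open>PT (en B)\<close>. That sum therefore has codimension at most one, and it lies in the
  kernel of the nonzero form \<open>F B\<close>.\<close>

lemma hyperplane_eq_K:
  assumes B: "B \<in> J" and T: "T \<subseteq> transpositions n" and gen: "generate (sym_group n) T = {\<sigma>. \<sigma> permutes B}"
  shows "intrinsic_hyperplane n (hook_partition n k) T = K B"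
proof
  let ?H = "intrinsic_hyperplane n (hook_partition n k) T"
  have perm: "\<tau> permutes B" if "\<tau> \<in> T" for \<tau> using generate.incl[OF that, of "sym_group n"] gen by simp
  have "(\<Union>\<tau>\<in>T. fixed_subspace n (hook_partition n k) \<tau>) \<subseteq> K B"
    using fixed_subset_K[OF B] perm T by blast
  then show HK: "?H \<subseteq> K B"
    unfolding intrinsic_hyperplane_def by (rule span_subset_lin_closed) (use K_zero K_lin in auto)
  have Hlin: "lin x c y \<in> ?H" if "x \<in> ?H" "y \<in> ?H" for x y c
    using that unfolding intrinsic_hyperplane_def by (rule span_lin)
  have Hzero: "(\<lambda>_. 0) \<in> ?H" unfolding intrinsic_hyperplane_def by (rule span_zero_fun)
  have BJ: "B \<subseteq> {1..n}" "card B = Suc k" using B by (auto simp: J_def)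
  let ?b = "en B"
  have b: "bij_betw ?b {..k} B" by (rule en_bij[OF B])
  have bc: "?b \<in> columns" by (rule columns_bij[OF B b])
  have swap: "lin (PT (Transposition.transpose x y \<circ> c)) 1 (PT c) \<in> ?H"
    if "x \<in> B" "y \<in> B" "x \<noteq> y" "c \<in> columns" for x y c
  proof -
    have "Transposition.transpose x y permutes B" using that by (intro permutes_swap_id) auto
    then have "Transposition.transpose x y \<in> generate (sym_group n) T" "Transposition.transpose x y permutes {1..n}"
      using gen permutes_subset[OF _ BJ(1)] by auto
    then show ?thesis using perm_action_modulo[OF T _ V_PT[OF that(4)], of "Transposition.transpose x y"] that(3)
      by (simp add: perm_action_PT sign_swap_id)
  qed
  have modH: "\<exists>z. lin (PT c) z (PT ?b) \<in> ?H" if c: "c \<in> columns" for c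
  proof -
    let ?C = "c ` {..k}"
    have cC: "bij_betw c {..k} ?C" by (rule columns_image_bij[OF c])
    have CJ: "?C \<in> J" by (rule columns_J[OF c])
    have fC: "finite ?C" "card ?C = Suc k" using CJ by (auto simp: J_def)
    \<comment> \<open>The column enumerates \<open>B\<close>, or misses at least two elements of
      \<open>B\<close>, or misses exactly one.\<close>
    consider "?C = B" | x y where "x \<in> B" "y \<in> B" "x \<noteq> y" "x \<notin> ?C" "y \<notin> ?C" | x where "B - ?C = {x}"
    proof -
      have "?C = B" if "B \<subseteq> ?C" using card_subset_eq[OF fC(1) that] fC BJ by simp
      then consider "?C = B" | x where "x \<in> B" "x \<notin> ?C" by blast
      then show ?thesis using that by cases blast+
    qed
    then show ?thesis
    proof cases
      case 1
      obtain s where s: "s * s = (1::complex)" "PT c = lin (\<lambda>_. 0) s (PT ?b)"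
        using same_image[of c B ?b] cC b unfolding 1 by metis
      then have "lin (PT c) (- s) (PT ?b) = (\<lambda>_. 0)" by (simp add: lin_def)
      then show ?thesis using Hzero by metis
    next
      case (2 x y)
      \<comment> \<open>The transposition moves no entry of the column, so \<open>PT c\<close> is
        fixed and at the same time congruent to its negative.\<close>
      have "PT (Transposition.transpose x y \<circ> c) = PT c"
        by (rule PT_cong) (use 2 in \<open>auto simp: Transposition.transpose_def\<close>)
      then have "lin (PT c) 1 (PT c) \<in> ?H" using swap[OF 2(1-3) c] by simp
      then have "lin (\<lambda>_. 0) (1/2) (lin (PT c) 1 (PT c)) \<in> ?H" by (rule Hlin[OF Hzero])
      moreover have "lin (\<lambda>_. 0) (1/2) (lin (PT c) 1 (PT c)) = lin (PT c) 0 (PT ?b)" by (simp add: lin_def fun_eq_iff)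
      ultimately show ?thesis by metis
    next
      case (3 x)
      have xB: "x \<in> B" "x \<notin> ?C" using 3 by auto
      have "card (B \<inter> ?C) + card (B - ?C) = card B"
        using J_finite[OF B] by (metis card_Int_Diff)
      then have "card (B \<inter> ?C) = k" using 3 BJ by simp
      then have "card (?C - B) = 1"
        using card_Int_Diff[OF fC(1), of B] fC(2) by (simp add: Int_commute)
      then obtain w where w: "?C - B = {w}" by (auto simp: card_1_singleton_iff)
      have wn: "w \<in> {1..n}" "w \<notin> B" using w CJ unfolding J_def by blast+
      have Ceq: "?C = insert w (B - {x})" using w 3 by blast
      have "x \<in> ?b ` {..k}" using b xB by (simp add: bij_betw_def)
      then obtain i0 where i0: "i0 \<le> k" "?b i0 = x" by auto
      have inj: "inj_on ?b {..k}" and bim: "?b ` {..k} = B" using b by (simp_all add: bij_betw_def)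
      \<comment> \<open>The Garnir relation writes \<open>PT (en B)\<close> as the sum of these
        \<open>k + 1\<close> polytabloids. They are congruent to each other, so it is congruent to
        \<open>k + 1\<close> times any one of them.\<close>
      let ?c = "\<lambda>i. ?b(i := w)"
      have bB: "?b i \<in> B" if "i \<le> k" for i using bim that by blast
      have cinj: "inj_on (?c i) {..k}" for i
        using inj bB wn(2) by (auto simp: inj_on_def)
      have cc: "?c i \<in> columns" if "i \<le> k" for i
        using cinj bB BJ(1) wn(1) unfolding columns_def by auto
      have "?c i0 ` {..k} \<subseteq> ?C"
        unfolding Ceq using bB i0 inj by (auto simp: inj_on_def)
      moreover have "card (?c i0 ` {..k}) = Suc k" unfolding card_image[OF cinj] by simp
      ultimately have im: "?c i0 ` {..k} = ?C" using fC by (intro card_subset_eq) auto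
      have diff: "lin (PT (?c i)) (-1) (PT (?c i0)) \<in> ?H" if i: "i \<le> k" for i
      proof (cases "i = i0")
        case True
        then show ?thesis using Hzero by (simp add: lin_def)
      next
        case False
        have ne: "?b i \<noteq> ?b i0" using inj_onD[OF inj, of i i0] False i i0(1) by auto
        \<comment> \<open>Two signs cancel: \<open>?t\<close> acts as -1 modulo the sum, and on
          columns it amounts to exchanging two positions, which is -1 again.\<close>
        let ?t = "Transposition.transpose (?b i) (?b i0)"
        have "(?t \<circ> ?c i) l = (?c i0 \<circ> Transposition.transpose i i0) l" if l: "l \<le> k" for l
        proof -
          have "?b l = ?b i \<longleftrightarrow> l = i" "?b l = ?b i0 \<longleftrightarrow> l = i0" "w \<noteq> ?b i" "w \<noteq> ?b i0"
            using inj l i i0(1) bB wn(2) by (auto simp: inj_on_def)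
          then show ?thesis using False by (auto simp: Transposition.transpose_def)
        qed
        then have "PT (?t \<circ> ?c i) = PT (?c i0 \<circ> Transposition.transpose i i0)" by (rule PT_cong)
        then have "lin (lin (\<lambda>_. 0) (-1) (PT (?c i0))) 1 (PT (?c i)) \<in> ?H"
          using swap[OF bB[OF i] bB[OF i0(1)] ne cc[OF i]] PT_transpose[OF i i0(1) False] by simp
        moreover have "lin (lin (\<lambda>_. 0) (-1) (PT (?c i0))) 1 (PT (?c i)) = lin (PT (?c i)) (-1) (PT (?c i0))"
          by (simp add: lin_def)
        ultimately show ?thesis by simp
      qed
      have "(\<lambda>r. \<Sum>i\<le>k. lin (PT (?c i)) (-1) (PT (?c i0)) r) \<in> ?H"
        by (rule lin_closed_sum) (use Hzero Hlin diff in auto)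
      moreover have "(\<Sum>i\<le>k. lin (PT (?c i)) (-1) (PT (?c i0)) r) = PT ?b r - of_nat (Suc k) * PT (?c i0) r" for r
        using PT_replace[of ?b w r] bim BJ(1) wn(1) by (simp add: lin_def sum_subtractf)
      ultimately have E: "(\<lambda>r. PT ?b r - of_nat (Suc k) * PT (?c i0) r) \<in> ?H" by simp
      obtain s where s: "PT c = lin (\<lambda>_. 0) s (PT (?c i0))"
        using same_image[OF cC, of "?c i0"] cinj[of i0] im unfolding bij_betw_def by metis
      have "lin (\<lambda>_. 0) (- s / of_nat (Suc k)) (\<lambda>r. PT ?b r - of_nat (Suc k) * PT (?c i0) r) \<in> ?H"
        by (rule Hlin[OF Hzero E])
      moreover have "lin (\<lambda>_. 0) (- s / of_nat (Suc k)) (\<lambda>r. PT ?b r - of_nat (Suc k) * PT (?c i0) r)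
          = lin (PT c) (- s / of_nat (Suc k)) (PT ?b)"
        unfolding s lin_def by (rule ext) (simp add: field_simps del: of_nat_Suc)
      ultimately show ?thesis by metis
    qed
  qed
  have modV: "\<exists>z. lin v z (PT ?b) \<in> ?H" if "v \<in> V" for v
    using that
  proof (induct rule: V_induct)
    case zero
    have "lin (\<lambda>_. 0) 0 (PT ?b) \<in> ?H" using Hzero by simp
    then show ?case by blast
  next
    case (lin v c a)
    obtain z where z: "lin v z (PT ?b) \<in> ?H" using lin(1) by blast
    obtain y where y: "lin (PT a) y (PT ?b) \<in> ?H" using modH[OF lin(2)] by blast
    have "lin (lin v z (PT ?b)) c (lin (PT a) y (PT ?b)) = lin (lin v c (PT a)) (z + c * y) (PT ?b)"
      by (simp add: lin_def fun_eq_iff algebra_simps)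
    then show ?case using Hlin[OF z y, of c] by metis
  qed
  \<comment> \<open>If \<open>F B\<close> vanished on \<open>PT (en B)\<close>, it would vanish on
    all of \<open>V\<close>.\<close>
  have Fb: "F B (PT ?b) \<noteq> 0"
  proof
    assume 0: "F B (PT ?b) = 0"
    obtain v where v: "v \<in> V" "F B v \<noteq> 0" using form_nonzero[OF B] by blast
    obtain z where "lin v z (PT ?b) \<in> ?H" using modV[OF v(1)] by blast
    then have "lin v z (PT ?b) \<in> K B" using HK by blast
    then show False using 0 v(2) by (simp add: K_def)
  qed
  show "K B \<subseteq> ?H"
  proof
    fix v assume v: "v \<in> K B"
    obtain z where z: "lin v z (PT ?b) \<in> ?H" using modV v by (auto simp: K_def)
    then have "lin v z (PT ?b) \<in> K B" using HK by blast
    then have "z = 0" using v Fb by (simp add: K_def)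
    then show "v \<in> ?H" using z by simp
  qed
qed

subsection \<open>Set partitions of the conjugate type\<close>

text \<open>The first column of the hook has \<open>k + 1\<close> cells and each of the others has
  one. A set partition of this type is thus given by its only block with more than one
  element.\<close>

lemma conjugate_hook: "mset (conjugate_partition (hook_partition n k)) = add_mset (Suc k) (replicate_mset (n - k - 1) 1)"
proof -
  have "foldr max (replicate m (1::nat)) 0 \<le> 1" for m by (induct m) auto
  moreover have "1 \<le> n - k" using kn by simp
  ultimately have "foldr max (replicate k 1) 0 \<le> n - k" by (rule order_trans)
  then have fm: "foldr max (hook_partition n k) 0 = n - k"
    by (simp add: hook_partition_def max_absorb1 del: foldr_replicate)
  have l: "length (filter (\<lambda>p. j < p) (hook_partition n k)) = (if j = 0 then Suc k else 1)" if "j < n - k" for j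
    using that by (simp add: hook_partition_def)
  have "conjugate_partition (hook_partition n k) = map (\<lambda>j. if j = 0 then Suc k else 1) [0..<n - k]"
    unfolding conjugate_partition_def fm by (rule map_cong[OF refl]) (simp add: l)
  also have "[0..<n - k] = 0 # [1..<n - k]" using kn by (simp add: upt_conv_Cons)
  also have "map (\<lambda>j. if j = 0 then Suc k else 1) (0 # [1..<n - k]) = Suc k # map (\<lambda>_. 1) [1..<n - k]"
    by simp
  also have "\<dots> = Suc k # replicate (n - k - 1) 1" by (simp add: map_replicate_const)
  finally show ?thesis by simp
qed

lemma young_subgroup_block:
  assumes \<alpha>: "partition_on {1..n} \<alpha>" and B: "B \<in> \<alpha>" and one: "\<And>C. C \<in> \<alpha> \<Longrightarrow> C \<noteq> B \<Longrightarrow> card C = 1"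
  shows "young_subgroup n \<alpha> = {\<sigma>. \<sigma> permutes B}"
proof (intro equalityI subsetI CollectI)
  fix \<sigma> assume "\<sigma> \<in> young_subgroup n \<alpha>"
  then have \<sigma>: "\<sigma> permutes {1..n}" "\<And>C. C \<in> \<alpha> \<Longrightarrow> \<sigma> ` C = C" by (auto simp: young_subgroup_def)
  have "\<sigma> x = x" if x: "x \<in> {1..n} - B" for x
  proof -
    have "x \<in> \<Union>\<alpha>" using partition_onD1[OF \<alpha>] x by blast
    then obtain C where C: "C \<in> \<alpha>" "x \<in> C" by (elim UnionE)
    then have "card C = 1" using one[of C] x by blast
    then have "C = {x}" using C(2) by (auto simp: card_1_singleton_iff)
    then show ?thesis using \<sigma>(2)[OF C(1)] by simp
  qed
  then show "\<sigma> permutes B" by (rule permutes_superset[OF \<sigma>(1)])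
next
  fix \<sigma> assume "\<sigma> \<in> {\<sigma>. \<sigma> permutes B}"
  then have \<sigma>: "\<sigma> permutes B" by simp
  have Bn: "B \<subseteq> {1..n}" using \<alpha> B by (auto simp: partition_on_def)
  have "\<sigma> ` C = C" if C: "C \<in> \<alpha>" for C
  proof (cases "C = B")
    case True
    then show ?thesis using permutes_image[OF \<sigma>] by simp
  next
    case False
    then have "C \<inter> B = {}" using \<alpha> B C by (auto simp: partition_on_def disjoint_def)
    then have "\<sigma> x = x" if "x \<in> C" for x using permutes_not_in[OF \<sigma>] that by blast
    then show ?thesis by simp
  qed
  then show "\<sigma> \<in> young_subgroup n \<alpha>" using permutes_subset[OF \<sigma> Bn] by (simp add: young_subgroup_def)
qed

lemma type_block:
  assumes "\<alpha> \<in> set_partitions_of_type n (conjugate_partition (hook_partition n k))"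
  obtains B where "B \<in> J" "young_subgroup n \<alpha> = {\<sigma>. \<sigma> permutes B}"
proof -
  have \<alpha>: "partition_on {1..n} \<alpha>" and m: "image_mset card (mset_set \<alpha>) = add_mset (Suc k) (replicate_mset (n - k - 1) 1)"
    using assms conjugate_hook by (auto simp: set_partitions_of_type_def)
  have fin: "finite \<alpha>" by (rule finite_elements[OF _ \<alpha>]) simp
  have "Suc k \<in># image_mset card (mset_set \<alpha>)" unfolding m by simp
  then obtain B where B: "B \<in> \<alpha>" "card B = Suc k" using fin by auto
  have "mset_set \<alpha> = add_mset B (mset_set (\<alpha> - {B}))" using fin B(1) by (simp add: mset_set.remove)
  then have r: "image_mset card (mset_set (\<alpha> - {B})) = replicate_mset (n - k - 1) 1" using m B(2) by simp
  have "card C = 1" if "C \<in> \<alpha>" "C \<noteq> B" for C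
  proof -
    have "card C \<in># image_mset card (mset_set (\<alpha> - {B}))" using that fin by auto
    then show ?thesis unfolding r by (simp add: in_replicate_mset split: if_splits)
  qed
  then have "young_subgroup n \<alpha> = {\<sigma>. \<sigma> permutes B}" by (rule young_subgroup_block[OF \<alpha> B(1)])
  moreover have "B \<in> J" using B \<alpha> by (auto simp: J_def partition_on_def)
  ultimately show ?thesis using that by blast
qed

lemma block_type:
  assumes B: "B \<in> J"
  obtains \<alpha> where "\<alpha> \<in> set_partitions_of_type n (conjugate_partition (hook_partition n k))"
    "young_subgroup n \<alpha> = {\<sigma>. \<sigma> permutes B}"
proof -
  let ?S = "(\<lambda>x. {x}) ` ({1..n} - B)"
  define \<alpha> where "\<alpha> = insert B ?S"
  have Bn: "B \<subseteq> {1..n}" "card B = Suc k" using B by (auto simp: J_def)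
  have Bne: "B \<noteq> {}" using Bn by auto
  have nB: "B \<notin> ?S" using Bne by auto
  have p: "partition_on {1..n} \<alpha>"
    unfolding partition_on_def \<alpha>_def disjoint_def using Bn(1) Bne by auto
  have "card ?S = n - k - 1"
    using Bn J_finite[OF B] by (simp add: card_image card_Diff_subset)
  moreover have "image_mset card (mset_set ?S) = image_mset (\<lambda>_. 1) (mset_set ?S)"
    by (rule image_mset_cong) auto
  ultimately have "image_mset card (mset_set \<alpha>) = add_mset (Suc k) (replicate_mset (n - k - 1) 1)"
    using nB Bn(2) unfolding \<alpha>_def by (simp add: image_mset_const_eq)
  then have 1: "\<alpha> \<in> set_partitions_of_type n (conjugate_partition (hook_partition n k))"
    using p conjugate_hook by (simp add: set_partitions_of_type_def)
  have 2: "young_subgroup n \<alpha> = {\<sigma>. \<sigma> permutes B}"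
    by (rule young_subgroup_block[OF p]) (auto simp: \<alpha>_def)
  show ?thesis by (rule that[OF 1 2])
qed

text \<open>The arrangement ranges over generating sets of transpositions, so for each block at
  least one such set has to be exhibited.\<close>

lemma transpositions_generate:
  assumes B: "B \<in> J"
  obtains T where "T \<subseteq> transpositions n" "generate (sym_group n) T = {\<sigma>. \<sigma> permutes B}"
proof -
  define T where "T = {Transposition.transpose a b | a b. a \<in> B \<and> b \<in> B \<and> a \<noteq> b}"
  have Bn: "B \<subseteq> {1..n}" using B by (auto simp: J_def)
  have T1: "T \<subseteq> transpositions n" unfolding T_def transpositions_def using Bn by blast
  have TB: "\<tau> permutes B" if "\<tau> \<in> T" for \<tau> using that unfolding T_def by (auto intro: permutes_swap_id)
  have "generate (sym_group n) T = {\<sigma>. \<sigma> permutes B}"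
  proof (rule equalityI; rule subsetI)
    fix \<sigma> assume "\<sigma> \<in> generate (sym_group n) T"
    then have "\<sigma> permutes B"
    proof (induct rule: generate.induct)
      case (inv h)
      then have "h \<in> carrier (sym_group n)" using T1 transposition_permutes by (auto simp: sym_group_carrier)
      then show ?case using permutes_inv[OF TB[OF inv]] by simp
    next
      case one
      show ?case unfolding sym_group_one by (rule permutes_id)
    next
      case (eng g h)
      show ?case unfolding sym_group_mult by (rule permutes_compose[OF eng(4,2)])
    qed (rule TB)
    then show "\<sigma> \<in> {\<sigma>. \<sigma> permutes B}" by simp
  next
    fix \<sigma> assume "\<sigma> \<in> {\<sigma>. \<sigma> permutes B}"
    then have "\<sigma> permutes B" by simp
    from this J_finite[OF B] show "\<sigma> \<in> generate (sym_group n) T"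
    proof (induct rule: permutes_induct)
      case id
      show ?case using generate.one[of "sym_group n" T] by (simp only: sym_group_one)
    next
      case (swap a b p)
      have "Transposition.transpose a b \<in> T" unfolding T_def using swap(1-3) by blast
      from generate.eng[OF generate.incl[OF this] swap(4)] show ?case by (simp only: sym_group_mult)
    qed
  qed
  from that[OF T1 this] show ?thesis .
qed

lemma arrangement_eq: "intrinsic_arrangement n (hook_partition n k) = K ` J"
proof (intro equalityI subsetI)
  fix H assume "H \<in> intrinsic_arrangement n (hook_partition n k)"
  then obtain \<alpha> T where *: "H = intrinsic_hyperplane n (hook_partition n k) T"
    "\<alpha> \<in> set_partitions_of_type n (conjugate_partition (hook_partition n k))"
    "T \<subseteq> transpositions n" "generate (sym_group n) T = young_subgroup n \<alpha>"
    unfolding intrinsic_arrangement_def by blast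
  obtain B where B: "B \<in> J" "young_subgroup n \<alpha> = {\<sigma>. \<sigma> permutes B}" by (rule type_block[OF *(2)])
  have "H = K B" unfolding *(1) using *(4) B(2) by (intro hyperplane_eq_K[OF B(1) *(3)]) simp
  then show "H \<in> K ` J" using B(1) by blast
next
  fix H assume "H \<in> K ` J"
  then obtain B where B: "B \<in> J" "H = K B" by blast
  obtain \<alpha> where \<alpha>: "\<alpha> \<in> set_partitions_of_type n (conjugate_partition (hook_partition n k))"
    "young_subgroup n \<alpha> = {\<sigma>. \<sigma> permutes B}" by (rule block_type[OF B(1)])
  obtain T where T: "T \<subseteq> transpositions n" "generate (sym_group n) T = {\<sigma>. \<sigma> permutes B}"
    by (rule transpositions_generate[OF B(1)])
  have "H = intrinsic_hyperplane n (hook_partition n k) T" unfolding B(2) by (rule hyperplane_eq_K[OF B(1) T, symmetric])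
  moreover have "generate (sym_group n) T = young_subgroup n \<alpha>" using T(2) \<alpha>(2) by simp
  ultimately show "H \<in> intrinsic_arrangement n (hook_partition n k)"
    unfolding intrinsic_arrangement_def using \<alpha>(1) T(1) by blast
qed

lemma arrangement_complement_eq:
  "arrangement_complement n (hook_partition n k) = top_of_set {v \<in> V. \<forall>B\<in>J. F B v \<noteq> 0}"
proof -
  have "V - \<Union>(K ` J) = {v \<in> V. \<forall>B\<in>J. F B v \<noteq> 0}" by (auto simp: K_def)
  then show ?thesis unfolding arrangement_complement_def arrangement_eq by simp
qed

end

section \<open>Maps of cubes\<close>

text \<open>A cube with countably many coordinates; statements in dimension \<open>m\<close> speak
  of the first \<open>m\<close> only. It is compact by Tychonoff's theorem and lies in the metric
  space \<open>nat \<Rightarrow> real\<close>.\<close>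

definition unit_cube :: "(nat \<Rightarrow> real) set" where
  "unit_cube = {x. \<forall>i. x i \<in> {0..1}}"

lemma compact_unit_cube: "compact unit_cube"
proof -
  have "unit_cube = Pi\<^sub>E UNIV (\<lambda>_. {0..1})" by (auto simp: unit_cube_def PiE_UNIV_domain)
  moreover have "compactin (product_topology (\<lambda>_. euclidean) UNIV) (Pi\<^sub>E UNIV (\<lambda>_::nat. {0..1::real}))"
    unfolding compactin_PiE by simp
  ultimately show ?thesis by (simp add: euclidean_product_topology)
qed

lemma tendsto_coordinatewise:
  fixes f :: "'b \<Rightarrow> 'a \<Rightarrow> 'c::topological_space"
  shows "(f \<longlongrightarrow> l) F \<longleftrightarrow> (\<forall>i. ((\<lambda>c. f c i) \<longlongrightarrow> l i) F)"
  using limitin_componentwise[of "\<lambda>_::'a. euclidean :: 'c topology" UNIV f l F]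
  by (simp add: euclidean_product_topology)

text \<open>Kuhn's combinatorial lemma on a grid of mesh \<open>1 / p\<close>. The labels record
  whether \<open>f\<close> moves a coordinate up or down, and some small cell shows both labels for
  every coordinate.\<close>

lemma brouwer_unit_cube_approx:
  fixes f :: "nat \<Rightarrow> (nat \<Rightarrow> real) \<Rightarrow> real"
  assumes f: "\<And>i x. i < m \<Longrightarrow> x \<in> unit_cube \<Longrightarrow> f i x \<in> {0..1}" and p: "0 < p"
  shows "\<exists>x\<in>unit_cube. \<forall>i<m. \<exists>r\<in>unit_cube. \<exists>s\<in>unit_cube. (\<forall>j. \<bar>r j - x j\<bar> \<le> 1 / real p \<and> \<bar>s j - x j\<bar> \<le> 1 / real p)
    \<and> r i \<le> f i r \<and> f i s \<le> s i"
proof -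
  \<comment> \<open>The minimum with 1 keeps every grid vector in the cube; coordinates from
    \<open>m\<close> on are set to 0.\<close>
  define emb where "emb q = (\<lambda>i. if i < m then min 1 (real (q i) / real p) else 0)" for q :: "nat \<Rightarrow> nat"
  have embU: "emb q \<in> unit_cube" for q by (auto simp: emb_def unit_cube_def)
  define label where "label q i = (if q i = 0 then 0 else if q i \<ge> p then 1 else if emb q i \<le> f i (emb q) then 0 else (1::nat))" for q i
  have l0: "emb q i \<le> f i (emb q)" if "label q i = 0" "i < m" for q i
    using that f[OF that(2) embU, of q] by (auto simp: label_def emb_def split: if_splits)
  have l1: "f i (emb q) \<le> emb q i" if "label q i \<noteq> 0" "i < m" for q i
  proof (cases "q i \<ge> p")
    case True
    then have "emb q i = 1" using that(2) p by (simp add: emb_def min_def)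
    then show ?thesis using f[OF that(2) embU, of q] by simp
  qed (use that in \<open>auto simp: label_def split: if_splits\<close>)
  obtain q where q: "\<forall>i<m. \<exists>r s. (\<forall>j<m. q j \<le> r j \<and> r j \<le> q j + 1) \<and> (\<forall>j<m. q j \<le> s j \<and> s j \<le> q j + 1) \<and> label r i \<noteq> label s i"
    by (rule kuhn_lemma[OF p, of m label]) (use p in \<open>auto simp: label_def\<close>)
  have close: "\<bar>emb r j - emb q j\<bar> \<le> 1 / real p" if "\<forall>j<m. q j \<le> r j \<and> r j \<le> q j + 1" for r j
  proof (cases "j < m")
    case True
    have "real (r j) / p \<le> real (q j) / p + 1 / p" "real (q j) / p \<le> real (r j) / p"
      using that True p by (auto simp: add_divide_distrib[symmetric] divide_right_mono)
    then show ?thesis using True by (auto simp: emb_def min_def)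
  qed (simp add: emb_def)
  show ?thesis
  proof (rule bexI[OF _ embU[of q]], intro allI impI)
    fix i assume i: "i < m"
    obtain r s where rs: "\<forall>j<m. q j \<le> r j \<and> r j \<le> q j + 1" "\<forall>j<m. q j \<le> s j \<and> s j \<le> q j + 1" "label r i \<noteq> label s i"
      using q i by blast
    consider "label r i = 0" "label s i \<noteq> 0" | "label s i = 0" "label r i \<noteq> 0"
      using rs(3) by (auto simp: label_def split: if_splits)
    then show "\<exists>r\<in>unit_cube. \<exists>s\<in>unit_cube. (\<forall>j. \<bar>r j - emb q j\<bar> \<le> 1 / real p \<and> \<bar>s j - emb q j\<bar> \<le> 1 / real p)
        \<and> r i \<le> f i r \<and> f i s \<le> s i"
    proof cases
      case 1
      show ?thesis
        by (rule bexI[OF _ embU[of r]], rule bexI[OF _ embU[of s]]) (intro conjI allI close rs(1,2) l0 l1 1 i)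
    next
      case 2
      show ?thesis
        by (rule bexI[OF _ embU[of s]], rule bexI[OF _ embU[of r]]) (intro conjI allI close rs(1,2) l0 l1 2 i)
    qed
  qed
qed

text \<open>A limit of approximate solutions. The comparison points \<open>r\<close> and
  \<open>s\<close> converge to it as well, and each yields one of the two inequalities.\<close>

lemma brouwer_unit_cube:
  fixes f :: "nat \<Rightarrow> (nat \<Rightarrow> real) \<Rightarrow> real"
  assumes f: "\<And>i x. i < m \<Longrightarrow> x \<in> unit_cube \<Longrightarrow> f i x \<in> {0..1}"
    and cont: "\<And>i. i < m \<Longrightarrow> continuous_on unit_cube (f i)"
  shows "\<exists>x\<in>unit_cube. \<forall>i<m. f i x = x i"
proof -
  have "\<forall>N. \<exists>x\<in>unit_cube. \<forall>i<m. \<exists>r\<in>unit_cube. \<exists>s\<in>unit_cube.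
      (\<forall>j. \<bar>r j - x j\<bar> \<le> 1 / real (Suc N) \<and> \<bar>s j - x j\<bar> \<le> 1 / real (Suc N)) \<and> r i \<le> f i r \<and> f i s \<le> s i"
    using brouwer_unit_cube_approx[where f = f and m = m] f by blast
  then obtain X where X: "\<And>N. X N \<in> unit_cube" "\<And>N i. i < m \<Longrightarrow> \<exists>r\<in>unit_cube. \<exists>s\<in>unit_cube.
      (\<forall>j. \<bar>r j - X N j\<bar> \<le> 1 / real (Suc N) \<and> \<bar>s j - X N j\<bar> \<le> 1 / real (Suc N)) \<and> r i \<le> f i r \<and> f i s \<le> s i"
    by metis
  have "seq_compact unit_cube" using compact_unit_cube by (simp add: compact_eq_seq_compact_metric)
  then obtain l \<sigma> where l: "l \<in> unit_cube" "strict_mono \<sigma>" "(X \<circ> \<sigma>) \<longlonglongrightarrow> l"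
    using X(1) unfolding seq_compact_def by metis
  have z: "(\<lambda>N. 1 / real (Suc (\<sigma> N))) \<longlonglongrightarrow> 0"
    using LIMSEQ_subseq_LIMSEQ[OF lim_1_over_n[THEN LIMSEQ_Suc] l(2)] by (simp add: o_def)
  have near: "R \<longlonglongrightarrow> l" if "\<And>N j. \<bar>R N j - X (\<sigma> N) j\<bar> \<le> 1 / real (Suc (\<sigma> N))" for R
  proof (rule tendsto_coordinatewise[THEN iffD2, rule_format])
    fix j
    have "(\<lambda>N. R N j - X (\<sigma> N) j) \<longlonglongrightarrow> 0"
      by (rule tendsto_0_le[OF z, of _ 1]) (use that in auto)
    moreover have "(\<lambda>N. X (\<sigma> N) j) \<longlonglongrightarrow> l j"
      using l(3) unfolding tendsto_coordinatewise by (simp add: o_def)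
    ultimately have "(\<lambda>N. (R N j - X (\<sigma> N) j) + X (\<sigma> N) j) \<longlonglongrightarrow> 0 + l j" by (rule tendsto_add)
    then show "(\<lambda>N. R N j) \<longlonglongrightarrow> l j" by simp
  qed
  have "f i l = l i" if i: "i < m" for i
  proof -
    obtain R S where RS: "\<And>N. R N \<in> unit_cube" "\<And>N. S N \<in> unit_cube"
      "\<And>N j. \<bar>R N j - X N j\<bar> \<le> 1 / real (Suc N)" "\<And>N j. \<bar>S N j - X N j\<bar> \<le> 1 / real (Suc N)"
      "\<And>N. R N i \<le> f i (R N)" "\<And>N. f i (S N) \<le> S N i"
      using X(2)[OF i] by metis
    have R: "(\<lambda>N. R (\<sigma> N)) \<longlonglongrightarrow> l" and S: "(\<lambda>N. S (\<sigma> N)) \<longlonglongrightarrow> l"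
      by (rule near, use RS(3,4) in blast)+
    have fl: "(\<lambda>N. f i (T N)) \<longlonglongrightarrow> f i l" if "T \<longlonglongrightarrow> l" "\<And>N. T N \<in> unit_cube" for T
      using cont[OF i] l(1) that unfolding continuous_on_sequentially by (auto simp: o_def)
    have "(\<lambda>N. R (\<sigma> N) i) \<longlonglongrightarrow> l i" "(\<lambda>N. S (\<sigma> N) i) \<longlonglongrightarrow> l i"
      using R S unfolding tendsto_coordinatewise by blast+
    then have "l i \<le> f i l" "f i l \<le> l i"
      using LIMSEQ_le[OF _ fl[OF R RS(1)]] LIMSEQ_le[OF fl[OF S RS(2)]] RS(5,6) by blast+
    then show ?thesis by simp
  qed
  then show ?thesis using l(1) by blast
qed

text \<open>Lifts a homotopy through the exponential map, by adding up principal logarithms of quotients of nearby values.\<close>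

lemma log_lift:
  fixes w :: "real \<times> 'a::metric_space \<Rightarrow> complex"
  assumes C: "compact C" and cont: "continuous_on ({0..1} \<times> C) w" and nz: "\<And>q. q \<in> {0..1} \<times> C \<Longrightarrow> w q \<noteq> 0"
    and l: "continuous_on C l" "\<And>x. x \<in> C \<Longrightarrow> exp (l x) = w (0, x)"
  shows "\<exists>g. continuous_on ({0..1} \<times> C) g \<and> (\<forall>q\<in>{0..1} \<times> C. exp (g q) = w q) \<and> (\<forall>x\<in>C. g (0, x) = l x) \<and>
    (\<forall>s\<in>{0..1}. \<forall>x\<in>C. (\<forall>t\<in>{0..1}. w (t, x) = w (0, x)) \<longrightarrow> g (s, x) = l x)"
proof (cases "C = {}")
  case True
  then show ?thesis by simp
next
  case False
  let ?S = "{0..1::real} \<times> C"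
  have S: "compact ?S" using C by (intro compact_Times) auto
  have "continuous_on ?S (\<lambda>q. norm (w q))" by (intro continuous_intros cont)
  moreover have "?S \<noteq> {}" using False by simp
  ultimately have "\<exists>q0\<in>?S. \<forall>q\<in>?S. norm (w q0) \<le> norm (w q)" using continuous_attains_inf[OF S] by blast
  then obtain q0 where q0: "q0 \<in> ?S" "\<And>q. q \<in> ?S \<Longrightarrow> norm (w q0) \<le> norm (w q)" by blast
  \<comment> \<open>With the minimal modulus as tolerance, uniform continuity keeps quotients of
    nearby values within distance 1 of 1, away from the slit of \<open>Ln\<close>.\<close>
  let ?\<delta> = "norm (w q0)"
  have \<delta>: "0 < ?\<delta>" using nz[OF q0(1)] by simp
  have "\<forall>e>0. \<exists>d>0. \<forall>q\<in>?S. \<forall>q'\<in>?S. dist q' q < d \<longrightarrow> dist (w q') (w q) < e"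
    using compact_uniformly_continuous[OF cont S] by (simp only: uniformly_continuous_on_def)
  from this[rule_format, OF \<delta>]
  obtain d where d: "0 < d" "\<forall>q\<in>?S. \<forall>q'\<in>?S. dist q' q < d \<longrightarrow> dist (w q') (w q) < ?\<delta>" by (elim exE conjE)
  obtain N where N: "inverse (real (Suc N)) < d" using reals_Archimedean[OF d(1)] by blast
  \<comment> \<open>The time interval from 0 to \<open>fst q\<close> is cut into
    \<open>N + 1\<close> equal parts; the quotients along them telescope.\<close>
  define P where "P i q = (real i * fst q / real (Suc N), snd q)" for i and q :: "real \<times> 'a"
  have PS: "P i q \<in> ?S" if "i \<le> Suc N" "q \<in> ?S" for i q
  proof -
    have "real i * fst q \<le> real (Suc N) * 1" using that by (intro mult_mono) auto
    then show ?thesis using that by (auto simp: P_def mem_Times_iff divide_simps)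
  qed
  have P0: "P 0 q = (0, snd q)" and PN: "P (Suc N) q = q" for q by (auto simp: P_def)
  have ratio: "w (P (Suc i) q) / w (P i q) \<notin> \<real>\<^sub>\<le>\<^sub>0" if "i \<le> N" "q \<in> ?S" for i q
  proof -
    have a: "P i q \<in> ?S" "P (Suc i) q \<in> ?S" using PS that by auto
    have e: "real (Suc i) * fst q / real (Suc N) - real i * fst q / real (Suc N) = fst q / real (Suc N)"
      unfolding diff_divide_distrib[symmetric] left_diff_distrib[symmetric] by simp
    have "dist (P (Suc i) q) (P i q) = \<bar>fst q / real (Suc N)\<bar>"
      unfolding P_def dist_Pair_Pair dist_real_def e by simp
    also have "\<dots> = fst q / real (Suc N)" using that(2) by (auto simp: mem_Times_iff)
    also have "\<dots> \<le> inverse (real (Suc N))"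
      unfolding inverse_eq_divide using that(2) by (intro divide_right_mono) (auto simp: mem_Times_iff)
    finally have "dist (w (P (Suc i) q)) (w (P i q)) < norm (w q0)" using d(2)[rule_format, OF a] N by simp
    also have "\<dots> \<le> norm (w (P i q))" by (rule q0(2)[OF a(1)])
    finally have "norm (w (P (Suc i) q) / w (P i q) - 1) < 1"
      using nz[OF a(1)] diff_divide_distrib[of "w (P (Suc i) q)" "w (P i q)" "w (P i q)"]
      by (simp add: dist_norm) (metis divide_less_eq_1_pos norm_divide zero_less_norm_iff)
    then have "\<bar>Re (w (P (Suc i) q) / w (P i q) - 1)\<bar> < 1" by (rule order_le_less_trans[OF abs_Re_le_cmod])
    then show ?thesis by (auto simp: complex_nonpos_Reals_iff)
  qed
  define g where "g q = l (snd q) + (\<Sum>i\<le>N. Ln (w (P (Suc i) q) / w (P i q)))" for q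
  have contP: "continuous_on ?S (\<lambda>q. w (P i q))" if "i \<le> Suc N" for i
    by (rule continuous_on_compose2[OF cont]) (use PS[OF that] in \<open>auto simp: P_def intro!: continuous_intros\<close>)
  have 1: "continuous_on ?S g"
    unfolding g_def
  proof (intro continuous_intros contP)
    show "continuous_on ?S (\<lambda>q. l (snd q))" by (rule continuous_on_compose2[OF l(1)]) (auto intro: continuous_intros)
  qed (use ratio nz PS in auto)
  have tele: "exp (\<Sum>i<j. Ln (w (P (Suc i) q) / w (P i q))) = w (P j q) / w (P 0 q)" if "j \<le> Suc N" "q \<in> ?S" for j q
    using that(1)
  proof (induct j)
    case 0
    then show ?case using nz[OF PS[OF _ that(2)], of 0] by simp
  next
    case (Suc j)
    have "w (P (Suc j) q) \<noteq> 0" "w (P j q) \<noteq> 0" using nz[OF PS[OF _ that(2)]] Suc(2) by auto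
    then show ?case using Suc by (simp add: exp_add)
  qed
  have 2: "exp (g q) = w q" if q: "q \<in> ?S" for q
  proof -
    have "w (P 0 q) = exp (l (snd q))" using l(2)[of "snd q"] q by (auto simp: P0)
    then show ?thesis
      using tele[OF order_refl q] by (simp add: g_def exp_add lessThan_Suc_atMost PN)
  qed
  have 3: "g (0, x) = l x" if x: "x \<in> C" for x
    using nz[of "(0, x)"] x by (simp add: g_def P_def)
  have 4: "g (s, x) = l x" if "s \<in> {0..1}" "x \<in> C" and c: "\<And>t. t \<in> {0..1} \<Longrightarrow> w (t, x) = w (0, x)" for s x
  proof -
    have "w (P i (s, x)) = w (0, x)" if i: "i \<le> Suc N" for i
    proof -
      have "P i (s, x) \<in> ?S" using PS[OF i, of "(s, x)"] \<open>s \<in> {0..1}\<close> \<open>x \<in> C\<close> by blast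
      then have "real i * s / real (Suc N) \<in> {0..1}" by (simp add: P_def del: of_nat_Suc)
      from c[OF this] show ?thesis by (simp add: P_def)
    qed
    then show ?thesis using nz[of "(0, x)"] \<open>x \<in> C\<close> by (simp add: g_def)
  qed
  show ?thesis
  proof (intro exI[of _ g] conjI ballI impI)
    fix s :: real and x assume "s \<in> {0..1}" "x \<in> C" "\<forall>t\<in>{0..1}. w (t, x) = w (0, x)"
    then show "g (s, x) = l x" by (intro 4) blast+
  qed (rule 1 2 3, assumption?)+
qed

text \<open>Different logarithms of one number are at least \<open>2 * pi\<close> apart, so the
  range of \<open>h\<close> is discrete.\<close>

lemma log_unique_on_connected:
  fixes h :: "'a::topological_space \<Rightarrow> complex"
  assumes "connected S" "continuous_on S h" "\<And>x y. x \<in> S \<Longrightarrow> y \<in> S \<Longrightarrow> exp (h x) = exp (h y)" "a \<in> S" "b \<in> S"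
  shows "h a = h b"
proof -
  have "h constant_on S"
  proof (rule continuous_discrete_range_constant[OF assms(1,2)])
    fix x assume x: "x \<in> S"
    show "\<exists>e>0. \<forall>y. y \<in> S \<and> h y \<noteq> h x \<longrightarrow> e \<le> norm (h y - h x)"
    proof (intro exI[of _ "2 * pi"] conjI allI impI)
      fix y assume y: "y \<in> S \<and> h y \<noteq> h x"
      then have "exp (h y) = exp (h x)" using assms(3) x by blast
      then obtain m :: int where m: "h y = h x + (of_int (2 * m) * pi) * \<i>" unfolding exp_eq by blast
      then have "m \<noteq> 0" using y by auto
      then have "1 \<le> \<bar>real_of_int m\<bar>" by linarith
      then have "2 * pi * 1 \<le> 2 * pi * \<bar>real_of_int m\<bar>" by (intro mult_left_mono) auto
      then show "2 * pi \<le> norm (h y - h x)" unfolding m by (simp add: norm_mult mult_ac)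
    qed simp
  qed
  then show ?thesis using assms(4,5) by (auto simp: constant_on_def)
qed

subsection \<open>A sphere with prescribed arguments\<close>

definition bt :: "real \<Rightarrow> real" where "bt t = max 0 (\<bar>t\<bar> - 1/2)"

text \<open>A thick shell instead of the boundary of the cube of side 2 about 0: some coordinate
  exceeds 1/2 in modulus, which is where \<open>bt\<close> is positive. Maps into it need not be
  normalised.\<close>

definition sphere_dom :: "nat \<Rightarrow> (nat \<Rightarrow> real) set" where
  "sphere_dom k = {p. (\<forall>j\<le>k. \<bar>p j\<bar> \<le> 1) \<and> (\<exists>j\<le>k. 1/2 < \<bar>p j\<bar>)}"

text \<open>For the rotated number, imaginary part times \<open>sin \<theta>\<close> plus real part
  times \<open>cos \<theta>\<close> is \<open>Re z\<close>, and both trigonometric factors are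
  nonnegative.\<close>

lemma rotate_half_plane:
  assumes z: "0 < Re z" and \<theta>: "0 \<le> \<theta>" "\<theta> \<le> pi / 2"
  shows "0 < Im (z * cis \<theta>) \<or> 0 < Re (z * cis \<theta>)"
proof (rule ccontr)
  assume "\<not> ?thesis"
  then have a: "Re z * sin \<theta> + Im z * cos \<theta> \<le> 0" "Re z * cos \<theta> - Im z * sin \<theta> \<le> 0" by (auto simp: algebra_simps)
  have s: "0 \<le> sin \<theta>" "0 \<le> cos \<theta>" using \<theta> by (auto intro: sin_ge_zero cos_ge_zero)
  have "(Re z * sin \<theta> + Im z * cos \<theta>) * sin \<theta> + (Re z * cos \<theta> - Im z * sin \<theta>) * cos \<theta> \<le> 0"
    by (rule add_nonpos_nonpos[OF mult_nonpos_nonneg[OF a(1) s(1)] mult_nonpos_nonneg[OF a(2) s(2)]])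
  moreover have "(Re z * sin \<theta> + Im z * cos \<theta>) * sin \<theta> + (Re z * cos \<theta> - Im z * sin \<theta>) * cos \<theta>
      = Re z * ((sin \<theta>)\<^sup>2 + (cos \<theta>)\<^sup>2)" by algebra
  ultimately show False using z by simp
qed

lemma half_plane_Ln:
  assumes q: "0 < Im q \<or> 0 < Re q"
  shows "q \<notin> \<real>\<^sub>\<le>\<^sub>0" "- (pi / 2) < Im (Ln q)"
proof -
  show "q \<notin> \<real>\<^sub>\<le>\<^sub>0" using q by (auto simp: complex_nonpos_Reals_iff)
  have "q \<noteq> 0" using q by auto
  then show "- (pi / 2) < Im (Ln q)"
    using q Re_Ln_pos_lt_imp[of q] Im_Ln_pos_lt_imp[of q] pi_gt_zero by fastforce
qed

text \<open>The moduli of the summands with \<open>\<bar>p j\<bar> > 1/2\<close> can be enlarged, along directions close to \<open>-1\<close>, until the sum is \<open>-1\<close>;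
  this does not move their arguments across \<open>0\<close>.\<close>

lemma sphere_logarithms:
  fixes k :: nat
  shows "\<exists>l :: nat \<Rightarrow> (nat \<Rightarrow> real) \<Rightarrow> complex. (\<forall>j\<le>k. continuous_on (sphere_dom k) (l j)) \<and>
    (\<forall>p\<in>sphere_dom k. (\<Sum>j\<le>k. exp (l j p)) = -1) \<and>
    (\<forall>j\<le>k. \<forall>p\<in>sphere_dom k. norm (exp (l j p)) \<le> 2 \<and> sgn (Im (l j p)) = sgn (p j))"
proof -
  \<comment> \<open>Chosen so that \<open>Z\<close> has modulus at most 1/2, hence
    \<open>Re (1 + Z p) > 0\<close>; the bound on the summands is then
    \<open>1/2 + 3/2 = 2\<close>.\<close>
  define \<eta> where "\<eta> = 1 / (2 * real (Suc k))"
  have \<eta>: "0 < \<eta>" "\<eta> \<le> 1/2" "\<eta> * real (Suc k) = 1/2" by (auto simp: \<eta>_def field_simps)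
  define Z where "Z p = complex_of_real \<eta> * (\<Sum>i\<le>k. cis (pi * p i))" for p :: "nat \<Rightarrow> real"
  define S where "S p = (\<Sum>i\<le>k. bt (p i))" for p :: "nat \<Rightarrow> real"
  \<comment> \<open>The summand is to be \<open>\<eta> * cis (pi * p j)\<close> minus
    \<open>(1 + Z p) * bt (p j) / S p\<close>: the first parts add up to \<open>Z p\<close>, the
    second to \<open>1 + Z p\<close>. \<open>Q j p\<close> is the summand divided by
    \<open>cis (pi * p j)\<close>, and it avoids the slit of \<open>Ln\<close>.\<close>
  define Q where "Q j p = complex_of_real \<eta> + (- (1 + Z p) * cis (- pi * p j)) * of_real (bt (p j) / S p)" for j p
  define l where "l j p = \<i> * of_real (pi * p j) + Ln (Q j p)" for j p
  have bt0: "0 \<le> bt t" for t by (simp add: bt_def)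
  have Sp: "0 < S p" if "p \<in> sphere_dom k" for p
  proof -
    have "\<exists>j\<le>k. 1/2 < \<bar>p j\<bar>" using that unfolding sphere_dom_def mem_Collect_eq by (rule conjunct2)
    then obtain j where j: "j \<le> k" "1/2 < \<bar>p j\<bar>" by (elim exE conjE)
    have "0 < bt (p j)" using j(2) by (simp add: bt_def)
    then show ?thesis unfolding S_def by (intro sum_pos2[of "{..k}" j]) (use j(1) bt0 in simp_all)
  qed
  have nZ: "norm (Z p) \<le> 1/2" for p
  proof -
    have "norm (\<Sum>i\<le>k. cis (pi * p i)) \<le> (\<Sum>i\<le>k. 1)" by (rule sum_norm_le) simp
    then have "\<eta> * norm (\<Sum>i\<le>k. cis (pi * p i)) \<le> \<eta> * real (Suc k)" using \<eta>(1) by (intro mult_left_mono) auto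
    moreover have "norm (Z p) = \<eta> * norm (\<Sum>i\<le>k. cis (pi * p i))" using \<eta>(1) by (simp add: Z_def norm_mult)
    ultimately show ?thesis unfolding \<eta>(3) by simp
  qed
  have ReZ: "0 < Re (1 + Z p)" for p using nZ[of p] abs_Re_le_cmod[of "Z p"] by simp
  have Q0: "Q j p = of_real \<eta>" if "\<bar>p j\<bar> \<le> 1/2" for j p using that by (simp add: Q_def bt_def)
  have ratio: "0 \<le> bt (p j) / S p" if "p \<in> sphere_dom k" for p j using bt0 Sp[OF that] by (simp add: less_imp_le)
  have shift: "q \<noteq> 0 \<longrightarrow> 0 < Im (of_real \<eta> + w * of_real q) \<or> 0 < Re (of_real \<eta> + w * of_real q)"
    if "0 < Im w \<or> 0 < Re w" "0 \<le> q" for w q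
    using that \<eta>(1) by (auto intro: add_pos_nonneg)
  have Qpos: "0 < Im (Q j p) \<or> 0 < Re (Q j p)" if p: "p \<in> sphere_dom k" "j \<le> k" "0 \<le> p j" for j p
  proof (cases "p j \<le> 1/2")
    case True
    then show ?thesis using Q0[of p j] p(3) \<eta>(1) by simp
  next
    case False
    have "p j \<le> 1" using p by (auto simp: sphere_dom_def)
    \<comment> \<open>The correction in \<open>Q\<close> is \<open>1 + Z p\<close>, which lies in
      the right half-plane, turned by \<open>pi * (1 - p j)\<close>; since \<open>p j > 1/2\<close>,
      this is at most a right angle.\<close>
    then have b: "0 \<le> pi * (1 - p j)" "pi * (1 - p j) \<le> pi / 2" using False by (auto simp: field_simps)
    have "cis (pi * (1 - p j)) = - cis (- pi * p j)"
      by (simp add: complex_eq_iff right_diff_distrib cos_diff sin_diff)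
    then have "- (1 + Z p) * cis (- pi * p j) = (1 + Z p) * cis (pi * (1 - p j))"
      by (simp only: mult_minus_left mult_minus_right)
    moreover have "bt (p j) / S p \<noteq> 0" using False Sp[OF p(1)] by (auto simp: bt_def)
    ultimately show ?thesis unfolding Q_def
      using shift[OF rotate_half_plane[OF ReZ[of p] b] ratio[OF p(1), of j]] by simp
  qed
  have Qneg: "0 < Im (cnj (Q j p)) \<or> 0 < Re (cnj (Q j p))" if p: "p \<in> sphere_dom k" "j \<le> k" "p j \<le> 0" for j p
  proof (cases "- 1/2 \<le> p j")
    case True
    then show ?thesis using Q0[of p j] p(3) \<eta>(1) by simp
  next
    case False
    have "- 1 \<le> p j" using p by (auto simp: sphere_dom_def)
    then have b: "0 \<le> pi * (1 + p j)" "pi * (1 + p j) \<le> pi / 2"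
      using False mult_left_mono[of "1 + p j" "1/2" pi] by auto
    have "cis (pi * (1 + p j)) = - cis (pi * p j)"
      by (simp add: complex_eq_iff distrib_left cos_add sin_add)
    then have "cnj (- (1 + Z p) * cis (- pi * p j)) = cnj (1 + Z p) * cis (pi * (1 + p j))"
      using cis_cnj[of "- pi * p j"] by (simp only: complex_cnj_mult complex_cnj_minus mult_minus_left mult_minus_right minus_minus)
    moreover have "bt (p j) / S p \<noteq> 0" using False Sp[OF p(1)] by (auto simp: bt_def)
    moreover have "0 < Re (cnj (1 + Z p))" using ReZ[of p] by simp
    moreover have "cnj (Q j p) = of_real \<eta> + cnj (- (1 + Z p) * cis (- pi * p j)) * of_real (bt (p j) / S p)"
      unfolding Q_def by (simp only: complex_cnj_add complex_cnj_mult complex_cnj_complex_of_real)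
    ultimately show ?thesis
      using shift[OF rotate_half_plane[OF _ b] ratio[OF p(1), of j], of "cnj (1 + Z p)"] by simp
  qed
  have Qslit: "Q j p \<notin> \<real>\<^sub>\<le>\<^sub>0" if p: "p \<in> sphere_dom k" "j \<le> k" for j p
  proof (cases "0 \<le> p j")
    case True
    then show ?thesis using half_plane_Ln(1) Qpos[OF p] by blast
  next
    case False
    then have "cnj (Q j p) \<notin> \<real>\<^sub>\<le>\<^sub>0" using half_plane_Ln(1) Qneg[OF p] by simp
    then show ?thesis by (auto simp: complex_nonpos_Reals_iff)
  qed
  have el: "exp (l j p) = of_real \<eta> * cis (pi * p j) - (1 + Z p) * of_real (bt (p j) / S p)"
    if p: "p \<in> sphere_dom k" "j \<le> k" for j p
  proof -
    have "Q j p \<noteq> 0" using Qslit[OF p] by auto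
    then have "exp (l j p) = cis (pi * p j) * Q j p" by (simp add: l_def exp_add cis_conv_exp)
    also have "\<dots> = of_real \<eta> * cis (pi * p j) - (1 + Z p) * (cis (pi * p j) * cis (- pi * p j)) * of_real (bt (p j) / S p)"
      by (simp add: Q_def algebra_simps)
    also have "cis (pi * p j) * cis (- pi * p j) = 1" by (simp add: cis_mult)
    finally show ?thesis by simp
  qed
  have 1: "continuous_on (sphere_dom k) (l j)" if j: "j \<le> k" for j
  proof -
    have c: "continuous_on (sphere_dom k) (\<lambda>p. p i)" for i by (rule continuous_on_product_then_coordinatewise[OF continuous_on_id])
    have cb: "continuous_on (sphere_dom k) (\<lambda>p. bt (p i))" for i unfolding bt_def by (intro continuous_intros c)
    have cS: "continuous_on (sphere_dom k) S" unfolding S_def by (intro continuous_intros cb)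
    have ccis: "continuous_on (sphere_dom k) (\<lambda>p. cis (pi * p i))" for i by (intro continuous_intros c)
    have ccis': "continuous_on (sphere_dom k) (\<lambda>p. cis (- pi * p i))" for i by (intro continuous_intros c)
    have cZ: "continuous_on (sphere_dom k) Z" unfolding Z_def by (intro continuous_intros ccis)
    have cQ: "continuous_on (sphere_dom k) (Q j)"
      unfolding Q_def by (intro continuous_intros cZ ccis' cb cS) (use Sp in force)
    show ?thesis unfolding l_def by (intro continuous_intros c cQ) (use Qslit j in auto)
  qed
  have 2: "(\<Sum>j\<le>k. exp (l j p)) = -1" if p: "p \<in> sphere_dom k" for p
  proof -
    have "(\<Sum>j\<le>k. exp (l j p)) = (\<Sum>j\<le>k. of_real \<eta> * cis (pi * p j) - (1 + Z p) * of_real (bt (p j) / S p))"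
      by (rule sum.cong[OF refl]) (use el[OF p] in simp)
    also have "\<dots> = Z p - (1 + Z p) * of_real (S p / S p)"
      unfolding sum_subtractf Z_def[of p] sum_distrib_left[symmetric] of_real_sum[symmetric] sum_divide_distrib[symmetric]
      by (simp only: S_def)
    also have "\<dots> = -1" using Sp[OF p] by simp
    finally show ?thesis .
  qed
  have 3: "norm (exp (l j p)) \<le> 2" if j: "j \<le> k" and p: "p \<in> sphere_dom k" for j p
  proof -
    have "bt (p j) \<le> S p" unfolding S_def using bt0 j by (intro member_le_sum) auto
    then have r: "\<bar>bt (p j) / S p\<bar> \<le> 1" using Sp[OF p] bt0[of "p j"] by simp
    have "norm (1 + Z p) \<le> 3/2" using norm_triangle_ineq[of 1 "Z p"] nZ[of p] by simp
    then have "norm (1 + Z p) * \<bar>bt (p j) / S p\<bar> \<le> 3/2 * 1" using r by (intro mult_mono) auto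
    moreover have "norm (exp (l j p)) \<le> norm (of_real \<eta> * cis (pi * p j)) + norm ((1 + Z p) * of_real (bt (p j) / S p))"
      unfolding el[OF p j] by (rule norm_triangle_ineq4)
    ultimately show ?thesis using \<eta> by (simp only: norm_mult norm_of_real norm_cis abs_of_pos)
  qed
  have 4: "sgn (Im (l j p)) = sgn (p j)" if j: "j \<le> k" and p: "p \<in> sphere_dom k" for j p
  proof -
    have Im: "Im (l j p) = pi * p j + Im (Ln (Q j p))" by (simp add: l_def)
    consider "\<bar>p j\<bar> \<le> 1/2" | "1/2 < p j" | "p j < - 1/2" by linarith
    then show ?thesis
    proof cases
      case 1
      have "Ln (complex_of_real \<eta>) = of_real (ln \<eta>)" using \<eta>(1) by (rule Ln_of_real)
      then show ?thesis using Im Q0[of p j, OF 1] by (simp add: sgn_mult)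
    next
      case 2
      then have "- (pi / 2) < Im (Ln (Q j p))" using half_plane_Ln(2) Qpos[OF p j] by simp
      moreover have "pi / 2 < pi * p j" using 2 by (simp add: field_simps)
      ultimately have "0 < Im (l j p)" using Im by linarith
      then show ?thesis using 2 by simp
    next
      case 3
      then have "- (pi / 2) < Im (Ln (cnj (Q j p)))" using half_plane_Ln(2) Qneg[OF p j] by simp
      moreover have "Ln (cnj (Q j p)) = cnj (Ln (Q j p))"
        using cnj_Ln[OF Qslit[OF p j]] by simp
      moreover have "pi * p j < - (pi / 2)" using 3 mult_strict_left_mono[of "p j" "- 1/2" pi] by simp
      ultimately have "Im (l j p) < 0" using Im by simp
      then show ?thesis using 3 by simp
    qed
  qed
  show ?thesis
    by (rule exI[of _ l]) (intro conjI allI impI ballI 1 2 3 4)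
qed

subsection \<open>The sphere cannot be filled\<close>

definition clamp1 :: "real \<Rightarrow> real" where "clamp1 t = max (-1) (min 1 t)"

lemma clamp1: "\<bar>clamp1 t\<bar> \<le> 1" "sgn (clamp1 t) = sgn t" "1/2 < \<bar>t\<bar> \<Longrightarrow> 1/2 < \<bar>clamp1 t\<bar>" "1 \<le> \<bar>t\<bar> \<Longrightarrow> \<bar>clamp1 t\<bar> = 1"
  by (auto simp: clamp1_def max_def min_def sgn_if)

lemma continuous_on_clamp1 [continuous_intros]: "continuous_on S f \<Longrightarrow> continuous_on S (\<lambda>x. clamp1 (f x))"
  unfolding clamp1_def by (intro continuous_intros)

text \<open>Collapses the boundary of the \<open>k\<close>-cube to the south pole
  \<open>base_pt k\<close>. \<open>D\<close> is 0 on the boundary and 1 at the centre, and the last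
  coordinate grows with it from -1 to 1. The factor \<open>4 * real k\<close> makes another
  coordinate exceed 1/2 in modulus wherever the last one does not.\<close>

definition wrap :: "nat \<Rightarrow> (nat \<Rightarrow> real) \<Rightarrow> nat \<Rightarrow> real" where
  "wrap k x = (let D = \<Prod>i<k. (1 - (2 * x i - 1)\<^sup>2) in
     (\<lambda>j. if j < k then clamp1 (4 * real k * D * (2 * x j - 1)) else if j = k then clamp1 (4 * D - 2) else 0))"

definition base_pt :: "nat \<Rightarrow> nat \<Rightarrow> real" where
  "base_pt k = (\<lambda>j. if j = k then -1 else 0)"

lemma wrap_boundary:
  assumes "i < k" "x i = 0 \<or> x i = 1"
  shows "wrap k x = base_pt k"
proof -
  have "(\<Prod>i<k. (1 - (2 * x i - 1)\<^sup>2)) = 0" using assms by (intro prod_zero[OF _ bexI[of _ i]]) auto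
  then show ?thesis unfolding wrap_def Let_def base_pt_def clamp1_def by (intro ext) (simp only: mult_zero_left mult_zero_right, simp)
qed

lemma continuous_on_wrap: "continuous_on S (wrap k)"
proof (rule continuous_on_coordinatewise_then_product)
  fix j
  have c: "continuous_on S (\<lambda>x. x i)" for i by (rule continuous_on_product_then_coordinatewise[OF continuous_on_id])
  show "continuous_on S (\<lambda>x. wrap k x j)"
    unfolding wrap_def Let_def by (cases "j < k"; cases "j = k") (simp_all, (intro continuous_intros c)+)
qed

lemma wrap_sphere_dom:
  assumes x: "x \<in> unit_cube"
  shows "wrap k x \<in> sphere_dom k"
proof -
  let ?t = "\<lambda>i. (2 * x i - 1)\<^sup>2"
  define D where "D = (\<Prod>i<k. (1 - ?t i))"
  have xi: "\<bar>2 * x i - 1\<bar> \<le> 1" for i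
  proof -
    have "0 \<le> x i" "x i \<le> 1" using x by (auto simp: unit_cube_def)
    then show ?thesis by (auto simp: abs_if)
  qed
  have t: "?t i \<le> 1" for i using abs_square_le_1[of "2 * x i - 1"] xi[of i] by simp
  have wk: "wrap k x k = clamp1 (4 * D - 2)" by (simp add: wrap_def D_def Let_def)
  have wj: "wrap k x j = clamp1 (4 * real k * D * (2 * x j - 1))" if "j < k" for j
    using that by (simp add: wrap_def D_def Let_def)
  have "\<exists>j\<le>k. 1/2 < \<bar>wrap k x j\<bar>"
  proof (cases "1/2 < \<bar>4 * D - 2\<bar>")
    case True
    then show ?thesis using clamp1(3) wk by (intro exI[of _ k]) simp
  next
    case False
    then have D: "3/8 \<le> D" "D \<le> 5/8" by (auto simp: abs_if split: if_splits)
    have "1 - (\<Sum>i<k. ?t i) \<le> D"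
      unfolding D_def by (rule Weierstrass_prod_ineq) (use t in auto)
    then have "3/8 \<le> (\<Sum>i<k. ?t i)" using D(2) by simp
    have "\<exists>j<k. 3/8 \<le> real k * ?t j"
    proof (rule ccontr)
      assume "\<not> ?thesis"
      then have lt: "real k * ?t j < 3/8" if "j < k" for j using that by (auto simp: not_le)
      have k0: "0 < k"
      proof (rule ccontr)
        assume "\<not> 0 < k"
        then show False using \<open>3/8 \<le> (\<Sum>i<k. ?t i)\<close> by simp
      qed
      have "(\<Sum>i<k. real k * ?t i) < (\<Sum>i<k. 3/8)" using lt k0 by (intro sum_strict_mono) auto
      then have "real k * (\<Sum>i<k. ?t i) < real k * (3/8)" by (simp add: sum_distrib_left)
      then show False using \<open>3/8 \<le> (\<Sum>i<k. ?t i)\<close> k0 by simp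
    qed
    then obtain j where j: "j < k" "3/8 \<le> real k * ?t j" by blast
    have "?t j \<le> \<bar>2 * x j - 1\<bar>"
      using mult_left_le[of "\<bar>2 * x j - 1\<bar>" "\<bar>2 * x j - 1\<bar>"] xi[of j] by (simp add: power2_eq_square abs_mult_self_eq)
    then have "real k * ?t j \<le> real k * \<bar>2 * x j - 1\<bar>" by (rule mult_left_mono) simp
    \<comment> \<open>With the factor 4 of \<open>wrap\<close> this gives 9/16, just above
      1/2.\<close>
    then have "3/8 * (3/8) \<le> D * (real k * \<bar>2 * x j - 1\<bar>)" using j(2) D(1) by (intro mult_mono) auto
    moreover have "\<bar>4 * real k * D * (2 * x j - 1)\<bar> = 4 * (D * (real k * \<bar>2 * x j - 1\<bar>))"
      unfolding abs_mult using D(1) by (simp only: abs_of_nonneg abs_of_nat abs_numeral) simp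
    ultimately have "1/2 < \<bar>4 * real k * D * (2 * x j - 1)\<bar>" by linarith
    then show ?thesis using clamp1(3) wj[OF j(1)] j(1) by (intro exI[of _ j]) simp
  qed
  then show ?thesis using clamp1(1) by (auto simp: sphere_dom_def wrap_def Let_def)
qed

lemma base_pt_sphere_dom: "base_pt k \<in> sphere_dom k"
  by (auto simp: base_pt_def sphere_dom_def)

text \<open>The coordinate \<open>x k\<close> of a \<open>(k + 1)\<close>-cube serves as homotopy
  time. If the lifted arguments \<open>A\<close> had no common zero, scaling and clamping would turn
  \<open>A\<close> into a map to the boundary of the cube, and its signs on the faces exclude a
  fixed point of the reflected map.\<close>

lemma no_filling:
  fixes l :: "nat \<Rightarrow> (nat \<Rightarrow> real) \<Rightarrow> complex" and w :: "nat \<Rightarrow> real \<times> (nat \<Rightarrow> real) \<Rightarrow> complex"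
  assumes k: "0 < k"
    and l: "\<And>j. j \<le> k \<Longrightarrow> continuous_on (sphere_dom k) (l j)"
      "\<And>j p. j \<le> k \<Longrightarrow> p \<in> sphere_dom k \<Longrightarrow> sgn (Im (l j p)) = sgn (p j)"
    and w: "\<And>j. j \<le> k \<Longrightarrow> continuous_on ({0..1} \<times> unit_cube) (w j)"
      "\<And>j q. j \<le> k \<Longrightarrow> q \<in> {0..1} \<times> unit_cube \<Longrightarrow> w j q \<noteq> 0"
      "\<And>q. q \<in> {0..1} \<times> unit_cube \<Longrightarrow> (\<Sum>j\<le>k. w j q) = -1"
      "\<And>j x. j \<le> k \<Longrightarrow> x \<in> unit_cube \<Longrightarrow> w j (0, x) = exp (l j (wrap k x))"
      "\<And>j x. j \<le> k \<Longrightarrow> x \<in> unit_cube \<Longrightarrow> w j (1, x) = exp (l j (base_pt k))"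
      "\<And>i j s x. i < k \<Longrightarrow> j \<le> k \<Longrightarrow> s \<in> {0..1} \<Longrightarrow> x \<in> unit_cube \<Longrightarrow> x i = 0 \<or> x i = 1 \<Longrightarrow> w j (s, x) = w j (0, x)"
  shows False
proof -
  let ?S = "{0..1::real} \<times> unit_cube"
  let ?P = "\<lambda>j g. continuous_on ?S g \<and> (\<forall>q\<in>?S. exp (g q) = w j q) \<and> (\<forall>x\<in>unit_cube. g (0, x) = l j (wrap k x)) \<and>
      (\<forall>s\<in>{0..1}. \<forall>x\<in>unit_cube. (\<forall>t\<in>{0..1}. w j (t, x) = w j (0, x)) \<longrightarrow> g (s, x) = l j (wrap k x))"
  have "\<exists>g. ?P j g" if j: "j \<in> {..k}" for j
  proof (rule log_lift[OF compact_unit_cube w(1)])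
    show "continuous_on unit_cube (\<lambda>x. l j (wrap k x))"
      by (rule continuous_on_compose2[OF l(1) continuous_on_wrap]) (use wrap_sphere_dom j in auto)
  qed (use j w(2,4) in simp_all)
  then have "\<forall>j\<in>{..k}. \<exists>g. ?P j g" by (rule ballI)
  from bchoice[OF this] obtain g where gP: "\<forall>j\<in>{..k}. ?P j (g j)" by (elim exE)
  have g: "\<And>j. j \<le> k \<Longrightarrow> continuous_on ?S (g j)" "\<And>j q. j \<le> k \<Longrightarrow> q \<in> ?S \<Longrightarrow> exp (g j q) = w j q"
      "\<And>j x. j \<le> k \<Longrightarrow> x \<in> unit_cube \<Longrightarrow> g j (0, x) = l j (wrap k x)"
      "\<And>j s x. j \<le> k \<Longrightarrow> s \<in> {0..1} \<Longrightarrow> x \<in> unit_cube \<Longrightarrow> \<forall>t\<in>{0..1}. w j (t, x) = w j (0, x) \<Longrightarrow> g j (s, x) = l j (wrap k x)"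
    using gP by (simp_all only: atMost_iff)
  have side: "g j (s, x) = l j (base_pt k)" if "i < k" "j \<le> k" "s \<in> {0..1}" "x \<in> unit_cube" "x i = 0 \<or> x i = 1" for i j s x
  proof -
    have "\<forall>t\<in>{0..1}. w j (t, x) = w j (0, x)" by (rule ballI, rule w(6)[OF that(1,2) _ that(4,5)])
    from g(4)[OF that(2-4) this] show ?thesis unfolding wrap_boundary[of i k x, OF that(1,5)] .
  qed
  \<comment> \<open>On the end face \<open>w\<close> is constant, so the lift is constant along
    every segment in direction 0 and takes the value known on the side face.\<close>
  have floor: "g j (1, x) = l j (base_pt k)" if j: "j \<le> k" and x: "x \<in> unit_cube" for j x
  proof -
    have c: "continuous_on {0..1} (\<lambda>t. (1::real, x(0 := t)))"
    proof (intro continuous_intros continuous_on_coordinatewise_then_product)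
      fix i show "continuous_on {0..1} (\<lambda>t. (x(0 := t)) i)" by (cases "i = 0") (auto intro: continuous_intros)
    qed
    have U: "x(0 := t) \<in> unit_cube" if "t \<in> {0..1}" for t using x that by (auto simp: unit_cube_def)
    have "g j (1, x(0 := x 0)) = g j (1, x(0 := 0))"
    proof (rule log_unique_on_connected[of "{0..1}" "\<lambda>t. g j (1, x(0 := t))"])
      show "continuous_on {0..1} (\<lambda>t. g j (1, x(0 := t)))"
        by (rule continuous_on_compose2[OF g(1)[OF j] c]) (use U in auto)
      show "exp (g j (1, x(0 := s))) = exp (g j (1, x(0 := t)))" if "s \<in> {0..1}" "t \<in> {0..1}" for s t
        using g(2)[OF j] w(5)[OF j] U that by simp
      show "x 0 \<in> {0..1}" using x by (auto simp: unit_cube_def)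
    qed auto
    then show ?thesis using side[OF k j, of 1 "x(0 := 0)"] U[of 0] by simp
  qed
  define A where "A j x = Im (g j (x k, x))" for j and x :: "nat \<Rightarrow> real"
  have XS: "(x k, x) \<in> ?S" if "x \<in> unit_cube" for x using that by (auto simp: unit_cube_def)
  have Acont: "continuous_on unit_cube (A j)" if "j \<le> k" for j
    unfolding A_def
  proof (rule continuous_on_Im, rule continuous_on_compose2[OF g(1)[OF that]])
    show "continuous_on unit_cube (\<lambda>x. (x k, x))"
      by (intro continuous_on_Pair continuous_on_id continuous_on_product_then_coordinatewise)
  qed (use XS in blast)
  have Anz: "0 < (\<Sum>j\<le>k. \<bar>A j x\<bar>)" if x: "x \<in> unit_cube" for x
  proof (rule ccontr)
    assume "\<not> ?thesis"
    moreover have "0 \<le> (\<Sum>j\<le>k. \<bar>A j x\<bar>)" by (rule sum_nonneg) simp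
    ultimately have "(\<Sum>j\<le>k. \<bar>A j x\<bar>) = 0" by linarith
    then have A0: "A j x = 0" if "j \<le> k" for j using that by (simp add: sum_nonneg_eq_0_iff)
    have "Re (w j (x k, x)) > 0" if j: "j \<le> k" for j
    proof -
      have "Re (w j (x k, x)) = exp (Re (g j (x k, x))) * cos (Im (g j (x k, x)))"
        unfolding g(2)[OF j XS[OF x], symmetric] by (rule Re_exp)
      then show ?thesis using A0[OF j] by (simp add: A_def)
    qed
    then have "0 < (\<Sum>j\<le>k. Re (w j (x k, x)))" by (intro sum_pos) auto
    also have "\<dots> = Re (\<Sum>j\<le>k. w j (x k, x))" by simp
    finally show False unfolding w(3)[OF XS[OF x]] by simp
  qed
  have ne: "(\<lambda>_. 0) \<in> unit_cube" by (simp add: unit_cube_def)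
  have "continuous_on unit_cube (\<lambda>x. \<Sum>j\<le>k. \<bar>A j x\<bar>)" by (intro continuous_intros Acont) auto
  then have "\<exists>x0\<in>unit_cube. \<forall>x\<in>unit_cube. (\<Sum>j\<le>k. \<bar>A j x0\<bar>) \<le> (\<Sum>j\<le>k. \<bar>A j x\<bar>)"
    using continuous_attains_inf[OF compact_unit_cube] ne by blast
  then obtain x0 where x0: "x0 \<in> unit_cube" "\<And>x. x \<in> unit_cube \<Longrightarrow> (\<Sum>j\<le>k. \<bar>A j x0\<bar>) \<le> (\<Sum>j\<le>k. \<bar>A j x\<bar>)" by blast
  define \<delta> where "\<delta> = (\<Sum>j\<le>k. \<bar>A j x0\<bar>)"
  have \<delta>: "0 < \<delta>" unfolding \<delta>_def by (rule Anz[OF x0(1)])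
  \<comment> \<open>Large enough that at every point some \<open>L * A j x\<close> has modulus at
    least 1 and is clamped to 1 or -1.\<close>
  define L where "L = real (Suc k) / \<delta>"
  have L: "0 < L" using \<delta> by (simp add: L_def)
  have big: "\<exists>j\<le>k. 1 \<le> \<bar>L * A j x\<bar>" if x: "x \<in> unit_cube" for x
  proof (rule ccontr)
    assume "\<not> ?thesis"
    then have lt: "\<bar>L * A j x\<bar> < 1" if "j \<le> k" for j using that not_le by blast
    have "(\<Sum>j\<le>k. \<bar>L * A j x\<bar>) < (\<Sum>j\<le>k. 1)" by (rule sum_strict_mono) (use lt in simp_all)
    then have "L * (\<Sum>j\<le>k. \<bar>A j x\<bar>) < real (Suc k)" using L by (simp add: abs_mult sum_distrib_left)
    moreover have "L * \<delta> \<le> L * (\<Sum>j\<le>k. \<bar>A j x\<bar>)" using x0(2)[OF x] L unfolding \<delta>_def by (intro mult_left_mono) auto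
    ultimately show False using \<delta> by (simp add: L_def)
  qed
  \<comment> \<open>In coordinates \<open>\<xi>\<close> between -1 and 1 a fixed point reads
    \<open>\<xi> j = clamp1 (- L * A j x)\<close>. The last coordinate is reversed, so that time 0
    is the face \<open>\<xi> k = 1\<close> and time 1, where all is at the south pole, the face
    \<open>\<xi> k = -1\<close>.\<close>
  define f where "f i x = (if i < k then (1 + clamp1 (- L * A i x)) / 2 else (1 - clamp1 (- L * A i x)) / 2)" for i x
  have fin: "f i x \<in> {0..1}" for i x using clamp1(1)[of "- L * A i x"] by (auto simp: f_def abs_le_iff)
  have fcont: "continuous_on unit_cube (f i)" if "i < Suc k" for i
  proof -
    have "continuous_on unit_cube (\<lambda>x. clamp1 (- L * A i x))" using that by (intro continuous_intros Acont) simp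
    then show ?thesis unfolding f_def by (cases "i < k") (simp_all add: continuous_on_divide continuous_on_add continuous_on_diff)
  qed
  obtain x where x: "x \<in> unit_cube" "\<And>i. i < Suc k \<Longrightarrow> f i x = x i"
    using brouwer_unit_cube[of "Suc k" f] fin fcont by blast
  define \<xi> where "\<xi> j = (if j < k then 2 * x j - 1 else 1 - 2 * x j)" for j
  have \<xi>: "\<xi> j = clamp1 (- L * A j x)" if "j \<le> k" for j
    using x(2)[of j] that by (auto simp: \<xi>_def f_def split: if_splits)
  have sg: "sgn (A j x) = - sgn (\<xi> j)" if "j \<le> k" for j
    unfolding \<xi>[OF that] clamp1(2) using L by (simp add: sgn_mult sgn_minus)
  have one: "\<exists>j\<le>k. \<bar>\<xi> j\<bar> = 1"
  proof -
    obtain j where "j \<le> k" "1 \<le> \<bar>L * A j x\<bar>" using big[OF x(1)] by blast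
    then have "\<bar>\<xi> j\<bar> = 1" unfolding \<xi>[OF \<open>j \<le> k\<close>] by (intro clamp1(4)) simp
    then show ?thesis using \<open>j \<le> k\<close> by blast
  qed
  have xk: "x k \<in> {0..1}" using x(1) by (auto simp: unit_cube_def)
  show False
  proof (cases "\<exists>i<k. x i = 0 \<or> x i = 1")
    case True
    then obtain i where i: "i < k" "x i = 0 \<or> x i = 1" by blast
    have "A i x = Im (l i (base_pt k))" unfolding A_def using side[OF i(1) _ xk x(1) i(2), of i] i(1) by simp
    then have "sgn (A i x) = 0" using l(2)[OF _ base_pt_sphere_dom, of i] i(1) by (simp add: base_pt_def)
    then have "\<xi> i = 0" using sg[of i] i(1) by (simp add: sgn_0_0)
    then show False using i by (auto simp: \<xi>_def)
  next
    case False
    then have "\<bar>\<xi> j\<bar> \<noteq> 1" if "j < k" for j using that by (auto simp: \<xi>_def abs_if split: if_splits)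
    then have "\<bar>\<xi> k\<bar> = 1" using one by (metis le_neq_implies_less)
    then consider "x k = 0" | "x k = 1" by (auto simp: \<xi>_def abs_if split: if_splits)
    then show False
    proof cases
      case 1
      \<comment> \<open>At time 0 and for \<open>j < k\<close> the sign of \<open>A j x\<close> is
        that of \<open>\<xi> j\<close> and also opposite to it, so both vanish and \<open>x\<close>
        is the centre of the cube. There the last coordinate of \<open>wrap\<close> is positive,
        against \<open>\<xi> k = 1\<close>.\<close>
      have Aw: "sgn (A j x) = sgn (wrap k x j)" if "j \<le> k" for j
        unfolding A_def 1 using g(3)[OF that x(1)] l(2)[OF that wrap_sphere_dom[OF x(1)]] by simp
      define D where "D = (\<Prod>i<k. (1 - (2 * x i - 1)\<^sup>2))"
      have "0 < 1 - (2 * x i - 1)\<^sup>2" if "i < k" for i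
      proof -
        have "x i \<noteq> 0" "x i \<noteq> 1" "x i \<in> {0..1}" using False that x(1) by (auto simp: unit_cube_def)
        then have "0 < x i" "x i < 1" by auto
        then have "0 < 4 * (x i * (1 - x i))" by simp
        then show ?thesis by (simp add: power2_eq_square algebra_simps)
      qed
      then have D: "0 < D" unfolding D_def by (intro prod_pos) auto
      have z: "2 * x i - 1 = 0" if i: "i < k" for i
      proof -
        have "sgn (wrap k x i) = sgn (2 * x i - 1)"
          using i D k by (simp add: wrap_def Let_def D_def[symmetric] clamp1(2) sgn_mult)
        then have "sgn (2 * x i - 1) = - sgn (2 * x i - 1)" using Aw[of i] sg[of i] i by (simp add: \<xi>_def)
        then show ?thesis by (simp add: sgn_0_0)
      qed
      have "D = 1" unfolding D_def by (rule prod.neutral) (use z in auto)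
      then have "sgn (wrap k x k) = 1" by (simp add: wrap_def Let_def D_def[symmetric] clamp1(2))
      then show False using Aw[of k] sg[of k] 1 by (simp add: \<xi>_def)
    next
      case 2
      have "A k x = Im (l k (base_pt k))" unfolding A_def 2 using floor[OF _ x(1), of k] by simp
      then have "sgn (A k x) = -1" using l(2)[OF _ base_pt_sphere_dom, of k] by (simp add: base_pt_def)
      then show False using sg[of k] 2 by (simp add: \<xi>_def)
    qed
  qed
qed

lemma wrap_cong: "(\<And>i. i < k \<Longrightarrow> x i = y i) \<Longrightarrow> wrap k x = wrap k y"
proof -
  assume e: "\<And>i. i < k \<Longrightarrow> x i = y i"
  then have "(\<Prod>i<k. (1 - (2 * x i - 1)\<^sup>2)) = (\<Prod>i<k. (1 - (2 * y i - 1)\<^sup>2))" by (intro prod.cong) auto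
  then show ?thesis using e by (simp add: wrap_def Let_def fun_eq_iff)
qed

text \<open>Points of \<open>cube k\<close> are undefined outside \<open>{..<k}\<close>; padding
  with 0 moves them to \<open>unit_cube\<close>, where Brouwer's theorem is available.\<close>

definition pad :: "nat \<Rightarrow> (nat \<Rightarrow> real) \<Rightarrow> nat \<Rightarrow> real" where
  "pad k x = (\<lambda>i. if i < k then x i else 0)"

lemma pad_unit_cube: "x \<in> topspace (cube k) \<Longrightarrow> pad k x \<in> unit_cube"
  by (auto simp: topspace_cube pad_def unit_cube_def PiE_iff)

lemma restrict_cube: "x \<in> unit_cube \<Longrightarrow> restrict x {..<k} \<in> topspace (cube k)"
  by (auto simp: topspace_cube unit_cube_def)

lemma continuous_map_pad: "continuous_map (cube k) (top_of_set unit_cube) (pad k)"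
proof -
  have "continuous_map (cube k) (product_topology (\<lambda>_. euclidean) UNIV) (pad k)"
  proof (rule continuous_map_coordinatewise_then_product)
    fix i :: nat
    show "continuous_map (cube k) euclidean (\<lambda>x. pad k x i)"
    proof (cases "i < k")
      case True
      have "continuous_map (cube k) (top_of_set {0..1}) (\<lambda>x. x i)"
        unfolding cube_def by (rule continuous_map_product_projection) (use True in simp)
      then show ?thesis using True by (simp add: pad_def continuous_map_in_subtopology)
    qed (simp add: pad_def)
  qed simp
  then show ?thesis
    using pad_unit_cube by (auto simp: continuous_map_in_subtopology euclidean_product_topology)
qed

lemma continuous_map_restrict_cube:
  "continuous_map (top_of_set ({0..1::real} \<times> unit_cube)) (prod_topology (top_of_set {0..1}) (cube k)) (\<lambda>q. (fst q, restrict (snd q) {..<k}))"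
proof (rule continuous_map_pairedI)
  show "continuous_map (top_of_set ({0..1::real} \<times> unit_cube)) (top_of_set {0..1}) fst"
    by (auto simp: continuous_map_in_subtopology intro: continuous_intros)
  show "continuous_map (top_of_set ({0..1::real} \<times> unit_cube)) (cube k) (\<lambda>q. restrict (snd q) {..<k})"
    unfolding cube_def
  proof (rule continuous_map_coordinatewise_then_product)
    fix i assume i: "i \<in> {..<k}"
    have "continuous_on ({0..1::real} \<times> unit_cube) (\<lambda>q. snd q i)"
      by (rule continuous_on_product_then_coordinatewise) (intro continuous_intros)
    then show "continuous_map (top_of_set ({0..1::real} \<times> unit_cube)) (top_of_set {0..1}) (\<lambda>q. restrict (snd q) {..<k} i)"
      using i by (auto simp: continuous_map_in_subtopology unit_cube_def)
  qed simp
qed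

section \<open>A generic slice of the complement and the sphere in it\<close>

context hook
begin

definition complement :: "tabloid_vector set" where
  "complement = {v \<in> V. \<forall>B\<in>J. F B v \<noteq> 0}"

definition comb :: "real \<Rightarrow> tabloid_vector \<Rightarrow> (nat \<Rightarrow> tabloid_vector) \<Rightarrow> (nat \<Rightarrow> complex) \<Rightarrow> tabloid_vector" where
  "comb R x u y = lin (\<lambda>r. \<Sum>j\<le>k. lin (\<lambda>_. 0) (y j) (u j) r) (of_real R) x"

lemma fn_comb: "fn b (comb R x u y) = (\<Sum>j\<le>k. y j * fn b (u j)) + of_real R * fn b x"
proof -
  have "fn b (\<lambda>r. \<Sum>j\<le>k. lin (\<lambda>_. 0) (y j) (u j) r) = (\<Sum>j\<le>k. fn b (lin (\<lambda>_. 0) (y j) (u j)))"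
    unfolding fn_def sum_distrib_left by (rule sum.swap)
  then show ?thesis by (simp add: comb_def)
qed

lemma comb_V: "x \<in> V \<Longrightarrow> (\<And>j. j \<le> k \<Longrightarrow> u j \<in> V) \<Longrightarrow> comb R x u y \<in> V"
  unfolding comb_def by (intro V_lin lin_closed_sum V_zero) auto

text \<open>The forms of the \<open>k + 1\<close> hyperplanes through a point \<open>x\<close> and contained in \<open>D\<close> with \<open>\<bar>D\<bar> = k + 2\<close> are
  independent, and they add up to the form of the last hyperplane in \<open>D\<close>.  So the complement contains a copy of the
  complement of \<open>k + 2\<close> generic hyperplanes in dimension \<open>k + 1\<close>, displaced into general position with respect to the rest.\<close>

lemma generic_slice:
  assumes nk: "1 < n - k"
  shows "\<exists>R x u. x \<in> V \<and> (\<forall>j\<le>k. u j \<in> V) \<and>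
    (\<forall>i\<le>k. \<forall>y. fn (Suc(i := Suc (Suc k))) (comb R x u y) = y i) \<and>
    (\<forall>v. (\<Sum>i\<le>k. fn (Suc(i := Suc (Suc k))) v) = fn Suc v) \<and>
    (\<forall>v\<in>complement. \<forall>i\<le>k. fn (Suc(i := Suc (Suc k))) v \<noteq> 0) \<and> (\<forall>v\<in>complement. fn Suc v \<noteq> 0) \<and>
    (\<forall>y. (\<forall>j\<le>k. y j \<noteq> 0 \<and> norm (y j) \<le> 2) \<longrightarrow> (\<Sum>j\<le>k. y j) = -1 \<longrightarrow> comb R x u y \<in> complement)"
proof -
  let ?z = "Suc (Suc k)" and ?D = "{1..Suc (Suc k)}" and ?B = "{1..Suc k}"
  \<comment> \<open>\<open>Suc\<close> enumerates \<open>?B\<close>, and with position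
    \<open>i\<close> changed to the new entry it enumerates \<open>?E i\<close>. Together these are
    all \<open>k + 2\<close> subsets of \<open>?D\<close> with \<open>k + 1\<close>
    elements.\<close>
  let ?c = "\<lambda>i. Suc(i := Suc (Suc k))" and ?E = "\<lambda>i. {1..Suc (Suc k)} - {Suc i}"
  have BJ: "?B \<in> J" using nk by (auto simp: J_def)
  have bB: "bij_betw Suc {..k} ?B"
    by (rule bij_betw_imageI) (auto simp: image_Suc_atMost)
  have EJ: "?E i \<in> J" if "i \<le> k" for i using that nk by (auto simp: J_def)
  have cE: "bij_betw (?c i) {..k} (?E i)" if i: "i \<le> k" for i
  proof (rule bij_betw_imageI)
    show "inj_on (?c i) {..k}" by (auto simp: inj_on_def)
    have "?c i ` {..k} = insert ?z (Suc ` ({..k} - {i}))" using i by auto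
    also have "Suc ` ({..k} - {i}) = {1..Suc k} - {Suc i}" using image_Suc_atMost[of k] by (simp add: image_set_diff)
    also have "insert ?z ({1..Suc k} - {Suc i}) = ?E i" using i by auto
    finally show "?c i ` {..k} = ?E i" .
  qed
  have c0: "fn (?c i) v = 0 \<longleftrightarrow> F (?E i) v = 0" if "i \<le> k" for i v by (rule F_zero_iff[OF EJ[OF that] cE[OF that]])
  have b0: "fn Suc v = 0 \<longleftrightarrow> F ?B v = 0" for v by (rule F_zero_iff[OF BJ bB])
  \<comment> \<open>The single relation among the \<open>k + 2\<close> forms is the Garnir relation
    for the entry \<open>k + 2\<close>.\<close>
  have sumF: "(\<Sum>i\<le>k. fn (?c i) v) = fn Suc v" for v
    by (rule fn_replace) (use nk in auto)
  have "\<exists>u\<in>V. \<forall>i\<le>k. fn (?c i) u = (if i = j then 1 else 0)" if j: "j \<le> k" for j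
  proof -
    have "?z \<in> ?E j" using j by auto
    then obtain v where v: "v \<in> V" "F (?E j) v \<noteq> 0" "\<And>C. C \<in> J \<Longrightarrow> \<not> ?E j - {?z} \<subseteq> C \<Longrightarrow> F C v = 0"
      using separating_vector[OF EJ[OF j], of ?z] by blast
    have nz: "fn (?c j) v \<noteq> 0" using v(2) c0[OF j] by simp
    have "fn (?c i) v = 0" if i: "i \<le> k" "i \<noteq> j" for i
    proof -
      have "Suc i \<in> ?E j - {?z}" "Suc i \<notin> ?E i" using i by auto
      then have "\<not> ?E j - {?z} \<subseteq> ?E i" by blast
      then show ?thesis using v(3)[OF EJ[OF i(1)]] c0[OF i(1)] by simp
    qed
    then have "\<forall>i\<le>k. fn (?c i) (lin (\<lambda>_. 0) (1 / fn (?c j) v) v) = (if i = j then 1 else 0)" using nz by simp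
    then show ?thesis using V_lin[OF V_zero v(1)] by blast
  qed
  then have "\<forall>j\<in>{..k}. \<exists>u. u \<in> V \<and> (\<forall>i\<le>k. fn (?c i) u = (if i = j then 1 else 0))" by blast
  from bchoice[OF this] obtain u where u0: "\<forall>j\<in>{..k}. u j \<in> V \<and> (\<forall>i\<le>k. fn (?c i) (u j) = (if i = j then 1 else 0))" by (elim exE)
  have u: "\<And>j. j \<le> k \<Longrightarrow> u j \<in> V" "\<And>i j. i \<le> k \<Longrightarrow> j \<le> k \<Longrightarrow> fn (?c i) (u j) = (if i = j then 1 else 0)"
    using u0 by (simp_all only: atMost_iff)
  define U where "U = {v \<in> V. \<forall>i\<le>k. fn (?c i) v = 0}"
  define I where "I = {C \<in> J. \<not> C \<subseteq> ?D}"
  have "\<exists>x\<in>U. \<forall>C\<in>I. F C x \<noteq> 0"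
  proof (rule generic_point)
    show "finite I" using finite_J by (simp add: I_def)
    show "U \<noteq> {}" using V_zero by (auto simp: U_def)
    show "lin v c w \<in> U" if "v \<in> U" "w \<in> U" for v w c using that V_lin by (simp add: U_def)
    fix C assume "C \<in> I"
    then obtain s where C: "C \<in> J" "s \<in> C" "s \<notin> ?D" by (auto simp: I_def simp del: atLeastAtMost_iff)
    \<comment> \<open>The omitted \<open>y\<close> must differ from \<open>s\<close>: then
      \<open>C - {y}\<close> still contains \<open>s\<close> and lies in no
      \<open>?E i\<close>.\<close>
    have "C \<noteq> {s}" using C(1) k1 by (auto simp: J_def)
    then obtain y where y: "y \<in> C" "y \<noteq> s" using C(2) by blast
    obtain v where v: "v \<in> V" "F C v \<noteq> 0" "\<And>C'. C' \<in> J \<Longrightarrow> \<not> C - {y} \<subseteq> C' \<Longrightarrow> F C' v = 0"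
      using separating_vector[OF C(1) y(1)] by blast
    have "fn (?c i) v = 0" if i: "i \<le> k" for i
    proof -
      have "\<not> C - {y} \<subseteq> ?E i" using C(2,3) y(2) by blast
      then show ?thesis using v(3)[OF EJ[OF i]] c0[OF i] by simp
    qed
    then show "\<exists>v\<in>U. F C v \<noteq> 0" using v(1,2) by (auto simp: U_def)
  qed simp
  then obtain x where x: "x \<in> U" "\<And>C. C \<in> I \<Longrightarrow> F C x \<noteq> 0" by blast
  have xV: "x \<in> V" and xF: "\<And>i. i \<le> k \<Longrightarrow> fn (?c i) x = 0" using x(1) by (auto simp: U_def)
  \<comment> \<open>So large that on each form from \<open>I\<close> the point \<open>R x\<close>
    outweighs every combination of the \<open>u j\<close> with coefficients of modulus at most 2,
    the bound supplied by \<open>sphere_logarithms\<close>.\<close>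
  define R where "R = 1 + (\<Sum>C\<in>I. (\<Sum>j\<le>k. 2 * norm (F C (u j))) / norm (F C x))"
  have R: "(\<Sum>j\<le>k. 2 * norm (F C (u j))) < R * norm (F C x)" if C: "C \<in> I" for C
  proof -
    have "(\<Sum>j\<le>k. 2 * norm (F C (u j))) / norm (F C x) \<le> (\<Sum>C\<in>I. (\<Sum>j\<le>k. 2 * norm (F C (u j))) / norm (F C x))"
      using finite_J C by (intro member_le_sum) (auto simp: I_def intro!: divide_nonneg_nonneg sum_nonneg)
    then have "(\<Sum>j\<le>k. 2 * norm (F C (u j))) / norm (F C x) < R" by (simp add: R_def)
    then show ?thesis using x(2)[OF C] by (simp add: pos_divide_less_eq)
  qed
  have ci: "fn (?c i) (comb R x u y) = y i" if i: "i \<le> k" for i y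
  proof -
    have "(\<Sum>j\<le>k. y j * fn (?c i) (u j)) = (\<Sum>j\<le>k. if i = j then y j else 0)"
      by (rule sum.cong[OF refl]) (use u(2)[OF i] in auto)
    also have "\<dots> = y i" using i by (simp add: sum.delta)
    finally show ?thesis unfolding fn_comb using xF[OF i] by simp
  qed
  have inM: "comb R x u y \<in> complement" if y: "\<And>j. j \<le> k \<Longrightarrow> y j \<noteq> 0 \<and> norm (y j) \<le> 2" and s: "(\<Sum>j\<le>k. y j) = -1" for y
  proof -
    have "F C (comb R x u y) \<noteq> 0" if C: "C \<in> J" for C
    proof (cases "C \<subseteq> ?D")
      case True
      have "card (?D - C) = 1"
        using C card_Diff_subset[OF J_finite[OF C] True] by (simp add: J_def)
      then obtain d where d: "?D - C = {d}" by (auto simp: card_1_singleton_iff simp del: atLeastAtMost_iff)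
      have Cd: "C = ?D - {d}" using d True by blast
      have dD: "d \<in> ?D" using d by blast
      show ?thesis
      proof (cases "d = ?z")
        case True
        then have "C = ?B" using Cd by auto
        moreover have "fn Suc (comb R x u y) \<noteq> 0" unfolding sumF[symmetric] using ci s by simp
        ultimately show ?thesis using b0 by simp
      next
        case False
        then obtain i where i: "d = Suc i" "i \<le> k" using dD by (cases d) auto
        have "fn (?c i) (comb R x u y) \<noteq> 0" unfolding ci[OF i(2)] using y[OF i(2)] by simp
        then show ?thesis using c0[OF i(2)] Cd i(1) by simp
      qed
    next
      case False
      then have CI: "C \<in> I" using C by (simp add: I_def)
      have "norm (\<Sum>j\<le>k. y j * F C (u j)) \<le> (\<Sum>j\<le>k. 2 * norm (F C (u j)))"
        by (rule sum_norm_le) (use y in \<open>auto simp: norm_mult intro: mult_right_mono\<close>)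
      also have "\<dots> < R * norm (F C x)" by (rule R[OF CI])
      also have "\<dots> \<le> norm (of_real R * F C x)" by (simp add: norm_mult mult_right_mono)
      finally have "(\<Sum>j\<le>k. y j * F C (u j)) \<noteq> - (of_real R * F C x)" by auto
      then show ?thesis unfolding fn_comb by (simp add: eq_neg_iff_add_eq_0)
    qed
    then show ?thesis using comb_V[OF xV u(1)] by (simp add: complement_def)
  qed
  have cnz: "fn (?c i) v \<noteq> 0" if "v \<in> complement" "i \<le> k" for v i
    using that EJ[OF that(2)] c0[OF that(2)] unfolding complement_def by blast
  have bnz: "fn Suc v \<noteq> 0" if "v \<in> complement" for v
    using that BJ b0 unfolding complement_def by blast
  show ?thesis
  proof (intro exI[of _ R] exI[of _ x] exI[of _ u] conjI allI impI ballI)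
    fix y :: "nat \<Rightarrow> complex" assume "\<forall>j\<le>k. y j \<noteq> 0 \<and> norm (y j) \<le> 2" "(\<Sum>j\<le>k. y j) = -1"
    then show "comb R x u y \<in> complement" by (intro inM) blast+
  qed (rule xV u(1) ci sumF cnz bnz; assumption)+
qed

text \<open>The hypothesis means \<open>k + 2 \<le> n\<close> and makes room for the set
  \<open>D\<close>; \<open>1 < k\<close> puts degree \<open>k\<close> among those in which an
  aspherical space has trivial homotopy.\<close>

theorem not_aspherical:
  assumes nk: "1 < n - k"
  shows "\<not> K_pi_1_space (top_of_set complement)"
proof
  assume K: "K_pi_1_space (top_of_set complement)"
  from generic_slice[OF nk] obtain R x u where xV: "x \<in> V" and u: "\<forall>j\<le>k. u j \<in> V"
    and ci: "\<forall>i\<le>k. \<forall>y. fn (Suc(i := Suc (Suc k))) (comb R x u y) = y i"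
    and sumF: "\<forall>v. (\<Sum>i\<le>k. fn (Suc(i := Suc (Suc k))) v) = fn Suc v"
    and cnz: "\<forall>v\<in>complement. \<forall>i\<le>k. fn (Suc(i := Suc (Suc k))) v \<noteq> 0"
    and bnz: "\<forall>v\<in>complement. fn Suc v \<noteq> 0"
    and inM: "\<forall>y. (\<forall>j\<le>k. y j \<noteq> 0 \<and> norm (y j) \<le> 2) \<longrightarrow> (\<Sum>j\<le>k. y j) = -1 \<longrightarrow> comb R x u y \<in> complement"
    by (elim exE conjE)
  note ci = ci[rule_format] and sumF = sumF[rule_format] and cnz = cnz[rule_format] and bnz = bnz[rule_format] and inM = inM[rule_format]
  let ?c = "\<lambda>i. Suc(i := Suc (Suc k))"
  from sphere_logarithms[of k] obtain l :: "nat \<Rightarrow> (nat \<Rightarrow> real) \<Rightarrow> complex"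
    where "\<forall>j\<le>k. continuous_on (sphere_dom k) (l j)" "\<forall>p\<in>sphere_dom k. (\<Sum>j\<le>k. exp (l j p)) = -1"
      "\<forall>j\<le>k. \<forall>p\<in>sphere_dom k. norm (exp (l j p)) \<le> 2 \<and> sgn (Im (l j p)) = sgn (p j)"
    by (elim exE conjE)
  note l = this(1)[rule_format] this(2)[rule_format] this(3)[rule_format, THEN conjunct1] this(3)[rule_format, THEN conjunct2]
  define G where "G p = comb R x u (\<lambda>j. exp (l j p))" for p
  have GM: "G p \<in> complement" if "p \<in> sphere_dom k" for p
    unfolding G_def by (rule inM) (use l(2)[OF that] l(3)[OF _ that] in auto)
  have Gc: "fn (?c j) (G p) = exp (l j p)" if "j \<le> k" for j p unfolding G_def by (rule ci[OF that])
  have Gb: "fn Suc (G p) = -1" if "p \<in> sphere_dom k" for p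
    unfolding sumF[symmetric] using Gc l(2)[OF that] by simp
  have Gcont: "continuous_on (sphere_dom k) G"
  proof (rule continuous_on_coordinatewise_then_product)
    fix r show "continuous_on (sphere_dom k) (\<lambda>p. G p r)"
      unfolding G_def comb_def lin_def by (intro continuous_intros l(1)) auto
  qed
  define p0 where "p0 = G (base_pt k)"
  define \<phi> where "\<phi> y = G (wrap k (pad k y))" for y
  have p0: "p0 \<in> complement" unfolding p0_def by (rule GM[OF base_pt_sphere_dom])
  have "continuous_on unit_cube (\<lambda>y. G (wrap k y))"
    by (rule continuous_on_compose2[OF Gcont continuous_on_wrap]) (use wrap_sphere_dom in blast)
  then have "continuous_map (top_of_set unit_cube) (top_of_set complement) (\<lambda>y. G (wrap k y))"
    using GM wrap_sphere_dom by (auto simp: continuous_map_in_subtopology)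
  from continuous_map_compose[OF continuous_map_pad[of k] this]
  have \<phi>c: "continuous_map (cube k) (top_of_set complement) \<phi>" by (simp add: o_def \<phi>_def[abs_def])
  have "\<phi> y = p0" if y: "y \<in> cube_boundary k" for y
  proof -
    obtain i where i: "i < k" "y i = 0 \<or> y i = 1" using y by (auto simp: cube_boundary_def)
    have "wrap k (pad k y) = base_pt k" by (rule wrap_boundary[OF i(1)]) (use i in \<open>simp add: pad_def\<close>)
    then show ?thesis by (simp add: \<phi>_def p0_def)
  qed
  then have \<phi>: "\<phi> \<in> spheroids k (top_of_set complement) p0" using \<phi>c by (simp add: spheroids_def)
  have const: "(\<lambda>_. p0) \<in> spheroids k (top_of_set complement) p0" using p0 by (simp add: spheroids_def)
  have "carrier (homotopy_group k (top_of_set complement) p0) = {one (homotopy_group k (top_of_set complement) p0)}"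
    using K k1 p0 by (simp add: K_pi_1_space_def)
  then have "spheroid_class k (top_of_set complement) p0 ` spheroids k (top_of_set complement) p0
      = {spheroid_class k (top_of_set complement) p0 (\<lambda>_. p0)}" by (simp add: homotopy_group_def)
  then have "spheroid_class k (top_of_set complement) p0 \<phi> = spheroid_class k (top_of_set complement) p0 (\<lambda>_. p0)"
    using imageI[OF \<phi>, of "spheroid_class k (top_of_set complement) p0"] by simp
  then have "sph_rel k (top_of_set complement) p0 \<phi> (\<lambda>_. p0)" using spheroid_class_iff[OF \<phi> const] by simp
  then have "\<exists>h. continuous_map (prod_topology (top_of_set {0..1::real}) (cube k)) (top_of_set complement) h \<and>
      (\<forall>y. h (0, y) = \<phi> y) \<and> (\<forall>y. h (1, y) = p0) \<and> (\<forall>t\<in>{0..1}. \<forall>y\<in>cube_boundary k. h (t, y) = p0)"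
    by (simp only: homotopic_with_def)
  then obtain h :: "real \<times> (nat \<Rightarrow> real) \<Rightarrow> tabloid_vector" where h: "continuous_map (prod_topology (top_of_set {0..1}) (cube k)) (top_of_set complement) h"
    "\<forall>y. h (0, y) = \<phi> y" "\<forall>y. h (1, y) = p0" "\<forall>t\<in>{0..1}. \<forall>y\<in>cube_boundary k. h (t, y) = p0"
    by (elim exE conjE)
  note h = h(1) h(2-4)[rule_format]
  define H where "H q = h (fst q, restrict (snd q) {..<k})" for q
  have "continuous_map (top_of_set ({0..1} \<times> unit_cube)) (top_of_set complement) H"
    using continuous_map_compose[OF continuous_map_restrict_cube[of k] h(1)] by (simp add: o_def H_def[abs_def])
  then have Hc: "continuous_on ({0..1} \<times> unit_cube) H" and HM: "\<And>q. q \<in> {0..1} \<times> unit_cube \<Longrightarrow> H q \<in> complement"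
    by (auto simp: continuous_map_in_subtopology)
  \<comment> \<open>Division by the form of \<open>{1..k+1}\<close>, the sum of the other
    \<open>k + 1\<close> forms, makes these ratios add up to -1 on the whole complement, so the
    homotopy may leave the slice.\<close>
  define w where "w j q = - fn (?c j) (H q) / fn Suc (H q)" for j q
  have fH: "continuous_on ({0..1} \<times> unit_cube) (\<lambda>q. fn b (H q))" for b
    by (rule continuous_on_compose2[OF continuous_on_fn Hc]) simp
  have H0: "H (0, y) = G (wrap k y)" for y
  proof -
    have "wrap k (pad k (restrict y {..<k})) = wrap k y" by (rule wrap_cong) (simp add: pad_def)
    then show ?thesis by (simp add: H_def h(2) \<phi>_def)
  qed
  have Hside: "H (s, y) = p0" if "i < k" "s \<in> {0..1}" "y \<in> unit_cube" "y i = 0 \<or> y i = 1" for i s y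
  proof -
    have "restrict y {..<k} \<in> cube_boundary k" using restrict_cube[OF that(3)] that(1,4) by (auto simp: cube_boundary_def)
    then show ?thesis using h(4)[OF that(2)] by (simp add: H_def)
  qed
  show False
  proof (rule no_filling[of k l w])
    show "0 < k" using k1 by simp
    show "continuous_on (sphere_dom k) (l j)" if "j \<le> k" for j by (rule l(1)[OF that])
    show "sgn (Im (l j p)) = sgn (p j)" if "j \<le> k" "p \<in> sphere_dom k" for j p by (rule l(4)[OF that])
    show "continuous_on ({0..1} \<times> unit_cube) (w j)" for j
      unfolding w_def by (intro continuous_intros fH) (use HM bnz in blast)
    show "w j q \<noteq> 0" if "j \<le> k" "q \<in> {0..1} \<times> unit_cube" for j q
      using cnz[OF HM[OF that(2)] that(1)] bnz[OF HM[OF that(2)]] by (simp add: w_def)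
    show "(\<Sum>j\<le>k. w j q) = -1" if q: "q \<in> {0..1} \<times> unit_cube" for q
      unfolding w_def sum_divide_distrib[symmetric] sum_negf sumF using bnz[OF HM[OF q]] by simp
    show "w j (0, y) = exp (l j (wrap k y))" if "j \<le> k" "y \<in> unit_cube" for j y
      unfolding w_def H0 Gc[OF that(1)] Gb[OF wrap_sphere_dom[OF that(2)]] by simp
    show "w j (1, y) = exp (l j (base_pt k))" if "j \<le> k" "y \<in> unit_cube" for j y
    proof -
      have "H (1, y) = G (base_pt k)" by (simp add: H_def h(3) p0_def)
      then show ?thesis unfolding w_def by (simp add: Gc[OF that(1)] Gb[OF base_pt_sphere_dom])
    qed
    show "w j (s, y) = w j (0, y)" if "i < k" "j \<le> k" "s \<in> {0..1}" "y \<in> unit_cube" "y i = 0 \<or> y i = 1" for i j s y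
      unfolding w_def Hside[OF that(1,3-5)] Hside[OF that(1) _ that(4,5), of 0, simplified] by (rule refl)
  qed
qed

text \<open>The forms are reindexed by the hyperplanes themselves through the injection
  \<open>K\<close>, so that the free generators are the members of the arrangement.\<close>

lemma fundamental_group_free:
  assumes p: "p \<in> complement"
  shows "fundamental_group (top_of_set complement) p \<cong> free_Abelian_group (intrinsic_arrangement n (hook_partition n k))"
proof -
  let ?f = "\<lambda>H. F (inv_into J K H)"
  have fK: "?f (K B) = F B" if "B \<in> J" for B using inv_into_f_f[OF inj_K that] by simp
  have cont: "continuous_on UNIV (?f H)" for H by (rule continuous_on_fn)
  have nz: "\<exists>v\<in>V. ?f H v \<noteq> 0" if H: "H \<in> K ` J" for H
  proof -
    obtain B where B: "B \<in> J" "H = K B" using H by (elim imageE)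
    then show ?thesis using form_nonzero[OF B(1)] fK[OF B(1)] by simp
  qed
  have indep: "\<exists>v\<in>V. ?f H1 v \<noteq> 0 \<and> ?f H2 v = 0 \<and> ?f H3 v = 0"
    if H: "H1 \<in> K ` J" "H2 \<in> K ` J - {H1}" "H3 \<in> K ` J - {H1}" for H1 H2 H3
  proof -
    obtain B C D where B: "B \<in> J" "H1 = K B" "C \<in> J" "H2 = K C" "D \<in> J" "H3 = K D" using H by blast
    then have "C \<noteq> B" "D \<noteq> B" using H by auto
    then show ?thesis using forms_independent[OF B(1,3) _ B(5)] fK[OF B(1)] fK[OF B(3)] fK[OF B(5)] B(2,4,6) by simp
  qed
  have arr: "arrangement V (K ` J) ?f"
    by (unfold_locales) (use V_lin V_zero finite_J cont nz indep in \<open>simp_all only: fn_lin finite_imageI\<close>)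
  have M: "arrangement.M V (K ` J) ?f = complement"
    unfolding arrangement.M_def[OF arr] complement_def using fK by auto
  have "based V (K ` J) ?f p"
    by (rule based.intro[OF arr]) (rule based_axioms.intro, unfold M, rule p)
  from based.fundamental_group_free[OF this] show ?thesis unfolding M arrangement_eq .
qed

end

text \<open>For \<open>n = k + 1\<close> the module is the sign representation: it is
  one-dimensional, the only hyperplane is 0, and the complement is a punctured complex line, which
  is aspherical. Hence the restriction in the second part.\<close>

theorem theorem3:
  fixes n k :: nat
  assumes "1 < k" and "k < n"
  shows "(\<forall>p \<in> topspace (arrangement_complement n (hook_partition n k)).
            fundamental_group (arrangement_complement n (hook_partition n k)) p
              \<cong> free_Abelian_group (intrinsic_arrangement n (hook_partition n k))) \<and>
         (1 < n - k \<longrightarrow> \<not> K_pi_1_space (arrangement_complement n (hook_partition n k)))"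
proof -
  interpret hook n k by (rule hook.intro[OF assms])
  have "arrangement_complement n (hook_partition n k) = top_of_set complement"
    unfolding arrangement_complement_eq complement_def ..
  then show ?thesis using fundamental_group_free not_aspherical by simp
qed

end
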